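(* Let $n\in\mathbb N$. For all $z\in\mathbb C\setminus[0,\infty)$ and $\psi_1,\psi_2\in L^2(\mathbb R^d)$ the limit $\lim_{L\to\infty}T_{n,L}[z;\psi_1,\psi_2]$ exists in $\mathbb C$. Moreover there is a constant $K_n$ such that $$|T_{n,L}[z;\psi_1,\psi_2]|\le\frac{K_n\|\psi_1\|\,\|\psi_2\|}{\operatorname{dist}(z,[0,\infty))^{n+1}}$$ for all $L\ge1$, $z\in\mathbb C\setminus[0,\infty)$ and $\psi_1,\psi_2\in L^2(\mathbb R^d)$.
   Context: For $L>0$: $\Lambda_L=[-L/2,L/2)^d$, $\Lambda_L^*=(\frac1L\mathbb Z)^d$. For $h:\mathbb R^d\to\mathbb C$, $h_\#$ is the $L$-periodic extension of $h|_{\Lambda_L}$. Inner products on $L^2(\Lambda_L)$ are antilinear in the first argument; $\|\psi\|$ is the $L^2(\mathbb R^d)$ norm. $\nu(p)=\frac12|p|^2$; $K_L$ is the self-adjoint operator on $L^2(\Lambda_L)$ with $\widehat{K_Lf}(p)=\nu(p)\hat f(p)$, $\hat f(p)=\int_{\Lambda_L}e^{-2\pi ip\cdot x}f(x)dx$ ($p\in\Lambda_L^*$), on $\{f:\nu\hat f\in\ell^2(\Lambda_L^* )\}$; $R_L(z)=(K_L-z)^{-1}$. $B$ is a real Schwartz function on $\mathbb R^d$ with compact support or invariant under each reflection $x_j\mapsto-x_j$. $M$ Poisson with mean $|\Lambda_L|$, $y_{L,\gamma}$ i.i.d. uniform on $\Lambda_L$, $v_\gamma$ i.i.d. real with all moments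 finite, all independent; $V_L(x)=\sum_{\gamma=1}^Mv_\gamma B_\#(x-y_{L,\gamma})$; $\mathbf E_L$ joint expectation; $T_{n,L}[z;\psi_1,\psi_2]:=\mathbf E_L\langle\psi_{1,\#},R_L(z)[V_LR_L(z)]^n\psi_{2,\#}\rangle$. *)

theory Defs
  imports "HOL-Probability.Probability"
begin

definition Lam :: "real \<Rightarrow> (real^'d) set" where
  "Lam L = {x. \<forall>i. - L / 2 \<le> x $ i \<and> x $ i < L / 2}"

definition dual_lattice :: "real \<Rightarrow> (real^'d) set" where
  "dual_lattice L = {p. \<forall>i. p $ i * L \<in> \<int>}"

text \<open>Representative in \<Lambda>_L of x modulo L Z^d; h_# = h o wrap L.\<close>
definition wrap :: "real \<Rightarrow> real^'d \<Rightarrow> real^'d" where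
  "wrap L x = (\<chi> i. x $ i - L * of_int \<lfloor>x $ i / L + 1 / 2\<rfloor>)"

definition per :: "real \<Rightarrow> (real^'d \<Rightarrow> 'b) \<Rightarrow> real^'d \<Rightarrow> 'b" where
  "per L h x = h (wrap L x)"

definition nu :: "real^'d \<Rightarrow> real" where
  "nu p = (norm p)^2 / 2"

definition fourier :: "real \<Rightarrow> (real^'d \<Rightarrow> complex) \<Rightarrow> real^'d \<Rightarrow> complex" where
  "fourier L f p = set_lebesgue_integral lborel (Lam L) (\<lambda>x. cis (- 2 * pi * (p \<bullet> x)) * f x)"

definition L2on :: "real \<Rightarrow> (real^'d \<Rightarrow> complex) \<Rightarrow> bool" where
  "L2on L g \<longleftrightarrow> set_borel_measurable lborel (Lam L) g \<and>
     set_integrable lborel (Lam L) (\<lambda>x. (cmod (g x))^2)"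

definition domK :: "real \<Rightarrow> (real^'d \<Rightarrow> complex) set" where
  "domK L = {g. L2on L g \<and>
     (\<lambda>p. (cmod (complex_of_real (nu p) * fourier L g p))^2) summable_on dual_lattice L}"

text \<open>Resolvent R_L(z) f = (K_L - z)^{-1} f: the element g of the domain with
  (K_L - z) g = f, i.e. (nu p - z) ghat(p) = fhat(p) for all p in the dual lattice
  (an L^2(\<Lambda>_L) class is determined by its Fourier coefficients).\<close>
definition resolvent :: "real \<Rightarrow> complex \<Rightarrow> (real^'d \<Rightarrow> complex) \<Rightarrow> real^'d \<Rightarrow> complex" where
  "resolvent L z f = (SOME g. g \<in> domK L \<and>
     (\<forall>p \<in> dual_lattice L. (complex_of_real (nu p) - z) * fourier L g p = fourier L f p))"

fun iterR :: "real \<Rightarrow> complex \<Rightarrow> (real^'d \<Rightarrow> real) \<Rightarrow> nat \<Rightarrow> (real^'d \<Rightarrow> complex) \<Rightarrow> real^'d \<Rightarrow> complex" where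
  "iterR L z V 0 f = resolvent L z f"
| "iterR L z V (Suc k) f = resolvent L z (\<lambda>x. complex_of_real (V x) * iterR L z V k f x)"

definition inner_L :: "real \<Rightarrow> (real^'d \<Rightarrow> complex) \<Rightarrow> (real^'d \<Rightarrow> complex) \<Rightarrow> complex" where
  "inner_L L f g = set_lebesgue_integral lborel (Lam L) (\<lambda>x. cnj (f x) * g x)"

definition potential :: "real \<Rightarrow> (real^'d \<Rightarrow> real) \<Rightarrow> nat \<Rightarrow> (nat \<Rightarrow> real^'d) \<Rightarrow> (nat \<Rightarrow> real)
     \<Rightarrow> real^'d \<Rightarrow> real" where
  "potential L B m y v x = (\<Sum>\<gamma><m. v \<gamma> * per L B (x - y \<gamma>))"

definition T :: "(real^'d \<Rightarrow> real) \<Rightarrow> real measure \<Rightarrow> nat \<Rightarrow> real \<Rightarrow> complex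
     \<Rightarrow> (real^'d \<Rightarrow> complex) \<Rightarrow> (real^'d \<Rightarrow> complex) \<Rightarrow> complex" where
  "T B \<mu> n L z \<psi>1 \<psi>2 =
     measure_pmf.expectation (poisson_pmf (L ^ CARD('d)))
       (\<lambda>m. integral\<^sup>L
          (PiM {..<m} (\<lambda>_. uniform_measure lborel (Lam L)) \<Otimes>\<^sub>M PiM {..<m} (\<lambda>_. \<mu>))
          (\<lambda>(y, v). inner_L L (per L \<psi>1)
              (iterR L z (potential L B m y v) n (per L \<psi>2))))"

fun pderivs :: "'d list \<Rightarrow> (real^'d \<Rightarrow> real) \<Rightarrow> real^'d \<Rightarrow> real" where
  "pderivs [] f = f"
| "pderivs (i # is) f = (\<lambda>x. vector_derivative (\<lambda>t. pderivs is f (x + t *\<^sub>R axis i 1)) (at 0))"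

text \<open>Real Schwartz functions: all iterated partial derivatives exist (each is
  Frechet differentiable, so f is C^infinity) and decay faster than any polynomial.\<close>
definition schwartz :: "(real^'d \<Rightarrow> real) \<Rightarrow> bool" where
  "schwartz f \<longleftrightarrow>
     (\<forall>is x. pderivs is f differentiable (at x)) \<and>
     (\<forall>is (k::nat). bounded (range (\<lambda>x. (1 + norm x) ^ k * pderivs is f x)))"

definition L2norm :: "(real^'d \<Rightarrow> complex) \<Rightarrow> real" where
  "L2norm \<psi> = sqrt (integral\<^sup>L lborel (\<lambda>x. (cmod (\<psi> x))^2))"

definition L2 :: "(real^'d \<Rightarrow> complex) set" where
  "L2 = {\<psi>. \<psi> \<in> borel_measurable lborel \<and> integrable lborel (\<lambda>x. (cmod (\<psi> x))^2)}"

end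

theory Submission
  imports Defs
begin

text \<open>
  Truncate the resolvent to frequencies of norm at most N; since the truncations converge strongly,
  T is the limit of its truncated versions by dominated convergence. Expand the product of the
  potentials over the scatterer met at each of the n steps and group the label sequences by their
  coincidence pattern, normalised to a canonical map \<open>\<sigma>\<close>. The factorial moments of the Poisson variable
  cancel the normalisation of the uniform measures, so the truncated T is the sum over \<open>\<sigma>\<close> of
  a moment of the \<open>v\<close> times the inner product of \<open>\<psi>1\<close> with a function in which every
  scatterer position is integrated over the whole box.

  That function is built step by step, carrying a function of x and of the positions of
  the active scatterers, those already met and still to be met again. Multiplication by B(x - y), with y
  created when first met and integrated out when last met, is bounded in L2 in terms
  of the sup, L1 and L2 norms of B alone, uniformly in L. This gives the bound. For the limit, a cutoff that
  vanishes on the boundary of a smaller box shows that the resolvents are strongly Cauchy along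
  every sequence of boxes tending to infinity; the convergence propagates through the steps.
\<close>

section \<open>Square integrable functions\<close>

text \<open>The function \<open>resolvent\<close> is chosen among functions that agree almost
  everywhere, so nothing makes it measurable in the scatterer positions. A truncated resolvent is an
  explicit finite sum: it is jointly measurable in all parameters, and it sends square integrable
  functions of bounded norm to bounded functions, which is what the uses of Fubini require. A bound
  on the potential as an operator grows with the number of scatterers, hence with the volume. Such
  bounds serve only to dominate limits at fixed L. The uniform estimate has to integrate out the
  positions before norms are taken, which is why functions of x and of the active positions are
  carried along. The cutoff N is removed at each fixed L. The limit in L is therefore taken along
  pairs (L_k, N_k), with N_k so large that the truncated value is within 1/(k+1) of the true one;
  for this reason the convergence statements about resolvents concern joint sequences of boxes and
  cutoffs.\<close>

definition nsq :: "'a measure \<Rightarrow> ('a \<Rightarrow> complex) \<Rightarrow> ennreal" where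
  "nsq M f = (\<integral>\<^sup>+x. ennreal ((cmod (f x))^2) \<partial>M)"

definition ip :: "'a measure \<Rightarrow> ('a \<Rightarrow> complex) \<Rightarrow> ('a \<Rightarrow> complex) \<Rightarrow> complex" where
  "ip M f g = (\<integral>x. cnj (f x) * g x \<partial>M)"

lemma borel_measurable_cnj_comp[measurable (raw)]:
  assumes "f \<in> borel_measurable M"
  shows "(\<lambda>x. cnj (f x)) \<in> borel_measurable M"
  using measurable_comp[OF assms borel_measurable_continuous_onI[OF continuous_on_cnj[OF continuous_on_id]]]
  by (simp add: comp_def)

lemma ennreal_tendsto_0_le:
  fixes f g :: "'b \<Rightarrow> ennreal"
  assumes "(g \<longlongrightarrow> 0) F" "\<And>k. f k \<le> g k"
  shows "(f \<longlongrightarrow> 0) F"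
  by (rule tendsto_sandwich[OF _ _ tendsto_const assms(1)]) (simp_all add: assms(2))

lemma nsq_cong: "(\<And>x. x \<in> space M \<Longrightarrow> f x = g x) \<Longrightarrow> nsq M f = nsq M g"
  unfolding nsq_def by (intro nn_integral_cong) simp

lemma nsq_mono:
  assumes "\<And>x. x \<in> space M \<Longrightarrow> cmod (f x) \<le> cmod (g x)"
  shows "nsq M f \<le> nsq M g"
  unfolding nsq_def by (intro nn_integral_mono ennreal_leI power_mono assms) auto

lemma norm_sum_sq_le:
  fixes f :: "'i \<Rightarrow> 'b::real_normed_vector"
  shows "(norm (\<Sum>i\<in>I. f i))^2 \<le> real (card I) * (\<Sum>i\<in>I. (norm (f i))^2)"
proof -
  have "(norm (\<Sum>i\<in>I. f i))^2 \<le> (\<Sum>i\<in>I. norm (f i) * 1)^2"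
    by (intro power_mono) (auto intro: norm_sum)
  also have "\<dots> \<le> (\<Sum>i\<in>I. (norm (f i))^2) * (\<Sum>i\<in>I. 1^2)"
    by (rule Cauchy_Schwarz_ineq_sum)
  finally show ?thesis by (simp add: mult.commute)
qed

lemma nsq_sum_le:
  assumes "\<And>i. i \<in> I \<Longrightarrow> f i \<in> borel_measurable M"
  shows "nsq M (\<lambda>x. \<Sum>i\<in>I. f i x) \<le> of_nat (card I) * (\<Sum>i\<in>I. nsq M (f i))"
proof -
  have "nsq M (\<lambda>x. \<Sum>i\<in>I. f i x) \<le> (\<integral>\<^sup>+x. of_nat (card I) * (\<Sum>i\<in>I. ennreal ((cmod (f i x))^2)) \<partial>M)"
    unfolding nsq_def
  proof (rule nn_integral_mono)
    fix x
    have "ennreal ((cmod (\<Sum>i\<in>I. f i x))^2) \<le> ennreal (real (card I) * (\<Sum>i\<in>I. (cmod (f i x))^2))"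
      by (intro ennreal_leI norm_sum_sq_le)
    also have "\<dots> = of_nat (card I) * (\<Sum>i\<in>I. ennreal ((cmod (f i x))^2))"
      by (simp add: ennreal_mult sum_nonneg ennreal_of_nat_eq_real_of_nat)
    finally show "ennreal ((cmod (\<Sum>i\<in>I. f i x))^2) \<le> of_nat (card I) * (\<Sum>i\<in>I. ennreal ((cmod (f i x))^2))" .
  qed
  also have "\<dots> = of_nat (card I) * (\<Sum>i\<in>I. nsq M (f i))"
    unfolding nsq_def using assms
    by (subst nn_integral_cmult) (auto simp: nn_integral_sum simp del: sum_ennreal)
  finally show ?thesis .
qed

text \<open>Squared norms obey the triangle inequality only up to the factor 2 from (a + b)^2 <= 2
  a^2 + 2 b^2. The estimate is used for limits and finiteness, where the loss does not matter.
  Working with squares in \<open>ennreal\<close> keeps integrability side conditions out of the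
  estimates.\<close>

lemma nsq_add_le:
  assumes [measurable]: "f \<in> borel_measurable M" "g \<in> borel_measurable M"
  shows "nsq M (\<lambda>x. f x + g x) \<le> 2 * nsq M f + 2 * nsq M g"
proof -
  have "nsq M (\<lambda>x. f x + g x) = nsq M (\<lambda>x. \<Sum>b\<in>UNIV. (if b then f x else g x))"
    by (simp add: UNIV_bool add.commute)
  also have "\<dots> \<le> of_nat (card (UNIV::bool set)) * (\<Sum>b\<in>UNIV. nsq M (\<lambda>x. if b then f x else g x))"
    by (rule nsq_sum_le) simp
  also have "\<dots> = 2 * nsq M f + 2 * nsq M g"
    by (simp add: UNIV_bool distrib_left add.commute)
  finally show ?thesis .
qed

lemma nsq_minus_commute: "nsq M (\<lambda>x. f x - g x) = nsq M (\<lambda>x. g x - f x)"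
  unfolding nsq_def by (simp add: norm_minus_commute)

lemma nsq_diff_le:
  assumes [measurable]: "f \<in> borel_measurable M" "g \<in> borel_measurable M"
  shows "nsq M (\<lambda>x. f x - g x) \<le> 2 * nsq M f + 2 * nsq M g"
  using nsq_add_le[of f M "\<lambda>x. - g x"] by (simp add: nsq_def)

lemma nsq_triangle:
  assumes [measurable]: "f \<in> borel_measurable M" "g \<in> borel_measurable M" "h \<in> borel_measurable M"
  shows "nsq M (\<lambda>x. f x - h x) \<le> 2 * nsq M (\<lambda>x. f x - g x) + 2 * nsq M (\<lambda>x. g x - h x)"
  using nsq_add_le[of "\<lambda>x. f x - g x" M "\<lambda>x. g x - h x"] by simp

lemma nsq_mult_le:
  assumes [measurable]: "f \<in> borel_measurable M" and "\<And>x. x \<in> space M \<Longrightarrow> cmod (b x) \<le> c"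
  shows "nsq M (\<lambda>x. b x * f x) \<le> ennreal (c^2) * nsq M f"
proof -
  have "nsq M (\<lambda>x. b x * f x) \<le> (\<integral>\<^sup>+x. ennreal (c^2) * ennreal ((cmod (f x))^2) \<partial>M)"
    unfolding nsq_def
  proof (rule nn_integral_mono)
    fix x assume "x \<in> space M"
    then have "(cmod (b x))^2 \<le> c^2" using assms(2) by (intro power_mono) auto
    then show "ennreal ((cmod (b x * f x))^2) \<le> ennreal (c^2) * ennreal ((cmod (f x))^2)"
      by (simp add: norm_mult power_mult_distrib ennreal_mult[symmetric] mult_right_mono ennreal_leI)
  qed
  also have "\<dots> = ennreal (c^2) * nsq M f"
    unfolding nsq_def by (subst nn_integral_cmult) auto
  finally show ?thesis .
qed

lemma nsq_cmult:
  assumes [measurable]: "f \<in> borel_measurable M"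
  shows "nsq M (\<lambda>x. c * f x) = ennreal ((cmod c)^2) * nsq M f"
  unfolding nsq_def by (subst nn_integral_cmult[symmetric]) (auto simp: norm_mult power_mult_distrib ennreal_mult)

lemma nsq_finite_iff:
  assumes [measurable]: "f \<in> borel_measurable M"
  shows "nsq M f < \<top> \<longleftrightarrow> integrable M (\<lambda>x. (cmod (f x))^2)"
  unfolding nsq_def integrable_iff_bounded by simp

lemma nsq_eq_integral:
  assumes [measurable]: "f \<in> borel_measurable M" and "nsq M f < \<top>"
  shows "nsq M f = ennreal (\<integral>x. (cmod (f x))^2 \<partial>M)"
  using assms nsq_finite_iff[of f M] unfolding nsq_def
  by (intro nn_integral_eq_integral) auto

lemma Cauchy_Schwarz_nsq:
  assumes [measurable]: "f \<in> borel_measurable M" "g \<in> borel_measurable M"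
  shows "(\<integral>\<^sup>+x. ennreal (cmod (cnj (f x) * g x)) \<partial>M)^2 \<le> nsq M f * nsq M g"
proof -
  have "(\<integral>\<^sup>+x. ennreal (cmod (f x)) * ennreal (cmod (g x)) \<partial>M)^2
     \<le> (\<integral>\<^sup>+x. (ennreal (cmod (f x)))^2 \<partial>M) * (\<integral>\<^sup>+x. (ennreal (cmod (g x)))^2 \<partial>M)"
    by (rule Cauchy_Schwarz_nn_integral) auto
  then show ?thesis
    by (simp add: nsq_def ennreal_power norm_mult ennreal_mult)
qed

lemma integrable_cnj_mult:
  assumes [measurable]: "f \<in> borel_measurable M" "g \<in> borel_measurable M"
    and "nsq M f < \<top>" "nsq M g < \<top>"
  shows "integrable M (\<lambda>x. cnj (f x) * g x)"
proof -
  have "(\<integral>\<^sup>+x. ennreal (cmod (cnj (f x) * g x)) \<partial>M)^2 < \<top>"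
    using Cauchy_Schwarz_nsq[OF assms(1,2)] assms(3,4)
    by (intro le_less_trans[OF Cauchy_Schwarz_nsq[OF assms(1,2)]]) (simp add: ennreal_mult_less_top)
  then have "(\<integral>\<^sup>+x. ennreal (cmod (cnj (f x) * g x)) \<partial>M) < \<top>"
    by (auto simp: power2_eq_square ennreal_mult_less_top)
  then show ?thesis by (auto simp: integrable_iff_bounded)
qed

text \<open>If the product is not integrable, \<open>ip\<close> is 0 by the convention for the
  Bochner integral, so Cauchy-Schwarz holds for all measurable functions.\<close>

lemma ip_le:
  assumes [measurable]: "f \<in> borel_measurable M" "g \<in> borel_measurable M"
  shows "ennreal ((cmod (ip M f g))^2) \<le> nsq M f * nsq M g"
proof -
  have "ennreal (cmod (ip M f g)) \<le> (\<integral>\<^sup>+x. ennreal (cmod (cnj (f x) * g x)) \<partial>M)"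
    unfolding ip_def
    by (cases "integrable M (\<lambda>x. cnj (f x) * g x)")
       (auto simp: not_integrable_integral_eq intro: integral_norm_bound_ennreal)
  then have "ennreal (cmod (ip M f g))^2 \<le> (\<integral>\<^sup>+x. ennreal (cmod (cnj (f x) * g x)) \<partial>M)^2"
    by (rule power_mono) auto
  with Cauchy_Schwarz_nsq[OF assms] show ?thesis by (simp add: ennreal_power order.trans)
qed

lemma ip_diff_right:
  assumes [measurable]: "f \<in> borel_measurable M" "g \<in> borel_measurable M" "h \<in> borel_measurable M"
    and "nsq M f < \<top>" "nsq M g < \<top>" "nsq M h < \<top>"
  shows "ip M f (\<lambda>x. g x - h x) = ip M f g - ip M f h"
  unfolding ip_def using integrable_cnj_mult[of f M g] integrable_cnj_mult[of f M h] assms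
  by (simp add: right_diff_distrib)

lemma ip_cmult_right: "ip M f (\<lambda>x. c * g x) = c * ip M f g"
  unfolding ip_def by (simp add: mult.left_commute)

lemma ip_cmult_left: "ip M (\<lambda>x. c * f x) g = cnj c * ip M f g"
  unfolding ip_def by (simp add: mult.assoc)

lemma ip_sum_right:
  assumes "f \<in> borel_measurable M" "nsq M f < \<top>"
    "\<And>i. i \<in> I \<Longrightarrow> g i \<in> borel_measurable M" "\<And>i. i \<in> I \<Longrightarrow> nsq M (g i) < \<top>"
  shows "ip M f (\<lambda>x. \<Sum>i\<in>I. g i x) = (\<Sum>i\<in>I. ip M f (g i))"
  unfolding ip_def sum_distrib_left using assms
  by (intro Bochner_Integration.integral_sum integrable_cnj_mult) auto

lemma ip_sum_left:
  assumes "f \<in> borel_measurable M" "nsq M f < \<top>"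
    "\<And>i. i \<in> I \<Longrightarrow> g i \<in> borel_measurable M" "\<And>i. i \<in> I \<Longrightarrow> nsq M (g i) < \<top>"
  shows "ip M (\<lambda>x. \<Sum>i\<in>I. g i x) f = (\<Sum>i\<in>I. ip M (g i) f)"
  unfolding ip_def cnj_sum sum_distrib_right using assms
  by (intro Bochner_Integration.integral_sum integrable_cnj_mult) auto

lemma ip_self:
  assumes "f \<in> borel_measurable M" "nsq M f < \<top>"
  shows "ennreal (Re (ip M f f)) = nsq M f"
proof -
  have "ip M f f = (\<integral>x. complex_of_real ((cmod (f x))^2) \<partial>M)"
    unfolding ip_def by (intro Bochner_Integration.integral_cong) (auto simp: complex_norm_square[symmetric] mult.commute)
  also have "\<dots> = complex_of_real (\<integral>x. (cmod (f x))^2 \<partial>M)"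
    by (rule integral_complex_of_real)
  finally show ?thesis using nsq_eq_integral[OF assms] by simp
qed

lemma nsq_tendsto_finite:
  assumes [measurable]: "f \<in> borel_measurable M" "\<And>k. u k \<in> borel_measurable M"
    and "\<And>k. nsq M (u k) < \<top>" and lim: "(\<lambda>k. nsq M (\<lambda>x. u k x - f x)) \<longlonglongrightarrow> 0"
  shows "nsq M f < \<top>"
proof -
  have "eventually (\<lambda>k. nsq M (\<lambda>x. u k x - f x) < 1) sequentially"
    using lim by (rule order_tendstoD) simp
  then obtain k where k: "nsq M (\<lambda>x. u k x - f x) < 1"
    by (auto simp: eventually_sequentially)
  have "nsq M f \<le> 2 * nsq M (u k) + 2 * nsq M (\<lambda>x. u k x - f x)"
    using nsq_diff_le[of "u k" M "\<lambda>x. u k x - f x"] by simp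
  also have "\<dots> < \<top>"
    using assms(3)[of k] k by (auto simp: ennreal_mult_less_top intro: less_trans)
  finally show ?thesis .
qed

text \<open>Riesz-Fischer. A subsequence with fast decreasing increments converges almost
  everywhere, and Fatou's lemma turns the Cauchy condition for the whole sequence into a bound on
  the distance to that pointwise limit.\<close>

lemma nsq_complete:
  fixes f :: "nat \<Rightarrow> 'a \<Rightarrow> complex"
  assumes [measurable]: "\<And>k. f k \<in> borel_measurable M"
    and cauchy: "\<And>\<epsilon>::ennreal. 0 < \<epsilon> \<Longrightarrow> \<exists>K. \<forall>j\<ge>K. \<forall>k\<ge>K. nsq M (\<lambda>x. f j x - f k x) \<le> \<epsilon>"
  shows "\<exists>g\<in>borel_measurable M. (\<lambda>k. nsq M (\<lambda>x. f k x - g x)) \<longlonglongrightarrow> 0"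
proof -
  have "\<forall>i::nat. \<exists>K. \<forall>j\<ge>K. \<forall>k\<ge>K. nsq M (\<lambda>x. f j x - f k x) \<le> ennreal ((1/4)^i)"
    by (intro allI cauchy) simp
  then obtain K where K: "\<And>i j k. K i \<le> j \<Longrightarrow> K i \<le> k \<Longrightarrow> nsq M (\<lambda>x. f j x - f k x) \<le> ennreal ((1/4)^i)"
    by metis
  \<comment> \<open>\<open>r\<close> must dominate \<open>K\<close>, be monotone and tend to
    infinity: summing the earlier \<open>K j\<close> gives monotonicity, the summand i gives
    growth.\<close>
  define r where "r i = (\<Sum>j\<le>i. K j) + i" for i
  have rK: "K i \<le> r i" for i
    unfolding r_def by (intro trans_le_add1 member_le_sum) auto
  have rS: "r i \<le> r (Suc i)" for i unfolding r_def by simp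
  have step: "nsq M (\<lambda>x. f (r (Suc i)) x - f (r i) x) \<le> ennreal ((1/4)^i)" for i
    using K[of i "r (Suc i)" "r i"] rK[of i] rS[of i] by simp
  \<comment> \<open>The squared increments have integral at most (1/4)^i, so even with the weight
    2^i their sum has a finite integral and is finite almost everywhere.\<close>
  define a where "a i x = cmod (f (r (Suc i)) x - f (r i) x)" for i x
  have [measurable]: "a i \<in> borel_measurable M" for i unfolding a_def by simp
  have "(\<integral>\<^sup>+x. (\<Sum>i. ennreal (2^i * (a i x)^2)) \<partial>M) = (\<Sum>i. \<integral>\<^sup>+x. ennreal (2^i * (a i x)^2) \<partial>M)"
    by (intro nn_integral_suminf) simp
  also have "\<dots> = (\<Sum>i. ennreal (2^i) * nsq M (\<lambda>x. f (r (Suc i)) x - f (r i) x))"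
    unfolding nsq_def a_def by (subst nn_integral_cmult[symmetric]) (auto simp: ennreal_mult)
  also have "\<dots> \<le> (\<Sum>i. ennreal ((1/2)^i))"
  proof (intro suminf_le summableI)
    fix i :: nat
    have "ennreal (2^i) * nsq M (\<lambda>x. f (r (Suc i)) x - f (r i) x) \<le> ennreal (2^i) * ennreal ((1/4)^i)"
      by (intro mult_left_mono step) simp
    also have "\<dots> = ennreal ((1/2)^i)"
      by (simp add: ennreal_mult[symmetric] power_mult_distrib[symmetric])
    finally show "ennreal (2^i) * nsq M (\<lambda>x. f (r (Suc i)) x - f (r i) x) \<le> ennreal ((1/2)^i)" .
  qed
  also have "\<dots> = ennreal (\<Sum>i. (1/2)^i)" by (intro suminf_ennreal2) (auto simp: summable_geometric)
  finally have fin: "(\<integral>\<^sup>+x. (\<Sum>i. ennreal (2^i * (a i x)^2)) \<partial>M) \<noteq> \<infinity>"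
    by (auto simp: top_unique)
  have "AE x in M. (\<Sum>i. ennreal (2^i * (a i x)^2)) \<noteq> \<infinity>"
    by (intro nn_integral_PInf_AE fin) simp
  then have conv: "AE x in M. convergent (\<lambda>i. f (r i) x)"
  proof eventually_elim
    fix x assume "(\<Sum>i. ennreal (2^i * (a i x)^2)) \<noteq> \<infinity>"
    then have s1: "summable (\<lambda>i. 2^i * (a i x)^2)"
      by (intro summable_suminf_not_top) auto
    have "summable (\<lambda>i. (1/2)^i + 2^i * (a i x)^2)"
      by (intro summable_add s1 summable_geometric) simp
    then have "summable (\<lambda>i. a i x)"
    proof (rule summable_comparison_test')
      fix i :: nat assume "0 \<le> i"
      \<comment> \<open>Turns weighted square summability into absolute summability: with t =
        (1/2)^i, an increment is at most (1/2)^i plus 2^i times its square.\<close>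
      have am_gm: "s \<le> t + s^2 / t" if "0 < t" "0 \<le> s" for s t :: real
      proof (cases "s \<le> t")
        case True
        then show ?thesis using that by (simp add: add_increasing2)
      next
        case False
        then have "s * t \<le> s * s" using that by (intro mult_left_mono) auto
        then have "s \<le> s^2 / t" using that by (simp add: field_simps power2_eq_square)
        then show ?thesis using that by linarith
      qed
      show "norm (a i x) \<le> (1/2)^i + 2^i * (a i x)^2"
        using am_gm[of "(1/2)^i" "a i x"] by (simp add: a_def power_one_over field_simps)
    qed
    then have "summable (\<lambda>i. f (r (Suc i)) x - f (r i) x)"
      unfolding a_def by (rule summable_norm_cancel)
    then have "convergent (\<lambda>n. \<Sum>i<n. f (r (Suc i)) x - f (r i) x)"
      by (simp add: summable_iff_convergent)
    then have "convergent (\<lambda>n. f (r n) x - f (r 0) x)"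
      by (simp add: sum_lessThan_telescope[of "\<lambda>i. f (r i) x"])
    then show "convergent (\<lambda>i. f (r i) x)"
      using convergent_diff_const_right_iff by blast
  qed
  define g where "g x = lim (\<lambda>i. f (r i) x)" for x
  have g[measurable]: "g \<in> borel_measurable M"
    unfolding g_def by (intro borel_measurable_lim_metric) simp
  have bd: "nsq M (\<lambda>x. f k x - g x) \<le> \<epsilon>"
    if Kp: "\<forall>j\<ge>K0. \<forall>k\<ge>K0. nsq M (\<lambda>x. f j x - f k x) \<le> \<epsilon>" and "K0 \<le> k" for k K0 \<epsilon>
  proof -
    have "nsq M (\<lambda>x. f k x - g x) = (\<integral>\<^sup>+x. liminf (\<lambda>i. ennreal ((cmod (f k x - f (r i) x))^2)) \<partial>M)"
      unfolding nsq_def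
    proof (rule nn_integral_cong_AE)
      from conv show "AE x in M. ennreal ((cmod (f k x - g x))^2) = liminf (\<lambda>i. ennreal ((cmod (f k x - f (r i) x))^2))"
      proof eventually_elim
        fix x assume "convergent (\<lambda>i. f (r i) x)"
        then have "(\<lambda>i. f (r i) x) \<longlonglongrightarrow> g x" unfolding g_def by (simp add: convergent_LIMSEQ_iff)
        then have "(\<lambda>i. ennreal ((cmod (f k x - f (r i) x))^2)) \<longlonglongrightarrow> ennreal ((cmod (f k x - g x))^2)"
          by (intro tendsto_intros tendsto_ennrealI)
        then show "ennreal ((cmod (f k x - g x))^2) = liminf (\<lambda>i. ennreal ((cmod (f k x - f (r i) x))^2))"
          by (rule lim_imp_Liminf[symmetric, rotated]) simp
      qed
    qed
    also have "\<dots> \<le> liminf (\<lambda>i. nsq M (\<lambda>x. f k x - f (r i) x))"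
      unfolding nsq_def by (intro nn_integral_liminf) simp
    also have "\<dots> \<le> \<epsilon>"
    proof (rule Liminf_le)
      show "\<forall>\<^sub>F i in sequentially. nsq M (\<lambda>x. f k x - f (r i) x) \<le> \<epsilon>"
        unfolding eventually_sequentially
      proof (intro exI[of _ K0] allI impI)
        fix i assume "K0 \<le> i"
        then have "K0 \<le> r i" unfolding r_def by linarith
        then show "nsq M (\<lambda>x. f k x - f (r i) x) \<le> \<epsilon>" using Kp \<open>K0 \<le> k\<close> by blast
      qed
    qed simp
    finally show ?thesis .
  qed
  have "(\<lambda>k. nsq M (\<lambda>x. f k x - g x)) \<longlonglongrightarrow> 0"
  proof (rule order_tendstoI)
    fix e :: ennreal assume "0 < e"
    then obtain \<epsilon> where \<epsilon>: "0 < \<epsilon>" "\<epsilon> < e" using dense by blast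
    from cauchy[OF \<epsilon>(1)] obtain K0 where "\<forall>j\<ge>K0. \<forall>k\<ge>K0. nsq M (\<lambda>x. f j x - f k x) \<le> \<epsilon>" by blast
    from bd[OF this] \<epsilon>(2) show "\<forall>\<^sub>F k in sequentially. nsq M (\<lambda>x. f k x - g x) < e"
      unfolding eventually_sequentially by (meson le_less_trans)
  qed simp
  then show ?thesis using g by blast
qed

section \<open>Fourier multipliers of orthonormal systems\<close>

lemma nsq_finite_sum:
  assumes "finite J" "\<And>i. i \<in> J \<Longrightarrow> f i \<in> borel_measurable N" "\<And>i. i \<in> J \<Longrightarrow> nsq N (f i) < \<top>"
  shows "nsq N (\<lambda>x. \<Sum>i\<in>J. f i x) < \<top>"
  using assms by (intro le_less_trans[OF nsq_sum_le]) (auto simp: ennreal_mult_less_top of_nat_less_top)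

definition orthonormal :: "'a measure \<Rightarrow> ('i \<Rightarrow> 'a \<Rightarrow> complex) \<Rightarrow> 'i set \<Rightarrow> bool" where
  "orthonormal M e I \<longleftrightarrow> (\<forall>p\<in>I. e p \<in> borel_measurable M \<and> nsq M (e p) < \<top>) \<and>
     (\<forall>p\<in>I. \<forall>q\<in>I. ip M (e p) (e q) = (if p = q then 1 else 0))"

text \<open>A Fourier multiplier cut off to the indices in P. The projection has symbol 1 and the
  truncated resolvent has symbol 1 / (nu p - z), so the abstract estimates below cover both.\<close>

definition mulop :: "'a measure \<Rightarrow> ('i \<Rightarrow> 'a \<Rightarrow> complex) \<Rightarrow> 'i set \<Rightarrow> ('i \<Rightarrow> complex) \<Rightarrow> ('a \<Rightarrow> complex) \<Rightarrow> 'a \<Rightarrow> complex" where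
  "mulop M e P m f x = (\<Sum>p\<in>P. m p * ip M (e p) f * e p x)"

context
  fixes M :: "'a measure" and e :: "'i \<Rightarrow> 'a \<Rightarrow> complex" and I :: "'i set"
  assumes orth: "orthonormal M e I"
begin

lemma orthonormal_measurable: "p \<in> I \<Longrightarrow> e p \<in> borel_measurable M"
  using orth by (auto simp: orthonormal_def)

lemma orthonormal_nsq: "p \<in> I \<Longrightarrow> nsq M (e p) < \<top>"
  using orth by (auto simp: orthonormal_def)

lemma orthonormal_nsq_cmult: "p \<in> I \<Longrightarrow> nsq M (\<lambda>x. c * e p x) < \<top>"
  using orthonormal_nsq[of p] orthonormal_measurable[of p] by (simp add: nsq_cmult ennreal_mult_less_top)

lemma orthonormal_sum_measurable:
  "P \<subseteq> I \<Longrightarrow> (\<lambda>x. \<Sum>p\<in>P. c p * e p x) \<in> borel_measurable M"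
  by (intro borel_measurable_sum borel_measurable_times borel_measurable_const orthonormal_measurable) auto

lemma orthonormal_sum_nsq_finite:
  "finite P \<Longrightarrow> P \<subseteq> I \<Longrightarrow> nsq M (\<lambda>x. \<Sum>p\<in>P. c p * e p x) < \<top>"
  by (rule nsq_finite_sum) (auto intro!: orthonormal_measurable borel_measurable_times intro: orthonormal_nsq_cmult)

lemma ip_orthonormal_sum:
  assumes "finite P" "P \<subseteq> I" "q \<in> I"
  shows "ip M (e q) (\<lambda>x. \<Sum>p\<in>P. c p * e p x) = (if q \<in> P then c q else 0)"
proof -
  have "ip M (e q) (\<lambda>x. \<Sum>p\<in>P. c p * e p x) = (\<Sum>p\<in>P. ip M (e q) (\<lambda>x. c p * e p x))"
    using assms by (intro ip_sum_right) (auto intro!: orthonormal_measurable borel_measurable_times intro: orthonormal_nsq orthonormal_nsq_cmult)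
  also have "\<dots> = (\<Sum>p\<in>P. c p * (if q = p then 1 else 0))"
    using assms orth by (intro sum.cong) (auto simp: ip_cmult_right orthonormal_def subset_iff)
  also have "\<dots> = (if q \<in> P then c q else 0)"
    using assms(1) by (simp add: if_distrib if_distribR cong: if_cong)
  finally show ?thesis .
qed

lemma ip_orthonormal_sum_left:
  assumes "finite P" "P \<subseteq> I" "f \<in> borel_measurable M" "nsq M f < \<top>"
  shows "ip M (\<lambda>x. \<Sum>p\<in>P. c p * e p x) f = (\<Sum>p\<in>P. cnj (c p) * ip M (e p) f)"
proof -
  have "ip M (\<lambda>x. \<Sum>p\<in>P. c p * e p x) f = (\<Sum>p\<in>P. ip M (\<lambda>x. c p * e p x) f)"
    using assms by (intro ip_sum_left) (auto intro!: orthonormal_measurable borel_measurable_times intro: orthonormal_nsq_cmult)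
  then show ?thesis by (simp add: ip_cmult_left)
qed

lemma nsq_orthonormal_sum:
  assumes "finite P" "P \<subseteq> I"
  shows "nsq M (\<lambda>x. \<Sum>p\<in>P. c p * e p x) = ennreal (\<Sum>p\<in>P. (cmod (c p))^2)"
proof -
  let ?s = "\<lambda>x. \<Sum>p\<in>P. c p * e p x"
  have "ip M ?s ?s = (\<Sum>p\<in>P. cnj (c p) * ip M (e p) ?s)"
    using assms by (intro ip_orthonormal_sum_left orthonormal_sum_measurable orthonormal_sum_nsq_finite)
  also have "\<dots> = (\<Sum>p\<in>P. cnj (c p) * c p)"
    using assms by (intro sum.cong) (auto simp: ip_orthonormal_sum subset_iff)
  also have "\<dots> = complex_of_real (\<Sum>p\<in>P. (cmod (c p))^2)"
    unfolding of_real_sum complex_norm_square by (simp add: mult.commute)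
  finally have *: "Re (ip M ?s ?s) = (\<Sum>p\<in>P. (cmod (c p))^2)" by (rule ssubst) (rule Re_complex_of_real)
  have "ennreal (Re (ip M ?s ?s)) = nsq M ?s"
    by (rule ip_self[OF orthonormal_sum_measurable[OF assms(2)] orthonormal_sum_nsq_finite[OF assms]])
  then show ?thesis unfolding * by (rule sym)
qed

text \<open>Pair f with the partial sum of its own expansion. The result is the sum S of squared
  coefficients, while Cauchy-Schwarz bounds S^2 by S times the squared norm of f; then S is
  cancelled.\<close>

lemma bessel:
  assumes "finite P" "P \<subseteq> I" and f[measurable]: "f \<in> borel_measurable M"
  shows "ennreal (\<Sum>p\<in>P. (cmod (ip M (e p) f))^2) \<le> nsq M f"
proof (cases "nsq M f < \<top>")
  case True
  let ?s = "\<lambda>x. \<Sum>p\<in>P. ip M (e p) f * e p x" and ?S = "\<Sum>p\<in>P. (cmod (ip M (e p) f))^2"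
  have m: "?s \<in> borel_measurable M" by (rule orthonormal_sum_measurable[OF assms(2)])
  have "ip M ?s f = (\<Sum>p\<in>P. cnj (ip M (e p) f) * ip M (e p) f)"
    using assms True by (intro ip_orthonormal_sum_left)
  also have "\<dots> = complex_of_real ?S"
    unfolding of_real_sum complex_norm_square by (simp add: mult.commute)
  finally have "ennreal (?S^2) \<le> ennreal ?S * nsq M f"
    using ip_le[OF m f] nsq_orthonormal_sum[OF assms(1,2), of "\<lambda>p. ip M (e p) f"]
    by (simp add: sum_nonneg del: of_real_sum)
  moreover have "nsq M f = ennreal (\<integral>x. (cmod (f x))^2 \<partial>M)" (is "_ = ennreal ?n")
    using True by (rule nsq_eq_integral[OF f])
  ultimately have "ennreal (?S * ?S) \<le> ennreal (?S * ?n)"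
    by (simp add: power2_eq_square ennreal_mult sum_nonneg)
  then have "?S * ?S \<le> ?S * ?n"
    by (subst (asm) ennreal_le_iff) (auto intro!: mult_nonneg_nonneg sum_nonneg)
  then have "?S \<le> ?n"
    by (cases "?S = 0") (auto simp: mult_le_cancel_left sum_nonneg order.strict_iff_order)
  then show ?thesis using \<open>nsq M f = ennreal ?n\<close> by (simp add: ennreal_leI)
next
  case False
  then have "nsq M f = \<top>" using less_top by blast
  then show ?thesis by simp
qed

lemma mulop_measurable: "P \<subseteq> I \<Longrightarrow> mulop M e P m f \<in> borel_measurable M"
  unfolding mulop_def[abs_def] by (rule orthonormal_sum_measurable)

lemma mulop_nsq_finite: "finite P \<Longrightarrow> P \<subseteq> I \<Longrightarrow> nsq M (mulop M e P m f) < \<top>"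
  unfolding mulop_def[abs_def] by (rule orthonormal_sum_nsq_finite)

lemma nsq_mulop_le:
  assumes "finite P" "P \<subseteq> I" and "f \<in> borel_measurable M" and "\<And>p. p \<in> P \<Longrightarrow> cmod (m p) \<le> c"
  shows "nsq M (mulop M e P m f) \<le> ennreal (c^2) * nsq M f"
proof -
  have "nsq M (mulop M e P m f) = ennreal (\<Sum>p\<in>P. (cmod (m p * ip M (e p) f))^2)"
    unfolding mulop_def[abs_def] using assms by (intro nsq_orthonormal_sum)
  also have "\<dots> \<le> ennreal (c^2 * (\<Sum>p\<in>P. (cmod (ip M (e p) f))^2))"
    unfolding sum_distrib_left norm_mult power_mult_distrib
    using assms(4) by (intro ennreal_leI sum_mono mult_right_mono power_mono) auto
  also have "\<dots> \<le> ennreal (c^2) * nsq M f"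
    using assms bessel[of P f] by (simp add: ennreal_mult sum_nonneg mult_left_mono)
  finally show ?thesis .
qed

lemma mulop_diff:
  assumes "P \<subseteq> I" "f \<in> borel_measurable M" "nsq M f < \<top>" "g \<in> borel_measurable M" "nsq M g < \<top>"
  shows "mulop M e P m (\<lambda>x. f x - g x) x = mulop M e P m f x - mulop M e P m g x"
proof -
  have "ip M (e p) (\<lambda>x. f x - g x) = ip M (e p) f - ip M (e p) g" if "p \<in> P" for p
    using assms that by (intro ip_diff_right) (auto intro!: orthonormal_measurable intro: orthonormal_nsq)
  then show ?thesis unfolding mulop_def sum_subtractf[symmetric]
    by (intro sum.cong refl) (simp add: left_diff_distrib right_diff_distrib)
qed

text \<open>By Bessel the sums \<open>a N\<close> are increasing and bounded, hence Cauchy, and they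
  control the distance between partial sums of the multiplier series. The coefficients of the limit
  are found by continuity of \<open>ip\<close>, since each coefficient is constant once N is
  large.\<close>

lemma mulop_convergent:
  fixes P :: "nat \<Rightarrow> 'i set"
  assumes P: "\<And>N. finite (P N)" "\<And>N. P N \<subseteq> I" "\<And>N N'. N \<le> N' \<Longrightarrow> P N \<subseteq> P N'"
    and f: "f \<in> borel_measurable M" "nsq M f < \<top>" and m: "\<And>p. p \<in> I \<Longrightarrow> cmod (m p) \<le> c"
  shows "\<exists>g\<in>borel_measurable M. nsq M g < \<top> \<and>
    (\<lambda>N. nsq M (\<lambda>x. mulop M e (P N) m f x - g x)) \<longlonglongrightarrow> 0 \<and>
    (\<forall>p\<in>(\<Union>N. P N). ip M (e p) g = m p * ip M (e p) f)"
proof -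
  define a where "a N = (\<Sum>p\<in>P N. (cmod (ip M (e p) f))^2)" for N
  have "incseq a" unfolding a_def incseq_def by (intro allI impI sum_mono2 P(1) P(3)) auto
  moreover have "a N \<le> enn2real (nsq M f)" for N
    using enn2real_mono[OF bessel[OF P(1,2) f(1), of N]] f(2) unfolding a_def by (simp add: sum_nonneg)
  ultimately have "convergent a" using incseq_convergent[of a "enn2real (nsq M f)"] unfolding convergent_def by blast
  then have "Cauchy a" by (rule convergent_Cauchy)
  have diff: "nsq M (\<lambda>x. mulop M e (P j) m f x - mulop M e (P k) m f x) \<le> ennreal (c^2 * (a j - a k))"
    if "k \<le> j" for j k
  proof -
    have sub: "P k \<subseteq> P j" by (rule P(3)[OF that])
    have "mulop M e (P j) m f x - mulop M e (P k) m f x = (\<Sum>p\<in>P j - P k. (m p * ip M (e p) f) * e p x)" for x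
      unfolding mulop_def using sub P(1) by (simp add: sum_diff)
    then have "nsq M (\<lambda>x. mulop M e (P j) m f x - mulop M e (P k) m f x)
       = ennreal (\<Sum>p\<in>P j - P k. (cmod (m p * ip M (e p) f))^2)"
      using P(1,2)[of j] by (simp add: nsq_orthonormal_sum Diff_subset[THEN subset_trans])
    also have "\<dots> \<le> ennreal (\<Sum>p\<in>P j - P k. c^2 * (cmod (ip M (e p) f))^2)"
      unfolding norm_mult power_mult_distrib
      using m P(2)[of j] by (intro ennreal_leI sum_mono mult_right_mono power_mono) auto
    also have "\<dots> = ennreal (c^2 * (a j - a k))"
      unfolding a_def using sub P(1) by (simp add: sum_diff sum_distrib_left[symmetric])
    finally show ?thesis .
  qed
  have "\<exists>g\<in>borel_measurable M. (\<lambda>N. nsq M (\<lambda>x. mulop M e (P N) m f x - g x)) \<longlonglongrightarrow> 0"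
  proof (rule nsq_complete)
    show "mulop M e (P k) m f \<in> borel_measurable M" for k by (rule mulop_measurable[OF P(2)])
    fix \<epsilon> :: ennreal assume "0 < \<epsilon>"
    then obtain \<delta> :: real where \<delta>: "0 < \<delta>" "ennreal \<delta> \<le> \<epsilon>"
    proof (cases \<epsilon>)
      case (real r)
      with \<open>0 < \<epsilon>\<close> show ?thesis by (intro that[of r]) auto
    next
      case top
      then show ?thesis by (intro that[of 1]) auto
    qed
    \<comment> \<open>The summand 1 covers c = 0.\<close>
    have "0 < \<delta> / (c^2 + 1)" using \<delta>(1) by (simp add: add_nonneg_pos)
    from metric_CauchyD[OF \<open>Cauchy a\<close> this]
    obtain K where K: "\<And>j k. K \<le> j \<Longrightarrow> K \<le> k \<Longrightarrow> dist (a j) (a k) < \<delta> / (c^2 + 1)" by blast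
    have *: "nsq M (\<lambda>x. mulop M e (P j) m f x - mulop M e (P k) m f x) \<le> \<epsilon>" if "K \<le> k" "k \<le> j" for j k
    proof -
      have "c^2 * (a j - a k) \<le> (c^2 + 1) * (\<delta> / (c^2 + 1))"
        using K[of j k] that incseqD[OF \<open>incseq a\<close> that(2)] by (intro mult_mono) (auto simp: dist_real_def)
      also have "\<dots> = \<delta>" by (simp add: add_nonneg_eq_0_iff)
      finally show ?thesis using diff[OF that(2)] \<delta>(2) by (meson ennreal_leI order_trans)
    qed
    show "\<exists>K. \<forall>j\<ge>K. \<forall>k\<ge>K. nsq M (\<lambda>x. mulop M e (P j) m f x - mulop M e (P k) m f x) \<le> \<epsilon>"
    proof (intro exI allI impI)
      fix j k assume "K \<le> j" "K \<le> k"
      then show "nsq M (\<lambda>x. mulop M e (P j) m f x - mulop M e (P k) m f x) \<le> \<epsilon>"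
        using *[of j k] *[of k j] unfolding nsq_minus_commute[of M "mulop M e (P j) m f" "mulop M e (P k) m f"]
        by (metis nat_le_linear nsq_minus_commute)
    qed
  qed
  then obtain g where g[measurable]: "g \<in> borel_measurable M"
    and lim: "(\<lambda>N. nsq M (\<lambda>x. mulop M e (P N) m f x - g x)) \<longlonglongrightarrow> 0" by blast
  have mm[measurable]: "mulop M e (P N) m f \<in> borel_measurable M" for N by (rule mulop_measurable[OF P(2)])
  have fing: "nsq M g < \<top>"
    by (rule nsq_tendsto_finite[OF g mm mulop_nsq_finite[OF P(1,2)] lim])
  have "ip M (e p) g = m p * ip M (e p) f" if "p \<in> P N0" for p N0
  proof -
    have pI: "p \<in> I" using that P(2) by blast
    have ev: "eventually (\<lambda>N. ip M (e p) (mulop M e (P N) m f) = m p * ip M (e p) f) sequentially"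
      unfolding eventually_sequentially mulop_def[abs_def]
    proof (intro exI[of _ N0] allI impI)
      fix N assume "N0 \<le> N"
      then have "p \<in> P N" using that P(3) by blast
      then show "ip M (e p) (\<lambda>x. \<Sum>p\<in>P N. m p * ip M (e p) f * e p x) = m p * ip M (e p) f"
        using ip_orthonormal_sum[OF P(1,2) pI, where c = "\<lambda>p. m p * ip M (e p) f"] by simp
    qed
    have "ennreal ((cmod (ip M (e p) (mulop M e (P N) m f) - ip M (e p) g))^2)
          \<le> nsq M (e p) * nsq M (\<lambda>x. mulop M e (P N) m f x - g x)" for N
      using ip_le[OF orthonormal_measurable[OF pI], of "\<lambda>x. mulop M e (P N) m f x - g x"]
        ip_diff_right[OF orthonormal_measurable[OF pI] mm g orthonormal_nsq[OF pI] mulop_nsq_finite[OF P(1,2)] fing]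
      by simp
    moreover have "(\<lambda>N. nsq M (e p) * nsq M (\<lambda>x. mulop M e (P N) m f x - g x)) \<longlonglongrightarrow> 0"
      using ennreal_tendsto_cmult[OF orthonormal_nsq[OF pI] lim] by simp
    ultimately have "(\<lambda>N. ennreal ((cmod (ip M (e p) (mulop M e (P N) m f) - ip M (e p) g))^2)) \<longlonglongrightarrow> 0"
      by (rule ennreal_tendsto_0_le[rotated])
    then have "(\<lambda>N. (cmod (ip M (e p) (mulop M e (P N) m f) - ip M (e p) g))^2) \<longlonglongrightarrow> 0"
      using tendsto_ennreal_iff[of "\<lambda>N. (cmod (ip M (e p) (mulop M e (P N) m f) - ip M (e p) g))^2" sequentially 0] by simp
    then have "(\<lambda>N. sqrt ((cmod (ip M (e p) (mulop M e (P N) m f) - ip M (e p) g))^2)) \<longlonglongrightarrow> sqrt 0"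
      by (rule tendsto_real_sqrt)
    then have "(\<lambda>N. ip M (e p) (mulop M e (P N) m f)) \<longlonglongrightarrow> ip M (e p) g"
      by (simp add: LIM_zero_cancel tendsto_norm_zero_iff)
    moreover have "(\<lambda>N. ip M (e p) (mulop M e (P N) m f)) \<longlonglongrightarrow> m p * ip M (e p) f"
      using ev by (rule tendsto_eventually)
    ultimately show ?thesis by (rule LIMSEQ_unique)
  qed
  then have "\<forall>p\<in>(\<Union>N. P N). ip M (e p) g = m p * ip M (e p) f" by auto
  with lim fing show ?thesis by (intro bexI[OF _ g] conjI)
qed

end

section \<open>Trigonometric system on the box\<close>

text \<open>Fubini in coordinates. Lebesgue measure on \<open>real^'d\<close> is presented as an
  image of the product over \<open>Basis\<close>, so the index type is matched with
  \<open>Basis\<close> through i -> \<open>axis i 1\<close>.\<close>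

lemma integral_prod_vec_nth:
  fixes f :: "'d::finite \<Rightarrow> real \<Rightarrow> 'b::{real_normed_field,banach,second_countable_topology}"
  assumes f: "\<And>i. integrable lborel (f i)"
  shows "integrable lborel (\<lambda>x::real^'d. \<Prod>i\<in>UNIV. f i (x $ i))" (is ?A)
    and "(\<integral>x. (\<Prod>i\<in>UNIV. f i (x $ i)) \<partial>(lborel :: (real^'d) measure)) = (\<Prod>i\<in>UNIV. \<integral>t. f i t \<partial>lborel)" (is ?B)
proof -
  interpret product_sigma_finite "\<lambda>_::real^'d. lborel :: real measure" ..
  define ax where "ax i = (axis i 1 :: real^'d)" for i
  have bij: "bij_betw ax UNIV Basis"
    unfolding bij_betw_def ax_def Basis_vec_def by (auto simp: inj_on_def axis_eq_axis)
  define h where "h b = f (inv_into UNIV ax b)" for b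
  have h_ax: "h (ax i) = f i" for i
    using bij_betw_inv_into_left[OF bij, of i] by (simp add: h_def)
  have meas: "(\<lambda>x::real^'d. \<Prod>i\<in>UNIV. f i (x $ i)) \<in> borel_measurable borel"
    using f[THEN borel_measurable_integrable]
    by (intro borel_measurable_prod measurable_compose[OF borel_measurable_nth]) auto
  have eq: "(\<Prod>i\<in>UNIV. f i ((\<Sum>b\<in>Basis. g b *\<^sub>R b) $ i)) = (\<Prod>b\<in>Basis. h b (g b))" for g :: "real^'d \<Rightarrow> real"
  proof -
    have "(\<Sum>b\<in>Basis. g b *\<^sub>R b) $ i = g (ax i)" for i
      unfolding cart_eq_inner_axis ax_def by (subst inner_sum_left_Basis) auto
    then have "(\<Prod>i\<in>UNIV. f i ((\<Sum>b\<in>Basis. g b *\<^sub>R b) $ i)) = (\<Prod>i\<in>UNIV. h (ax i) (g (ax i)))"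
      by (simp add: h_ax)
    also have "\<dots> = (\<Prod>b\<in>Basis. h b (g b))" by (rule prod.reindex_bij_betw[OF bij])
    finally show ?thesis .
  qed
  have h: "integrable lborel (h b)" for b unfolding h_def by (rule f)
  have mb: "(\<lambda>f. \<Sum>b\<in>Basis. f b *\<^sub>R b) \<in> (\<Pi>\<^sub>M b\<in>(Basis::(real^'d) set). lborel) \<rightarrow>\<^sub>M (borel :: (real^'d) measure)"
    by measurable
  show ?A
    unfolding lborel_eq[where ?'a = "real^'d"] integrable_distr_eq[OF mb meas] eq
    by (rule product_integrable_prod) (auto intro: h)
  have "(\<integral>x. (\<Prod>i\<in>UNIV. f i (x $ i)) \<partial>(lborel :: (real^'d) measure)) = (\<Prod>b\<in>Basis. \<integral>t. h b t \<partial>lborel)"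
    unfolding lborel_eq[where ?'a = "real^'d"] integral_distr[OF mb meas] eq
    by (rule product_integral_prod) (auto intro: h)
  also have "\<dots> = (\<Prod>i\<in>UNIV. \<integral>t. h (ax i) t \<partial>lborel)" by (rule prod.reindex_bij_betw[OF bij, symmetric])
  finally show ?B by (simp add: h_ax)
qed

section \<open>One-dimensional oscillatory integrals and integrals over the box\<close>

definition osc_integral :: "real \<Rightarrow> real \<Rightarrow> complex" where
  "osc_integral L a = (\<integral>t. indicator {- L/2 ..< L/2} t *\<^sub>R cis (2 * pi * (a * t)) \<partial>lborel)"

lemma integrable_osc: "integrable lborel (\<lambda>t. indicator {- L/2 ..< L/2} t *\<^sub>R cis (2 * pi * (a * t)))"
proof (rule Bochner_Integration.integrable_bound)
  show "integrable lborel (indicator {- L/2 ..< L/2} :: real \<Rightarrow> real)"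
    by (cases "0 \<le> L") (auto intro!: integrable_real_indicator simp: emeasure_lborel_Ico)
  show "AE t in lborel. norm (indicator {- L/2 ..< L/2} t *\<^sub>R cis (2 * pi * (a * t))) \<le> norm (indicator {- L/2 ..< L/2} t :: real)"
    by (auto split: split_indicator)
  have "(\<lambda>t. cis (2 * pi * (a * t))) \<in> borel_measurable borel"
    by (intro borel_measurable_continuous_onI continuous_intros)
  then show "(\<lambda>t. indicator {- L/2 ..< L/2} t *\<^sub>R cis (2 * pi * (a * t))) \<in> borel_measurable lborel"
    by simp
qed

lemma osc_integral_0: "0 \<le> L \<Longrightarrow> osc_integral L 0 = complex_of_real L"
  by (simp add: osc_integral_def scaleR_conv_of_real)

text \<open>For a different from 0 the integral is sin (pi a L) / (pi a). Moving the denominator to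
  the left covers a = 0 and is the form used later, for orthogonality as well as for the
  cutoff.\<close>

lemma osc_integral_mult:
  assumes "0 \<le> L"
  shows "complex_of_real (pi * a) * osc_integral L a = complex_of_real (sin (pi * a * L))"
proof -
  have "(\<integral>t. indicator {- L/2 .. L/2} t *\<^sub>R ((2 * pi * a) *\<^sub>R (\<i> * cis (2 * pi * (a * t)))) \<partial>lborel)
      = cis (2 * pi * (a * (L/2))) - cis (2 * pi * (a * (- L/2)))"
    using assms
    by (intro integral_FTC_atLeastAtMost)
       (auto intro!: continuous_intros derivative_eq_intros simp: has_vector_derivative_def algebra_simps)
  also have "(\<integral>t. indicator {- L/2 .. L/2} t *\<^sub>R ((2 * pi * a) *\<^sub>R (\<i> * cis (2 * pi * (a * t)))) \<partial>lborel)
     = (\<integral>t. (2 * pi * a * \<i>) * (indicator {- L/2 ..< L/2} t *\<^sub>R cis (2 * pi * (a * t))) \<partial>lborel)"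
  \<comment> \<open>The fundamental theorem is applied on the closed interval, whereas the box is
    half-open; the endpoint L/2 is a null set.\<close>
  proof (rule integral_cong_AE)
    show "AE t in lborel. indicator {- L/2 .. L/2} t *\<^sub>R ((2 * pi * a) *\<^sub>R (\<i> * cis (2 * pi * (a * t))))
       = (2 * pi * a * \<i>) * (indicator {- L/2 ..< L/2} t *\<^sub>R cis (2 * pi * (a * t)))"
      using AE_lborel_singleton[of "L/2"]
      by eventually_elim (auto split: split_indicator simp: scaleR_conv_of_real)
    have "(\<lambda>t. cis (2 * pi * (a * t))) \<in> borel_measurable borel"
      by (intro borel_measurable_continuous_onI continuous_intros)
    then show "(\<lambda>t. indicator {- L/2 .. L/2} t *\<^sub>R ((2 * pi * a) *\<^sub>R (\<i> * cis (2 * pi * (a * t))))) \<in> borel_measurable lborel"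
      "(\<lambda>t. (2 * pi * a * \<i>) * (indicator {- L/2 ..< L/2} t *\<^sub>R cis (2 * pi * (a * t)))) \<in> borel_measurable lborel"
      by simp_all
  qed
  also have "\<dots> = (2 * pi * a * \<i>) * osc_integral L a"
    unfolding osc_integral_def by (rule integral_mult_right_zero)
  also have "cis (2 * pi * (a * (L/2))) - cis (2 * pi * (a * (- L/2))) = 2 * \<i> * complex_of_real (sin (pi * a * L))"
    by (simp add: complex_eq_iff mult_ac)
  finally show ?thesis by (simp add: mult.assoc)
qed

lemma sets_Lam[measurable]: "Lam L \<in> sets borel"
proof -
  have "Lam L = (\<Inter>i. {x. - L / 2 \<le> x $ i} \<inter> {x. x $ i < L / 2})"
    by (auto simp: Lam_def)
  also have "\<dots> \<in> sets borel"
    by (intro sets.finite_INT sets.Int borel_closed borel_open closed_halfspace_component_ge_cart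
        open_halfspace_component_lt_cart) auto
  finally show ?thesis .
qed

lemma indicator_Lam: "indicator (Lam L) x = (\<Prod>i\<in>UNIV. indicator {- L/2 ..< L/2} (x $ i) :: 'b::{comm_semiring_1})"
proof (cases "x \<in> Lam L")
  case True
  then show ?thesis by (auto simp: Lam_def)
next
  case False
  then obtain i where "x $ i \<notin> {- L/2 ..< L/2}" by (auto simp: Lam_def)
  then have "(\<Prod>i\<in>UNIV. indicator {- L/2 ..< L/2} (x $ i) :: 'b) = 0"
    by (intro prod_zero) (auto simp: indicator_def)
  with False show ?thesis by simp
qed

lemma cis_inner: "cis (2 * pi * (p \<bullet> x)) = (\<Prod>i\<in>UNIV. cis (2 * pi * (p $ i * x $ i)))"
proof -
  have "cis (\<Sum>i\<in>A. f i) = (\<Prod>i\<in>A. cis (f i))" for A :: "'a set" and f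
    by (induction A rule: infinite_finite_induct) (auto simp: cis_mult[symmetric])
  then show ?thesis by (simp add: inner_vec_def sum_distrib_left)
qed

lemma cis_inner_measurable[measurable]: "(\<lambda>x. cis (2 * pi * (p \<bullet> x))) \<in> borel_measurable borel"
  by (intro borel_measurable_continuous_onI continuous_intros)

lemma integral_Lam_cis:
  "integrable lborel (\<lambda>x::real^'d. indicator (Lam L) x *\<^sub>R cis (2 * pi * (s \<bullet> x)))"
  "(\<integral>x. indicator (Lam L) x *\<^sub>R cis (2 * pi * (s \<bullet> x)) \<partial>(lborel :: (real^'d) measure)) = (\<Prod>i\<in>UNIV. osc_integral L (s $ i))"
proof -
  have eq: "indicator (Lam L) x *\<^sub>R cis (2 * pi * (s \<bullet> x)) = (\<Prod>i\<in>UNIV. indicator {- L/2 ..< L/2} (x $ i) *\<^sub>R cis (2 * pi * (s $ i * x $ i)))" for x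
    by (simp add: scaleR_conv_of_real indicator_Lam cis_inner prod.distrib)
  show "integrable lborel (\<lambda>x::real^'d. indicator (Lam L) x *\<^sub>R cis (2 * pi * (s \<bullet> x)))"
    unfolding eq by (rule integral_prod_vec_nth integrable_osc)+
  show "(\<integral>x. indicator (Lam L) x *\<^sub>R cis (2 * pi * (s \<bullet> x)) \<partial>(lborel :: (real^'d) measure)) = (\<Prod>i\<in>UNIV. osc_integral L (s $ i))"
    unfolding eq osc_integral_def by (rule integral_prod_vec_nth integrable_osc)+
qed

lemma emeasure_Lam:
  assumes "0 \<le> L"
  shows "emeasure lborel (Lam L :: (real^'d) set) = ennreal (L ^ CARD('d))"
proof -
  have i: "integrable lborel (indicator {- L/2 ..< L/2} :: real \<Rightarrow> real)"
    using assms by (intro integrable_real_indicator) auto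
  have "integrable lborel (indicator (Lam L) :: real^'d \<Rightarrow> real)"
    "(\<integral>x. indicator (Lam L) x \<partial>(lborel :: (real^'d) measure)) = L ^ CARD('d)"
    using integral_prod_vec_nth[of "\<lambda>_::'d. indicator {- L/2 ..< L/2} :: real \<Rightarrow> real", OF i] assms
    unfolding indicator_Lam by auto
  then have "(\<integral>\<^sup>+x. indicator (Lam L :: (real^'d) set) x \<partial>lborel) = ennreal (L ^ CARD('d))"
    by (subst nn_integral_eq_integral[symmetric, THEN trans[rotated]]) (auto simp: ennreal_indicator)
  then show ?thesis by simp
qed

text \<open>The plane waves are extended by zero outside the box. All functions then live in L2 of
  the whole space, and operators for different L can be compared directly.\<close>

definition ef :: "real \<Rightarrow> real^'d \<Rightarrow> real^'d \<Rightarrow> complex" where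
  "ef L p x = indicator (Lam L) x *\<^sub>R cis (2 * pi * (p \<bullet> x)) / complex_of_real (sqrt (L ^ CARD('d)))"

lemma ef_measurable[measurable]: "ef L p \<in> borel_measurable borel"
  unfolding ef_def[abs_def] by measurable

lemma norm_ef_le: "0 \<le> L \<Longrightarrow> cmod (ef L (p::real^'d) x) \<le> 1 / sqrt (L ^ CARD('d))"
  by (auto simp: ef_def norm_divide split: split_indicator)

lemma ip_ef:
  fixes p q :: "real^'d"
  assumes "0 < L"
  shows "ip lborel (ef L p) (ef L q) = (\<Prod>i\<in>UNIV. osc_integral L (q $ i - p $ i)) / complex_of_real (L ^ CARD('d))"
proof -
  have "cnj (ef L p x) * ef L q x = indicator (Lam L) x *\<^sub>R cis (2 * pi * ((q - p) \<bullet> x)) / complex_of_real (L ^ CARD('d))" for x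
    using assms by (simp add: ef_def cis_cnj cis_mult inner_diff_left right_diff_distrib of_real_mult[symmetric]
        split: split_indicator del: of_real_mult)
  then have "ip lborel (ef L p) (ef L q) = (\<integral>x. indicator (Lam L) x *\<^sub>R cis (2 * pi * ((q - p) \<bullet> x)) / complex_of_real (L ^ CARD('d)) \<partial>lborel)"
    by (simp add: ip_def)
  also have "\<dots> = (\<integral>x. indicator (Lam L) x *\<^sub>R cis (2 * pi * ((q - p) \<bullet> x)) \<partial>lborel) / complex_of_real (L ^ CARD('d))"
    by (rule integral_divide_zero)
  finally show ?thesis by (simp add: integral_Lam_cis)
qed

lemma nsq_ef_finite:
  assumes "0 < L" shows "nsq lborel (ef L (p::real^'d)) < \<top>"
proof -
  have "nsq lborel (ef L p) = (\<integral>\<^sup>+x. ennreal (1 / L ^ CARD('d)) * indicator (Lam L) x \<partial>(lborel :: (real^'d) measure))"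
    unfolding nsq_def using assms
    by (intro nn_integral_cong) (auto simp: ef_def norm_divide power_divide split: split_indicator)
  also have "\<dots> < \<top>" using assms
    by (simp add: nn_integral_cmult emeasure_Lam ennreal_mult_less_top)
  finally show ?thesis .
qed

lemma orthonormal_ef:
  assumes "0 < L"
  shows "orthonormal lborel (ef L) (dual_lattice L)"
  unfolding orthonormal_def
proof (intro conjI ballI)
  fix p q :: "real^'a" assume pq: "p \<in> dual_lattice L" "q \<in> dual_lattice L"
  show "ip lborel (ef L p) (ef L q) = (if p = q then 1 else 0)"
  proof (cases "p = q")
    case True
    then show ?thesis using assms by (simp add: ip_ef osc_integral_0)
  next
    case False
    then obtain i where i: "p $ i \<noteq> q $ i" by (auto simp: vec_eq_iff)
    have "p $ i * L \<in> \<int>" "q $ i * L \<in> \<int>" using pq by (auto simp: dual_lattice_def)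
    then have "(q $ i - p $ i) * L \<in> \<int>" by (simp add: left_diff_distrib)
    then obtain k where "(q $ i - p $ i) * L = of_int k" by (auto elim: Ints_cases)
    then have "sin (pi * (q $ i - p $ i) * L) = 0" by (simp add: mult.assoc sin_zero_iff_int2 mult.commute)
    with osc_integral_mult[of L "q $ i - p $ i"] assms i have "osc_integral L (q $ i - p $ i) = 0"
      by (simp add: of_real_diff[symmetric] del: of_real_diff)
    then have "(\<Prod>i\<in>UNIV. osc_integral L (q $ i - p $ i)) = 0" by (intro prod_zero) auto
    then show ?thesis using False assms by (simp add: ip_ef)
  qed
qed (use assms nsq_ef_finite in auto)

lemma fourier_eq_ip:
  fixes f :: "real^'d \<Rightarrow> complex"
  assumes "0 < L"
  shows "fourier L f p = complex_of_real (sqrt (L ^ CARD('d))) * ip lborel (ef L p) f"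
proof -
  have "indicator (Lam L) x *\<^sub>R (cis (- 2 * pi * (p \<bullet> x)) * f x)
      = complex_of_real (sqrt (L ^ CARD('d))) * (cnj (ef L p x) * f x)" for x
    using assms by (simp add: ef_def cis_cnj scaleR_conv_of_real split: split_indicator)
  then show ?thesis
    unfolding fourier_def set_lebesgue_integral_def ip_def by simp
qed

definition lat :: "real \<Rightarrow> nat \<Rightarrow> (real^'d) set" where
  "lat L N = {p \<in> dual_lattice L. norm p \<le> real N}"

lemma finite_lat:
  assumes "0 < L" shows "finite (lat L N :: (real^'d) set)"
proof -
  let ?K = "\<lambda>i::'d. (\<lambda>k::int. of_int k / L) ` {- \<lceil>real N * L\<rceil> .. \<lceil>real N * L\<rceil>}"
  have "lat L N \<subseteq> {p. \<forall>i. p $ i \<in> ?K i}"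
  proof safe
    fix p :: "real^'d" and i assume "p \<in> lat L N"
    then have p: "p $ i * L \<in> \<int>" "norm p \<le> real N" by (auto simp: lat_def dual_lattice_def)
    then obtain k where k: "p $ i * L = of_int k" by (auto elim: Ints_cases)
    have "\<bar>p $ i\<bar> * L \<le> real N * L" using p(2) component_le_norm_cart[of p i] assms by (intro mult_right_mono) auto
    then have "\<bar>of_int k :: real\<bar> \<le> real N * L" using assms unfolding k[symmetric] by (simp add: abs_mult)
    then have "k \<in> {- \<lceil>real N * L\<rceil> .. \<lceil>real N * L\<rceil>}"
      by (simp add: abs_le_iff) (smt (verit) le_of_int_ceiling of_int_le_iff of_int_minus)
    then show "p $ i \<in> ?K i" using k assms by (intro image_eqI[of _ _ k]) (auto simp: field_simps)
  qed
  moreover have "finite {p::real^'d. \<forall>i. p $ i \<in> ?K i}"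
  proof (rule finite_subset)
    show "{p::real^'d. \<forall>i. p $ i \<in> ?K i} \<subseteq> vec_lambda ` (PiE UNIV ?K)"
    proof safe
      fix p :: "real^'d" assume "\<forall>i. p $ i \<in> ?K i"
      then show "p \<in> vec_lambda ` (PiE UNIV ?K)" by (intro image_eqI[of _ _ "vec_nth p"]) auto
    qed
    show "finite (vec_lambda ` (PiE UNIV ?K) :: (real^'d) set)" by (intro finite_imageI finite_PiE) auto
  qed
  ultimately show ?thesis by (rule finite_subset)
qed

lemma lat_subset: "lat L N \<subseteq> dual_lattice L" by (auto simp: lat_def)

lemma lat_mono: "N \<le> N' \<Longrightarrow> lat L N \<subseteq> lat L N'" by (auto simp: lat_def)

lemma UN_lat: "(\<Union>N. lat L N) = dual_lattice L"
  by (auto simp: lat_def real_arch_simple)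

section \<open>Trigonometric polynomials and completeness of the plane waves\<close>

inductive trig :: "real \<Rightarrow> (real^'d \<Rightarrow> complex) \<Rightarrow> bool" for L where
  trig_monom: "p \<in> dual_lattice L \<Longrightarrow> trig L (\<lambda>x. c * cis (2 * pi * (p \<bullet> x)))"
| trig_add: "trig L f \<Longrightarrow> trig L g \<Longrightarrow> trig L (\<lambda>x. f x + g x)"

lemma dual_lattice_closed:
  "0 \<in> dual_lattice L"
  "p \<in> dual_lattice L \<Longrightarrow> - p \<in> dual_lattice L"
  "p \<in> dual_lattice L \<Longrightarrow> q \<in> dual_lattice L \<Longrightarrow> p + q \<in> dual_lattice L"
  by (auto simp: dual_lattice_def distrib_right)

lemma axis_in_dual_lattice: "0 < L \<Longrightarrow> axis i (1 / L) \<in> dual_lattice L"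
  by (auto simp: dual_lattice_def axis_def)

lemma trig_const: "trig L (\<lambda>x. c)"
  using trig_monom[OF dual_lattice_closed(1), where c = c] by simp

lemma trig_sum: "(\<And>i. i \<in> I \<Longrightarrow> trig L (f i)) \<Longrightarrow> trig L (\<lambda>x. \<Sum>i\<in>I. f i x)"
  by (induction I rule: infinite_finite_induct) (auto intro: trig_const trig_add)

lemma trig_mult_monom:
  assumes "trig L f" "q \<in> dual_lattice L"
  shows "trig L (\<lambda>x. c * cis (2 * pi * (q \<bullet> x)) * f x)"
  using assms(1)
proof induction
  case (trig_monom p c')
  have "c * cis (2 * pi * (q \<bullet> x)) * (c' * cis (2 * pi * (p \<bullet> x))) = (c * c') * cis (2 * pi * ((p + q) \<bullet> x))" for x
    by (simp add: inner_add_left distrib_left cis_mult[symmetric])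
  with trig.trig_monom[OF dual_lattice_closed(3)[OF trig_monom assms(2)], of "c * c'"] show ?case by presburger
next
  case (trig_add f g)
  then show ?case by (simp add: distrib_left trig.trig_add)
qed

lemma trig_mult:
  assumes "trig L f" "trig L g"
  shows "trig L (\<lambda>x. f x * g x)"
  using assms(1)
proof induction
  case (trig_monom p c)
  then show ?case by (rule trig_mult_monom[OF assms(2)])
next
  case (trig_add f h)
  then show ?case by (simp add: distrib_right trig.trig_add)
qed

text \<open>Embeds the torus in \<open>complex^'d\<close>. A real polynomial in the image
  coordinates is a trigonometric polynomial, which makes Stone-Weierstrass available.\<close>

definition torus_map :: "real \<Rightarrow> real^'d \<Rightarrow> complex^'d" where
  "torus_map L x = (\<chi> i. cis (2 * pi * (x $ i / L)))"

lemma continuous_torus_map: "continuous_on A (torus_map L)"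
  unfolding torus_map_def divide_inverse by (intro continuous_intros)

lemma trig_real_polynomial:
  fixes f :: "complex^'d \<Rightarrow> real"
  assumes "real_polynomial_function f" and L: "0 < L"
  shows "trig L (\<lambda>x. complex_of_real (f (torus_map L x)))"
  using assms(1)
proof induction
  case (linear f)
  let ?q = "\<lambda>i::'d. axis i (1 / L) :: real^'d"
  have q: "?q i \<bullet> x = x $ i / L" for i and x :: "real^'d" by (simp add: inner_axis')
  have re: "trig L (\<lambda>x. complex_of_real (torus_map L x \<bullet> axis i 1))" for i :: 'd
  proof -
    have *: "complex_of_real (torus_map L x \<bullet> axis i 1) = (1/2) * cis (2 * pi * (?q i \<bullet> x)) + (1/2) * cis (2 * pi * ((- ?q i) \<bullet> x))" for x
      by (simp add: torus_map_def inner_axis q inner_minus_left complex_eq_iff inner_complex_def)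
    show ?thesis unfolding * by (intro trig_add trig_monom dual_lattice_closed(2) axis_in_dual_lattice L)
  qed
  have im: "trig L (\<lambda>x. complex_of_real (torus_map L x \<bullet> axis i \<i>))" for i :: 'd
  proof -
    have *: "complex_of_real (torus_map L x \<bullet> axis i \<i>) = (-\<i>/2) * cis (2 * pi * (?q i \<bullet> x)) + (\<i>/2) * cis (2 * pi * ((- ?q i) \<bullet> x))" for x
      by (simp add: torus_map_def inner_axis q inner_minus_left complex_eq_iff inner_complex_def)
    show ?thesis unfolding * by (intro trig_add trig_monom dual_lattice_closed(2) axis_in_dual_lattice L)
  qed
  have "trig L (\<lambda>x. complex_of_real (torus_map L x \<bullet> b))" if "b \<in> Basis" for b :: "complex^'d"
    using that re im by (auto simp: Basis_vec_def Basis_complex_def)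
  then have "trig L (\<lambda>x. \<Sum>b\<in>Basis. complex_of_real (f b) * complex_of_real (torus_map L x \<bullet> b))"
    by (intro trig_sum trig_mult[OF trig_const]) auto
  moreover have "complex_of_real (f w) = (\<Sum>b\<in>Basis. complex_of_real (f b) * complex_of_real (w \<bullet> b))" for w :: "complex^'d"
  proof -
    interpret bounded_linear f by fact
    have "f w = f (\<Sum>b\<in>Basis. (w \<bullet> b) *\<^sub>R b)" by (simp add: euclidean_representation)
    also have "\<dots> = (\<Sum>b\<in>Basis. f b * (w \<bullet> b))" by (simp add: sum scaleR mult.commute)
    finally show ?thesis by simp
  qed
  then have "(\<lambda>x. complex_of_real (f (torus_map L x))) = (\<lambda>x. \<Sum>b\<in>Basis. complex_of_real (f b) * complex_of_real (torus_map L x \<bullet> b))"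
    by blast
  ultimately show ?case by metis
qed (auto intro: trig_const trig_add trig_mult)

lemma torus_map_inj:
  assumes "0 < L" "x \<in> Lam L" "y \<in> Lam L" "torus_map L x = torus_map L y"
  shows "x = y"
proof -
  have "x $ i = y $ i" for i
  proof -
    have "cis (2 * pi * (x $ i / L)) = cis (2 * pi * (y $ i / L))"
      using assms(4) by (simp add: torus_map_def vec_eq_iff)
    then have "sin (2 * pi * (x $ i / L)) = sin (2 * pi * (y $ i / L)) \<and> cos (2 * pi * (x $ i / L)) = cos (2 * pi * (y $ i / L))"
      by (simp add: complex_eq_iff)
    then obtain n :: int where "2 * pi * (x $ i / L) = 2 * pi * (y $ i / L) + 2 * pi * of_int n"
      using sin_cos_eq_iff[of "2 * pi * (x $ i / L)" "2 * pi * (y $ i / L)"] by (auto simp: mult_ac)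
    then have "2 * pi * (x $ i / L) = 2 * pi * (y $ i / L + of_int n)" by (simp add: distrib_left)
    then have n: "x $ i / L = y $ i / L + of_int n" by (subst (asm) mult_cancel_left) auto
    have "- 1/2 \<le> x $ i / L" "x $ i / L < 1/2" "- 1/2 \<le> y $ i / L" "y $ i / L < 1/2"
      using assms by (auto simp: Lam_def field_simps)
    with n have "\<bar>of_int n :: real\<bar> < 1" by linarith
    then have "n = 0" by linarith
    with n assms(1) show ?thesis by simp
  qed
  then show ?thesis by (simp add: vec_eq_iff)
qed

text \<open>Let G be g cut to the box. The functions that integrate to 0 against G include the
  trigonometric polynomials; then, successively, bounded continuous functions of the torus
  coordinates, indicators of preimages of closed sets, of compact subsets of the box, of closed sets
  and of all Borel sets. An integrable function whose integral over every Borel set vanishes is 0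
  almost everywhere.\<close>

lemma trig_complete:
  fixes g :: "real^'d \<Rightarrow> complex"
  assumes L: "0 < L" and g[measurable]: "g \<in> borel_measurable borel" and fin: "nsq lborel g < \<top>"
    and zero: "\<And>p. p \<in> dual_lattice L \<Longrightarrow> ip lborel (ef L p) g = 0"
  shows "AE x in lborel. x \<in> Lam L \<longrightarrow> g x = 0"
proof -
  define G where "G x = indicator (Lam L) x * g x" for x
  have "nsq lborel (\<lambda>x::real^'d. indicator (Lam L) x) = (\<integral>\<^sup>+x. indicator (Lam L) x \<partial>(lborel :: (real^'d) measure))"
    unfolding nsq_def by (intro nn_integral_cong) (auto split: split_indicator)
  then have "nsq lborel (\<lambda>x::real^'d. indicator (Lam L) x) < \<top>"
    using L by (simp add: emeasure_Lam)
  then have "integrable lborel (\<lambda>x. cnj (indicator (Lam L) x) * g x)"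
    by (intro integrable_cnj_mult fin) auto
  have Geq: "G = (\<lambda>x. cnj (indicator (Lam L) x) * g x)"
    by (auto simp: G_def fun_eq_iff split: split_indicator)
  have G: "integrable lborel G" unfolding Geq by fact
  note Gm[measurable] = borel_measurable_integrable[OF G]
  have bint: "integrable lborel (\<lambda>x. b x * G x)" if [measurable]: "b \<in> borel_measurable borel" and "\<And>x. cmod (b x) \<le> c" for b c
  proof (rule Bochner_Integration.integrable_bound[where f = "\<lambda>x. complex_of_real c * G x"])
    show "integrable lborel (\<lambda>x. complex_of_real c * G x)" by (intro integrable_mult_right G)
    show "AE x in lborel. norm (b x * G x) \<le> norm (complex_of_real c * G x)"
    proof (rule AE_I2)
      fix x
      have "cmod (b x) \<le> \<bar>c\<bar>" using that(2)[of x] by linarith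
      then show "norm (b x * G x) \<le> norm (complex_of_real c * G x)"
        unfolding norm_mult norm_of_real by (rule mult_right_mono) simp
    qed
    show "(\<lambda>x. b x * G x) \<in> borel_measurable lborel" by measurable
  qed
  have trig0: "integrable lborel (\<lambda>x. t x * G x) \<and> (\<integral>x. t x * G x \<partial>lborel) = 0" if "trig L t" for t
    using that
  proof induction
    case (trig_monom p c)
    let ?s = "complex_of_real (sqrt (L ^ CARD('d)))"
    have i: "integrable lborel (\<lambda>x. cis (2 * pi * (p \<bullet> x)) * G x)"
      by (intro bint[where c = 1]) auto
    \<comment> \<open>\<open>ip\<close> conjugates its first argument, so the wave with frequency p
      is tested through \<open>ef L (- p)\<close>.\<close>
    have "cis (2 * pi * (p \<bullet> x)) * G x = ?s * (cnj (ef L (- p) x) * g x)" for x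
      using L by (auto simp: G_def ef_def cis_cnj inner_minus_left split: split_indicator)
    then have "(\<integral>x. cis (2 * pi * (p \<bullet> x)) * G x \<partial>lborel) = ?s * ip lborel (ef L (- p)) g"
      by (simp add: ip_def)
    also have "\<dots> = 0" using zero dual_lattice_closed(2)[OF trig_monom] by simp
    finally show ?case using i integrable_mult_right[OF i, of c] by (simp add: mult.assoc)
  next
    case (trig_add f h)
    then show ?case by (simp add: distrib_right)
  qed
  have cont0: "(\<integral>x. complex_of_real (\<phi> (torus_map L x)) * G x \<partial>lborel) = 0"
    if \<phi>: "continuous_on UNIV \<phi>" "\<And>w. \<bar>\<phi> w\<bar> \<le> 1" for \<phi> :: "complex^'d \<Rightarrow> real"
  proof -
    have [measurable]: "(\<lambda>x. \<phi> (torus_map L x)) \<in> borel_measurable borel"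
      by (intro borel_measurable_continuous_onI continuous_on_compose2[OF \<phi>(1) continuous_torus_map]) auto
    have i1: "integrable lborel (\<lambda>x. complex_of_real (\<phi> (torus_map L x)) * G x)"
      using \<phi>(2) by (intro bint[where c = 1]) auto
    have "cmod (\<integral>x. complex_of_real (\<phi> (torus_map L x)) * G x \<partial>lborel) \<le> e * (\<integral>x. cmod (G x) \<partial>lborel)" if "0 < e" for e
    proof -
      \<comment> \<open>A compact set that contains the image of \<open>torus_map\<close>, whose
        coordinates all have modulus 1.\<close>
      let ?S = "cball 0 (real CARD('d)) :: (complex^'d) set"
      obtain h where h: "real_polynomial_function h" "\<And>w. w \<in> ?S \<Longrightarrow> \<bar>\<phi> w - h w\<bar> < e"
        using Stone_Weierstrass_real_polynomial_function[of ?S \<phi> e] \<phi>(1) \<open>0 < e\<close>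
        by (metis compact_cball continuous_on_subset top_greatest)
      have S: "torus_map L x \<in> ?S" for x
        using L2_set_le_sum[of UNIV "\<lambda>i. norm (torus_map L x $ i)"]
        by (simp add: norm_vec_def torus_map_def)
      note t = trig0[OF trig_real_polynomial[OF h(1) L]]
      have "(\<integral>x. complex_of_real (\<phi> (torus_map L x)) * G x \<partial>lborel)
        = (\<integral>x. complex_of_real (\<phi> (torus_map L x)) * G x - complex_of_real (h (torus_map L x)) * G x \<partial>lborel)"
        using t i1 by (subst Bochner_Integration.integral_diff) auto
      also have "cmod \<dots> \<le> (\<integral>x. e * cmod (G x) \<partial>lborel)"
      proof (rule Bochner_Integration.integral_norm_bound_integral)
        show "integrable lborel (\<lambda>x. complex_of_real (\<phi> (torus_map L x)) * G x - complex_of_real (h (torus_map L x)) * G x)"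
          using i1 t by auto
        show "integrable lborel (\<lambda>x. e * cmod (G x))" using G by auto
        fix x
        have "cmod (complex_of_real (\<phi> (torus_map L x)) * G x - complex_of_real (h (torus_map L x)) * G x)
          = \<bar>\<phi> (torus_map L x) - h (torus_map L x)\<bar> * cmod (G x)"
          by (metis left_diff_distrib norm_mult norm_of_real of_real_diff)
        also have "\<dots> \<le> e * cmod (G x)" using h(2)[OF S, of x] by (intro mult_right_mono) auto
        finally show "norm (complex_of_real (\<phi> (torus_map L x)) * G x - complex_of_real (h (torus_map L x)) * G x) \<le> e * cmod (G x)" .
      qed
      finally show ?thesis by simp
    qed
    then have "cmod (\<integral>x. complex_of_real (\<phi> (torus_map L x)) * G x \<partial>lborel) \<le> 0 + \<delta>" if "0 < \<delta>" for \<delta>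
    proof -
      let ?n = "\<integral>x. cmod (G x) \<partial>lborel"
      have "0 \<le> ?n" by simp
      \<comment> \<open>The summand 1 avoids a division by 0 when G vanishes almost
        everywhere.\<close>
      then have "0 < \<delta> / (?n + 1)" using that by (intro divide_pos_pos) linarith+
      from \<open>\<And>e. 0 < e \<Longrightarrow> _\<close>[OF this]
      have "cmod (\<integral>x. complex_of_real (\<phi> (torus_map L x)) * G x \<partial>lborel) \<le> \<delta> / (?n + 1) * ?n" .
      also have "d / (n + 1) * n \<le> d" if "0 \<le> n" "0 < d" for n d :: real using that by (simp add: field_simps)
      from this[OF \<open>0 \<le> ?n\<close> that] have "\<delta> / (?n + 1) * ?n \<le> \<delta>" .
      finally show ?thesis by simp
    qed
    then have "cmod (\<integral>x. complex_of_real (\<phi> (torus_map L x)) * G x \<partial>lborel) \<le> 0"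
      by (rule field_le_epsilon)
    then show ?thesis by simp
  qed
  have closed0: "(\<integral>x. indicator C (torus_map L x) * G x \<partial>lborel) = 0" if C: "closed C" for C
  proof (cases "C = {}")
    case False
    \<comment> \<open>These continuous functions decrease to the indicator of C because C is
      closed.\<close>
    define \<phi> where "\<phi> k w = max 0 (1 - real k * infdist w C)" for k w
    have \<phi>c: "continuous_on A (\<phi> k)" for k A unfolding \<phi>_def by (intro continuous_intros)
    have \<phi>1: "\<bar>\<phi> k w\<bar> \<le> 1" for k w unfolding \<phi>_def by (auto simp: infdist_nonneg)
    have \<phi>lim: "(\<lambda>k. \<phi> k w) \<longlonglongrightarrow> indicator C w" for w
    proof (cases "w \<in> C")
      case True
      then show ?thesis by (simp add: \<phi>_def)
    next
      case nin: False
      then have pos: "0 < infdist w C"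
        using in_closed_iff_infdist_zero[OF C False, of w] infdist_nonneg[of w C] by linarith
      obtain K :: nat where K: "1 / infdist w C \<le> real K" using real_arch_simple by blast
      have "\<phi> k w = 0" if "K \<le> k" for k
      proof -
        have "1 / infdist w C \<le> real k" using K that by linarith
        then have "1 \<le> real k * infdist w C" using pos by (simp add: field_simps)
        then show ?thesis by (simp add: \<phi>_def)
      qed
      then have "(\<lambda>k. \<phi> k w) \<longlonglongrightarrow> 0"
        by (intro tendsto_eventually) (auto simp: eventually_sequentially)
      then show ?thesis using nin by simp
    qed
    have [measurable]: "torus_map L \<in> borel \<rightarrow>\<^sub>M borel"
      by (intro borel_measurable_continuous_onI continuous_torus_map)
    have [measurable]: "\<phi> k \<in> borel_measurable borel" for k
      by (intro borel_measurable_continuous_onI \<phi>c)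
    have [measurable]: "C \<in> sets borel" using C by (rule borel_closed)
    have "(\<lambda>k. \<integral>x. complex_of_real (\<phi> k (torus_map L x)) * G x \<partial>lborel) \<longlonglongrightarrow> (\<integral>x. complex_of_real (indicator C (torus_map L x)) * G x \<partial>lborel)"
    proof (rule integral_dominated_convergence[where w = "\<lambda>x. cmod (G x)"])
      show "integrable lborel (\<lambda>x. cmod (G x))" using G by auto
      show "AE x in lborel. (\<lambda>k. complex_of_real (\<phi> k (torus_map L x)) * G x) \<longlonglongrightarrow> complex_of_real (indicator C (torus_map L x)) * G x"
        by (intro AE_I2 tendsto_intros \<phi>lim)
      show "AE x in lborel. norm (complex_of_real (\<phi> k (torus_map L x)) * G x) \<le> cmod (G x)" for k
        using \<phi>1 by (auto simp: norm_mult intro!: mult_left_le_one_le)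
    qed measurable
    moreover have "(\<integral>x. complex_of_real (\<phi> k (torus_map L x)) * G x \<partial>lborel) = 0" for k
      by (rule cont0[OF \<phi>c \<phi>1])
    moreover have "complex_of_real (indicator C w) = indicator C w" for w by (auto split: split_indicator)
    ultimately show ?thesis by (simp add: LIMSEQ_const_iff)
  qed simp
  \<comment> \<open>On the box \<open>torus_map\<close> is injective, so a compact K inside it is
    recovered from its image, which is compact and hence closed.\<close>
  have compact0: "(\<integral>x. indicator K x * G x \<partial>lborel) = 0" if K: "compact K" "K \<subseteq> Lam L" for K
  proof -
    have eq: "indicator (torus_map L ` K) (torus_map L x) * G x = indicator K x * G x" for x
    proof (cases "x \<in> Lam L")
      case True
      then have "torus_map L x \<in> torus_map L ` K \<longleftrightarrow> x \<in> K"
        using torus_map_inj[OF L True] K(2) by (auto dest: subsetD)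
      then show ?thesis by (simp add: indicator_def)
    qed (simp add: G_def)
    have "closed (torus_map L ` K)"
      by (intro compact_imp_closed compact_continuous_image continuous_torus_map K)
    from closed0[OF this] show ?thesis unfolding eq .
  qed
  have clo: "(\<integral>x. indicator F x * G x \<partial>lborel) = 0" if F: "closed F" for F
  proof -
    \<comment> \<open>The half-open box is not compact; it is exhausted by these closed
      boxes.\<close>
    define Q where "Q k = cbox (\<chi> i. - L/2) (\<chi> i. L/2 - 1 / real (Suc k) :: real^'d)" for k
    have QL: "Q k \<subseteq> Lam L" for k
    proof
      fix x assume x: "x \<in> Q k"
      have "x $ i \<le> L/2 - 1 / real (Suc k)" for i
        using x by (simp add: Q_def mem_box_cart del: of_nat_Suc)
      moreover have "0 < 1 / real (Suc k)" by simp
      ultimately have "x $ i < L / 2" for i using order_le_less_trans[of "x $ i" "L/2 - 1 / real (Suc k)" "L/2"] by simp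
      then show "x \<in> Lam L" using x by (auto simp: Q_def mem_box_cart Lam_def)
    qed
    have Qlim: "(\<lambda>k. indicator (F \<inter> Q k) x * G x) \<longlonglongrightarrow> indicator F x * G x" for x
    proof (cases "x \<in> Lam L")
      case True
      define m where "m = Min (range (\<lambda>i. L/2 - x $ i))"
      have "0 < m" using True unfolding m_def by (auto simp: Lam_def)
      then obtain K where K: "1 / real (Suc K) < m" using reals_Archimedean by (metis inverse_eq_divide)
      have "x \<in> Q k" if "K \<le> k" for k
      proof -
        have "1 / real (Suc k) \<le> 1 / real (Suc K)" using that by (simp add: frac_le)
        moreover have "m \<le> L/2 - x $ i" for i unfolding m_def by (intro Min_le) auto
        moreover have "a \<le> b - c" if "c \<le> c'" "c' < m'" "m' \<le> b - a" for a b c c' m' :: real using that by linarith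
        ultimately have "x $ i \<le> L/2 - 1 / real (Suc k)" for i using K by blast
        then show ?thesis using True by (auto simp: Q_def mem_box_cart Lam_def)
      qed
      then have "eventually (\<lambda>k. indicator (F \<inter> Q k) x * G x = indicator F x * G x) sequentially"
        unfolding eventually_sequentially by (intro exI[of _ K]) (auto split: split_indicator)
      then show ?thesis by (rule tendsto_eventually)
    qed (simp add: G_def)
    have [measurable]: "F \<in> sets borel" "Q k \<in> sets borel" for k using F by (auto simp: Q_def)
    have "(\<lambda>k. \<integral>x. indicator (F \<inter> Q k) x * G x \<partial>lborel) \<longlonglongrightarrow> (\<integral>x. indicator F x * G x \<partial>lborel)"
    proof (rule integral_dominated_convergence[where w = "\<lambda>x. cmod (G x)"])
      show "integrable lborel (\<lambda>x. cmod (G x))" using G by auto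
      show "AE x in lborel. norm (indicator (F \<inter> Q k) x * G x) \<le> cmod (G x)" for k
        by (auto simp: norm_mult split: split_indicator)
    qed (use Qlim in auto)
    moreover have "(\<integral>x. indicator (F \<inter> Q k) x * G x \<partial>lborel) = 0" for k
      using QL[of k] F by (intro compact0) (auto simp: Q_def intro: closed_Int_compact)
    ultimately show ?thesis by (simp add: LIMSEQ_const_iff)
  qed
  \<comment> \<open>Dynkin induction from the closed sets, which are stable under intersection and
    generate the Borel sets; the closed set \<open>UNIV\<close> settles complements.\<close>
  have all0: "(LINT x:A|lborel. G x) = 0" if "A \<in> sets borel" for A
  proof -
    have "Int_stable (Collect closed :: (real^'d) set set)" "Collect closed \<subseteq> Pow (UNIV :: (real^'d) set)" "A \<in> sigma_sets UNIV (Collect closed)"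
      using that by (auto simp: Int_stable_def borel_eq_closed)
    then show ?thesis
    proof (induction A rule: sigma_sets_induct_disjoint)
      case (basic A)
      have "indicator A x *\<^sub>R G x = indicator A x * G x" for x by (auto split: split_indicator)
      then show ?case using clo[of A] basic by (simp only: set_lebesgue_integral_def mem_Collect_eq)
    next
      case empty
      show ?case by (simp add: set_lebesgue_integral_def)
    next
      case (compl A)
      have [measurable]: "A \<in> sets borel" using compl(1) by (simp add: borel_eq_closed)
      have si: "set_integrable lborel B G" if "B \<in> sets borel" for B
        using that G unfolding set_integrable_def by (intro integrable_mult_indicator) auto
      have "(LINT x:A \<union> (UNIV - A)|lborel. G x) = (LINT x:A|lborel. G x) + (LINT x:UNIV - A|lborel. G x)"
        by (intro set_integral_Un si) auto
      moreover have "(LINT x:UNIV|lborel. G x) = 0"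
        using clo[of UNIV] by (simp add: set_lebesgue_integral_def)
      ultimately show ?case using compl(2) by (simp add: Un_Diff_cancel)
    next
      case (union A)
      have A: "A i \<in> sets borel" for i using union(2) by (auto simp: borel_eq_closed)
      have "(LINT x:(\<Union>i. A i)|lborel. G x) = (\<Sum>i. (LINT x:A i|lborel. G x))"
      proof (rule lebesgue_integral_countable_add)
        show "A i \<inter> A j = {}" if "i \<noteq> j" for i j using union(1) that by (auto simp: disjoint_family_on_def)
        show "set_integrable lborel (\<Union>i. A i) G"
          using A G unfolding set_integrable_def by (intro integrable_mult_indicator) auto
      qed (use A in simp)
      then show ?case using union(3) by simp
    qed
  qed
  have "AE x in lborel. Re (G x) = 0"
  proof (rule density_unique_real)
    show "integrable lborel (\<lambda>x. Re (G x))" using G by (rule integrable_Re)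
    fix A :: "(real^'d) set" assume A: "A \<in> sets lborel"
    have "(LINT x:A|lborel. Re (G x)) = Re (LINT x:A|lborel. G x)"
      unfolding set_lebesgue_integral_def using A G
      by (subst integral_Re[symmetric]) (auto intro!: integrable_mult_indicator)
    then show "(LINT x:A|lborel. Re (G x)) = (LINT x:A|lborel. 0)" using all0[of A] A by simp
  qed simp
  moreover have "AE x in lborel. Im (G x) = 0"
  proof (rule density_unique_real)
    show "integrable lborel (\<lambda>x. Im (G x))" using G by (rule integrable_Im)
    fix A :: "(real^'d) set" assume A: "A \<in> sets lborel"
    have "(LINT x:A|lborel. Im (G x)) = Im (LINT x:A|lborel. G x)"
      unfolding set_lebesgue_integral_def using A G
      by (subst integral_Im[symmetric]) (auto intro!: integrable_mult_indicator)
    then show "(LINT x:A|lborel. Im (G x)) = (LINT x:A|lborel. 0)" using all0[of A] A by simp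
  qed simp
  ultimately show ?thesis
    by eventually_elim (auto simp: G_def complex_eq_iff)
qed

section \<open>Truncated resolvents\<close>

abbreviation (input) rpos :: "complex set" where "rpos \<equiv> complex_of_real ` {0..}"

definition proj :: "real \<Rightarrow> nat \<Rightarrow> (real^'d \<Rightarrow> complex) \<Rightarrow> real^'d \<Rightarrow> complex" where
  "proj L N f = mulop lborel (ef L) (lat L N) (\<lambda>_. 1) f"

definition RT :: "real \<Rightarrow> nat \<Rightarrow> complex \<Rightarrow> (real^'d \<Rightarrow> complex) \<Rightarrow> real^'d \<Rightarrow> complex" where
  "RT L N z f = mulop lborel (ef L) (lat L N) (\<lambda>p. 1 / (complex_of_real (nu p) - z)) f"

text \<open>\<open>L2on\<close> constrains a function on the box only, so the function itself may
  fail to be measurable. Norms and measurability are therefore always stated for the cut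
  version.\<close>

definition lamcut :: "real \<Rightarrow> (real^'d \<Rightarrow> complex) \<Rightarrow> real^'d \<Rightarrow> complex" where
  "lamcut L f x = indicator (Lam L) x * f x"

lemma closed_rpos: "closed rpos"
proof -
  have "rpos = {z. Im z = 0} \<inter> {z. 0 \<le> Re z}"
    by (auto simp: complex_eq_iff image_iff intro!: bexI[of _ "Re _"])
  moreover have "closed ({z. Im z = 0} \<inter> {z. 0 \<le> Re z})"
    by (intro closed_Int closed_Collect_eq closed_Collect_le continuous_intros)
  ultimately show ?thesis by simp
qed

lemma infdist_rpos_pos: "z \<notin> rpos \<Longrightarrow> 0 < infdist z rpos"
  using in_closed_iff_infdist_zero[OF closed_rpos, of z] infdist_nonneg[of z rpos] by fastforce

lemma infdist_rpos_le: "infdist z rpos \<le> cmod (complex_of_real (nu p) - z)"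
proof -
  have "complex_of_real (nu p) \<in> rpos" by (intro imageI) (simp add: nu_def)
  from infdist_le[OF this, of z] show ?thesis by (simp add: dist_norm norm_minus_commute)
qed

lemma resolvent_mult_bound:
  assumes "z \<notin> rpos" shows "cmod (1 / (complex_of_real (nu p) - z)) \<le> 1 / infdist z rpos"
  using infdist_rpos_pos[OF assms] infdist_rpos_le[of z p] by (simp add: norm_divide frac_le)

lemma nu_minus_nonzero: "z \<notin> rpos \<Longrightarrow> complex_of_real (nu p) - z \<noteq> 0"
  using infdist_rpos_pos[of z] infdist_rpos_le[of z p] by auto

lemma mulop_ef_cut: "mulop lborel (ef L) P m f x = indicator (Lam L) x * mulop lborel (ef L) P m f x"
  by (auto simp: mulop_def ef_def split: split_indicator)

lemma ip_ef_lamcut: "ip lborel (ef L p) (lamcut L f) = ip lborel (ef L p) f"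
  unfolding ip_def lamcut_def by (intro Bochner_Integration.integral_cong) (auto simp: ef_def split: split_indicator)

lemma RT_lamcut: "RT L N z (lamcut L f) = RT L N z f"
  unfolding RT_def mulop_def[abs_def] ip_ef_lamcut ..

lemma RT_outside: "x \<notin> Lam L \<Longrightarrow> RT L N z f x = 0"
  using mulop_ef_cut[of L _ _ f x] unfolding RT_def by simp

lemma lamcut_measurable[measurable]: "f \<in> borel_measurable borel \<Longrightarrow> lamcut L f \<in> borel_measurable borel"
  unfolding lamcut_def[abs_def] by measurable

lemma lamcut_lamcut[simp]: "lamcut L (lamcut L f) = lamcut L f"
  by (auto simp: lamcut_def fun_eq_iff split: split_indicator)

lemma nsq_lamcut_le: "nsq M (lamcut L f) \<le> nsq M f"
  by (intro nsq_mono) (auto simp: lamcut_def split: split_indicator)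

lemma RT_measurable[measurable]: "0 < L \<Longrightarrow> RT L N z f \<in> borel_measurable borel"
  using mulop_measurable[OF orthonormal_ef lat_subset] unfolding RT_def by simp

lemma RT_nsq_finite: "0 < L \<Longrightarrow> nsq lborel (RT L N z f) < \<top>"
  unfolding RT_def by (rule mulop_nsq_finite[OF orthonormal_ef finite_lat lat_subset])

lemma nsq_RT_le:
  assumes "0 < L" "z \<notin> rpos" and f: "f \<in> borel_measurable borel"
  shows "nsq lborel (RT L N z f) \<le> ennreal ((1 / infdist z rpos)^2) * nsq lborel f"
  unfolding RT_def using assms
  by (intro nsq_mulop_le[OF orthonormal_ef finite_lat lat_subset] resolvent_mult_bound) auto

lemma RT_diff:
  assumes "0 < L" "f \<in> borel_measurable borel" "nsq lborel f < \<top>" "g \<in> borel_measurable borel" "nsq lborel g < \<top>"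
  shows "RT L N z (\<lambda>x. f x - g x) x = RT L N z f x - RT L N z g x"
  unfolding RT_def using assms by (intro mulop_diff[OF orthonormal_ef lat_subset]) auto

text \<open>The projections converge to some g by \<open>mulop_convergent\<close>. As g and f have
  the same coefficients, completeness identifies them on the box; outside the box the projections
  vanish.\<close>

lemma proj_tendsto:
  assumes L: "0 < L" and f[measurable]: "f \<in> borel_measurable borel" and fin: "nsq lborel f < \<top>"
  shows "(\<lambda>N. nsq lborel (\<lambda>x. proj L N f x - lamcut L f x)) \<longlonglongrightarrow> 0"
proof -
  have "\<exists>g\<in>borel_measurable lborel. nsq lborel g < \<top> \<and>
    (\<lambda>N. nsq lborel (\<lambda>x. mulop lborel (ef L) (lat L N) (\<lambda>_. 1) f x - g x)) \<longlonglongrightarrow> 0 \<and>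
    (\<forall>p\<in>(\<Union>N. lat L N). ip lborel (ef L p) g = 1 * ip lborel (ef L p) f)"
    using fin by (intro mulop_convergent[OF orthonormal_ef[OF L] finite_lat[OF L] lat_subset lat_mono, where c = 1]) auto
  then obtain g where g[measurable]: "g \<in> borel_measurable borel" and ginf: "nsq lborel g < \<top>"
    and lim: "(\<lambda>N. nsq lborel (\<lambda>x. proj L N f x - g x)) \<longlonglongrightarrow> 0"
    and ipg: "\<And>p. p \<in> dual_lattice L \<Longrightarrow> ip lborel (ef L p) g = ip lborel (ef L p) f"
    unfolding proj_def UN_lat by auto
  have "nsq lborel (\<lambda>x. g x - f x) \<le> 2 * nsq lborel g + 2 * nsq lborel f"
    by (rule nsq_diff_le) simp_all
  also have "\<dots> < \<top>" using fin ginf by (simp add: ennreal_mult_less_top)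
  finally have "nsq lborel (\<lambda>x. g x - f x) < \<top>" .
  then have ae: "AE x in lborel. x \<in> Lam L \<longrightarrow> g x - f x = 0"
  proof (intro trig_complete[OF L])
    fix p :: "real^'a" assume "p \<in> dual_lattice L"
    have "ip lborel (ef L p) (\<lambda>x. g x - f x) = ip lborel (ef L p) g - ip lborel (ef L p) f"
      using nsq_ef_finite[OF L] fin ginf by (intro ip_diff_right) auto
    then show "ip lborel (ef L p) (\<lambda>x. g x - f x) = 0" using ipg[OF \<open>p \<in> dual_lattice L\<close>] by simp
  qed simp_all
  have "nsq lborel (\<lambda>x. proj L N f x - lamcut L f x) \<le> nsq lborel (\<lambda>x. proj L N f x - g x)" for N
    unfolding nsq_def
  proof (rule nn_integral_mono_AE)
    from ae show "AE x in lborel. ennreal ((cmod (proj L N f x - lamcut L f x))^2) \<le> ennreal ((cmod (proj L N f x - g x))^2)"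
    proof eventually_elim
      fix x assume x: "x \<in> Lam L \<longrightarrow> g x - f x = 0"
      show "ennreal ((cmod (proj L N f x - lamcut L f x))^2) \<le> ennreal ((cmod (proj L N f x - g x))^2)"
      proof (cases "x \<in> Lam L")
        case True
        then show ?thesis using x by (simp add: lamcut_def)
      next
        case False
        then have "proj L N f x = 0" using mulop_ef_cut[of L _ _ f x] unfolding proj_def by simp
        with False show ?thesis by (simp add: lamcut_def)
      qed
    qed
  qed
  with lim show ?thesis by (rule ennreal_tendsto_0_le)
qed

lemma L2on_iff:
  "L2on L f \<longleftrightarrow> lamcut L f \<in> borel_measurable borel \<and> nsq lborel (lamcut L f) < \<top>"
proof -
  have *: "(\<lambda>x. indicator (Lam L) x *\<^sub>R f x) = lamcut L f" by (auto simp: lamcut_def fun_eq_iff split: split_indicator)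
  have **: "indicator (Lam L) x *\<^sub>R (cmod (f x))^2 = (cmod (lamcut L f x))^2" for x
    by (auto simp: lamcut_def split: split_indicator)
  show ?thesis
    unfolding L2on_def set_borel_measurable_def set_integrable_def * **
    using nsq_finite_iff[of "lamcut L f" lborel] by auto
qed

text \<open>\<open>SOME\<close> yields information only once a candidate exists. The limit of the
  multiplier series is one: it has the right coefficients, and it lies in the domain because nu /
  (nu - z) is bounded. Of the chosen function, later arguments use just the square integrability and
  the coefficients.\<close>

lemma resolvent_spec:
  fixes f :: "real^'d \<Rightarrow> complex"
  assumes L: "0 < L" and z: "z \<notin> rpos" and f: "L2on L f"
  shows "L2on L (resolvent L z f)"
    and "p \<in> dual_lattice L \<Longrightarrow> ip lborel (ef L p) (resolvent L z f) = 1 / (complex_of_real (nu p) - z) * ip lborel (ef L p) f"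
proof -
  let ?m = "\<lambda>p::real^'d. 1 / (complex_of_real (nu p) - z)" and ?s = "complex_of_real (sqrt (L ^ CARD('d)))"
  have f': "lamcut L f \<in> borel_measurable borel" "nsq lborel (lamcut L f) < \<top>" using f by (auto simp: L2on_iff)
  have "\<exists>g\<in>borel_measurable lborel. nsq lborel g < \<top> \<and>
    (\<lambda>N. nsq lborel (\<lambda>x. mulop lborel (ef L) (lat L N) ?m (lamcut L f) x - g x)) \<longlonglongrightarrow> 0 \<and>
    (\<forall>p\<in>(\<Union>N. lat L N). ip lborel (ef L p) g = ?m p * ip lborel (ef L p) (lamcut L f))"
    using f' by (intro mulop_convergent[OF orthonormal_ef[OF L] finite_lat[OF L] lat_subset lat_mono, where c = "1 / infdist z rpos"]
        resolvent_mult_bound z) auto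
  then obtain g where g: "g \<in> borel_measurable borel" "nsq lborel g < \<top>"
    and ipg: "\<And>p. p \<in> dual_lattice L \<Longrightarrow> ip lborel (ef L p) g = ?m p * ip lborel (ef L p) f"
    unfolding UN_lat ip_ef_lamcut by auto
  have four: "(complex_of_real (nu p) - z) * fourier L g p = fourier L f p" if "p \<in> dual_lattice L" for p
    using nu_minus_nonzero[OF z, of p] ipg[OF that] by (simp add: fourier_eq_ip[OF L])
  have g2: "L2on L g" unfolding L2on_iff using g nsq_lamcut_le[of lborel L g] by (auto intro: le_less_trans)
  \<comment> \<open>From nu / (nu - z) = 1 + z / (nu - z), where |nu - z| is at least the distance
    of z to the half-line.\<close>
  define C where "C = 1 + cmod z / infdist z rpos"
  have C: "cmod (complex_of_real (nu p) * ?m p) \<le> C" for p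
  proof -
    have "complex_of_real (nu p) * ?m p = 1 + z * ?m p"
      using nu_minus_nonzero[OF z, of p] by (simp add: field_simps)
    then have "cmod (complex_of_real (nu p) * ?m p) \<le> 1 + cmod z * cmod (?m p)"
      by (metis norm_mult norm_one norm_triangle_ineq)
    also have "\<dots> \<le> 1 + cmod z * (1 / infdist z rpos)"
      by (intro add_left_mono mult_left_mono resolvent_mult_bound z) simp
    finally show ?thesis by (simp add: C_def)
  qed
  have "(\<lambda>p. (cmod (complex_of_real (nu p) * fourier L g p))^2) summable_on dual_lattice L"
  proof (rule nonneg_bdd_above_summable_on)
    show "bdd_above (sum (\<lambda>p. (cmod (complex_of_real (nu p) * fourier L g p))\<^sup>2) ` {F. F \<subseteq> dual_lattice L \<and> finite F})"
    proof (rule bdd_aboveI2)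
      fix F :: "(real^'d) set" assume "F \<in> {F. F \<subseteq> dual_lattice L \<and> finite F}"
      then have F: "F \<subseteq> dual_lattice L" "finite F" by auto
      have "(cmod (complex_of_real (nu p) * fourier L g p))\<^sup>2 \<le> C^2 * L ^ CARD('d) * (cmod (ip lborel (ef L p) (lamcut L f)))^2" if "p \<in> F" for p
      proof -
        have "cmod (complex_of_real (nu p) * fourier L g p) = cmod (complex_of_real (nu p) * ?m p) * (sqrt (L ^ CARD('d)) * cmod (ip lborel (ef L p) (lamcut L f)))"
          using L ipg[of p] that F by (simp add: fourier_eq_ip[OF L] norm_mult norm_divide ip_ef_lamcut subset_iff)
        also have "\<dots> \<le> C * (sqrt (L ^ CARD('d)) * cmod (ip lborel (ef L p) (lamcut L f)))"
          using L by (intro mult_right_mono C) auto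
        finally have "(cmod (complex_of_real (nu p) * fourier L g p))^2 \<le> (C * (sqrt (L ^ CARD('d)) * cmod (ip lborel (ef L p) (lamcut L f))))^2"
          by (intro power_mono) auto
        then show ?thesis using L by (simp add: power_mult_distrib mult.assoc)
      qed
      then have "sum (\<lambda>p. (cmod (complex_of_real (nu p) * fourier L g p))\<^sup>2) F \<le> C^2 * L ^ CARD('d) * (\<Sum>p\<in>F. (cmod (ip lborel (ef L p) (lamcut L f)))^2)"
        unfolding sum_distrib_left by (intro sum_mono)
      also have "(\<Sum>p\<in>F. (cmod (ip lborel (ef L p) (lamcut L f)))^2) \<le> enn2real (nsq lborel (lamcut L f))"
        using enn2real_mono[OF bessel[OF orthonormal_ef[OF L] F(2,1), of "lamcut L f"]] f' by (simp add: sum_nonneg)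
      finally show "sum (\<lambda>p. (cmod (complex_of_real (nu p) * fourier L g p))\<^sup>2) F \<le> C^2 * L ^ CARD('d) * enn2real (nsq lborel (lamcut L f))"
        using L by (simp add: mult_left_mono)
    qed
  qed simp
  then have "g \<in> domK L" using g2 by (auto simp: domK_def)
  with four have "\<exists>g. g \<in> domK L \<and> (\<forall>p \<in> dual_lattice L. (complex_of_real (nu p) - z) * fourier L g p = fourier L f p)" by blast
  then have R: "resolvent L z f \<in> domK L \<and> (\<forall>p \<in> dual_lattice L. (complex_of_real (nu p) - z) * fourier L (resolvent L z f) p = fourier L f p)"
    unfolding resolvent_def by (rule someI_ex)
  then show "L2on L (resolvent L z f)" by (simp add: domK_def)
  assume "p \<in> dual_lattice L"
  with R have "(complex_of_real (nu p) - z) * (?s * ip lborel (ef L p) (resolvent L z f)) = ?s * ip lborel (ef L p) f"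
    by (metis fourier_eq_ip[OF L])
  moreover have "?s \<noteq> 0" using L by simp
  ultimately have "(complex_of_real (nu p) - z) * ip lborel (ef L p) (resolvent L z f) = ip lborel (ef L p) f"
    by (metis mult.left_commute mult_cancel_left)
  then show "ip lborel (ef L p) (resolvent L z f) = ?m p * ip lborel (ef L p) f"
    using nu_minus_nonzero[OF z, of p] by (simp add: field_simps)
qed

text \<open>The truncated resolvent of f is the projection of the full resolvent of f, since their
  coefficients agree; strong convergence is thus inherited from the projections.\<close>

lemma RT_tendsto_resolvent:
  assumes L: "0 < L" and z: "z \<notin> rpos" and f: "L2on L f"
  shows "(\<lambda>N. nsq lborel (\<lambda>x. RT L N z f x - lamcut L (resolvent L z f) x)) \<longlonglongrightarrow> 0"
proof -
  let ?g = "resolvent L z f"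
  have "RT L N z f = proj L N (lamcut L ?g)" for N
    unfolding RT_def proj_def mulop_def[abs_def] ip_ef_lamcut
    using lat_subset[of L N] by (intro ext sum.cong) (auto simp: resolvent_spec(2)[OF L z f])
  moreover have "(\<lambda>N. nsq lborel (\<lambda>x. proj L N (lamcut L ?g) x - lamcut L (lamcut L ?g) x)) \<longlonglongrightarrow> 0"
    using resolvent_spec(1)[OF L z f] by (intro proj_tendsto[OF L]) (auto simp: L2on_iff)
  ultimately show ?thesis by simp
qed

section \<open>The iterated operator and the removal of the frequency cutoff\<close>

fun itRT :: "real \<Rightarrow> nat \<Rightarrow> complex \<Rightarrow> (real^'d \<Rightarrow> real) \<Rightarrow> nat \<Rightarrow> (real^'d \<Rightarrow> complex) \<Rightarrow> real^'d \<Rightarrow> complex" where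
  "itRT L N z V 0 f = RT L N z f"
| "itRT L N z V (Suc k) f = RT L N z (\<lambda>x. complex_of_real (V x) * itRT L N z V k f x)"

lemma itRT_measurable: "0 < L \<Longrightarrow> itRT L N z V k f \<in> borel_measurable borel"
  by (cases k) (auto intro: RT_measurable)

lemma itRT_nsq_finite: "0 < L \<Longrightarrow> nsq lborel (itRT L N z V k f) < \<top>"
  by (cases k) (auto intro: RT_nsq_finite)

lemma nsq_bounded_mult_finite:
  assumes "f \<in> borel_measurable M" "nsq M f < \<top>" "\<And>x. x \<in> space M \<Longrightarrow> cmod (b x) \<le> c"
  shows "nsq M (\<lambda>x. b x * f x) < \<top>"
  using assms(2) by (intro le_less_trans[OF nsq_mult_le[of f M b c]] assms) (auto simp: ennreal_mult_less_top)

text \<open>A crude bound through the sup norm of V. For a random potential it grows with the number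
  of scatterers, and it serves to dominate limits at fixed L.\<close>

lemma itRT_nsq_le:
  assumes L: "0 < L" and z: "z \<notin> rpos" and f: "f \<in> borel_measurable borel"
    and V[measurable]: "V \<in> borel_measurable borel" and c: "\<And>x. \<bar>V x\<bar> \<le> c"
  shows "nsq lborel (itRT L N z V k f) \<le> ennreal ((c^2)^k * ((1 / infdist z rpos)^2)^(k + 1)) * nsq lborel f"
proof (induction k)
  case 0
  then show ?case using nsq_RT_le[OF L z f] by simp
next
  case (Suc k)
  note [measurable] = itRT_measurable[OF L]
  define d where "d = (1 / infdist z rpos)^2"
  have d0: "0 \<le> d" by (simp add: d_def)
  note Suc = Suc[folded d_def]
  have "nsq lborel (itRT L N z V (Suc k) f) \<le> ennreal d * nsq lborel (\<lambda>x. complex_of_real (V x) * itRT L N z V k f x)"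
    unfolding itRT.simps d_def by (rule nsq_RT_le[OF L z]) measurable
  also have "\<dots> \<le> ennreal d * (ennreal (c^2) * nsq lborel (itRT L N z V k f))"
    using c by (intro mult_left_mono nsq_mult_le) auto
  also have "\<dots> \<le> ennreal d * (ennreal (c^2) * (ennreal ((c^2)^k * d^(k + 1)) * nsq lborel f))"
    by (intro mult_left_mono Suc) auto
  also have "\<dots> = ennreal ((c^2)^(Suc k) * d^(Suc k + 1)) * nsq lborel f"
    using d0 by (simp add: ennreal_mult mult_ac)
  finally show ?case by (simp add: d_def)
qed

text \<open>There are two errors in each step: the previous error passes through operators bounded
  uniformly in N, and the truncation of the new resolvent acts on a fixed function, where it
  converges strongly. Square integrability is part of the induction because
  \<open>RT_tendsto_resolvent\<close> asks for it.\<close>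

lemma iterR_L2on_tendsto:
  assumes L: "0 < L" and z: "z \<notin> rpos" and f: "L2on L f"
    and V[measurable]: "V \<in> borel_measurable borel" and c: "\<And>x. \<bar>V x\<bar> \<le> c"
  shows "L2on L (iterR L z V k f) \<and>
    (\<lambda>N. nsq lborel (\<lambda>x. itRT L N z V k f x - lamcut L (iterR L z V k f) x)) \<longlonglongrightarrow> 0"
proof (induction k)
  case 0
  then show ?case using RT_tendsto_resolvent[OF L z f] resolvent_spec(1)[OF L z f] by simp
next
  case (Suc k)
  let ?g = "iterR L z V k f" and ?gN = "\<lambda>N. itRT L N z V k f"
  let ?h = "\<lambda>x. complex_of_real (V x) * ?g x" and ?hN = "\<lambda>N x. complex_of_real (V x) * ?gN N x"
  have g: "lamcut L ?g \<in> borel_measurable borel" "nsq lborel (lamcut L ?g) < \<top>" using Suc by (auto simp: L2on_iff)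
  note [measurable] = g(1) itRT_measurable[OF L]
  have ch: "lamcut L ?h = (\<lambda>x. complex_of_real (V x) * lamcut L ?g x)" by (auto simp: lamcut_def)
  have chm[measurable]: "lamcut L ?h \<in> borel_measurable borel" unfolding ch by measurable
  have chf: "nsq lborel (lamcut L ?h) < \<top>" unfolding ch using c g by (intro nsq_bounded_mult_finite) auto
  then have h: "L2on L ?h" by (auto simp: L2on_iff)
  have R: "lamcut L (resolvent L z ?h) \<in> borel_measurable borel"
    using resolvent_spec(1)[OF L z h] by (simp add: L2on_iff)
  let ?d = "ennreal ((1 / infdist z rpos)^2)"
  have bd: "nsq lborel (\<lambda>x. itRT L N z V (Suc k) f x - lamcut L (resolvent L z ?h) x)
     \<le> 2 * (?d * (ennreal (c^2) * nsq lborel (\<lambda>x. ?gN N x - lamcut L ?g x))) + 2 * nsq lborel (\<lambda>x. RT L N z ?h x - lamcut L (resolvent L z ?h) x)" for N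
  proof -
    have hN: "nsq lborel (?hN N) < \<top>"
      using c by (intro nsq_bounded_mult_finite itRT_nsq_finite L) auto
    have "nsq lborel (\<lambda>x. RT L N z (?hN N) x - RT L N z ?h x) = nsq lborel (RT L N z (\<lambda>x. ?hN N x - lamcut L ?h x))"
      using RT_diff[OF L _ hN chm chf, of N z] by (intro nsq_cong) (simp add: RT_lamcut)
    also have "\<dots> \<le> ?d * nsq lborel (\<lambda>x. ?hN N x - lamcut L ?h x)"
      by (intro nsq_RT_le L z) measurable
    also have "nsq lborel (\<lambda>x. ?hN N x - lamcut L ?h x) = nsq lborel (\<lambda>x. complex_of_real (V x) * (?gN N x - lamcut L ?g x))"
      by (simp add: ch right_diff_distrib)
    also have "\<dots> \<le> ennreal (c^2) * nsq lborel (\<lambda>x. ?gN N x - lamcut L ?g x)"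
      using c by (intro nsq_mult_le) auto
    finally have 1: "nsq lborel (\<lambda>x. RT L N z (?hN N) x - RT L N z ?h x) \<le> ?d * (ennreal (c^2) * nsq lborel (\<lambda>x. ?gN N x - lamcut L ?g x))"
      by (simp add: mult_left_mono)
    have "nsq lborel (\<lambda>x. itRT L N z V (Suc k) f x - lamcut L (resolvent L z ?h) x)
      \<le> 2 * nsq lborel (\<lambda>x. RT L N z (?hN N) x - RT L N z ?h x) + 2 * nsq lborel (\<lambda>x. RT L N z ?h x - lamcut L (resolvent L z ?h) x)"
      unfolding itRT.simps by (intro nsq_triangle) (use R L in auto)
    also have "\<dots> \<le> 2 * (?d * (ennreal (c^2) * nsq lborel (\<lambda>x. ?gN N x - lamcut L ?g x))) + 2 * nsq lborel (\<lambda>x. RT L N z ?h x - lamcut L (resolvent L z ?h) x)"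
      by (intro add_mono mult_left_mono 1) auto
    finally show ?thesis .
  qed
  have "(\<lambda>N. 2 * (?d * (ennreal (c^2) * nsq lborel (\<lambda>x. ?gN N x - lamcut L ?g x))) + 2 * nsq lborel (\<lambda>x. RT L N z ?h x - lamcut L (resolvent L z ?h) x))
      \<longlonglongrightarrow> 2 * (?d * (ennreal (c^2) * 0)) + 2 * 0"
    using Suc RT_tendsto_resolvent[OF L z h] by (intro tendsto_add ennreal_tendsto_cmult) auto
  then have "(\<lambda>N. nsq lborel (\<lambda>x. itRT L N z V (Suc k) f x - lamcut L (resolvent L z ?h) x)) \<longlonglongrightarrow> 0"
    by (intro ennreal_tendsto_0_le[OF _ bd]) simp
  then show ?case using resolvent_spec(1)[OF L z h] by simp
qed

lemma ip_tendsto: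
  assumes [measurable]: "\<And>N. u N \<in> borel_measurable M" "g \<in> borel_measurable M" "f \<in> borel_measurable M"
    and fin: "\<And>N. nsq M (u N) < \<top>" "nsq M g < \<top>" "nsq M f < \<top>"
    and lim: "(\<lambda>N. nsq M (\<lambda>x. u N x - g x)) \<longlonglongrightarrow> 0"
  shows "(\<lambda>N. ip M f (u N)) \<longlonglongrightarrow> ip M f g"
proof -
  have "ennreal ((cmod (ip M f (u N) - ip M f g))^2) \<le> nsq M f * nsq M (\<lambda>x. u N x - g x)" for N
    using ip_le[of f M "\<lambda>x. u N x - g x"] ip_diff_right[of f M "u N" g] fin by simp
  moreover have "(\<lambda>N. nsq M f * nsq M (\<lambda>x. u N x - g x)) \<longlonglongrightarrow> 0"
    using ennreal_tendsto_cmult[OF fin(3) lim] by simp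
  ultimately have "(\<lambda>N. ennreal ((cmod (ip M f (u N) - ip M f g))^2)) \<longlonglongrightarrow> 0"
    by (rule ennreal_tendsto_0_le[rotated])
  then have "(\<lambda>N. (cmod (ip M f (u N) - ip M f g))^2) \<longlonglongrightarrow> 0"
    using tendsto_ennreal_iff[of "\<lambda>N. (cmod (ip M f (u N) - ip M f g))^2" sequentially 0] by simp
  then have "(\<lambda>N. sqrt ((cmod (ip M f (u N) - ip M f g))^2)) \<longlonglongrightarrow> sqrt 0"
    by (rule tendsto_real_sqrt)
  then show ?thesis by (simp add: LIM_zero_cancel tendsto_norm_zero_iff)
qed

lemma ip_iterR_tendsto:
  assumes L: "0 < L" and z: "z \<notin> rpos" and f: "L2on L f" and h: "L2on L h"
    and V[measurable]: "V \<in> borel_measurable borel" and c: "\<And>x. \<bar>V x\<bar> \<le> c"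
  shows "(\<lambda>N. ip lborel (lamcut L h) (itRT L N z V k f)) \<longlonglongrightarrow> inner_L L h (iterR L z V k f)"
proof -
  note it = iterR_L2on_tendsto[OF L z f V c, of k]
  have "(\<lambda>N. ip lborel (lamcut L h) (itRT L N z V k f)) \<longlonglongrightarrow> ip lborel (lamcut L h) (lamcut L (iterR L z V k f))"
    using it h itRT_measurable[OF L] itRT_nsq_finite[OF L] by (intro ip_tendsto) (auto simp: L2on_iff)
  moreover have "ip lborel (lamcut L h) (lamcut L (iterR L z V k f)) = inner_L L h (iterR L z V k f)"
    unfolding ip_def inner_L_def set_lebesgue_integral_def lamcut_def
    by (intro Bochner_Integration.integral_cong) (auto split: split_indicator)
  ultimately show ?thesis by simp
qed

section \<open>Strong convergence of the resolvents as the box grows\<close>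

text \<open>The cutoff is the product of (1 + cos (2 pi x_i / L)) / 2 over i, written as a trigonometric
  polynomial with frequencies shiftq and weights chiw. It vanishes to second order on the boundary
  of the box, so a trigonometric polynomial times this cutoff, extended by zero, is in the domain
  of K on every larger box.\<close>

definition shifts :: "('d::finite \<Rightarrow> int) set" where
  "shifts = PiE UNIV (\<lambda>_. {-1, 0, 1})"

definition chiw1 :: "int \<Rightarrow> real" where "chiw1 k = (if k = 0 then 1/2 else 1/4)"

definition chiw :: "('d::finite \<Rightarrow> int) \<Rightarrow> real" where "chiw j = (\<Prod>i\<in>UNIV. chiw1 (j i))"

definition shiftq :: "real \<Rightarrow> ('d::finite \<Rightarrow> int) \<Rightarrow> real^'d" where
  "shiftq L j = (\<chi> i. of_int (j i) / L)"

definition chi :: "real \<Rightarrow> real^'d \<Rightarrow> complex" where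
  "chi L x = (\<Sum>j\<in>shifts. complex_of_real (chiw j) * cis (2 * pi * (shiftq L j \<bullet> x)))"

lemma finite_shifts[simp]: "finite (shifts :: ('d::finite \<Rightarrow> int) set)"
  unfolding shifts_def by (intro finite_PiE) auto

lemma chiw_nonneg: "0 \<le> chiw j" by (auto simp: chiw_def chiw1_def intro: prod_nonneg)

lemma sum_chiw: "(\<Sum>j\<in>(shifts :: ('d::finite \<Rightarrow> int) set). chiw j) = 1"
proof -
  have "(\<Sum>j\<in>(shifts :: ('d \<Rightarrow> int) set). chiw j) = (\<Prod>i\<in>(UNIV::'d set). \<Sum>k\<in>{-1,0,1}. chiw1 k)"
    unfolding shifts_def chiw_def by (rule prod_sum_PiE[symmetric]) auto
  also have "\<dots> = 1" by (simp add: chiw1_def)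
  finally show ?thesis .
qed

lemma chiw_le_1:
  fixes j :: "'d::finite \<Rightarrow> int"
  assumes "j \<in> shifts" shows "chiw j \<le> 1"
proof -
  have "chiw j \<le> (\<Sum>j\<in>(shifts :: ('d \<Rightarrow> int) set). chiw j)" using assms by (intro member_le_sum[of j shifts chiw]) (auto simp: chiw_nonneg)
  then show ?thesis by (simp add: sum_chiw)
qed

lemma norm_chi_le: "cmod (chi L x) \<le> 1"
proof -
  have "cmod (chi L x) \<le> (\<Sum>j\<in>shifts. cmod (complex_of_real (chiw j) * cis (2 * pi * (shiftq L j \<bullet> x))))"
    unfolding chi_def by (rule norm_sum)
  also have "\<dots> = 1" using sum_chiw by (simp add: norm_mult chiw_nonneg)
  finally show ?thesis .
qed

lemma chi_measurable[measurable]: "chi L \<in> borel_measurable borel"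
  unfolding chi_def[abs_def] by measurable

text \<open>The frequencies of the cutoff shrink like 1/L, so each of its waves tends to 1 at a
  fixed x, and the weights sum to 1.\<close>

lemma chi_tendsto:
  fixes x :: "real^'d"
  shows "(\<lambda>n. chi (real n) x) \<longlonglongrightarrow> 1"
proof -
  have "(\<lambda>n. shiftq (real n) j \<bullet> x) \<longlonglongrightarrow> 0" for j
  proof -
    have "(\<lambda>n. \<Sum>i\<in>UNIV. of_int (j i) / real n * x $ i) \<longlonglongrightarrow> (\<Sum>i\<in>UNIV. 0 * x $ i)"
      by (intro tendsto_sum tendsto_mult tendsto_const tendsto_divide_0[OF tendsto_const]
          filterlim_at_top_imp_at_infinity filterlim_real_sequentially)
    then show ?thesis by (simp add: inner_vec_def shiftq_def)
  qed
  note lim = this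
  have cont: "isCont cis t" for t
    using continuous_on_cis[OF continuous_on_id, of UNIV] by (simp add: continuous_on_eq_continuous_at)
  have "(\<lambda>n. cis (2 * pi * (shiftq (real n) j \<bullet> x))) \<longlonglongrightarrow> cis (2 * pi * 0)" for j
    by (rule isCont_tendsto_compose[OF cont]) (intro tendsto_mult tendsto_const lim)
  then have "(\<lambda>n. chi (real n) x) \<longlonglongrightarrow> (\<Sum>j\<in>(shifts :: ('d \<Rightarrow> int) set). complex_of_real (chiw j) * cis (2 * pi * 0))"
    unfolding chi_def by (intro tendsto_sum tendsto_mult tendsto_const)
  also have "(\<Sum>j\<in>(shifts :: ('d \<Rightarrow> int) set). complex_of_real (chiw j) * cis (2 * pi * 0)) = 1"
    using sum_chiw by (simp add: of_real_sum[symmetric] del: of_real_sum)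
  finally show ?thesis .
qed

text \<open>With w = u + k/L, each term (w^2 - v^2) \<open>osc_integral L (w - v)\<close> equals (w
  + v) sin (pi (w - v) L) / pi. A shift by 1/L flips the sign of the sine, so the weights 1/4, 1/2,
  1/4 act as -1/4, 1/2, -1/4. This is a second difference, and it kills the affine factor w +
  v.\<close>

lemma osc_cutoff:
  assumes L: "0 < L"
  shows "(\<Sum>k\<in>{-1,0,1}. complex_of_real (chiw1 k) * (complex_of_real ((u + of_int k / L)^2 - v^2) * osc_integral L (u + of_int k / L - v))) = 0"
proof -
  define s where "s = sin (pi * (u - v) * L)"
  have *: "complex_of_real pi * (complex_of_real ((u + of_int k / L)^2 - v^2) * osc_integral L (u + of_int k / L - v))
    = complex_of_real ((u + of_int k / L + v) * (if k = 0 then s else - s))" if "k \<in> {-1,0,1}" for k :: int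
  proof -
    have "complex_of_real pi * (complex_of_real ((u + of_int k / L)^2 - v^2) * osc_integral L (u + of_int k / L - v))
      = complex_of_real (u + of_int k / L + v) * (complex_of_real (pi * (u + of_int k / L - v)) * osc_integral L (u + of_int k / L - v))"
    proof -
      have "(t::real)^2 - v^2 = (t + v) * (t - v)" for t by (simp add: power2_eq_square algebra_simps)
      then show ?thesis by (simp only: of_real_mult) (simp only: mult_ac)
    qed
    also have "\<dots> = complex_of_real (u + of_int k / L + v) * complex_of_real (sin (pi * (u + of_int k / L - v) * L))"
      using L by (subst osc_integral_mult) auto
    also have "pi * (u + of_int k / L - v) * L = pi * (u - v) * L + of_int k * pi"
      using L by (simp add: field_simps)
    also have "sin (pi * (u - v) * L + of_int k * pi) = (if k = 0 then s else - s)"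
      using that by (auto simp: s_def sin_add sin_diff)
    finally show ?thesis by simp
  qed
  have "complex_of_real pi * (\<Sum>k\<in>{-1,0,1}. complex_of_real (chiw1 k) * (complex_of_real ((u + of_int k / L)^2 - v^2) * osc_integral L (u + of_int k / L - v)))
     = (\<Sum>k\<in>{-1,0,1}. complex_of_real (chiw1 k) * complex_of_real ((u + of_int k / L + v) * (if k = 0 then s else - s)))"
    unfolding sum_distrib_left
  proof (intro sum.cong refl)
    fix k :: int assume k: "k \<in> {-1,0,1}"
    show "complex_of_real pi * (complex_of_real (chiw1 k) * (complex_of_real ((u + of_int k / L)^2 - v^2) * osc_integral L (u + of_int k / L - v)))
       = complex_of_real (chiw1 k) * complex_of_real ((u + of_int k / L + v) * (if k = 0 then s else - s))"
      by (subst mult.left_commute) (simp only: *[OF k])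
  qed
  also have "\<dots> = complex_of_real (\<Sum>k\<in>{-1,0,1::int}. chiw1 k * ((u + of_int k / L + v) * (if k = 0 then s else - s)))"
    by simp
  also have "(\<Sum>k\<in>{-1,0,1::int}. chiw1 k * ((u + of_int k / L + v) * (if k = 0 then s else - s))) = 0"
    by (simp add: chiw1_def field_simps)
  finally show ?thesis by simp
qed

lemma Lam_mono: "L \<le> L' \<Longrightarrow> (Lam L :: (real^'d) set) \<subseteq> Lam L'"
proof
  fix x :: "real^'d" assume "L \<le> L'" "x \<in> Lam L"
  moreover from this have "- L / 2 \<le> x $ i" "x $ i < L / 2" for i by (auto simp: Lam_def)
  ultimately have "- L' / 2 \<le> x $ i \<and> x $ i < L' / 2" for i
    using order_trans[of "- L' / 2" "- L / 2" "x $ i"] order_less_le_trans[of "x $ i" "L / 2" "L' / 2"] by auto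
  then show "x \<in> Lam L'" by (simp add: Lam_def)
qed

lemma ip_ef_ef:
  fixes p s :: "real^'d"
  assumes L: "0 < L" "L \<le> L'"
  shows "ip lborel (ef L' p) (ef L s) =
    (\<Prod>i\<in>UNIV. osc_integral L (s $ i - p $ i)) / complex_of_real (sqrt (L' ^ CARD('d)) * sqrt (L ^ CARD('d)))"
proof -
  have sub: "x \<in> Lam L \<Longrightarrow> x \<in> Lam L'" for x :: "real^'d"
    using Lam_mono[OF L(2)] by blast
  have "cnj (ef L' p x) * ef L s x = indicator (Lam L) x *\<^sub>R cis (2 * pi * ((s - p) \<bullet> x)) / complex_of_real (sqrt (L' ^ CARD('d)) * sqrt (L ^ CARD('d)))" for x
    using sub[of x] by (auto simp: ef_def cis_cnj cis_mult inner_diff_left right_diff_distrib split: split_indicator)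
  then have "ip lborel (ef L' p) (ef L s) = (\<integral>x. indicator (Lam L) x *\<^sub>R cis (2 * pi * ((s - p) \<bullet> x)) / complex_of_real (sqrt (L' ^ CARD('d)) * sqrt (L ^ CARD('d))) \<partial>lborel)"
    by (simp add: ip_def)
  also have "\<dots> = (\<integral>x. indicator (Lam L) x *\<^sub>R cis (2 * pi * ((s - p) \<bullet> x)) \<partial>lborel) / complex_of_real (sqrt (L' ^ CARD('d)) * sqrt (L ^ CARD('d)))"
    by (rule integral_divide_zero)
  finally show ?thesis by (simp add: integral_Lam_cis)
qed

text \<open>Integration by parts without boundary terms, in Fourier form: for a plane wave times the
  cutoff, extended by zero to the larger box, multiplying by \<open>nu\<close> before or after
  passing to the frequency p' gives the same coefficient. The difference of the two values of
  \<open>nu\<close> is a sum over coordinates; for each coordinate i the sum over shifts factorises,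
  and its i-th factor vanishes by \<open>osc_cutoff\<close>.\<close>

lemma cutoff_fourier_zero:
  fixes p p' :: "real^'d"
  assumes L: "0 < L" "L \<le> L'"
  shows "(\<Sum>j\<in>shifts. complex_of_real (chiw j) * (complex_of_real (nu (p + shiftq L j) - nu p') * ip lborel (ef L' p') (ef L (p + shiftq L j)))) = 0"
proof -
  let ?D = "complex_of_real (sqrt (L' ^ CARD('d)) * sqrt (L ^ CARD('d)))"
  define a where "a l k = complex_of_real (chiw1 k) * osc_integral L (p $ l + of_int k / L - p' $ l)" for l and k :: int
  define b where "b l k = complex_of_real ((p $ l + of_int k / L)^2 - (p' $ l)^2)" for l and k :: int
  define \<phi> where "\<phi> i l k = a l k * (if l = i then b l k else 1)" for i l k
  have nu: "nu (p + shiftq L j) - nu p' = (\<Sum>i\<in>UNIV. ((p $ i + of_int (j i) / L)^2 - (p' $ i)^2)) / 2" for j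
    by (simp add: nu_def dot_square_norm[symmetric] inner_vec_def shiftq_def sum_subtractf diff_divide_distrib)
       (simp add: power2_eq_square)
  have "complex_of_real (chiw j) * (complex_of_real (nu (p + shiftq L j) - nu p') * ip lborel (ef L' p') (ef L (p + shiftq L j)))
     = (\<Sum>i\<in>UNIV. \<Prod>l\<in>UNIV. \<phi> i l (j l)) / (2 * ?D)" for j
  proof -
    have ph: "(\<Prod>l\<in>UNIV. \<phi> i l (j l)) = b i (j i) * (\<Prod>l\<in>UNIV. a l (j l))" for i
    proof -
      have "(\<Prod>l\<in>UNIV. \<phi> i l (j l)) = (\<Prod>l\<in>UNIV. a l (j l)) * (\<Prod>l\<in>UNIV. if l = i then b l (j l) else 1)"
        unfolding \<phi>_def by (rule prod.distrib)
      then show ?thesis by (simp add: prod.delta mult.commute)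
    qed
    have "(\<Prod>l\<in>UNIV. a l (j l)) = complex_of_real (chiw j) * (\<Prod>i\<in>UNIV. osc_integral L ((p + shiftq L j) $ i - p' $ i))"
      unfolding a_def chiw_def prod.distrib by (simp add: shiftq_def)
    moreover have "complex_of_real (nu (p + shiftq L j) - nu p') = (\<Sum>i\<in>UNIV. b i (j i)) / 2"
      unfolding nu b_def by simp
    ultimately show ?thesis
      unfolding ph sum_distrib_right[symmetric] ip_ef_ef[OF L]
      by (simp only: times_divide_eq_left times_divide_eq_right divide_divide_eq_left mult_ac)
  qed
  note terms = this
  have zero: "(\<Sum>j\<in>shifts. \<Prod>l\<in>UNIV. \<phi> i l (j l)) = 0" for i
  proof -
    have "(\<Sum>j\<in>shifts. \<Prod>l\<in>UNIV. \<phi> i l (j l)) = (\<Prod>l\<in>UNIV. \<Sum>k\<in>{-1,0,1}. \<phi> i l k)"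
      unfolding shifts_def by (rule prod_sum_PiE[symmetric]) auto
    moreover have "(\<Sum>k\<in>{-1,0,1}. \<phi> i i k) = 0"
      using osc_cutoff[OF L(1), of "p $ i" "p' $ i"] by (simp add: \<phi>_def a_def b_def mult_ac)
    then have "(\<Prod>l\<in>UNIV. \<Sum>k\<in>{-1,0,1}. \<phi> i l k) = 0" by (intro prod_zero) auto
    ultimately show ?thesis by simp
  qed
  have "(\<Sum>j\<in>shifts. complex_of_real (chiw j) * (complex_of_real (nu (p + shiftq L j) - nu p') * ip lborel (ef L' p') (ef L (p + shiftq L j))))
     = (\<Sum>j\<in>shifts. (\<Sum>i\<in>UNIV. \<Prod>l\<in>UNIV. \<phi> i l (j l)) / (2 * ?D))" by (simp only: terms)
  also have "\<dots> = (\<Sum>i\<in>UNIV. \<Sum>j\<in>shifts. \<Prod>l\<in>UNIV. \<phi> i l (j l)) / (2 * ?D)"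
    unfolding sum_divide_distrib[symmetric] by (subst sum.swap) (rule refl)
  also have "\<dots> = 0" by (simp only: zero) simp
  finally show ?thesis .
qed

lemma nsq_divide_tendsto_0:
  assumes "c < \<top>" shows "(\<lambda>n. ennreal ((K / real n)^2) * c) \<longlonglongrightarrow> 0"
proof -
  have "(\<lambda>n. (K / real n)^2) \<longlonglongrightarrow> 0^2"
    by (intro tendsto_power tendsto_divide_0[OF tendsto_const] filterlim_at_top_imp_at_infinity filterlim_real_sequentially)
  then have "(\<lambda>n. ennreal ((K / real n)^2)) \<longlonglongrightarrow> ennreal (0^2)" by (rule tendsto_ennrealI)
  then have "(\<lambda>n. c * ennreal ((K / real n)^2)) \<longlonglongrightarrow> c * ennreal (0^2)"
    by (rule ennreal_tendsto_cmult[OF assms])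
  then show ?thesis by (simp add: mult.commute)
qed

lemma nsq_tendsto_0_dominated:
  assumes [measurable]: "\<And>n. u n \<in> borel_measurable M" "w \<in> borel_measurable M"
    and "nsq M w < \<top>" and "\<And>n. AE x in M. cmod (u n x) \<le> c * cmod (w x)"
    and "AE x in M. (\<lambda>n. u n x) \<longlonglongrightarrow> 0"
  shows "(\<lambda>n. nsq M (u n)) \<longlonglongrightarrow> 0"
proof -
  have "(\<lambda>n. \<integral>\<^sup>+x. ennreal ((cmod (u n x))^2) \<partial>M) \<longlonglongrightarrow> (\<integral>\<^sup>+x. 0 \<partial>M)"
  proof (rule nn_integral_dominated_convergence)
    show "AE x in M. ennreal ((cmod (u n x))^2) \<le> ennreal (c^2) * ennreal ((cmod (w x))^2)" for n
      using assms(4)[of n]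
      by eventually_elim (auto simp: ennreal_mult[symmetric] power_mult_distrib[symmetric] intro!: ennreal_leI power_mono)
    show "(\<integral>\<^sup>+x. ennreal (c^2) * ennreal ((cmod (w x))^2) \<partial>M) < \<infinity>"
      using assms(3) by (subst nn_integral_cmult) (auto simp: nsq_def ennreal_mult_less_top)
    show "AE x in M. (\<lambda>n. ennreal ((cmod (u n x))^2)) \<longlonglongrightarrow> 0"
      using assms(5)
    proof eventually_elim
      fix x assume "(\<lambda>n. u n x) \<longlonglongrightarrow> 0"
      then have "(\<lambda>n. (cmod (u n x))^2) \<longlonglongrightarrow> (cmod 0)^2" by (intro tendsto_intros)
      then show "(\<lambda>n. ennreal ((cmod (u n x))^2)) \<longlonglongrightarrow> 0" using tendsto_ennrealI by fastforce
    qed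
  qed auto
  then show ?thesis by (simp add: nsq_def)
qed

lemma ef_shift: "ef L (p + q) x = cis (2 * pi * (q \<bullet> x)) * ef L p x"
  by (simp add: ef_def inner_add_left distrib_left cis_mult[symmetric] split: split_indicator)

lemma norm_shiftq_le:
  assumes "0 < L" "j \<in> shifts"
  shows "norm (shiftq L (j :: 'd::finite \<Rightarrow> int)) \<le> real CARD('d) / L"
proof -
  have "norm (shiftq L j) \<le> (\<Sum>i\<in>UNIV. \<bar>shiftq L j $ i\<bar>)" by (rule norm_le_l1_cart)
  also have "\<dots> \<le> (\<Sum>i\<in>(UNIV::'d set). 1 / L)"
  proof (rule sum_mono)
    fix i
    have "j i \<in> {-1,0,1}" using assms(2) by (auto simp: shifts_def PiE_iff)
    then show "\<bar>shiftq L j $ i\<bar> \<le> 1 / L" using assms(1) by (auto simp: shiftq_def)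
  qed
  finally show ?thesis by simp
qed

text \<open>This is the symbol of the commutator of K with the cutoff, composed with the resolvent.
  Its numerator grows like |p| / L, whereas the denominator grows like the square of |p|.\<close>

lemma commutator_bound:
  assumes z: "z \<notin> rpos"
  shows "\<exists>C. \<forall>L\<ge>1. \<forall>j\<in>shifts. \<forall>p::real^'d. cmod (complex_of_real (nu (p + shiftq L j) - nu p) / (complex_of_real (nu p) - z)) \<le> C / L"
proof -
  let ?\<delta> = "infdist z rpos" and ?d = "real CARD('d)"
  have \<delta>: "0 < ?\<delta>" by (rule infdist_rpos_pos[OF z])
  \<comment> \<open>From |p| <= 1 + nu p <= 1 + |nu p - z| + |z|, divided by |nu p - z|, which is at
    least the distance of z to the half-line.\<close>
  define A where "A = 1 / ?\<delta> + (1 + cmod z / ?\<delta>)"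
  have A: "norm p / cmod (complex_of_real (nu p) - z) \<le> A" for p :: "real^'d"
  proof -
    let ?w = "cmod (complex_of_real (nu p) - z)"
    have w: "?\<delta> \<le> ?w" "0 < ?w" using infdist_rpos_le[of z p] \<delta> by auto
    have "0 \<le> (norm p - 1)^2" by simp
    then have "norm p \<le> 1 + nu p" by (simp add: nu_def power2_eq_square algebra_simps)
    moreover have "nu p \<le> ?w + cmod z"
    proof -
      have "0 \<le> nu p" by (simp add: nu_def)
      then show ?thesis using norm_triangle_ineq2[of "complex_of_real (nu p)" z] by simp
    qed
    ultimately have "norm p \<le> 1 + ?w + cmod z" by linarith
    then have "norm p / ?w \<le> (1 + ?w + cmod z) / ?w" using w by (intro divide_right_mono) auto
    also have "\<dots> = 1 / ?w + 1 + cmod z / ?w" using w by (simp add: add_divide_distrib)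
    also have "\<dots> \<le> A"
    proof -
      have "1 / ?w \<le> 1 / ?\<delta>" "cmod z / ?w \<le> cmod z / ?\<delta>" using w \<delta> by (auto intro!: frac_le)
      then show ?thesis unfolding A_def by linarith
    qed
    finally show ?thesis .
  qed
  have A0: "0 \<le> A" unfolding A_def using \<delta> by simp
  show ?thesis
  proof (intro exI[of _ "?d * A + ?d^2 / ?\<delta>"] allI impI ballI)
    fix L :: real and j :: "'d \<Rightarrow> int" and p :: "real^'d" assume L: "1 \<le> L" and j: "j \<in> shifts"
    let ?w = "cmod (complex_of_real (nu p) - z)" and ?q = "shiftq L j"
    have w: "?\<delta> \<le> ?w" "0 < ?w" using infdist_rpos_le[of z p] \<delta> by auto
    have q: "norm ?q \<le> ?d / L" using norm_shiftq_le[OF _ j] L by simp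
    have "nu (p + ?q) - nu p = p \<bullet> ?q + (norm ?q)^2 / 2"
      by (simp add: nu_def power2_norm_eq_inner inner_add_left inner_add_right inner_commute field_simps)
    then have "\<bar>nu (p + ?q) - nu p\<bar> \<le> norm p * norm ?q + (norm ?q)^2"
      using Cauchy_Schwarz_ineq2[of p ?q] by (auto simp: abs_le_iff) (use zero_le_power2[of "norm ?q"] in linarith)+
    also have "\<dots> \<le> norm p * (?d / L) + (?d / L)^2"
      using q by (intro add_mono mult_left_mono power_mono) auto
    finally have "\<bar>nu (p + ?q) - nu p\<bar> / ?w \<le> (norm p * (?d / L) + (?d / L)^2) / ?w"
      using w by (intro divide_right_mono) auto
    also have "\<dots> = norm p / ?w * (?d / L) + (?d / L)^2 / ?w" by (simp add: add_divide_distrib)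
    also have "\<dots> \<le> A * (?d / L) + (?d / L)^2 / ?\<delta>"
      using A[of p] w \<delta> L by (intro add_mono mult_right_mono frac_le) auto
    \<comment> \<open>L >= 1 absorbs the term of order 1/L^2 into 1/L.\<close>
    also have "\<dots> \<le> A * (?d / L) + (?d^2 / L) / ?\<delta>"
    proof -
      have "L \<le> L * L" using L by simp
      then have "(?d / L)^2 \<le> ?d^2 / L"
        using L by (simp add: power_divide power2_eq_square[of L] divide_left_mono)
      then show ?thesis using \<delta> by (intro add_left_mono divide_right_mono) auto
    qed
    also have "\<dots> = (?d * A + ?d^2 / ?\<delta>) / L" by (simp add: add_divide_distrib mult.commute)
    finally show "cmod (complex_of_real (nu (p + ?q) - nu p) / (complex_of_real (nu p) - z)) \<le> (?d * A + ?d^2 / ?\<delta>) / L"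
      by (simp only: norm_divide norm_of_real)
  qed
qed

lemma nsq_sum_sum_finite:
  assumes "finite A" "finite C" "\<And>i j. i \<in> A \<Longrightarrow> j \<in> C \<Longrightarrow> f i j \<in> borel_measurable M"
    "\<And>i j. i \<in> A \<Longrightarrow> j \<in> C \<Longrightarrow> nsq M (f i j) < \<top>"
  shows "nsq M (\<lambda>x. \<Sum>i\<in>A. \<Sum>j\<in>C. f i j x) < \<top>"
  using assms by (intro nsq_finite_sum) (auto intro!: nsq_finite_sum)

lemma nsq_cmult_ef_finite: "0 < L \<Longrightarrow> nsq lborel (\<lambda>x. c * ef L p x) < \<top>"
  using nsq_ef_finite[of L p] by (simp add: nsq_cmult ennreal_mult_less_top)

lemma ip_ef_double_sum:
  assumes L: "0 < L" "0 < L'" and fin: "finite A" "finite C"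
  shows "ip lborel (ef L' p') (\<lambda>x. \<Sum>i\<in>A. \<Sum>j\<in>C. c i j * ef L (s i j) x) = (\<Sum>i\<in>A. \<Sum>j\<in>C. c i j * ip lborel (ef L' p') (ef L (s i j)))"
proof -
  have "ip lborel (ef L' p') (\<lambda>x. \<Sum>i\<in>A. \<Sum>j\<in>C. c i j * ef L (s i j) x) = (\<Sum>i\<in>A. ip lborel (ef L' p') (\<lambda>x. \<Sum>j\<in>C. c i j * ef L (s i j) x))"
    using fin L by (intro ip_sum_right nsq_ef_finite nsq_finite_sum nsq_cmult_ef_finite) auto
  also have "\<dots> = (\<Sum>i\<in>A. \<Sum>j\<in>C. ip lborel (ef L' p') (\<lambda>x. c i j * ef L (s i j) x))"
    using fin L by (intro sum.cong refl ip_sum_right nsq_ef_finite nsq_cmult_ef_finite) auto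
  finally show ?thesis by (simp add: ip_cmult_right)
qed

text \<open>The function \<open>h\<close> is the truncated resolvent of f on one box, times the
  cutoff of that box. By \<open>cutoff_fourier_zero\<close>, on every larger box it solves (K - z) h
  = w in Fourier coefficients, with one and the same \<open>w\<close>. As \<open>w\<close> is the
  cutoff times the projection of f plus a commutator of order 1/L, it approximates f on a large box
  with many frequencies.\<close>

lemma cutoff_approx:
  fixes f :: "real^'d \<Rightarrow> complex" and \<epsilon> :: ennreal
  assumes z: "z \<notin> rpos" and f[measurable]: "f \<in> borel_measurable borel" and fin: "nsq lborel f < \<top>" and \<epsilon>: "0 < \<epsilon>"
  shows "\<exists>L0 h w. 0 < L0 \<and> h \<in> borel_measurable borel \<and> w \<in> borel_measurable borel \<and> nsq lborel h < \<top> \<and> nsq lborel w < \<top> \<and>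
    nsq lborel (\<lambda>x. f x - w x) < \<epsilon> \<and> (\<forall>x. x \<notin> Lam L0 \<longrightarrow> h x = 0) \<and>
    (\<forall>L'\<ge>L0. \<forall>p. (complex_of_real (nu p) - z) * ip lborel (ef L' p) h = ip lborel (ef L' p) w)"
proof -
  obtain C where C: "\<And>L j p. 1 \<le> L \<Longrightarrow> j \<in> shifts \<Longrightarrow>
     cmod (complex_of_real (nu (p + shiftq L j) - nu p) / (complex_of_real (nu (p::real^'d)) - z)) \<le> C / L"
    using commutator_bound[OF z, where ?'d = 'd] by metis
  define q where "q L = (shiftq L :: ('d \<Rightarrow> int) \<Rightarrow> real^'d)" for L
  define S where "S = (shifts :: ('d \<Rightarrow> int) set)"
  have S[simp]: "finite S" by (simp add: S_def)
  define g where "g L p = 1 / (complex_of_real (nu p) - z) * ip lborel (ef L p) f" for L p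
  define h where "h L N x = (\<Sum>j\<in>S. \<Sum>p\<in>lat L N. (complex_of_real (chiw j) * g L p) * ef L (p + q L j) x)" for L N x
  define w where "w L N x = (\<Sum>j\<in>S. \<Sum>p\<in>lat L N. (complex_of_real (chiw j) * g L p * (complex_of_real (nu (p + q L j)) - z)) * ef L (p + q L j) x)" for L N x
  define m where "m L j p = complex_of_real (nu (p + q L j) - nu p) / (complex_of_real (nu p) - z)" for L j p
  define r where "r L N j = mulop lborel (ef L) (lat L N) (m L j) f" for L N j
  define E where "E L N x = (\<Sum>j\<in>S. (complex_of_real (chiw j) * cis (2 * pi * (q L j \<bullet> x))) * r L N j x)" for L N x
  have meas: "h L N \<in> borel_measurable borel" "w L N \<in> borel_measurable borel" for L N
    unfolding h_def[abs_def] w_def[abs_def] by measurable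
  have finh: "nsq lborel (h L N) < \<top>" "nsq lborel (w L N) < \<top>" if "0 < L" for L N
    unfolding h_def[abs_def] w_def[abs_def] using that
    by (intro nsq_sum_sum_finite finite_lat nsq_cmult_ef_finite; simp)+
  have hz: "h L N x = 0" if "x \<notin> Lam L" for L N x
    unfolding h_def using that by (intro sum.neutral ballI) (simp add: ef_def)
  \<comment> \<open>Wave by wave, the shifted frequency in \<open>w\<close> may be replaced by the
    frequency p' of the larger box: the difference is the sum that vanishes by
    \<open>cutoff_fourier_zero\<close>.\<close>
  have key: "(complex_of_real (nu p') - z) * ip lborel (ef L' p') (h L N) = ip lborel (ef L' p') (w L N)"
    if L: "0 < L" "L \<le> L'" for L L' N p'
  proof -
    let ?I = "\<lambda>p j. ip lborel (ef L' p') (ef L (p + q L j))"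
    have L': "0 < L'" using L by simp
    have "(complex_of_real (nu p') - z) * ip lborel (ef L' p') (h L N) - ip lborel (ef L' p') (w L N)
      = (\<Sum>j\<in>S. \<Sum>p\<in>lat L N. - g L p * (complex_of_real (chiw j) * (complex_of_real (nu (p + q L j) - nu p') * ?I p j)))"
      unfolding h_def[abs_def] w_def[abs_def] ip_ef_double_sum[OF L(1) L' S finite_lat[OF L(1)]]
        sum_distrib_left sum_subtractf[symmetric]
      by (intro sum.cong refl) (simp add: algebra_simps)
    also have "\<dots> = (\<Sum>p\<in>lat L N. - g L p * (\<Sum>j\<in>S. complex_of_real (chiw j) * (complex_of_real (nu (p + q L j) - nu p') * ?I p j)))"
      by (subst sum.swap) (simp add: sum_distrib_left)
    also have "\<dots> = 0" unfolding q_def S_def cutoff_fourier_zero[OF L] by simp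
    finally show ?thesis by simp
  qed
  \<comment> \<open>Split (nu (p + q) - z) / (nu p - z) = 1 + m. The 1 reproduces the projection
    times the cutoff; the symbol m gives the commutator term \<open>E\<close>.\<close>
  have wdec: "w L N x = chi L x * proj L N f x + E L N x" for L N x
  proof -
    have "(complex_of_real (chiw j) * g L p * (complex_of_real (nu (p + q L j)) - z)) * ef L (p + q L j) x
      = (complex_of_real (chiw j) * cis (2 * pi * (q L j \<bullet> x))) * (1 * ip lborel (ef L p) f * ef L p x)
        + (complex_of_real (chiw j) * cis (2 * pi * (q L j \<bullet> x))) * (m L j p * ip lborel (ef L p) f * ef L p x)" for j p
    proof -
      have nz: "complex_of_real (nu p) - z \<noteq> 0" by (rule nu_minus_nonzero[OF z])
      then have "g L p * (complex_of_real (nu (p + q L j)) - z) = ip lborel (ef L p) f + m L j p * ip lborel (ef L p) f"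
        by (simp add: g_def m_def field_simps)
      then show ?thesis unfolding ef_shift by (simp add: algebra_simps)
    qed
    then have "w L N x = (\<Sum>j\<in>S. (complex_of_real (chiw j) * cis (2 * pi * (q L j \<bullet> x))) * proj L N f x
       + (complex_of_real (chiw j) * cis (2 * pi * (q L j \<bullet> x))) * r L N j x)"
      unfolding w_def proj_def r_def mulop_def by (simp only: sum.distrib sum_distrib_left)
    also have "\<dots> = chi L x * proj L N f x + E L N x"
      unfolding E_def chi_def sum.distrib S_def q_def sum_distrib_right ..
    finally show ?thesis .
  qed
  have rm: "r L N j \<in> borel_measurable borel" if "0 < L" for L N j
    using mulop_measurable[OF orthonormal_ef[OF that] lat_subset, of N "m L j" f] by (simp add: r_def)
  have Em: "E L N \<in> borel_measurable borel" if "0 < L" for L N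
    unfolding E_def[abs_def] using rm[OF that] by measurable
  have pm: "proj L N f \<in> borel_measurable borel" if "0 < L" for L N
    using mulop_measurable[OF orthonormal_ef[OF that] lat_subset, of N "\<lambda>_. 1" f] by (simp add: proj_def)
  have Ebd: "nsq lborel (E L N) \<le> of_nat (card S) * (of_nat (card S) * (ennreal ((C / L)^2) * nsq lborel f))" if L: "1 \<le> L" for L N
  proof -
    have L0: "0 < L" using L by simp
    have "nsq lborel (E L N) \<le> of_nat (card S) * (\<Sum>j\<in>S. nsq lborel (\<lambda>x. (complex_of_real (chiw j) * cis (2 * pi * (q L j \<bullet> x))) * r L N j x))"
      unfolding E_def[abs_def] using rm[OF L0] by (intro nsq_sum_le) measurable
    also have "\<dots> \<le> of_nat (card S) * (\<Sum>j\<in>S. ennreal ((C / L)^2) * nsq lborel f)"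
    proof (intro mult_left_mono sum_mono)
      fix j assume j: "j \<in> S"
      have "nsq lborel (\<lambda>x. (complex_of_real (chiw j) * cis (2 * pi * (q L j \<bullet> x))) * r L N j x) \<le> ennreal (1^2) * nsq lborel (r L N j)"
        using rm[OF L0] j chiw_le_1[of j] chiw_nonneg[of j] by (intro nsq_mult_le) (auto simp: norm_mult S_def)
      also have "\<dots> \<le> ennreal ((C / L)^2) * nsq lborel f"
        unfolding r_def using C[OF L, of j] j
        by (simp, intro nsq_mulop_le[OF orthonormal_ef[OF L0] finite_lat[OF L0] lat_subset]) (auto simp: m_def q_def S_def)
      finally show "nsq lborel (\<lambda>x. (complex_of_real (chiw j) * cis (2 * pi * (q L j \<bullet> x))) * r L N j x) \<le> ennreal ((C / L)^2) * nsq lborel f" .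
    qed simp
    finally show ?thesis by simp
  qed
  have bd: "nsq lborel (\<lambda>x. f x - w L N x) \<le> (2 * nsq lborel (\<lambda>x. f x - chi L x * lamcut L f x) +
      4 * (of_nat (card S) * (of_nat (card S) * (ennreal ((C / L)^2) * nsq lborel f))))
      + 4 * nsq lborel (\<lambda>x. proj L N f x - lamcut L f x)" if L: "1 \<le> L" for L N
  proof -
    have L0: "0 < L" using L by simp
    note [measurable] = meas pm[OF L0] Em[OF L0]
    let ?u = "\<lambda>x. chi L x * lamcut L f x"
    have "nsq lborel (\<lambda>x. f x - w L N x) \<le> 2 * nsq lborel (\<lambda>x. f x - ?u x) + 2 * nsq lborel (\<lambda>x. ?u x - w L N x)"
      by (rule nsq_triangle) measurable
    also have "nsq lborel (\<lambda>x. ?u x - w L N x) = nsq lborel (\<lambda>x. chi L x * (lamcut L f x - proj L N f x) - E L N x)"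
      unfolding wdec by (simp add: algebra_simps)
    also have "\<dots> \<le> 2 * nsq lborel (\<lambda>x. chi L x * (lamcut L f x - proj L N f x)) + 2 * nsq lborel (E L N)"
      by (rule nsq_diff_le) measurable
    also have "\<dots> \<le> 2 * nsq lborel (\<lambda>x. proj L N f x - lamcut L f x) + 2 * (of_nat (card S) * (of_nat (card S) * (ennreal ((C / L)^2) * nsq lborel f)))"
    proof (intro add_mono mult_left_mono Ebd L)
      have "nsq lborel (\<lambda>x. chi L x * (lamcut L f x - proj L N f x)) \<le> ennreal (1^2) * nsq lborel (\<lambda>x. lamcut L f x - proj L N f x)"
        by (intro nsq_mult_le norm_chi_le) measurable
      then show "nsq lborel (\<lambda>x. chi L x * (lamcut L f x - proj L N f x)) \<le> nsq lborel (\<lambda>x. proj L N f x - lamcut L f x)"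
        by (simp add: nsq_minus_commute[of _ "lamcut L f"])
    qed auto
    finally have "nsq lborel (\<lambda>x. f x - w L N x) \<le> 2 * nsq lborel (\<lambda>x. f x - ?u x) + 2 * (2 * nsq lborel (\<lambda>x. proj L N f x - lamcut L f x) + 2 * (of_nat (card S) * (of_nat (card S) * (ennreal ((C / L)^2) * nsq lborel f))))"
      by (simp add: mult_left_mono add_left_mono)
    also have "\<dots> = (2 * nsq lborel (\<lambda>x. f x - ?u x) +
      4 * (of_nat (card S) * (of_nat (card S) * (ennreal ((C / L)^2) * nsq lborel f))))
      + 4 * nsq lborel (\<lambda>x. proj L N f x - lamcut L f x)"
      by (simp add: distrib_left mult.assoc[symmetric] add_ac)
    finally show ?thesis .
  qed
  have lim1: "(\<lambda>n. nsq lborel (\<lambda>x. f x - chi (real n) x * lamcut (real n) f x)) \<longlonglongrightarrow> 0"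
  proof (rule nsq_tendsto_0_dominated[where w = f and c = 2])
    show "AE x in lborel. cmod (f x - chi (real n) x * lamcut (real n) f x) \<le> 2 * cmod (f x)" for n
    proof (rule AE_I2)
      fix x
      have "cmod (chi (real n) x * lamcut (real n) f x) \<le> 1 * cmod (f x)"
        unfolding norm_mult by (intro mult_mono norm_chi_le) (auto simp: lamcut_def split: split_indicator)
      then show "cmod (f x - chi (real n) x * lamcut (real n) f x) \<le> 2 * cmod (f x)"
        using norm_triangle_ineq4[of "f x" "chi (real n) x * lamcut (real n) f x"] by simp
    qed
    show "AE x in lborel. (\<lambda>n. f x - chi (real n) x * lamcut (real n) f x) \<longlonglongrightarrow> 0"
    proof (rule AE_I2)
      fix x :: "real^'d"
      obtain K :: nat where K: "2 * norm x + 1 \<le> real K" using real_arch_simple by blast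
      have "x \<in> Lam (real n)" if "K \<le> n" for n
      proof -
        have "\<bar>x $ i\<bar> \<le> norm x" for i by (rule component_le_norm_cart)
        moreover have "2 * norm x + 1 \<le> real n" using K that by linarith
        ultimately have "- real n / 2 \<le> x $ i \<and> x $ i < real n / 2" for i
          by (smt (verit) \<open>\<And>i. \<bar>x $ i\<bar> \<le> norm x\<close> field_sum_of_halves)
        then show ?thesis by (simp add: Lam_def)
      qed
      then have "eventually (\<lambda>n. f x - chi (real n) x * f x = f x - chi (real n) x * lamcut (real n) f x) sequentially"
        unfolding eventually_sequentially by (intro exI[of _ K]) (auto simp: lamcut_def)
      moreover have "(\<lambda>n. f x - chi (real n) x * f x) \<longlonglongrightarrow> f x - 1 * f x"
        by (intro tendsto_intros chi_tendsto)
      ultimately show "(\<lambda>n. f x - chi (real n) x * lamcut (real n) f x) \<longlonglongrightarrow> 0"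
        using Lim_transform_eventually by fastforce
    qed
  qed (use fin in auto)
  have "(\<lambda>n. 2 * nsq lborel (\<lambda>x. f x - chi (real n) x * lamcut (real n) f x) + 4 * (of_nat (card S) * (of_nat (card S) * (ennreal ((C / real n)^2) * nsq lborel f))))
    \<longlonglongrightarrow> 2 * 0 + 4 * (of_nat (card S) * (of_nat (card S) * 0))"
    using fin by (intro tendsto_add ennreal_tendsto_cmult lim1 nsq_divide_tendsto_0) (auto simp: of_nat_less_top)
  moreover obtain \<epsilon>1 where \<epsilon>1: "0 < \<epsilon>1" "\<epsilon>1 < \<epsilon>" using dense[OF \<epsilon>] by blast
  ultimately have "eventually (\<lambda>n. 2 * nsq lborel (\<lambda>x. f x - chi (real n) x * lamcut (real n) f x) + 4 * (of_nat (card S) * (of_nat (card S) * (ennreal ((C / real n)^2) * nsq lborel f))) < \<epsilon>1) sequentially"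
    by (intro order_tendstoD) auto
  then have "eventually (\<lambda>n. 1 \<le> n \<and> 2 * nsq lborel (\<lambda>x. f x - chi (real n) x * lamcut (real n) f x) + 4 * (of_nat (card S) * (of_nat (card S) * (ennreal ((C / real n)^2) * nsq lborel f))) < \<epsilon>1) sequentially"
    by (intro eventually_conj eventually_ge_at_top)
  \<comment> \<open>The box is fixed first, which makes the part independent of N small; N is then
    chosen large on that box.\<close>
  then obtain n :: nat where n: "1 \<le> n" and na: "2 * nsq lborel (\<lambda>x. f x - chi (real n) x * lamcut (real n) f x) + 4 * (of_nat (card S) * (of_nat (card S) * (ennreal ((C / real n)^2) * nsq lborel f))) < \<epsilon>1" (is "?a < _")
    by (auto simp: eventually_sequentially)
  have n1: "1 \<le> real n" using n by simp
  then have n0: "0 < real n" by linarith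
  have "(\<lambda>N. ?a + 4 * nsq lborel (\<lambda>x. proj (real n) N f x - lamcut (real n) f x)) \<longlonglongrightarrow> ?a + 4 * 0"
    using fin by (intro tendsto_add tendsto_const ennreal_tendsto_cmult proj_tendsto n0) auto
  then have "eventually (\<lambda>N. ?a + 4 * nsq lborel (\<lambda>x. proj (real n) N f x - lamcut (real n) f x) < \<epsilon>1) sequentially"
    using na by (intro order_tendstoD) auto
  then obtain N where "?a + 4 * nsq lborel (\<lambda>x. proj (real n) N f x - lamcut (real n) f x) < \<epsilon>1"
    by (auto simp: eventually_sequentially)
  with bd[OF n1, of N] \<epsilon>1(2) have "nsq lborel (\<lambda>x. f x - w (real n) N x) < \<epsilon>" by (meson le_less_trans less_trans)
  then show ?thesis
    using n0 meas finh[OF n0] hz key[OF n0]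
    by (intro exI[of _ "real n"] exI[of _ "h (real n) N"] exI[of _ "w (real n) N"]) auto
qed

text \<open>The coefficients of h are those of w divided by nu p - z, so the part of h above
  frequency N is controlled by \<eta>, whatever the size of the box. This uniformity lets L and N
  tend to infinity together.\<close>

lemma proj_tail:
  fixes h w :: "real^'d \<Rightarrow> complex"
  assumes L: "0 < L" and h[measurable]: "h \<in> borel_measurable borel" and w[measurable]: "w \<in> borel_measurable borel"
    and fin: "nsq lborel h < \<top>" and z: "z \<notin> rpos"
    and eq: "\<And>p. (complex_of_real (nu p) - z) * ip lborel (ef L p) h = ip lborel (ef L p) w"
    and \<eta>: "\<And>p::real^'d. real N < norm p \<Longrightarrow> cmod (1 / (complex_of_real (nu p) - z)) \<le> \<eta>"
  shows "nsq lborel (\<lambda>x. proj L N h x - lamcut L h x) \<le> 2 * (ennreal (\<eta>^2) * nsq lborel w)"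
proof -
  have pm[measurable]: "proj L M h \<in> borel_measurable borel" for M
    using mulop_measurable[OF orthonormal_ef[OF L] lat_subset, of M "\<lambda>_. 1" h] by (simp add: proj_def)
  have diff: "nsq lborel (\<lambda>x. proj L M h x - proj L N h x) \<le> ennreal (\<eta>^2) * nsq lborel w" if "N \<le> M" for M
  proof -
    have "proj L M h x - proj L N h x = mulop lborel (ef L) (lat L M - lat L N) (\<lambda>p. 1 / (complex_of_real (nu p) - z)) w x" for x
    proof -
      have "1 / (complex_of_real (nu p) - z) * ip lborel (ef L p) w = 1 * ip lborel (ef L p) h" for p
        using eq[of p] nu_minus_nonzero[OF z, of p] by (simp add: field_simps)
      moreover have "(lat L N :: (real^'d) set) \<subseteq> lat L M" by (rule lat_mono[OF that])
      moreover have "finite (lat L M :: (real^'d) set)" by (rule finite_lat[OF L])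
      ultimately show ?thesis unfolding proj_def mulop_def by (simp add: sum_diff)
    qed
    then have "nsq lborel (\<lambda>x. proj L M h x - proj L N h x) = nsq lborel (mulop lborel (ef L) (lat L M - lat L N) (\<lambda>p. 1 / (complex_of_real (nu p) - z)) w)"
      by (intro nsq_cong) simp
    also have "\<dots> \<le> ennreal (\<eta>^2) * nsq lborel w"
      using finite_lat[OF L] lat_subset
      by (intro nsq_mulop_le[OF orthonormal_ef[OF L]] \<eta>) (auto simp: lat_def)
    finally show ?thesis .
  qed
  have "nsq lborel (\<lambda>x. proj L N h x - lamcut L h x) \<le> 2 * (ennreal (\<eta>^2) * nsq lborel w) + 2 * nsq lborel (\<lambda>x. proj L M h x - lamcut L h x)" if "N \<le> M" for M
  proof -
    have "nsq lborel (\<lambda>x. proj L N h x - lamcut L h x) \<le> 2 * nsq lborel (\<lambda>x. proj L N h x - proj L M h x) + 2 * nsq lborel (\<lambda>x. proj L M h x - lamcut L h x)"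
      by (rule nsq_triangle) measurable
    also have "\<dots> \<le> 2 * (ennreal (\<eta>^2) * nsq lborel w) + 2 * nsq lborel (\<lambda>x. proj L M h x - lamcut L h x)"
      using diff[OF that] by (intro add_right_mono mult_left_mono) (auto simp: nsq_minus_commute[of _ "proj L N h"])
    finally show ?thesis .
  qed
  moreover have "(\<lambda>M. 2 * (ennreal (\<eta>^2) * nsq lborel w) + 2 * nsq lborel (\<lambda>x. proj L M h x - lamcut L h x)) \<longlonglongrightarrow> 2 * (ennreal (\<eta>^2) * nsq lborel w) + 2 * 0"
    by (intro tendsto_add tendsto_const ennreal_tendsto_cmult proj_tendsto L h fin) simp
  ultimately show ?thesis by (intro LIMSEQ_le_const) auto
qed

lemma nu_minus_large:
  assumes "0 < \<eta>"
  shows "\<exists>N0. \<forall>N\<ge>N0. \<forall>p::real^'d. real N < norm p \<longrightarrow> cmod (1 / (complex_of_real (nu p) - z)) \<le> \<eta>"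
proof -
  obtain N0 :: nat where N0: "2 * (cmod z + 1 / \<eta>) + 1 \<le> real N0" using real_arch_simple by blast
  show ?thesis
  proof (intro exI[of _ N0] allI impI)
    fix N and p :: "real^'d" assume N: "N0 \<le> N" and p: "real N < norm p"
    have n: "2 * (cmod z + 1 / \<eta>) + 1 \<le> norm p" using N0 N p by linarith
    have e: "0 < 1 / \<eta>" using assms by simp
    have "1 \<le> norm p" by (rule order_trans[OF _ n]) (use e in simp)
    then have "norm p * 1 \<le> norm p * norm p" by (intro mult_left_mono) auto
    then have "cmod z + 1 / \<eta> \<le> nu p" using n by (simp add: nu_def power2_eq_square)
    moreover have "nu p - cmod z \<le> cmod (complex_of_real (nu p) - z)"
    proof -
      have "0 \<le> nu p" by (simp add: nu_def)
      then show ?thesis using norm_triangle_ineq2[of "complex_of_real (nu p)" z] by simp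
    qed
    ultimately have "1 / \<eta> \<le> cmod (complex_of_real (nu p) - z)" by linarith
    then have "1 / cmod (complex_of_real (nu p) - z) \<le> 1 / (1 / \<eta>)" using e by (intro divide_left_mono mult_pos_pos) auto
    then show "cmod (1 / (complex_of_real (nu p) - z)) \<le> \<eta>" by (simp add: norm_divide)
  qed
qed

lemma ennreal_double_sum_le:
  assumes "a \<le> ennreal s" "b \<le> ennreal t" "0 \<le> s" "0 \<le> t" "2 * s + 2 * t \<le> r"
  shows "2 * a + 2 * b \<le> ennreal r"
proof -
  have "2 * a + 2 * b \<le> ennreal 2 * ennreal s + ennreal 2 * ennreal t"
    using assms by (intro add_mono mult_mono) auto
  also have "\<dots> = ennreal (2 * s + 2 * t)" using assms by (simp add: ennreal_mult ennreal_plus)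
  also have "\<dots> \<le> ennreal r" using assms by (intro ennreal_leI)
  finally show ?thesis .
qed

text \<open>Replace f by the nearby \<open>w\<close> of \<open>cutoff_approx\<close>. Its truncated
  resolvents are projections of the single function \<open>h\<close>, and by
  \<open>proj_tail\<close> they are close to \<open>h\<close> for all large boxes and cutoffs. Hence
  all truncated resolvents of f are close to \<open>h\<close>, and so to each other.\<close>

lemma RT_Cauchy:
  fixes f :: "real^'d \<Rightarrow> complex" and a :: "nat \<Rightarrow> real" and Nn :: "nat \<Rightarrow> nat"
  assumes a: "filterlim a at_top sequentially" "\<And>k. 0 < a k" and N: "filterlim Nn at_top sequentially"
    and z: "z \<notin> rpos" and f[measurable]: "f \<in> borel_measurable borel" and fin: "nsq lborel f < \<top>" and \<epsilon>: "0 < (\<epsilon>::ennreal)"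
  shows "\<exists>K. \<forall>j\<ge>K. \<forall>k\<ge>K. nsq lborel (\<lambda>x. RT (a j) (Nn j) z f x - RT (a k) (Nn k) z f x) \<le> \<epsilon>"
proof -
  let ?\<delta> = "infdist z rpos"
  define c where "c = (1 / ?\<delta>)^2"
  have c0: "0 \<le> c" by (simp add: c_def)
  obtain e :: real where e: "0 < e" "ennreal e \<le> \<epsilon>"
  proof (cases \<epsilon>)
    case (real r)
    with \<epsilon> show ?thesis by (intro that[of r]) auto
  next
    case top
    then show ?thesis by (intro that[of 1]) auto
  qed
  \<comment> \<open>Chosen so that each of the two errors in \<open>close\<close> is at most e/32.
    The factor 2 of \<open>nsq_triangle\<close> then leaves e/8 in \<open>close\<close> and e/2 at
    the end.\<close>
  have e2: "0 < ennreal (e / (32 * (c + 1)))" using e c0 by simp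
  obtain L0 h w where L0: "0 < L0" and [measurable]: "h \<in> borel_measurable borel" "w \<in> borel_measurable borel"
    and fh: "nsq lborel h < \<top>" and fw: "nsq lborel w < \<top>" and fw2: "nsq lborel (\<lambda>x. f x - w x) < ennreal (e / (32 * (c + 1)))"
    and hz: "\<And>x. x \<notin> Lam L0 \<Longrightarrow> h x = 0"
    and eq: "\<And>L' p. L0 \<le> L' \<Longrightarrow> (complex_of_real (nu p) - z) * ip lborel (ef L' p) h = ip lborel (ef L' p) w"
    using cutoff_approx[OF z f fin e2] by blast
  have "(\<lambda>n. ennreal ((1 / real n)^2) * nsq lborel w) \<longlonglongrightarrow> 0" by (rule nsq_divide_tendsto_0[OF fw])
  moreover have "0 < ennreal (e / 64)" using e by simp
  ultimately have "eventually (\<lambda>n. ennreal ((1 / real n)^2) * nsq lborel w < ennreal (e / 64)) sequentially" by (rule order_tendstoD)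
  then have "eventually (\<lambda>n. 1 \<le> n \<and> ennreal ((1 / real n)^2) * nsq lborel w < ennreal (e / 64)) sequentially"
    by (intro eventually_conj eventually_ge_at_top)
  then obtain n :: nat where n: "1 \<le> n" "ennreal ((1 / real n)^2) * nsq lborel w < ennreal (e / 64)"
    by (auto simp: eventually_sequentially)
  define \<eta> where "\<eta> = 1 / real n"
  have \<eta>: "0 < \<eta>" "ennreal (\<eta>^2) * nsq lborel w < ennreal (e / 64)" using n by (auto simp: \<eta>_def)
  obtain N0 where N0: "\<And>N p. N0 \<le> N \<Longrightarrow> real N < norm (p::real^'d) \<Longrightarrow> cmod (1 / (complex_of_real (nu p) - z)) \<le> \<eta>"
    using nu_minus_large[OF \<eta>(1), of z, where ?'d = 'd] by blast
  have close: "nsq lborel (\<lambda>x. RT L' N' z f x - h x) \<le> ennreal (e / 8)" if L': "L0 \<le> L'" and N': "N0 \<le> N'" for L' N'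
  proof -
    have L'0: "0 < L'" using L0 L' by simp
    note [measurable] = RT_measurable[OF L'0]
    have cut: "lamcut L' h = h"
    proof
      fix x
      show "lamcut L' h x = h x"
        using hz[of x] Lam_mono[OF L'] by (cases "x \<in> Lam L'") (auto simp: lamcut_def)
    qed
    have RTw: "RT L' N' z w = proj L' N' h"
    proof -
      have "1 / (complex_of_real (nu p) - z) * ip lborel (ef L' p) w = 1 * ip lborel (ef L' p) h" for p
        using eq[OF L', of p] nu_minus_nonzero[OF z, of p] by (simp add: field_simps)
      then show ?thesis unfolding RT_def proj_def mulop_def[abs_def] by presburger
    qed
    have "nsq lborel (\<lambda>x. RT L' N' z f x - RT L' N' z w x) = nsq lborel (RT L' N' z (\<lambda>x. f x - w x))"
      by (intro nsq_cong) (use RT_diff[OF L'0 f fin _ fw, of N' z] in simp)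
    also have "\<dots> \<le> ennreal c * nsq lborel (\<lambda>x. f x - w x)" unfolding c_def by (intro nsq_RT_le L'0 z) measurable
    also have "\<dots> \<le> ennreal c * ennreal (e / (32 * (c + 1)))" using fw2 by (intro mult_left_mono) auto
    also have "\<dots> \<le> ennreal (e / 32)"
    proof -
      have "c * (e / (32 * (c + 1))) \<le> e / 32" using c0 e by (simp add: field_simps)
      then show ?thesis using c0 e by (simp add: ennreal_mult[symmetric] ennreal_leI)
    qed
    finally have 1: "nsq lborel (\<lambda>x. RT L' N' z f x - RT L' N' z w x) \<le> ennreal (e / 32)" .
    have "nsq lborel (\<lambda>x. RT L' N' z w x - h x) \<le> 2 * (ennreal (\<eta>^2) * nsq lborel w) + 2 * 0"
      using proj_tail[OF L'0 _ _ fh z eq[OF L'] N0[OF N']] by (simp add: RTw cut)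
    also have "\<dots> \<le> ennreal (e / 32)" using \<eta>(2) e by (intro ennreal_double_sum_le[where s = "e/64" and t = 0]) auto
    finally have 2: "nsq lborel (\<lambda>x. RT L' N' z w x - h x) \<le> ennreal (e / 32)" .
    have "nsq lborel (\<lambda>x. RT L' N' z f x - h x) \<le> 2 * nsq lborel (\<lambda>x. RT L' N' z f x - RT L' N' z w x) + 2 * nsq lborel (\<lambda>x. RT L' N' z w x - h x)"
      by (rule nsq_triangle) measurable
    also have "\<dots> \<le> ennreal (e / 8)" using e by (intro ennreal_double_sum_le[OF 1 2]) auto
    finally show ?thesis .
  qed
  have "eventually (\<lambda>k. L0 \<le> a k \<and> N0 \<le> Nn k) sequentially"
    using a(1) N by (intro eventually_conj) (auto simp: filterlim_at_top)
  then obtain K where K: "\<And>k. K \<le> k \<Longrightarrow> L0 \<le> a k \<and> N0 \<le> Nn k" by (auto simp: eventually_sequentially)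
  show ?thesis
  proof (intro exI[of _ K] allI impI)
    fix j k assume jk: "K \<le> j" "K \<le> k"
    have "nsq lborel (\<lambda>x. RT (a j) (Nn j) z f x - RT (a k) (Nn k) z f x) \<le> 2 * nsq lborel (\<lambda>x. RT (a j) (Nn j) z f x - h x) + 2 * nsq lborel (\<lambda>x. h x - RT (a k) (Nn k) z f x)"
      using RT_measurable[OF a(2)] by (intro nsq_triangle) auto
    also have "\<dots> \<le> ennreal e"
      using close[of "a j" "Nn j"] close[of "a k" "Nn k"] K[OF jk(1)] K[OF jk(2)] e
      by (intro ennreal_double_sum_le[where s = "e/8" and t = "e/8"]) (auto simp: nsq_minus_commute[of _ h])
    also have "\<dots> \<le> \<epsilon>" by (rule e(2))
    finally show "nsq lborel (\<lambda>x. RT (a j) (Nn j) z f x - RT (a k) (Nn k) z f x) \<le> \<epsilon>" .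
  qed
qed

section \<open>Truncated resolvents acting on x, with further variables as parameters\<close>

definition RTy :: "real \<Rightarrow> nat \<Rightarrow> complex \<Rightarrow> ((real^'d) \<times> 'y \<Rightarrow> complex) \<Rightarrow> (real^'d) \<times> 'y \<Rightarrow> complex" where
  "RTy L N z u xy = RT L N z (\<lambda>x. u (x, snd xy)) (fst xy)"

context
  fixes Y :: "'y measure"
  assumes Y: "sigma_finite_measure Y"
begin

interpretation Y: sigma_finite_measure Y by (rule Y)
interpretation P: pair_sigma_finite "lborel :: (real^'d) measure" Y ..

lemma nsq_pair:
  fixes u :: "(real^'d) \<times> 'y \<Rightarrow> complex"
  assumes [measurable]: "u \<in> borel_measurable (lborel \<Otimes>\<^sub>M Y)"
  shows "nsq (lborel \<Otimes>\<^sub>M Y) u = (\<integral>\<^sup>+y. nsq lborel (\<lambda>x. u (x, y)) \<partial>Y)"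
  unfolding nsq_def by (rule P.nn_integral_snd[symmetric]) measurable

lemma nsq_section_measurable:
  fixes u :: "(real^'d) \<times> 'y \<Rightarrow> complex"
  assumes [measurable]: "u \<in> borel_measurable (lborel \<Otimes>\<^sub>M Y)"
  shows "(\<lambda>y. nsq lborel (\<lambda>x. u (x, y))) \<in> borel_measurable Y"
  unfolding nsq_def by measurable

lemma section_measurable:
  fixes u :: "(real^'d) \<times> 'y \<Rightarrow> complex"
  assumes [measurable]: "u \<in> borel_measurable (lborel \<Otimes>\<^sub>M Y)" and "y \<in> space Y"
  shows "(\<lambda>x. u (x, y)) \<in> borel_measurable borel"
  using measurable_compose[OF measurable_Pair2'[OF assms(2)] assms(1)] by simp

lemma section_nsq_finite:
  fixes u :: "(real^'d) \<times> 'y \<Rightarrow> complex"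
  assumes u[measurable]: "u \<in> borel_measurable (lborel \<Otimes>\<^sub>M Y)" and "nsq (lborel \<Otimes>\<^sub>M Y) u < \<top>"
  shows "AE y in Y. nsq lborel (\<lambda>x. u (x, y)) < \<top>"
proof -
  have "AE y in Y. nsq lborel (\<lambda>x. u (x, y)) \<noteq> \<infinity>"
    using assms(2) nsq_section_measurable[OF u] unfolding nsq_pair[OF u] by (intro nn_integral_PInf_AE) auto
  then show ?thesis by (auto simp: less_top)
qed

lemma RTy_measurable:
  fixes u :: "(real^'d) \<times> 'y \<Rightarrow> complex"
  assumes [measurable]: "u \<in> borel_measurable (lborel \<Otimes>\<^sub>M Y)"
  shows "RTy L N z u \<in> borel_measurable (lborel \<Otimes>\<^sub>M Y)"
proof -
  have ipm[measurable]: "(\<lambda>y. ip lborel (ef L p) (\<lambda>x. u (x, y))) \<in> borel_measurable Y" for p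
    unfolding ip_def by measurable
  show ?thesis unfolding RTy_def[abs_def] RT_def mulop_def by measurable
qed

lemma nsq_RTy_le:
  fixes u :: "(real^'d) \<times> 'y \<Rightarrow> complex"
  assumes L: "0 < L" and z: "z \<notin> rpos" and u[measurable]: "u \<in> borel_measurable (lborel \<Otimes>\<^sub>M Y)"
  shows "nsq (lborel \<Otimes>\<^sub>M Y) (RTy L N z u) \<le> ennreal ((1 / infdist z rpos)^2) * nsq (lborel \<Otimes>\<^sub>M Y) u"
proof -
  have "nsq (lborel \<Otimes>\<^sub>M Y) (RTy L N z u) = (\<integral>\<^sup>+y. nsq lborel (RT L N z (\<lambda>x. u (x, y))) \<partial>Y)"
    by (subst nsq_pair[OF RTy_measurable[OF u]]) (simp add: RTy_def)
  also have "\<dots> \<le> (\<integral>\<^sup>+y. ennreal ((1 / infdist z rpos)^2) * nsq lborel (\<lambda>x. u (x, y)) \<partial>Y)"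
    by (intro nn_integral_mono nsq_RT_le L z section_measurable[OF u])
  also have "\<dots> = ennreal ((1 / infdist z rpos)^2) * nsq (lborel \<Otimes>\<^sub>M Y) u"
    by (simp add: nn_integral_cmult nsq_section_measurable[OF u] nsq_pair[OF u])
  finally show ?thesis .
qed

text \<open>Linearity is applied on each section, which is legitimate where both sections are square
  integrable, that is for almost every y.\<close>

lemma nsq_RTy_diff_le:
  fixes u v :: "(real^'d) \<times> 'y \<Rightarrow> complex"
  assumes L: "0 < L" and z: "z \<notin> rpos" and u[measurable]: "u \<in> borel_measurable (lborel \<Otimes>\<^sub>M Y)" and v[measurable]: "v \<in> borel_measurable (lborel \<Otimes>\<^sub>M Y)"
    and fin: "nsq (lborel \<Otimes>\<^sub>M Y) u < \<top>" "nsq (lborel \<Otimes>\<^sub>M Y) v < \<top>"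
  shows "nsq (lborel \<Otimes>\<^sub>M Y) (\<lambda>w. RTy L N z u w - RTy L N z v w)
    \<le> ennreal ((1 / infdist z rpos)^2) * nsq (lborel \<Otimes>\<^sub>M Y) (\<lambda>w. u w - v w)"
proof -
  note [measurable] = RTy_measurable[OF u] RTy_measurable[OF v]
  have uv[measurable]: "(\<lambda>w. u w - v w) \<in> borel_measurable (lborel \<Otimes>\<^sub>M Y)" by measurable
  have "nsq (lborel \<Otimes>\<^sub>M Y) (\<lambda>w. RTy L N z u w - RTy L N z v w)
    = (\<integral>\<^sup>+y. nsq lborel (\<lambda>x. RT L N z (\<lambda>x. u (x, y)) x - RT L N z (\<lambda>x. v (x, y)) x) \<partial>Y)"
    by (subst nsq_pair[OF borel_measurable_diff[OF RTy_measurable[OF u] RTy_measurable[OF v]]]) (simp add: RTy_def)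
  also have "\<dots> = (\<integral>\<^sup>+y. nsq lborel (RT L N z (\<lambda>x. u (x, y) - v (x, y))) \<partial>Y)"
  proof (rule nn_integral_cong_AE)
    from section_nsq_finite[OF u fin(1)] section_nsq_finite[OF v fin(2)] AE_space
    show "AE y in Y. nsq lborel (\<lambda>x. RT L N z (\<lambda>x. u (x, y)) x - RT L N z (\<lambda>x. v (x, y)) x) = nsq lborel (RT L N z (\<lambda>x. u (x, y) - v (x, y)))"
    proof eventually_elim
      fix y assume "nsq lborel (\<lambda>x. u (x, y)) < \<top>" "nsq lborel (\<lambda>x. v (x, y)) < \<top>" "y \<in> space Y"
      then show "nsq lborel (\<lambda>x. RT L N z (\<lambda>x. u (x, y)) x - RT L N z (\<lambda>x. v (x, y)) x) = nsq lborel (RT L N z (\<lambda>x. u (x, y) - v (x, y)))"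
        using RT_diff[OF L section_measurable[OF u] _ section_measurable[OF v], of y y N z] by (intro nsq_cong) simp
    qed
  qed
  also have "\<dots> = nsq (lborel \<Otimes>\<^sub>M Y) (RTy L N z (\<lambda>w. u w - v w))"
    by (subst nsq_pair[OF RTy_measurable[OF uv]]) (simp add: RTy_def)
  also have "\<dots> \<le> ennreal ((1 / infdist z rpos)^2) * nsq (lborel \<Otimes>\<^sub>M Y) (\<lambda>w. u w - v w)"
    by (rule nsq_RTy_le[OF L z uv])
  finally show ?thesis .
qed

text \<open>Almost every section is Cauchy by \<open>RT_Cauchy\<close>, but limits chosen separately
  for each y need not be measurable together. Instead the tail suprema of the distances are
  integrated over y by dominated convergence; the sequence is then Cauchy on the product space, and
  completeness supplies a measurable limit.\<close>

lemma RTy_strong_convergent: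
  fixes u :: "(real^'d) \<times> 'y \<Rightarrow> complex" and a :: "nat \<Rightarrow> real" and Nn :: "nat \<Rightarrow> nat"
  assumes a: "filterlim a at_top sequentially" "\<And>k. 0 < a k" and N: "filterlim Nn at_top sequentially"
    and z: "z \<notin> rpos" and u[measurable]: "u \<in> borel_measurable (lborel \<Otimes>\<^sub>M Y)" and fin: "nsq (lborel \<Otimes>\<^sub>M Y) u < \<top>"
  shows "\<exists>r\<in>borel_measurable (lborel \<Otimes>\<^sub>M Y). (\<lambda>k. nsq (lborel \<Otimes>\<^sub>M Y) (\<lambda>w. RTy (a k) (Nn k) z u w - r w)) \<longlonglongrightarrow> 0"
proof -
  let ?R = "\<lambda>k y. RT (a k) (Nn k) z (\<lambda>x. u (x, y))"
  let ?c = "ennreal ((1 / infdist z rpos)^2)"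
  define D where "D j k y = nsq lborel (\<lambda>x. ?R j y x - ?R k y x)" for j k y
  note Rm[measurable] = RTy_measurable[OF u]
  have D_eq: "nsq (lborel \<Otimes>\<^sub>M Y) (\<lambda>w. RTy (a j) (Nn j) z u w - RTy (a k) (Nn k) z u w) = (\<integral>\<^sup>+y. D j k y \<partial>Y)" for j k
  proof -
    have m: "(\<lambda>w. RTy (a j) (Nn j) z u w - RTy (a k) (Nn k) z u w) \<in> borel_measurable (lborel \<Otimes>\<^sub>M Y)"
      by (intro borel_measurable_diff Rm)
    show ?thesis unfolding nsq_pair[OF m] by (simp add: RTy_def D_def[abs_def])
  qed
  have Dm[measurable]: "D j k \<in> borel_measurable Y" for j k
  proof -
    have "(\<lambda>y. nsq lborel (\<lambda>x. (\<lambda>w. RTy (a j) (Nn j) z u w - RTy (a k) (Nn k) z u w) (x, y))) \<in> borel_measurable Y"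
      by (intro nsq_section_measurable) measurable
    then show ?thesis by (simp add: RTy_def D_def[abs_def])
  qed
  \<comment> \<open>The supremum runs over countably many j, so it is measurable; it is bounded by a
    multiple of the squared norm of the section.\<close>
  define E where "E k y = (SUP j\<in>{k..}. D j k y)" for k y
  have Em[measurable]: "E k \<in> borel_measurable Y" for k
    unfolding E_def[abs_def] by (intro borel_measurable_SUP) auto
  have Ebd: "E k y \<le> 4 * (?c * nsq lborel (\<lambda>x. u (x, y)))" if "y \<in> space Y" for k y
    unfolding E_def
  proof (rule SUP_least)
    fix j
    have "D j k y \<le> 2 * nsq lborel (?R j y) + 2 * nsq lborel (?R k y)"
      unfolding D_def using RT_measurable[OF a(2)] by (intro nsq_diff_le) auto
    also have "\<dots> \<le> 2 * (?c * nsq lborel (\<lambda>x. u (x, y))) + 2 * (?c * nsq lborel (\<lambda>x. u (x, y)))"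
      by (intro add_mono mult_left_mono nsq_RT_le a z section_measurable[OF u that]) auto
    also have "\<dots> = 4 * (?c * nsq lborel (\<lambda>x. u (x, y)))" by (simp add: distrib_right[symmetric])
    finally show "D j k y \<le> 4 * (?c * nsq lborel (\<lambda>x. u (x, y)))" .
  qed
  have "(\<lambda>k. \<integral>\<^sup>+y. E k y \<partial>Y) \<longlonglongrightarrow> (\<integral>\<^sup>+y. 0 \<partial>Y)"
  proof (rule nn_integral_dominated_convergence)
    show "AE y in Y. E k y \<le> 4 * (?c * nsq lborel (\<lambda>x. u (x, y)))" for k using Ebd by (intro AE_I2) auto
    show "(\<integral>\<^sup>+y. 4 * (?c * nsq lborel (\<lambda>x. u (x, y))) \<partial>Y) < \<infinity>"
      using fin nsq_section_measurable[OF u] unfolding nsq_pair[OF u]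
      by (simp add: nn_integral_cmult ennreal_mult_less_top)
    from section_nsq_finite[OF u fin] AE_space
    show "AE y in Y. (\<lambda>k. E k y) \<longlonglongrightarrow> 0"
    proof eventually_elim
      fix y assume y: "nsq lborel (\<lambda>x. u (x, y)) < \<top>" "y \<in> space Y"
      show "(\<lambda>k. E k y) \<longlonglongrightarrow> 0"
      proof (rule order_tendstoI)
        fix e :: ennreal assume "0 < e"
        then obtain \<epsilon> where \<epsilon>: "0 < \<epsilon>" "\<epsilon> < e" using dense by blast
        obtain K where K: "\<And>j k. K \<le> j \<Longrightarrow> K \<le> k \<Longrightarrow> D j k y \<le> \<epsilon>"
          using RT_Cauchy[OF a N z section_measurable[OF u y(2)] y(1) \<epsilon>(1)] unfolding D_def by blast
        have "E k y \<le> \<epsilon>" if "K \<le> k" for k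
          unfolding E_def using that by (intro SUP_least K) auto
        then show "\<forall>\<^sub>F k in sequentially. E k y < e"
          using \<epsilon>(2) unfolding eventually_sequentially by (meson le_less_trans)
      qed simp
    qed
  qed (use nsq_section_measurable[OF u] in \<open>auto simp: Em\<close>)
  then have Elim: "(\<lambda>k. \<integral>\<^sup>+y. E k y \<partial>Y) \<longlonglongrightarrow> 0" by simp
  have DE: "nsq (lborel \<Otimes>\<^sub>M Y) (\<lambda>w. RTy (a j) (Nn j) z u w - RTy (a k) (Nn k) z u w) \<le> (\<integral>\<^sup>+y. E k y \<partial>Y)" if "k \<le> j" for j k
    unfolding D_eq E_def using that by (intro nn_integral_mono SUP_upper) auto
  show ?thesis
  proof (rule nsq_complete)
    fix \<epsilon> :: ennreal assume \<epsilon>: "0 < \<epsilon>"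
    have "(\<lambda>k. 4 * (\<integral>\<^sup>+y. E k y \<partial>Y)) \<longlonglongrightarrow> 0"
      using ennreal_tendsto_cmult[OF _ Elim, of 4] by simp
    then have "eventually (\<lambda>k. 4 * (\<integral>\<^sup>+y. E k y \<partial>Y) < \<epsilon>) sequentially"
      using \<epsilon> by (rule order_tendstoD)
    then obtain K where K: "4 * (\<integral>\<^sup>+y. E K y \<partial>Y) < \<epsilon>" by (auto simp: eventually_sequentially)
    show "\<exists>K. \<forall>j\<ge>K. \<forall>k\<ge>K. nsq (lborel \<Otimes>\<^sub>M Y) (\<lambda>w. RTy (a j) (Nn j) z u w - RTy (a k) (Nn k) z u w) \<le> \<epsilon>"
    proof (intro exI[of _ K] allI impI)
      fix j k assume jk: "K \<le> j" "K \<le> k"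
      let ?v = "\<lambda>k. RTy (a k) (Nn k) z u"
      have "nsq (lborel \<Otimes>\<^sub>M Y) (\<lambda>w. ?v j w - ?v k w) \<le> 2 * nsq (lborel \<Otimes>\<^sub>M Y) (\<lambda>w. ?v j w - ?v K w) + 2 * nsq (lborel \<Otimes>\<^sub>M Y) (\<lambda>w. ?v K w - ?v k w)"
        by (intro nsq_triangle) (auto simp: Rm)
      also have "\<dots> \<le> 2 * (\<integral>\<^sup>+y. E K y \<partial>Y) + 2 * (\<integral>\<^sup>+y. E K y \<partial>Y)"
        using DE[OF jk(1)] DE[OF jk(2)] by (intro add_mono mult_left_mono) (auto simp: nsq_minus_commute[of _ "?v K"])
      also have "\<dots> = 4 * (\<integral>\<^sup>+y. E K y \<partial>Y)" by (simp add: distrib_right[symmetric])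
      finally show "nsq (lborel \<Otimes>\<^sub>M Y) (\<lambda>w. ?v j w - ?v k w) \<le> \<epsilon>" using K by simp
    qed
  qed (simp add: Rm)
qed

text \<open>The operators are uniformly bounded and converge strongly, so they may be applied to a
  convergent sequence of arguments.\<close>

lemma RTy_convergent:
  fixes u :: "(real^'d) \<times> 'y \<Rightarrow> complex" and a :: "nat \<Rightarrow> real" and Nn :: "nat \<Rightarrow> nat"
  assumes a: "filterlim a at_top sequentially" "\<And>k. 0 < a k" and N: "filterlim Nn at_top sequentially"
    and z: "z \<notin> rpos" and u[measurable]: "u \<in> borel_measurable (lborel \<Otimes>\<^sub>M Y)"
    and v[measurable]: "\<And>k. v k \<in> borel_measurable (lborel \<Otimes>\<^sub>M Y)" and fin: "\<And>k. nsq (lborel \<Otimes>\<^sub>M Y) (v k) < \<top>"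
    and lim: "(\<lambda>k. nsq (lborel \<Otimes>\<^sub>M Y) (\<lambda>w. v k w - u w)) \<longlonglongrightarrow> 0"
  shows "\<exists>r\<in>borel_measurable (lborel \<Otimes>\<^sub>M Y). (\<lambda>k. nsq (lborel \<Otimes>\<^sub>M Y) (\<lambda>w. RTy (a k) (Nn k) z (v k) w - r w)) \<longlonglongrightarrow> 0"
proof -
  let ?c = "ennreal ((1 / infdist z rpos)^2)"
  have finu: "nsq (lborel \<Otimes>\<^sub>M Y) u < \<top>" by (rule nsq_tendsto_finite[OF u v fin lim])
  obtain r where r[measurable]: "r \<in> borel_measurable (lborel \<Otimes>\<^sub>M Y)"
    and rl: "(\<lambda>k. nsq (lborel \<Otimes>\<^sub>M Y) (\<lambda>w. RTy (a k) (Nn k) z u w - r w)) \<longlonglongrightarrow> 0"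
    using RTy_strong_convergent[OF a N z u finu] by blast
  have le: "nsq (lborel \<Otimes>\<^sub>M Y) (\<lambda>w. RTy (a k) (Nn k) z (v k) w - r w)
    \<le> 2 * (?c * nsq (lborel \<Otimes>\<^sub>M Y) (\<lambda>w. v k w - u w)) + 2 * nsq (lborel \<Otimes>\<^sub>M Y) (\<lambda>w. RTy (a k) (Nn k) z u w - r w)" for k
  proof -
    have "nsq (lborel \<Otimes>\<^sub>M Y) (\<lambda>w. RTy (a k) (Nn k) z (v k) w - r w)
      \<le> 2 * nsq (lborel \<Otimes>\<^sub>M Y) (\<lambda>w. RTy (a k) (Nn k) z (v k) w - RTy (a k) (Nn k) z u w) + 2 * nsq (lborel \<Otimes>\<^sub>M Y) (\<lambda>w. RTy (a k) (Nn k) z u w - r w)"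
      by (intro nsq_triangle RTy_measurable r u v)
    also have "\<dots> \<le> 2 * (?c * nsq (lborel \<Otimes>\<^sub>M Y) (\<lambda>w. v k w - u w)) + 2 * nsq (lborel \<Otimes>\<^sub>M Y) (\<lambda>w. RTy (a k) (Nn k) z u w - r w)"
      by (intro add_right_mono mult_left_mono nsq_RTy_diff_le a z u v fin finu) auto
    finally show ?thesis .
  qed
  have "(\<lambda>k. 2 * (?c * nsq (lborel \<Otimes>\<^sub>M Y) (\<lambda>w. v k w - u w)) + 2 * nsq (lborel \<Otimes>\<^sub>M Y) (\<lambda>w. RTy (a k) (Nn k) z u w - r w)) \<longlonglongrightarrow> 2 * (?c * 0) + 2 * 0"
    by (intro tendsto_add ennreal_tendsto_cmult lim rl) auto
  then have "(\<lambda>k. nsq (lborel \<Otimes>\<^sub>M Y) (\<lambda>w. RTy (a k) (Nn k) z (v k) w - r w)) \<longlonglongrightarrow> 0"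
    by (intro ennreal_tendsto_0_le[OF _ le]) simp
  then show ?thesis by (rule bexI[OF _ r])
qed

end

section \<open>The periodised scatterer\<close>

lemma nn_integral_lborel_reflect:
  fixes c :: "'a::euclidean_space"
  assumes [measurable]: "f \<in> borel_measurable borel"
  shows "(\<integral>\<^sup>+t. f (c - t) \<partial>lborel) = (\<integral>\<^sup>+s. f s \<partial>lborel)"
proof -
  have "lborel = density (distr lborel borel (\<lambda>x. c + (-1) *\<^sub>R x)) (\<lambda>_. ennreal (\<bar>-1\<bar> ^ DIM('a)))"
    using lborel_affine[of "-1" c] by simp
  then have "(lborel :: 'a measure) = distr lborel borel (\<lambda>x. c - x)"
    by (simp add: density_1)
  then have "(\<integral>\<^sup>+s. f s \<partial>lborel) = (\<integral>\<^sup>+s. f s \<partial>(distr lborel borel (\<lambda>x. c - x)))" by simp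
  also have "\<dots> = (\<integral>\<^sup>+t. f (c - t) \<partial>lborel)" by (subst nn_integral_distr) auto
  finally show ?thesis by simp
qed

lemma wrap_measurable[measurable]: "wrap L \<in> borel \<rightarrow>\<^sub>M (borel :: (real^'d) measure)"
proof (rule borel_measurable_euclidean_space[THEN iffD2], rule ballI)
  fix b :: "real^'d" assume "b \<in> Basis"
  then obtain i where b: "b = axis i 1" by (auto simp: Basis_vec_def)
  have "(\<lambda>x. x $ i - L * of_int \<lfloor>x $ i / L + 1 / 2\<rfloor>) \<in> borel_measurable (borel :: (real^'d) measure)" by measurable
  then show "(\<lambda>x. wrap L x \<bullet> b) \<in> borel_measurable borel"
    by (simp add: b cart_eq_inner_axis[symmetric] wrap_def)
qed

lemma wrap_eq:
  assumes "0 < L" "x - L *\<^sub>R (\<chi> i. of_int (m $ i)) \<in> Lam L"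
  shows "wrap L x = x - L *\<^sub>R (\<chi> i. of_int (m $ i))"
proof -
  have "\<lfloor>x $ i / L + 1/2\<rfloor> = m $ i" for i
  proof -
    have "- L / 2 \<le> x $ i - L * of_int (m $ i)" "x $ i - L * of_int (m $ i) < L / 2"
      using assms(2) by (auto simp: Lam_def)
    then have "of_int (m $ i) \<le> x $ i / L + 1/2" "x $ i / L + 1/2 < of_int (m $ i) + 1"
      using assms(1) by (auto simp: field_simps)
    then show ?thesis by (simp add: floor_eq_iff)
  qed
  then show ?thesis by (simp add: wrap_def vec_eq_iff)
qed

lemma wrap_id: "0 < L \<Longrightarrow> x \<in> Lam L \<Longrightarrow> wrap L x = x"
  using wrap_eq[of L x 0] by (simp add: vec_eq_iff[of "vec_lambda _"] flip: zero_vec_def)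

lemma wrap_in_Lam:
  assumes "0 < L"
  shows "x - L *\<^sub>R (\<chi> i. of_int ((\<chi> i. \<lfloor>x $ i / L + 1/2\<rfloor>) $ i)) \<in> Lam L"
proof -
  have "- L / 2 \<le> x $ i - L * of_int \<lfloor>x $ i / L + 1/2\<rfloor> \<and> x $ i - L * of_int \<lfloor>x $ i / L + 1/2\<rfloor> < L / 2" for i
  proof -
    have "of_int \<lfloor>x $ i / L + 1/2\<rfloor> \<le> x $ i / L + 1/2" "x $ i / L + 1/2 < of_int \<lfloor>x $ i / L + 1/2\<rfloor> + 1" by linarith+
    then have "L * of_int \<lfloor>x $ i / L + 1/2\<rfloor> \<le> L * (x $ i / L + 1/2)" "L * (x $ i / L + 1/2) < L * (of_int \<lfloor>x $ i / L + 1/2\<rfloor> + 1)"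
      using assms by (auto intro!: mult_left_mono mult_strict_left_mono)
    then show ?thesis using assms by (auto simp: distrib_left)
  qed
  then show ?thesis by (simp add: Lam_def)
qed

text \<open>The map t -> wrap (x - t) is a measure-preserving involution of the box. Summing over
  lattice translates splits it into the reflections t -> x - \<tau> - t, which preserve Lebesgue
  measure.\<close>

lemma nn_integral_Lam_wrap:
  fixes x :: "real^'d" and H :: "real^'d \<Rightarrow> real^'d \<Rightarrow> ennreal"
  assumes L: "0 < L" and H[measurable]: "(\<lambda>(t, s). H t s) \<in> borel_measurable (borel \<Otimes>\<^sub>M borel)"
  shows "(\<integral>\<^sup>+t. indicator (Lam L) t * H t (wrap L (x - t)) \<partial>lborel) = (\<integral>\<^sup>+s. indicator (Lam L) s * H (wrap L (x - s)) s \<partial>lborel)"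
proof -
  let ?U = "UNIV :: (int^'d) set"
  define \<tau> :: "nat \<Rightarrow> real^'d" where "\<tau> n = L *\<^sub>R (\<chi> i. of_int (from_nat_into ?U n $ i))" for n
  have "infinite ?U"
  proof
    assume "finite ?U"
    then have "finite (range (\<lambda>k::int. (\<chi> i. k) :: int^'d))" by (rule finite_subset[OF subset_UNIV])
    then have "finite (UNIV :: int set)" by (rule finite_imageD) (auto simp: inj_on_def vec_eq_iff)
    then show False by simp
  qed
  then have bij: "bij_betw (from_nat_into ?U) UNIV ?U" by (intro bij_betw_from_nat_into) auto
  \<comment> \<open>Exactly one lattice translate of y lies in the half-open box, so at most one
    term of the series is nonzero.\<close>
  have expand: "F (wrap L y) = (\<Sum>n. indicator (Lam L) (y - \<tau> n) * F (y - \<tau> n))" for y and F :: "real^'d \<Rightarrow> ennreal"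
  proof -
    define m0 :: "int^'d" where "m0 = (\<chi> i. \<lfloor>y $ i / L + 1/2\<rfloor>)"
    obtain n0 where n0: "from_nat_into ?U n0 = m0" using bij by (metis bij_betw_imp_surj_on UNIV_I imageE)
    have t0: "y - \<tau> n0 \<in> Lam L" using wrap_in_Lam[OF L, of y] by (simp add: \<tau>_def n0 m0_def)
    have w0: "wrap L y = y - \<tau> n0" using t0 unfolding \<tau>_def by (rule wrap_eq[OF L])
    have "(\<Sum>n. indicator (Lam L) (y - \<tau> n) * F (y - \<tau> n)) = (\<Sum>n\<in>{n0}. indicator (Lam L) (y - \<tau> n) * F (y - \<tau> n))"
    proof (rule suminf_finite)
      fix n assume n: "n \<notin> {n0}"
      have "y - \<tau> n \<notin> Lam L"
      proof
        assume "y - \<tau> n \<in> Lam L"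
        then have "wrap L y = y - \<tau> n" unfolding \<tau>_def by (rule wrap_eq[OF L])
        with w0 have "\<tau> n = \<tau> n0" by simp
        then have "from_nat_into ?U n = from_nat_into ?U n0" using L by (simp add: \<tau>_def vec_eq_iff)
        with bij n show False by (auto simp: bij_betw_def inj_on_def)
      qed
      then show "indicator (Lam L) (y - \<tau> n) * F (y - \<tau> n) = 0" by simp
    qed simp
    then show ?thesis using t0 w0 by simp
  qed
  have "(\<integral>\<^sup>+t. indicator (Lam L) t * H t (wrap L (x - t)) \<partial>lborel)
    = (\<integral>\<^sup>+t. (\<Sum>n. indicator (Lam L) t * (indicator (Lam L) (x - t - \<tau> n) * H t (x - t - \<tau> n))) \<partial>lborel)"
    by (subst expand[of "H _"]) simp
  also have "\<dots> = (\<Sum>n. \<integral>\<^sup>+t. indicator (Lam L) t * (indicator (Lam L) (x - t - \<tau> n) * H t (x - t - \<tau> n)) \<partial>lborel)"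
    by (rule nn_integral_suminf) measurable
  also have "\<dots> = (\<Sum>n. \<integral>\<^sup>+s. indicator (Lam L) (x - s - \<tau> n) * (indicator (Lam L) s * H (x - s - \<tau> n) s) \<partial>lborel)"
  proof (intro suminf_cong)
    fix n
    have "(\<integral>\<^sup>+s. (\<lambda>t. indicator (Lam L) t * (indicator (Lam L) (x - t - \<tau> n) * H t (x - t - \<tau> n))) ((x - \<tau> n) - s) \<partial>lborel)
      = (\<integral>\<^sup>+t. indicator (Lam L) t * (indicator (Lam L) (x - t - \<tau> n) * H t (x - t - \<tau> n)) \<partial>lborel)"
      by (rule nn_integral_lborel_reflect) measurable
    moreover have "x - \<tau> n - s = x - s - \<tau> n" "x - (x - s - \<tau> n) - \<tau> n = s" for s
      by (simp_all add: algebra_simps)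
    ultimately show "(\<integral>\<^sup>+t. indicator (Lam L) t * (indicator (Lam L) (x - t - \<tau> n) * H t (x - t - \<tau> n)) \<partial>lborel)
      = (\<integral>\<^sup>+s. indicator (Lam L) (x - s - \<tau> n) * (indicator (Lam L) s * H (x - s - \<tau> n) s) \<partial>lborel)"
      by (simp only:)
  qed
  also have "\<dots> = (\<integral>\<^sup>+s. (\<Sum>n. indicator (Lam L) s * (indicator (Lam L) (x - s - \<tau> n) * H (x - s - \<tau> n) s)) \<partial>lborel)"
    by (subst nn_integral_suminf) (measurable, simp add: mult_ac)
  also have "\<dots> = (\<integral>\<^sup>+s. indicator (Lam L) s * H (wrap L (x - s)) s \<partial>lborel)"
    by (subst expand[of "\<lambda>t. H t _"]) simp
  finally show ?thesis .
qed

lemma eventually_in_Lam: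
  fixes x :: "real^'d"
  assumes "filterlim a at_top F"
  shows "eventually (\<lambda>k. x \<in> Lam (a k)) F"
proof -
  have "eventually (\<lambda>k. 2 * norm x + 1 \<le> a k) F" using assms by (auto simp: filterlim_at_top)
  then show ?thesis
  proof eventually_elim
    fix k assume k: "2 * norm x + 1 \<le> a k"
    have "- a k / 2 \<le> x $ i \<and> x $ i < a k / 2" for i
      using component_le_norm_cart[of x i] k by (simp add: abs_le_iff)
    then show "x \<in> Lam (a k)" by (simp add: Lam_def)
  qed
qed

text \<open>Cut to the box in both variables. Integrals over scatterer positions can then run over
  all of space, with the same measure for every L.\<close>

definition BL :: "real \<Rightarrow> (real^'d \<Rightarrow> real) \<Rightarrow> real^'d \<Rightarrow> real^'d \<Rightarrow> real" where
  "BL L B x t = indicator (Lam L) x * indicator (Lam L) t * B (wrap L (x - t))"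

lemma BL_measurable[measurable]:
  assumes [measurable]: "B \<in> borel_measurable borel"
  shows "(\<lambda>(x, t). BL L B x t) \<in> borel_measurable (borel \<Otimes>\<^sub>M borel)"
  unfolding BL_def by measurable

lemma abs_BL_le: "(\<And>s. \<bar>B s\<bar> \<le> b) \<Longrightarrow> \<bar>BL L B x t\<bar> \<le> b"
  by (auto simp: BL_def abs_mult split: split_indicator intro: order_trans[OF abs_ge_zero])

lemma BL_eventually:
  assumes "filterlim a at_top sequentially" "\<And>k. 0 < a k"
  shows "eventually (\<lambda>k. BL (a k) B x t = B (x - t)) sequentially"
  using eventually_in_Lam[OF assms(1), of x] eventually_in_Lam[OF assms(1), of t] eventually_in_Lam[OF assms(1), of "x - t"]
  by eventually_elim (simp add: BL_def wrap_id assms(2))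

text \<open>Wrapping preserves measure on the box, so the norms of the periodised scatterer are at
  most those of B on the whole space, uniformly in L and x.\<close>

lemma nn_integral_BL_le:
  fixes x :: "real^'d"
  assumes L: "0 < L" and [measurable]: "B \<in> borel_measurable borel" and q: "0 < q"
  shows "(\<integral>\<^sup>+t. ennreal (\<bar>BL L B x t\<bar> ^ q) \<partial>lborel) \<le> (\<integral>\<^sup>+s. ennreal (\<bar>B s\<bar> ^ q) \<partial>lborel)"
proof -
  have "(\<integral>\<^sup>+t. ennreal (\<bar>BL L B x t\<bar> ^ q) \<partial>lborel) \<le> (\<integral>\<^sup>+t. indicator (Lam L) t * (\<lambda>t s. ennreal (\<bar>B s\<bar> ^ q)) t (wrap L (x - t)) \<partial>lborel)"
    using q by (intro nn_integral_mono) (auto simp: BL_def split: split_indicator)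
  also have "\<dots> = (\<integral>\<^sup>+s. indicator (Lam L) s * ennreal (\<bar>B s\<bar> ^ q) \<partial>lborel)"
    by (rule nn_integral_Lam_wrap[OF L]) measurable
  also have "\<dots> \<le> (\<integral>\<^sup>+s. ennreal (\<bar>B s\<bar> ^ q) \<partial>lborel)"
    by (intro nn_integral_mono) (auto split: split_indicator)
  finally show ?thesis .
qed

lemma abs_diff_power_le: "\<bar>u - v\<bar> ^ q \<le> 2 ^ q * (\<bar>u\<bar> ^ q + \<bar>v\<bar> ^ q)" for u v :: real
proof -
  have "\<bar>u - v\<bar> \<le> 2 * max \<bar>u\<bar> \<bar>v\<bar>" by linarith
  then have "\<bar>u - v\<bar> ^ q \<le> (2 * max \<bar>u\<bar> \<bar>v\<bar>) ^ q" by (intro power_mono) auto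
  also have "\<dots> = 2 ^ q * (max \<bar>u\<bar> \<bar>v\<bar>) ^ q" by (rule power_mult_distrib)
  also have "\<dots> \<le> 2 ^ q * (\<bar>u\<bar> ^ q + \<bar>v\<bar> ^ q)" by (intro mult_left_mono) (auto simp: max_def)
  finally show ?thesis .
qed

text \<open>Off the bad set the periodised kernel equals B (x - t). On it both kernels contribute
  tails: \<open>f1\<close> is a tail of B (x - t), and \<open>f2\<close> becomes a tail of B after
  the change of variables \<open>nn_integral_Lam_wrap\<close>.\<close>

lemma nn_integral_BL_tendsto:
  fixes x :: "real^'d"
  assumes a: "filterlim a at_top sequentially" "\<And>k. 0 < a k" and B[measurable]: "B \<in> borel_measurable borel" and q: "0 < q"
    and fin: "(\<integral>\<^sup>+s. ennreal (\<bar>B s\<bar> ^ q) \<partial>lborel) < \<top>"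
  shows "(\<lambda>k. \<integral>\<^sup>+t. ennreal (\<bar>BL (a k) B x t - B (x - t)\<bar> ^ q) \<partial>lborel) \<longlonglongrightarrow> 0"
proof -
  define bad where "bad k t = (x \<notin> Lam (a k) \<or> t \<notin> Lam (a k) \<or> x - t \<notin> Lam (a k))" for k t
  have [measurable]: "Measurable.pred borel (bad k)" for k unfolding bad_def[abs_def] by measurable
  define f1 where "f1 k = (\<integral>\<^sup>+t. (if bad k t then ennreal (\<bar>B (x - t)\<bar> ^ q) else 0) \<partial>lborel)" for k
  define f2 where "f2 k = (\<integral>\<^sup>+t. indicator (Lam (a k)) t * (\<lambda>t s. if x - t \<in> Lam (a k) then 0 else ennreal (\<bar>B s\<bar> ^ q)) t (wrap (a k) (x - t)) \<partial>lborel)" for k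
  have pw: "ennreal (\<bar>BL (a k) B x t - B (x - t)\<bar> ^ q) \<le> ennreal (2^q) * ((if bad k t then ennreal (\<bar>B (x - t)\<bar> ^ q) else 0)
      + indicator (Lam (a k)) t * (if x - t \<in> Lam (a k) then 0 else ennreal (\<bar>B (wrap (a k) (x - t))\<bar> ^ q)))" for k t
  proof (cases "bad k t")
    case False
    then show ?thesis using q by (simp add: bad_def BL_def wrap_id a(2))
  next
    case True
    have "ennreal (\<bar>BL (a k) B x t - B (x - t)\<bar> ^ q) \<le> ennreal (2 ^ q * (\<bar>BL (a k) B x t\<bar> ^ q + \<bar>B (x - t)\<bar> ^ q))"
      by (intro ennreal_leI abs_diff_power_le)
    also have "\<dots> = ennreal (2^q) * (ennreal (\<bar>B (x - t)\<bar> ^ q) + ennreal (\<bar>BL (a k) B x t\<bar> ^ q))"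
      by (simp add: ennreal_mult ennreal_plus add.commute)
    also have "ennreal (\<bar>BL (a k) B x t\<bar> ^ q) \<le> indicator (Lam (a k)) t * (if x - t \<in> Lam (a k) then 0 else ennreal (\<bar>B (wrap (a k) (x - t))\<bar> ^ q))"
      using True q by (auto simp: BL_def bad_def split: split_indicator)
    finally show ?thesis using True by (simp add: mult_left_mono add_left_mono)
  qed
  have le: "(\<integral>\<^sup>+t. ennreal (\<bar>BL (a k) B x t - B (x - t)\<bar> ^ q) \<partial>lborel) \<le> ennreal (2^q) * (f1 k + f2 k)" for k
  proof -
    have "(\<integral>\<^sup>+t. ennreal (\<bar>BL (a k) B x t - B (x - t)\<bar> ^ q) \<partial>lborel) \<le> (\<integral>\<^sup>+t. ennreal (2^q) * ((if bad k t then ennreal (\<bar>B (x - t)\<bar> ^ q) else 0)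
      + indicator (Lam (a k)) t * (if x - t \<in> Lam (a k) then 0 else ennreal (\<bar>B (wrap (a k) (x - t))\<bar> ^ q))) \<partial>lborel)"
      by (intro nn_integral_mono pw)
    also have "\<dots> = ennreal (2^q) * (f1 k + f2 k)"
      unfolding f1_def f2_def by (subst nn_integral_cmult, measurable, subst nn_integral_add, measurable)
    finally show ?thesis .
  qed
  have "f1 \<longlonglongrightarrow> (\<integral>\<^sup>+t. 0 \<partial>(lborel :: (real^'d) measure))"
    unfolding f1_def
  proof (rule nn_integral_dominated_convergence[where w = "\<lambda>t. ennreal (\<bar>B (x - t)\<bar> ^ q)"])
    show "(\<integral>\<^sup>+t. ennreal (\<bar>B (x - t)\<bar> ^ q) \<partial>lborel) < \<infinity>"
      using fin nn_integral_lborel_reflect[of "\<lambda>s. ennreal (\<bar>B s\<bar> ^ q)" x] by simp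
    show "AE t in lborel. (\<lambda>k. if bad k t then ennreal (\<bar>B (x - t)\<bar> ^ q) else 0) \<longlonglongrightarrow> 0"
    proof (rule AE_I2)
      fix t
      have "eventually (\<lambda>k. (if bad k t then ennreal (\<bar>B (x - t)\<bar> ^ q) else 0) = 0) sequentially"
        using eventually_in_Lam[OF a(1), of x] eventually_in_Lam[OF a(1), of t] eventually_in_Lam[OF a(1), of "x - t"]
        by eventually_elim (simp add: bad_def)
      then show "(\<lambda>k. if bad k t then ennreal (\<bar>B (x - t)\<bar> ^ q) else 0) \<longlonglongrightarrow> 0" by (rule tendsto_eventually)
    qed
  qed auto
  then have f1: "f1 \<longlonglongrightarrow> 0" by simp
  define f3 where "f3 k = (\<integral>\<^sup>+s. (if x - s \<in> Lam (a k) then 0 else ennreal (\<bar>B s\<bar> ^ q)) \<partial>lborel)" for k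
  have "f2 k \<le> f3 k" for k
  proof -
    have "f2 k = (\<integral>\<^sup>+s. indicator (Lam (a k)) s * (if x - wrap (a k) (x - s) \<in> Lam (a k) then 0 else ennreal (\<bar>B s\<bar> ^ q)) \<partial>lborel)"
      unfolding f2_def by (rule nn_integral_Lam_wrap[OF a(2)]) measurable
    \<comment> \<open>If x - s lies in the box it is its own wrapped value, and x minus it is s,
      which the indicator places in the box; the integrand is then 0.\<close>
    also have "\<dots> \<le> f3 k"
      unfolding f3_def by (intro nn_integral_mono) (auto simp: wrap_id a(2) split: split_indicator)
    finally show ?thesis .
  qed
  moreover have "f3 \<longlonglongrightarrow> (\<integral>\<^sup>+s. 0 \<partial>(lborel :: (real^'d) measure))"
    unfolding f3_def
  proof (rule nn_integral_dominated_convergence[where w = "\<lambda>s. ennreal (\<bar>B s\<bar> ^ q)"])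
    show "AE s in lborel. (\<lambda>k. if x - s \<in> Lam (a k) then 0 else ennreal (\<bar>B s\<bar> ^ q)) \<longlonglongrightarrow> 0"
    proof (rule AE_I2)
      fix s
      have "eventually (\<lambda>k. (if x - s \<in> Lam (a k) then 0 else ennreal (\<bar>B s\<bar> ^ q)) = 0) sequentially"
        using eventually_in_Lam[OF a(1), of "x - s"] by eventually_elim simp
      then show "(\<lambda>k. if x - s \<in> Lam (a k) then 0 else ennreal (\<bar>B s\<bar> ^ q)) \<longlonglongrightarrow> 0" by (rule tendsto_eventually)
    qed
  qed (use fin in auto)
  ultimately have f2: "f2 \<longlonglongrightarrow> 0" using ennreal_tendsto_0_le[of f3 sequentially f2] by simp
  have "(\<lambda>k. ennreal (2^q) * (f1 k + f2 k)) \<longlonglongrightarrow> ennreal (2^q) * (0 + 0)"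
    by (intro ennreal_tendsto_cmult tendsto_add f1 f2) simp
  then show ?thesis by (intro ennreal_tendsto_0_le[OF _ le]) simp
qed

text \<open>For integrability, note that 1 + |x| to the power 2d dominates the product of the
  factors 1 + x_i^2, and the inverse of that product is a product of integrable functions of one
  variable.\<close>

lemma schwartz_bound:
  fixes B :: "real^'d \<Rightarrow> real"
  assumes "schwartz B"
  shows "continuous_on UNIV B" "\<exists>C. \<forall>x. \<bar>B x\<bar> \<le> C" "integrable lborel B"
proof -
  have "B differentiable (at x)" for x using assms unfolding schwartz_def by (metis pderivs.simps(1))
  then show c: "continuous_on UNIV B"
    by (simp add: continuous_on_eq_continuous_at differentiable_imp_continuous_within)
  have bd: "\<exists>C. \<forall>x. \<bar>(1 + norm x) ^ k * B x\<bar> \<le> C" for k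
  proof -
    have "bounded (range (\<lambda>x. (1 + norm x) ^ k * B x))" using assms unfolding schwartz_def by (metis pderivs.simps(1))
    then show ?thesis by (auto simp: bounded_iff)
  qed
  show "\<exists>C. \<forall>x. \<bar>B x\<bar> \<le> C" using bd[of 0] by simp
  obtain C where C: "\<And>x. \<bar>(1 + norm x) ^ (2 * CARD('d)) * B x\<bar> \<le> C" using bd by blast
  have iso: "integrable lborel (\<lambda>t::real. inverse (1 + t^2))"
    using integrable_inverse_1_plus_square by (simp add: set_integrable_def einterval_def)
  have I: "integrable lborel (\<lambda>x::real^'d. C * (\<Prod>i\<in>UNIV. inverse (1 + (x $ i)^2)))"
    by (intro integrable_mult_right integral_prod_vec_nth iso)
  show "integrable lborel B"
  proof (rule Bochner_Integration.integrable_bound[OF I])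
    show "B \<in> borel_measurable lborel" using borel_measurable_continuous_onI[OF c] by simp
    show "AE x in lborel. norm (B x) \<le> norm (C * (\<Prod>i\<in>UNIV. inverse (1 + (x $ i)^2)))"
    proof (rule AE_I2)
      fix x :: "real^'d"
      have "1 + (x $ i)^2 \<le> (1 + norm x)^2" for i
      proof -
        have "(x $ i)^2 \<le> (norm x)^2" using component_le_norm_cart[of x i] by (intro power2_le_iff_abs_le[THEN iffD2]) auto
        then show ?thesis by (simp add: power2_sum add_increasing2)
      qed
      then have "(\<Prod>i\<in>(UNIV::'d set). 1 + (x $ i)^2) \<le> (\<Prod>i\<in>(UNIV::'d set). (1 + norm x)^2)"
        by (intro prod_mono) (auto intro: add_nonneg_nonneg)
      also have "\<dots> = (1 + norm x) ^ (2 * CARD('d))" by (simp add: power_mult)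
      finally have le: "(\<Prod>i\<in>(UNIV::'d set). 1 + (x $ i)^2) \<le> (1 + norm x) ^ (2 * CARD('d))" .
      have pos: "0 < (\<Prod>i\<in>(UNIV::'d set). 1 + (x $ i)^2)" by (intro prod_pos) (auto intro: add_pos_nonneg)
      have "(\<Prod>i\<in>(UNIV::'d set). 1 + (x $ i)^2) * \<bar>B x\<bar> \<le> (1 + norm x) ^ (2 * CARD('d)) * \<bar>B x\<bar>"
        by (intro mult_right_mono le) simp
      also have "\<dots> \<le> C" using C[of x] by (simp add: abs_mult)
      finally have "\<bar>B x\<bar> \<le> C / (\<Prod>i\<in>(UNIV::'d set). 1 + (x $ i)^2)" using pos by (simp add: field_simps)
      also have "\<dots> = C * (\<Prod>i\<in>UNIV. inverse (1 + (x $ i)^2))"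
        by (simp add: divide_inverse prod_inversef[symmetric])
      finally show "norm (B x) \<le> norm (C * (\<Prod>i\<in>UNIV. inverse (1 + (x $ i)^2)))" by simp
    qed
  qed
qed

section \<open>Meeting a scatterer\<close>

text \<open>\<open>YY\<close> serves measurability, with all positions present whatever the active
  set is; \<open>PY A\<close> is the measure over which the active positions are integrated.\<close>

abbreviation YY :: "(nat \<Rightarrow> real^'d) measure" where "YY \<equiv> PiM UNIV (\<lambda>_. borel)"
abbreviation PY :: "nat set \<Rightarrow> (nat \<Rightarrow> real^'d) measure" where "PY A \<equiv> PiM A (\<lambda>_. lborel)"

text \<open>The functions take a full family of positions and must ignore those outside A. As the
  active set changes from step to step, this keeps the type and the measurable space of the
  arguments fixed.\<close>

definition stf :: "nat set \<Rightarrow> (real^'d \<Rightarrow> (nat \<Rightarrow> real^'d) \<Rightarrow> complex) \<Rightarrow> bool" where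
  "stf A u \<longleftrightarrow> (\<lambda>(x, y). u x y) \<in> borel_measurable (borel \<Otimes>\<^sub>M YY) \<and>
     (\<forall>x y y'. (\<forall>k\<in>A. y k = y' k) \<longrightarrow> u x y = u x y')"

definition nn :: "nat set \<Rightarrow> (real^'d \<Rightarrow> (nat \<Rightarrow> real^'d) \<Rightarrow> complex) \<Rightarrow> ennreal" where
  "nn A u = nsq (lborel \<Otimes>\<^sub>M PY A) (\<lambda>(x, y). u x y)"

text \<open>At the last meeting the position is integrated against Lebesgue measure rather than the
  uniform one; the volume factors reappear in \<open>Ust_eq_integral_Qst\<close>.\<close>

definition Wop :: "(real^'d \<Rightarrow> real^'d \<Rightarrow> real) \<Rightarrow> nat \<Rightarrow> bool \<Rightarrow> (real^'d \<Rightarrow> (nat \<Rightarrow> real^'d) \<Rightarrow> complex)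
    \<Rightarrow> real^'d \<Rightarrow> (nat \<Rightarrow> real^'d) \<Rightarrow> complex" where
  "Wop b s lst u x y = (if lst then (\<integral>t. complex_of_real (b x t) * u x (y(s := t)) \<partial>lborel)
     else complex_of_real (b x (y s)) * u x y)"

text \<open>A single weight for all four kinds of meeting: the squared L2 norm of b x when a
  position is created or integrated out, the squared value of b when it is met in between, and the
  squared L1 norm when it is met only once.\<close>

definition \<Theta> :: "(real^'d \<Rightarrow> real^'d \<Rightarrow> real) \<Rightarrow> nat \<Rightarrow> real^'d \<Rightarrow> (nat \<Rightarrow> real^'d) \<Rightarrow> ennreal" where
  "\<Theta> b s x y = (\<integral>\<^sup>+t. ennreal (\<bar>b x t\<bar>^2) \<partial>lborel) + ennreal (\<bar>b x (y s)\<bar>^2) + (\<integral>\<^sup>+t. ennreal (\<bar>b x t\<bar>^1) \<partial>lborel)^2"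

text \<open>How the set of labels that have occurred and will occur again changes from A to A'
  when the scatterer s is met: for the first time (not last), in between, for the last time,
  or only once.\<close>
definition label_step :: "nat \<Rightarrow> bool \<Rightarrow> nat set \<Rightarrow> nat set \<Rightarrow> bool" where
  "label_step s lst A A' \<longleftrightarrow> (if lst then (A = insert s A' \<or> A' = A) \<and> s \<notin> A' else A' = insert s A)"

lemma nn_eq: "nn A u = (\<integral>\<^sup>+(x, y). ennreal ((cmod (u x y))^2) \<partial>(lborel \<Otimes>\<^sub>M PY A))"
  unfolding nn_def nsq_def by (intro nn_integral_cong) auto

lemma YY_coord[measurable]: "(\<lambda>y. y k) \<in> YY \<rightarrow>\<^sub>M borel"
  by (rule measurable_component_singleton) simp

text \<open>Points of \<open>PY A\<close> are extensional, so a coordinate outside A is the constant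
  \<open>undefined\<close>.\<close>

lemma PY_coord[measurable]: "(\<lambda>y. y k) \<in> PY A \<rightarrow>\<^sub>M (borel :: (real^'d) measure)"
proof (cases "k \<in> A")
  case True
  then show ?thesis using measurable_component_singleton[of k A "\<lambda>_. lborel :: (real^'d) measure"] by simp
next
  case False
  have "(\<lambda>y. y k) \<in> PY A \<rightarrow>\<^sub>M (borel :: (real^'d) measure) \<longleftrightarrow> (\<lambda>y. undefined :: real^'d) \<in> (PY A :: (nat \<Rightarrow> real^'d) measure) \<rightarrow>\<^sub>M borel"
    using False by (intro measurable_cong) (auto simp: space_PiM PiE_def extensional_def)
  then show ?thesis by simp
qed

lemma measurable_YY:
  assumes "\<And>k. (\<lambda>m. c m k) \<in> M \<rightarrow>\<^sub>M borel"
  shows "c \<in> M \<rightarrow>\<^sub>M YY"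
  using measurable_PiM_single'[of UNIV "\<lambda>k m. c m k" M "\<lambda>_. borel"] assms by auto

lemma PY_YY: "(\<lambda>y. y) \<in> PY A \<rightarrow>\<^sub>M YY"
  by (rule measurable_YY) simp

lemma measurable_YY_upd[measurable (raw)]:
  assumes "f \<in> M \<rightarrow>\<^sub>M YY" "g \<in> M \<rightarrow>\<^sub>M borel"
  shows "(\<lambda>m. (f m)(s := g m)) \<in> M \<rightarrow>\<^sub>M YY"
proof (rule measurable_YY)
  fix k
  have "(\<lambda>m. f m k) \<in> M \<rightarrow>\<^sub>M borel" using measurable_compose[OF assms(1) YY_coord[of k]] .
  with assms(2) show "(\<lambda>m. ((f m)(s := g m)) k) \<in> M \<rightarrow>\<^sub>M borel" by (cases "k = s") simp_all
qed

lemma YY_comp: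
  assumes "(\<lambda>(x, y). u x y) \<in> borel_measurable (borel \<Otimes>\<^sub>M YY)" "f \<in> M \<rightarrow>\<^sub>M borel" "g \<in> M \<rightarrow>\<^sub>M YY"
  shows "(\<lambda>m. u (f m) (g m)) \<in> borel_measurable M"
  using measurable_compose[OF measurable_Pair[OF assms(2,3)] assms(1)] by simp

lemma stf_measurable:
  "stf A u \<Longrightarrow> f \<in> M \<rightarrow>\<^sub>M borel \<Longrightarrow> g \<in> M \<rightarrow>\<^sub>M YY \<Longrightarrow> (\<lambda>m. u (f m) (g m)) \<in> borel_measurable M"
  unfolding stf_def by (rule YY_comp[of u f M g]) (elim conjE)

lemma stf_pair_measurable:
  assumes "stf A' u" shows "(\<lambda>(x, y). u x y) \<in> borel_measurable (lborel \<Otimes>\<^sub>M PY A)"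
proof -
  have "(\<lambda>m. u (fst m) (snd m)) \<in> borel_measurable (lborel \<Otimes>\<^sub>M PY A)"
    by (rule stf_measurable[OF assms]) (auto intro: measurable_compose[OF measurable_snd PY_YY])
  then show ?thesis by (simp add: case_prod_beta)
qed

lemma stf_cong: "stf A u \<Longrightarrow> (\<And>k. k \<in> A \<Longrightarrow> y k = y' k) \<Longrightarrow> u x y = u x y'"
  by (simp add: stf_def)

lemma stf_indep: "stf A u \<Longrightarrow> s \<notin> A \<Longrightarrow> u x (y(s := t)) = u x y"
  unfolding stf_def by (metis fun_upd_apply)

lemma stf_sub: "stf A u \<Longrightarrow> stf A v \<Longrightarrow> stf A (\<lambda>x y. u x y - v x y)"
  unfolding stf_def by (auto simp: case_prod_beta) metis

lemma stf_Wop: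
  fixes u :: "real^'d \<Rightarrow> (nat \<Rightarrow> real^'d) \<Rightarrow> complex"
  assumes u: "stf A u" and b[measurable]: "(\<lambda>(x, t). b x t) \<in> borel_measurable (borel \<Otimes>\<^sub>M borel)" and tr: "label_step s lst A A'"
  shows "stf A' (Wop b s lst u)"
proof -
  have "(\<lambda>(x, y). Wop b s lst u x y) \<in> borel_measurable (borel \<Otimes>\<^sub>M YY)"
  proof (cases lst)
    case True
    have "(\<lambda>m. u (fst (fst m)) ((snd (fst m))(s := snd m))) \<in> borel_measurable ((borel \<Otimes>\<^sub>M YY) \<Otimes>\<^sub>M lborel)"
      by (rule stf_measurable[OF u]) measurable
    then have [measurable]: "(\<lambda>(m, t). complex_of_real (b (fst m) t) * u (fst m) ((snd m)(s := t))) \<in> borel_measurable ((borel \<Otimes>\<^sub>M YY) \<Otimes>\<^sub>M lborel)"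
      unfolding case_prod_beta by measurable
    have "(\<lambda>m. \<integral>t. complex_of_real (b (fst m) t) * u (fst m) ((snd m)(s := t)) \<partial>lborel) \<in> borel_measurable (borel \<Otimes>\<^sub>M YY)"
      by measurable
    then show ?thesis using True by (simp add: Wop_def case_prod_beta)
  next
    case False
    have [measurable]: "(\<lambda>m. u (fst m) (snd m)) \<in> borel_measurable (borel \<Otimes>\<^sub>M YY)"
      by (rule stf_measurable[OF u]) measurable
    have "(\<lambda>m. complex_of_real (b (fst m) (snd m s)) * u (fst m) (snd m)) \<in> borel_measurable (borel \<Otimes>\<^sub>M YY)" by measurable
    then show ?thesis using False by (simp add: Wop_def case_prod_beta)
  qed
  moreover have "Wop b s lst u x y = Wop b s lst u x y'" if "\<forall>k\<in>A'. y k = y' k" for x y y'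
  proof (cases lst)
    case True
    have "u x (y(s := t)) = u x (y'(s := t))" for t
      by (rule stf_cong[OF u]) (use that tr True in \<open>auto simp: label_step_def split: if_splits\<close>)
    then show ?thesis using True by (simp add: Wop_def)
  next
    case False
    have "u x y = u x y'" by (rule stf_cong[OF u]) (use that tr False in \<open>auto simp: label_step_def\<close>)
    moreover have "y s = y' s" using that tr False by (auto simp: label_step_def)
    ultimately
    show ?thesis using False by (simp add: Wop_def)
  qed
  ultimately show ?thesis unfolding stf_def by (intro conjI allI impI)
qed

interpretation PYps: product_sigma_finite "\<lambda>_::nat. lborel :: (real^'d) measure" ..

lemma PY_sigma_finite: "finite A \<Longrightarrow> sigma_finite_measure (PY A)"
  by (rule PYps.sigma_finite)

lemma nn_integral_PY_insert:
  fixes f :: "real^'d \<Rightarrow> (nat \<Rightarrow> real^'d) \<Rightarrow> ennreal"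
  assumes "finite A" "s \<notin> A" and f: "(\<lambda>(x, y). f x y) \<in> borel_measurable (borel \<Otimes>\<^sub>M YY)"
  shows "(\<integral>\<^sup>+(x, y). f x y \<partial>(lborel \<Otimes>\<^sub>M PY (insert s A))) = (\<integral>\<^sup>+(x, y). (\<integral>\<^sup>+t. f x (y(s := t)) \<partial>lborel) \<partial>(lborel \<Otimes>\<^sub>M PY A))"
proof -
  interpret A: sigma_finite_measure "PY A :: (nat \<Rightarrow> real^'d) measure" by (rule PY_sigma_finite) fact
  interpret A': sigma_finite_measure "PY (insert s A) :: (nat \<Rightarrow> real^'d) measure" by (rule PY_sigma_finite) (use assms in simp)
  have m1: "(\<lambda>(x, y). f x y) \<in> borel_measurable (lborel \<Otimes>\<^sub>M PY (insert s A))"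
    unfolding case_prod_beta' by (rule YY_comp[OF f _ measurable_compose[OF measurable_snd PY_YY]]) simp
  have "(\<lambda>m. f (fst (fst m)) ((snd (fst m))(s := snd m))) \<in> borel_measurable ((lborel \<Otimes>\<^sub>M PY A) \<Otimes>\<^sub>M lborel)"
    by (rule YY_comp[OF f]) (auto intro!: measurable_YY_upd measurable_compose[OF measurable_compose[OF measurable_fst measurable_snd] PY_YY])
  then have m2: "(\<lambda>(x, y). \<integral>\<^sup>+t. f x (y(s := t)) \<partial>lborel) \<in> borel_measurable (lborel \<Otimes>\<^sub>M PY A)"
    using lborel.borel_measurable_nn_integral[of "\<lambda>m t. f (fst m) ((snd m)(s := t))" "lborel \<Otimes>\<^sub>M PY A"]
    by (simp add: case_prod_beta)
  have fx: "f x \<in> borel_measurable (PY (insert s A))" for x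
    by (rule YY_comp[OF f measurable_const PY_YY]) simp
  have "(\<integral>\<^sup>+(x, y). f x y \<partial>(lborel \<Otimes>\<^sub>M PY (insert s A))) = (\<integral>\<^sup>+x. \<integral>\<^sup>+y. f x y \<partial>PY (insert s A) \<partial>lborel)"
    using A'.nn_integral_fst[OF m1] by simp
  also have "\<dots> = (\<integral>\<^sup>+x. \<integral>\<^sup>+y. \<integral>\<^sup>+t. f x (y(s := t)) \<partial>lborel \<partial>PY A \<partial>lborel)"
    by (intro nn_integral_cong PYps.product_nn_integral_insert[OF assms(1,2)] fx)
  also have "\<dots> = (\<integral>\<^sup>+(x, y). (\<integral>\<^sup>+t. f x (y(s := t)) \<partial>lborel) \<partial>(lborel \<Otimes>\<^sub>M PY A))"
    using A.nn_integral_fst[OF m2] by simp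
  finally show ?thesis .
qed

lemma \<Theta>_measurable:
  fixes b :: "real^'d \<Rightarrow> real^'d \<Rightarrow> real"
  assumes [measurable]: "(\<lambda>(x, t). b x t) \<in> borel_measurable (borel \<Otimes>\<^sub>M borel)"
  shows "(\<lambda>(x, y). \<Theta> b s x y) \<in> borel_measurable (borel \<Otimes>\<^sub>M YY)"
  unfolding \<Theta>_def by measurable

lemma norm_integral_sq_le:
  fixes f :: "'b \<Rightarrow> complex"
  assumes [measurable]: "c \<in> borel_measurable M" "f \<in> borel_measurable M"
  shows "ennreal ((cmod (\<integral>t. complex_of_real (c t) * f t \<partial>M))^2) \<le> (\<integral>\<^sup>+t. ennreal (\<bar>c t\<bar>^2) \<partial>M) * (\<integral>\<^sup>+t. ennreal ((cmod (f t))^2) \<partial>M)"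
  using ip_le[of "\<lambda>t. complex_of_real (c t)" M f] by (simp add: ip_def nsq_def)

text \<open>The weight stays under the integral so that both a uniform bound and, by dominated
  convergence, convergence of the kernels can be read off. An active s gives a pointwise bound; a
  new s is integrated to the L2 norm of b; a finished s is handled by Cauchy-Schwarz in its own
  variable; and for an s met once, u does not involve the integrated variable and comes out of the
  integral.\<close>

lemma nn_Wop_le:
  fixes u :: "real^'d \<Rightarrow> (nat \<Rightarrow> real^'d) \<Rightarrow> complex"
  assumes u: "stf A u" and fin: "finite A" and b[measurable]: "(\<lambda>(x, t). b x t) \<in> borel_measurable (borel \<Otimes>\<^sub>M borel)" and tr: "label_step s lst A A'"
  shows "nn A' (Wop b s lst u) \<le> (\<integral>\<^sup>+(x, y). \<Theta> b s x y * ennreal ((cmod (u x y))^2) \<partial>(lborel \<Otimes>\<^sub>M PY A))"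
proof -
  note W = stf_Wop[OF u b tr]
  let ?\<theta>2 = "\<lambda>x. \<integral>\<^sup>+t. ennreal (\<bar>b x t\<bar>^2) \<partial>lborel" and ?\<theta>1 = "\<lambda>x. \<integral>\<^sup>+t. ennreal (\<bar>b x t\<bar>^1) \<partial>lborel"
  have um: "(\<lambda>(x, y). ennreal ((cmod (u x y))^2)) \<in> borel_measurable (borel \<Otimes>\<^sub>M YY)"
    using stf_measurable[OF u measurable_fst measurable_snd] by (simp add: case_prod_beta)
  have ut[measurable]: "(\<lambda>t. u x (y(s := t))) \<in> borel_measurable borel" for x y
    by (rule stf_measurable[OF u]) (auto intro!: measurable_YY)
  have bt[measurable]: "b x \<in> borel_measurable borel" for x by measurable
  have eq: "nn A' (Wop b s lst u) = (\<integral>\<^sup>+(x, y). ennreal ((cmod (Wop b s lst u x y))^2) \<partial>(lborel \<Otimes>\<^sub>M PY A'))"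
    by (rule nn_eq)
  consider (mid) "\<not> lst" "s \<in> A" | (new) "\<not> lst" "s \<notin> A" | (fin) "lst" "A = insert s A'" "s \<notin> A'" | (single) "lst" "A' = A" "s \<notin> A"
    using tr by (auto simp: label_step_def split: if_splits)
  then show ?thesis
  proof cases
    case mid
    then have A': "A' = A" using tr by (auto simp: label_step_def)
    show ?thesis unfolding eq unfolding A'
    proof (rule nn_integral_mono, clarify)
      fix x y
      have "ennreal ((cmod (Wop b s lst u x y))^2) = ennreal (\<bar>b x (y s)\<bar>^2) * ennreal ((cmod (u x y))^2)"
        using mid by (simp add: Wop_def norm_mult power_mult_distrib ennreal_mult)
      also have "\<dots> \<le> \<Theta> b s x y * ennreal ((cmod (u x y))^2)"
        by (intro mult_right_mono) (auto simp: \<Theta>_def add.assoc intro: add_increasing add_increasing2)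
      finally show "ennreal ((cmod (Wop b s lst u x y))^2) \<le> \<Theta> b s x y * ennreal ((cmod (u x y))^2)" .
    qed
  next
    case new
    then have A': "A' = insert s A" using tr by (auto simp: label_step_def)
    have m: "(\<lambda>(x, y). ennreal ((cmod (Wop b s lst u x y))^2)) \<in> borel_measurable (borel \<Otimes>\<^sub>M YY)"
      using stf_measurable[OF W measurable_fst measurable_snd] by (simp add: case_prod_beta)
    have "nn A' (Wop b s lst u) = (\<integral>\<^sup>+(x, y). (\<integral>\<^sup>+t. ennreal ((cmod (Wop b s lst u x (y(s := t))))^2) \<partial>lborel) \<partial>(lborel \<Otimes>\<^sub>M PY A))"
      unfolding eq unfolding A' by (rule nn_integral_PY_insert[OF fin new(2) m])
    also have "\<dots> \<le> (\<integral>\<^sup>+(x, y). \<Theta> b s x y * ennreal ((cmod (u x y))^2) \<partial>(lborel \<Otimes>\<^sub>M PY A))"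
    proof (rule nn_integral_mono, clarify)
      fix x y
      have "(\<integral>\<^sup>+t. ennreal ((cmod (Wop b s lst u x (y(s := t))))^2) \<partial>lborel) = (\<integral>\<^sup>+t. ennreal (\<bar>b x t\<bar>^2) * ennreal ((cmod (u x y))^2) \<partial>lborel)"
        using new by (simp add: Wop_def norm_mult power_mult_distrib ennreal_mult stf_indep[OF u])
      also have "\<dots> = ?\<theta>2 x * ennreal ((cmod (u x y))^2)" using bt[of x] by (intro nn_integral_multc) simp
      also have "\<dots> \<le> \<Theta> b s x y * ennreal ((cmod (u x y))^2)"
        by (intro mult_right_mono) (auto simp: \<Theta>_def add.assoc intro: add_increasing2)
      finally show "(\<integral>\<^sup>+t. ennreal ((cmod (Wop b s lst u x (y(s := t))))^2) \<partial>lborel) \<le> \<Theta> b s x y * ennreal ((cmod (u x y))^2)" .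
    qed
    finally show ?thesis .
  next
    case fin
    have fA: "finite A'" using fin assms(2) by simp
    have m: "(\<lambda>(x, y). \<Theta> b s x y * ennreal ((cmod (u x y))^2)) \<in> borel_measurable (borel \<Otimes>\<^sub>M YY)"
      using borel_measurable_times_ennreal[OF \<Theta>_measurable[OF b] um, of s] by (simp add: case_prod_beta)
    have "nn A' (Wop b s lst u) \<le> (\<integral>\<^sup>+(x, y). (\<integral>\<^sup>+t. \<Theta> b s x (y(s := t)) * ennreal ((cmod (u x (y(s := t))))^2) \<partial>lborel) \<partial>(lborel \<Otimes>\<^sub>M PY A'))"
      unfolding eq
    proof (rule nn_integral_mono, clarify)
      fix x y
      have "ennreal ((cmod (Wop b s lst u x y))^2) \<le> ?\<theta>2 x * (\<integral>\<^sup>+t. ennreal ((cmod (u x (y(s := t))))^2) \<partial>lborel)"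
        using fin norm_integral_sq_le[of "b x" lborel "\<lambda>t. u x (y(s := t))"] by (simp add: Wop_def)
      also have "\<dots> = (\<integral>\<^sup>+t. ?\<theta>2 x * ennreal ((cmod (u x (y(s := t))))^2) \<partial>lborel)"
        using ut[of x y] by (intro nn_integral_cmult[symmetric]) simp
      also have "\<dots> \<le> (\<integral>\<^sup>+t. \<Theta> b s x (y(s := t)) * ennreal ((cmod (u x (y(s := t))))^2) \<partial>lborel)"
        by (intro nn_integral_mono mult_right_mono) (auto simp: \<Theta>_def add.assoc intro: add_increasing2)
      finally show "ennreal ((cmod (Wop b s lst u x y))^2) \<le> (\<integral>\<^sup>+t. \<Theta> b s x (y(s := t)) * ennreal ((cmod (u x (y(s := t))))^2) \<partial>lborel)" .
    qed
    also have "\<dots> = (\<integral>\<^sup>+(x, y). \<Theta> b s x y * ennreal ((cmod (u x y))^2) \<partial>(lborel \<Otimes>\<^sub>M PY A))"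
      unfolding fin(2) by (rule nn_integral_PY_insert[OF fA fin(3) m, symmetric])
    finally show ?thesis .
  next
    case single
    show ?thesis unfolding eq unfolding single(2)
    proof (rule nn_integral_mono, clarify)
      fix x y
      have "Wop b s lst u x y = (\<integral>t. complex_of_real (b x t) \<partial>lborel) * u x y"
        using single by (simp add: Wop_def stf_indep[OF u])
      then have "ennreal ((cmod (Wop b s lst u x y))^2) = (ennreal (cmod (\<integral>t. complex_of_real (b x t) \<partial>lborel)))^2 * ennreal ((cmod (u x y))^2)"
        by (simp add: norm_mult power_mult_distrib ennreal_mult ennreal_power)
      also have "\<dots> \<le> (?\<theta>1 x)^2 * ennreal ((cmod (u x y))^2)"
      proof (intro mult_right_mono power_mono)
        show "ennreal (cmod (\<integral>t. complex_of_real (b x t) \<partial>lborel)) \<le> ?\<theta>1 x"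
        proof (cases "integrable lborel (\<lambda>t. complex_of_real (b x t))")
          case True
          from integral_norm_bound_ennreal[OF True] show ?thesis by simp
        next
          case False
          then have "(\<integral>t. complex_of_real (b x t) \<partial>lborel) = 0" by (rule not_integrable_integral_eq)
          then show ?thesis by (simp only: norm_zero ennreal_0 zero_le)
        qed
      qed auto
      also have "\<dots> \<le> \<Theta> b s x y * ennreal ((cmod (u x y))^2)"
        by (intro mult_right_mono) (auto simp: \<Theta>_def intro: add_increasing)
      finally show "ennreal ((cmod (Wop b s lst u x y))^2) \<le> \<Theta> b s x y * ennreal ((cmod (u x y))^2)" .
    qed
  qed
qed

lemma nn_Wop_bound:
  fixes u :: "real^'d \<Rightarrow> (nat \<Rightarrow> real^'d) \<Rightarrow> complex"
  assumes u: "stf A u" and "finite A" "(\<lambda>(x, t). b x t) \<in> borel_measurable (borel \<Otimes>\<^sub>M borel)" "label_step s lst A A'"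
    and \<kappa>: "\<And>x y. \<Theta> b s x y \<le> \<kappa>"
  shows "nn A' (Wop b s lst u) \<le> \<kappa> * nn A u"
proof -
  have "nn A' (Wop b s lst u) \<le> (\<integral>\<^sup>+(x, y). \<Theta> b s x y * ennreal ((cmod (u x y))^2) \<partial>(lborel \<Otimes>\<^sub>M PY A))"
    by (rule nn_Wop_le) fact+
  also have "\<dots> \<le> (\<integral>\<^sup>+w. \<kappa> * (case w of (x, y) \<Rightarrow> ennreal ((cmod (u x y))^2)) \<partial>(lborel \<Otimes>\<^sub>M PY A))"
    by (intro nn_integral_mono) (auto intro!: mult_right_mono \<kappa>)
  also have "\<dots> = \<kappa> * nn A u"
    using stf_pair_measurable[OF u, of A] unfolding nn_eq by (intro nn_integral_cmult) (simp add: case_prod_beta)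
  finally show ?thesis .
qed

text \<open>The kernels tend to 0 pointwise in \<Theta>, not uniformly. Hence u is kept fixed and
  dominated convergence is applied, with \<kappa> times the squared modulus of u as
  majorant.\<close>

lemma nn_Wop_tendsto_0:
  fixes u :: "real^'d \<Rightarrow> (nat \<Rightarrow> real^'d) \<Rightarrow> complex"
  assumes u: "stf A u" and fA: "finite A" and fin: "nn A u < \<top>"
    and b: "\<And>k::nat. (\<lambda>(x, t). b k x t) \<in> borel_measurable (borel \<Otimes>\<^sub>M borel)" and tr: "label_step s lst A A'"
    and \<kappa>: "\<And>k x y. \<Theta> (b k) s x y \<le> \<kappa>" "\<kappa> < \<top>" and lim: "\<And>x y. (\<lambda>k. \<Theta> (b k) s x y) \<longlonglongrightarrow> 0"
  shows "(\<lambda>k. nn A' (Wop (b k) s lst u)) \<longlonglongrightarrow> 0"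
proof -
  let ?M = "(lborel :: (real^'d) measure) \<Otimes>\<^sub>M (PY A :: (nat \<Rightarrow> real^'d) measure)" and ?u = "\<lambda>(x, y). ennreal ((cmod (u x y))^2)"
  have um: "?u \<in> borel_measurable ?M"
    using stf_pair_measurable[OF u, of A] by (simp add: case_prod_beta)
  have "(\<lambda>k. \<integral>\<^sup>+w. (case w of (x, y) \<Rightarrow> \<Theta> (b k) s x y * ennreal ((cmod (u x y))^2)) \<partial>?M) \<longlonglongrightarrow> (\<integral>\<^sup>+w. 0 \<partial>?M)"
  proof (rule nn_integral_dominated_convergence[where w = "\<lambda>w. \<kappa> * ?u w"])
    show "(\<lambda>w. case w of (x, y) \<Rightarrow> \<Theta> (b k) s x y * ennreal ((cmod (u x y))^2)) \<in> borel_measurable ?M" for k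
    proof -
      have "(\<lambda>m. \<Theta> (b k) s (fst m) (snd m)) \<in> borel_measurable ?M"
        by (rule YY_comp[OF \<Theta>_measurable[OF b] _ measurable_compose[OF measurable_snd PY_YY]]) simp
      then show ?thesis using um unfolding case_prod_beta' by (rule borel_measurable_times_ennreal)
    qed
    show "(\<lambda>w. \<kappa> * ?u w) \<in> borel_measurable ?M" using um by simp
    show "AE w in ?M. (case w of (x, y) \<Rightarrow> \<Theta> (b k) s x y * ennreal ((cmod (u x y))^2)) \<le> \<kappa> * ?u w" for k
      by (intro AE_I2) (auto intro!: mult_right_mono \<kappa>)
    show "(\<integral>\<^sup>+w. \<kappa> * ?u w \<partial>?M) < \<infinity>"
      using fin \<kappa>(2) um unfolding nn_eq by (simp add: nn_integral_cmult ennreal_mult_less_top)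
    show "AE w in ?M. (\<lambda>k. case w of (x, y) \<Rightarrow> \<Theta> (b k) s x y * ennreal ((cmod (u x y))^2)) \<longlonglongrightarrow> 0"
    proof (intro AE_I2, clarify)
      fix x y
      show "(\<lambda>k. \<Theta> (b k) s x y * ennreal ((cmod (u x y))^2)) \<longlonglongrightarrow> 0"
        using ennreal_tendsto_cmult[OF _ lim, of "ennreal ((cmod (u x y))^2)" x y] by (simp add: mult.commute)
    qed
  qed simp
  then show ?thesis
    by (intro ennreal_tendsto_0_le[OF _ nn_Wop_le[OF u fA b tr]]) simp
qed

text \<open>Additivity of the integral at the last meeting needs integrability in t, since a
  non-integrable function has Bochner integral 0. If s was met before, Cauchy-Schwarz gives it for
  almost every remaining argument.\<close>

lemma Wop_integrable_AE:
  fixes u :: "real^'d \<Rightarrow> (nat \<Rightarrow> real^'d) \<Rightarrow> complex"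
  assumes u: "stf A u" and fA: "finite A" and fin: "nn A u < \<top>"
    and b: "(\<lambda>(x, t). b x t) \<in> borel_measurable (borel \<Otimes>\<^sub>M borel)" and tr: "label_step s True A A'"
    and \<kappa>: "\<And>x y. \<Theta> b s x y < \<top>"
  shows "AE w in lborel \<Otimes>\<^sub>M PY A'. integrable lborel (\<lambda>t. complex_of_real (b (fst w) t) * u (fst w) ((snd w)(s := t)))"
proof -
  have ut[measurable]: "(\<lambda>t. u x (y(s := t))) \<in> borel_measurable borel" for x y
    by (rule stf_measurable[OF u]) (auto intro!: measurable_YY)
  have bt[measurable]: "b x \<in> borel_measurable borel" for x using b by measurable
  \<comment> \<open>These two integrals do not involve y, so any value of y may be inserted.\<close>
  have \<theta>: "(\<integral>\<^sup>+t. ennreal (\<bar>b x t\<bar>^2) \<partial>lborel) < \<top>" "(\<integral>\<^sup>+t. ennreal (\<bar>b x t\<bar>^1) \<partial>lborel) < \<top>" for x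
    using \<kappa>[of x undefined] by (auto simp: \<Theta>_def power2_eq_square[of "integral\<^sup>N _ _"] ennreal_mult_less_top)
  consider (fin) "A = insert s A'" "s \<notin> A'" | (single) "A' = A" "s \<notin> A"
    using tr by (auto simp: label_step_def)
  then show ?thesis
  proof cases
    case fin
    have fA': "finite A'" using fin fA by simp
    have m: "(\<lambda>(x, y). ennreal ((cmod (u x y))^2)) \<in> borel_measurable (borel \<Otimes>\<^sub>M YY)"
      using stf_measurable[OF u measurable_fst measurable_snd] by (simp add: case_prod_beta)
    have "nn A u = (\<integral>\<^sup>+(x, y). (\<integral>\<^sup>+t. ennreal ((cmod (u x (y(s := t))))^2) \<partial>lborel) \<partial>(lborel \<Otimes>\<^sub>M PY A'))"
      unfolding nn_eq fin(1) by (rule nn_integral_PY_insert[OF fA' fin(2) m])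
    then have "(\<integral>\<^sup>+w. (\<integral>\<^sup>+t. ennreal ((cmod (u (fst w) ((snd w)(s := t))))^2) \<partial>lborel) \<partial>(lborel \<Otimes>\<^sub>M PY A')) \<noteq> \<infinity>"
      using assms(3) by (simp add: case_prod_beta')
    moreover have "(\<lambda>w. \<integral>\<^sup>+t. ennreal ((cmod (u (fst w) ((snd w)(s := t))))^2) \<partial>lborel) \<in> borel_measurable (lborel \<Otimes>\<^sub>M PY A')"
    proof -
      have "(\<lambda>m. u (fst (fst m)) ((snd (fst m))(s := snd m))) \<in> borel_measurable ((lborel \<Otimes>\<^sub>M PY A') \<Otimes>\<^sub>M lborel)"
        by (rule stf_measurable[OF u]) (auto intro!: measurable_YY_upd measurable_compose[OF measurable_compose[OF measurable_fst measurable_snd] PY_YY])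
      then show ?thesis
        by (intro lborel.borel_measurable_nn_integral) (simp add: case_prod_beta')
    qed
    ultimately have "AE w in lborel \<Otimes>\<^sub>M PY A'. (\<integral>\<^sup>+t. ennreal ((cmod (u (fst w) ((snd w)(s := t))))^2) \<partial>lborel) \<noteq> \<infinity>"
      by (intro nn_integral_PInf_AE)
    then show ?thesis
    proof eventually_elim
      fix w assume "(\<integral>\<^sup>+t. ennreal ((cmod (u (fst w) ((snd w)(s := t))))^2) \<partial>lborel) \<noteq> \<infinity>"
      then have "nsq lborel (\<lambda>t. u (fst w) ((snd w)(s := t))) < \<top>" by (simp add: nsq_def less_top)
      then have "integrable lborel (\<lambda>t. cnj (complex_of_real (b (fst w) t)) * u (fst w) ((snd w)(s := t)))"
        using \<theta>(1)[of "fst w"] by (intro integrable_cnj_mult) (auto simp: nsq_def)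
      then show "integrable lborel (\<lambda>t. complex_of_real (b (fst w) t) * u (fst w) ((snd w)(s := t)))" by simp
    qed
  next
    case single
    show ?thesis
    proof (rule AE_I2)
      fix w :: "(real^'d) \<times> (nat \<Rightarrow> real^'d)"
      have "integrable lborel (\<lambda>t. complex_of_real (b (fst w) t))"
        using \<theta>(2)[of "fst w"] by (auto simp: integrable_iff_bounded)
      then show "integrable lborel (\<lambda>t. complex_of_real (b (fst w) t) * u (fst w) ((snd w)(s := t)))"
        by (simp add: stf_indep[OF u single(2)])
    qed
  qed
qed

lemma Wop_diff_AE:
  fixes u v :: "real^'d \<Rightarrow> (nat \<Rightarrow> real^'d) \<Rightarrow> complex"
  assumes u: "stf A u" and v: "stf A v" and fA: "finite A" and fin: "nn A u < \<top>" "nn A v < \<top>"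
    and b: "(\<lambda>(x, t). b x t) \<in> borel_measurable (borel \<Otimes>\<^sub>M borel)" "(\<lambda>(x, t). c x t) \<in> borel_measurable (borel \<Otimes>\<^sub>M borel)"
    and tr: "label_step s lst A A'" and \<kappa>: "\<And>x y. \<Theta> b s x y < \<top>" "\<And>x y. \<Theta> c s x y < \<top>"
  shows "AE w in lborel \<Otimes>\<^sub>M PY A'. Wop b s lst v (fst w) (snd w) - Wop c s lst u (fst w) (snd w)
    = Wop b s lst (\<lambda>x y. v x y - u x y) (fst w) (snd w) + Wop (\<lambda>x t. b x t - c x t) s lst u (fst w) (snd w)"
proof (cases lst)
  case False
  then show ?thesis by (auto simp: Wop_def algebra_simps)
next
  case True
  note tr = tr[unfolded True[THEN eqTrueI]]
  from Wop_integrable_AE[OF v fA fin(2) b(1) tr \<kappa>(1)] Wop_integrable_AE[OF u fA fin(1) b(1) tr \<kappa>(1)] Wop_integrable_AE[OF u fA fin(1) b(2) tr \<kappa>(2)]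
  show ?thesis
  proof eventually_elim
    fix w :: "(real^'d) \<times> (nat \<Rightarrow> real^'d)"
    assume i: "integrable lborel (\<lambda>t. complex_of_real (b (fst w) t) * v (fst w) ((snd w)(s := t)))"
      "integrable lborel (\<lambda>t. complex_of_real (b (fst w) t) * u (fst w) ((snd w)(s := t)))"
      "integrable lborel (\<lambda>t. complex_of_real (c (fst w) t) * u (fst w) ((snd w)(s := t)))"
    show "Wop b s lst v (fst w) (snd w) - Wop c s lst u (fst w) (snd w)
      = Wop b s lst (\<lambda>x y. v x y - u x y) (fst w) (snd w) + Wop (\<lambda>x t. b x t - c x t) s lst u (fst w) (snd w)"
      using True i by (simp add: Wop_def left_diff_distrib right_diff_distrib)
  qed
qed

text \<open>Write W_b v - W_c u = W_b (v - u) + W_(b - c) u. In the first term a bounded operator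
  meets a null sequence; in the second u is fixed and \<open>nn_Wop_tendsto_0\<close>
  applies.\<close>

lemma nn_Wop_tendsto:
  fixes u :: "real^'d \<Rightarrow> (nat \<Rightarrow> real^'d) \<Rightarrow> complex"
  assumes u: "stf A u" and v: "\<And>k. stf A (v k)" and fA: "finite A" and fin: "nn A u < \<top>" "\<And>k. nn A (v k) < \<top>"
    and b: "\<And>k::nat. (\<lambda>(x, t). b k x t) \<in> borel_measurable (borel \<Otimes>\<^sub>M borel)" "(\<lambda>(x, t). c x t) \<in> borel_measurable (borel \<Otimes>\<^sub>M borel)"
    and tr: "label_step s lst A A'" and \<kappa>: "\<And>k x y. \<Theta> (b k) s x y \<le> \<kappa>" "\<And>x y. \<Theta> c s x y \<le> \<kappa>" "\<And>k x y. \<Theta> (\<lambda>x t. b k x t - c x t) s x y \<le> \<kappa>" "\<kappa> < \<top>"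
    and blim: "\<And>x y. (\<lambda>k. \<Theta> (\<lambda>x t. b k x t - c x t) s x y) \<longlonglongrightarrow> 0"
    and lim: "(\<lambda>k. nn A (\<lambda>x y. v k x y - u x y)) \<longlonglongrightarrow> 0"
  shows "(\<lambda>k. nn A' (\<lambda>x y. Wop (b k) s lst (v k) x y - Wop c s lst u x y)) \<longlonglongrightarrow> 0"
proof -
  have d: "(\<lambda>(x, t). b k x t - c x t) \<in> borel_measurable (borel \<Otimes>\<^sub>M borel)" for k
    using borel_measurable_diff[OF b(1)[of k] b(2)] by (simp add: case_prod_beta')
  have "nn A' (\<lambda>x y. Wop (b k) s lst (v k) x y - Wop c s lst u x y)
    \<le> 2 * (\<kappa> * nn A (\<lambda>x y. v k x y - u x y)) + 2 * nn A' (Wop (\<lambda>x t. b k x t - c x t) s lst u)" for k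
  proof -
    let ?f = "\<lambda>w. Wop (b k) s lst (\<lambda>x y. v k x y - u x y) (fst w) (snd w)" and ?g = "\<lambda>w. Wop (\<lambda>x t. b k x t - c x t) s lst u (fst w) (snd w)"
    note W1 = stf_Wop[OF stf_sub[OF v[of k] u] b(1)[of k] tr] and W2 = stf_Wop[OF u d[of k] tr]
    have "nn A' (\<lambda>x y. Wop (b k) s lst (v k) x y - Wop c s lst u x y) = nsq (lborel \<Otimes>\<^sub>M PY A') (\<lambda>w. ?f w + ?g w)"
      unfolding nn_def nsq_def
    proof (rule nn_integral_cong_AE)
      have "AE w in lborel \<Otimes>\<^sub>M PY A'. Wop (b k) s lst (v k) (fst w) (snd w) - Wop c s lst u (fst w) (snd w) = ?f w + ?g w"
        by (intro Wop_diff_AE[OF u v fA fin b tr] le_less_trans[OF \<kappa>(1) \<kappa>(4)] le_less_trans[OF \<kappa>(2) \<kappa>(4)])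
      then show "AE w in lborel \<Otimes>\<^sub>M PY A'. ennreal ((cmod (case w of (x, y) \<Rightarrow> Wop (b k) s lst (v k) x y - Wop c s lst u x y))^2) = ennreal ((cmod (?f w + ?g w))^2)"
        by eventually_elim (simp add: case_prod_beta')
    qed
    also have "\<dots> \<le> 2 * nsq (lborel \<Otimes>\<^sub>M PY A') ?f + 2 * nsq (lborel \<Otimes>\<^sub>M PY A') ?g"
      using stf_pair_measurable[OF W1, of A'] stf_pair_measurable[OF W2, of A'] by (intro nsq_add_le) (simp_all add: case_prod_beta')
    also have "\<dots> = 2 * nn A' (Wop (b k) s lst (\<lambda>x y. v k x y - u x y)) + 2 * nn A' (Wop (\<lambda>x t. b k x t - c x t) s lst u)"
      by (simp add: nn_def case_prod_beta')
    also have "\<dots> \<le> 2 * (\<kappa> * nn A (\<lambda>x y. v k x y - u x y)) + 2 * nn A' (Wop (\<lambda>x t. b k x t - c x t) s lst u)"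
      by (intro add_right_mono mult_left_mono nn_Wop_bound[OF stf_sub[OF v u] fA b(1) tr] \<kappa>) simp
    finally show ?thesis .
  qed
  note le = this
  have "(\<lambda>k. nn A' (Wop (\<lambda>x t. b k x t - c x t) s lst u)) \<longlonglongrightarrow> 0"
    by (rule nn_Wop_tendsto_0[OF u fA fin(1) d tr \<kappa>(3,4) blim])
  then have "(\<lambda>k. 2 * (\<kappa> * nn A (\<lambda>x y. v k x y - u x y)) + 2 * nn A' (Wop (\<lambda>x t. b k x t - c x t) s lst u)) \<longlonglongrightarrow> 2 * (\<kappa> * 0) + 2 * 0"
    by (intro tendsto_add ennreal_tendsto_cmult lim \<kappa>(4)) auto
  then show ?thesis by (intro ennreal_tendsto_0_le[OF _ le]) simp
qed

section \<open>Patterns of scatterers\<close>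

text \<open>The value of \<sigma> at i stands for the first step at which the scatterer of step i
  was met; hence it is at most i, and \<sigma> is idempotent. On the steps below n, each set
  partition corresponds to exactly one such map.\<close>

definition canon :: "nat \<Rightarrow> (nat \<Rightarrow> nat) \<Rightarrow> bool" where
  "canon n \<sigma> \<longleftrightarrow> (\<forall>i<n. \<sigma> i \<le> i \<and> \<sigma> (\<sigma> i) = \<sigma> i)"

definition act :: "nat \<Rightarrow> (nat \<Rightarrow> nat) \<Rightarrow> nat \<Rightarrow> nat set" where
  "act n \<sigma> i = {s. s < i \<and> (\<exists>j. i \<le> j \<and> j < n \<and> \<sigma> j = s)}"

definition lastp :: "nat \<Rightarrow> (nat \<Rightarrow> nat) \<Rightarrow> nat \<Rightarrow> bool" where
  "lastp n \<sigma> i \<longleftrightarrow> (\<forall>j. i < j \<and> j < n \<longrightarrow> \<sigma> j \<noteq> \<sigma> i)"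

lemma finite_act[simp]: "finite (act n \<sigma> i)" by (auto simp: act_def)

lemma act_0[simp]: "act n \<sigma> 0 = {}" by (auto simp: act_def)

lemma act_n[simp]: "act n \<sigma> n = {}" by (auto simp: act_def)

lemma label_step_act:
  assumes c: "canon n \<sigma>" and i: "i < n"
  shows "label_step (\<sigma> i) (lastp n \<sigma> i) (act n \<sigma> i) (act n \<sigma> (Suc i))"
proof -
  have ci: "\<sigma> i \<le> i" "\<sigma> (\<sigma> i) = \<sigma> i" using c i by (auto simp: canon_def)
  have cj: "\<sigma> j \<le> j" "\<sigma> (\<sigma> j) = \<sigma> j" if "j < n" for j using c that by (auto simp: canon_def)
  have mem: "s \<in> act n \<sigma> (Suc i) \<longleftrightarrow> (if s = \<sigma> i then \<not> lastp n \<sigma> i else s \<in> act n \<sigma> i)" for s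
  proof (cases "s = \<sigma> i")
    case True
    then show ?thesis using ci by (auto simp: act_def lastp_def Suc_le_eq)
  next
    case False
    \<comment> \<open>A label s = i different from \<open>\<sigma> i\<close> cannot occur at a step
      j: idempotence at j would give \<open>\<sigma> i = i\<close>.\<close>
    have "s < i" if "s < Suc i" "j < n" "\<sigma> j = s" for j
      using that cj[of j] ci False by (cases "s = i") auto
    note lt = this
    show ?thesis
    proof
      assume "s \<in> act n \<sigma> (Suc i)"
      then obtain j where "s < Suc i" "Suc i \<le> j" "j < n" "\<sigma> j = s" by (auto simp: act_def)
      with lt[of j] False show "if s = \<sigma> i then \<not> lastp n \<sigma> i else s \<in> act n \<sigma> i"
        by (auto simp: act_def intro!: exI[of _ j])
    next
      assume "if s = \<sigma> i then \<not> lastp n \<sigma> i else s \<in> act n \<sigma> i"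
      then obtain j where j: "s < i" "i \<le> j" "j < n" "\<sigma> j = s" using False by (auto simp: act_def)
      then have "i \<noteq> j" using False by auto
      with j show "s \<in> act n \<sigma> (Suc i)" by (auto simp: act_def intro!: exI[of _ j])
    qed
  qed
  show ?thesis
  proof (cases "lastp n \<sigma> i")
    case True
    then have "act n \<sigma> (Suc i) = act n \<sigma> i - {\<sigma> i}" by (intro set_eqI) (simp add: mem)
    then show ?thesis using True by (auto simp: label_step_def)
  next
    case False
    then have "act n \<sigma> (Suc i) = insert (\<sigma> i) (act n \<sigma> i)" by (intro set_eqI) (simp add: mem)
    then show ?thesis using False by (simp add: label_step_def)
  qed
qed

definition RTs :: "real \<Rightarrow> nat \<Rightarrow> complex \<Rightarrow> (real^'d \<Rightarrow> (nat \<Rightarrow> real^'d) \<Rightarrow> complex) \<Rightarrow> real^'d \<Rightarrow> (nat \<Rightarrow> real^'d) \<Rightarrow> complex" where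
  "RTs L N z u x y = RT L N z (\<lambda>x'. u x' y) x"

lemma RTs_eq_RTy: "(\<lambda>(x, y). RTs L N z u x y) = RTy L N z (\<lambda>(x, y). u x y)"
  by (auto simp: RTs_def RTy_def)

lemma stf_RTs:
  fixes u :: "real^'d \<Rightarrow> (nat \<Rightarrow> real^'d) \<Rightarrow> complex"
  assumes u: "stf A u"
  shows "stf A (RTs L N z u)"
proof -
  have [measurable]: "(\<lambda>(x, y). u x y) \<in> borel_measurable (borel \<Otimes>\<^sub>M YY)" using u by (simp add: stf_def)
  have ipm[measurable]: "(\<lambda>y. ip lborel (ef L p) (\<lambda>x. u x y)) \<in> borel_measurable YY" for p
    unfolding ip_def by measurable
  have "(\<lambda>(x, y). RTs L N z u x y) \<in> borel_measurable (borel \<Otimes>\<^sub>M YY)"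
    unfolding RTs_def RT_def mulop_def by measurable
  moreover have "RTs L N z u x y = RTs L N z u x y'" if "\<forall>k\<in>A. y k = y' k" for x y y'
  proof -
    have "u x' y = u x' y'" for x' by (rule stf_cong[OF u]) (use that in auto)
    then show ?thesis by (simp add: RTs_def)
  qed
  ultimately show ?thesis unfolding stf_def by (intro conjI allI impI)
qed

lemma nn_RTs_le:
  assumes "0 < L" "z \<notin> rpos" "stf A u" "finite A"
  shows "nn A (RTs L N z u) \<le> ennreal ((1 / infdist z rpos)^2) * nn A u"
  unfolding nn_def RTs_eq_RTy
  by (rule nsq_RTy_le[OF PY_sigma_finite[OF assms(4)] assms(1,2) stf_pair_measurable[OF assms(3)]])

text \<open>\<open>PY {}\<close> is a unit mass at a single point and u ignores all positions, so y0
  is arbitrary.\<close>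

lemma nn_empty:
  fixes u :: "real^'d \<Rightarrow> (nat \<Rightarrow> real^'d) \<Rightarrow> complex"
  assumes u: "stf {} u"
  shows "nn {} u = nsq lborel (\<lambda>x. u x y0)"
proof -
  interpret E: sigma_finite_measure "PY {} :: (nat \<Rightarrow> real^'d) measure" by (rule PY_sigma_finite) simp
  have m: "(\<lambda>(x, y). ennreal ((cmod (u x y))^2)) \<in> borel_measurable (lborel \<Otimes>\<^sub>M PY {})"
    using stf_pair_measurable[OF u, of "{}"] by (simp add: case_prod_beta)
  have "nn {} u = (\<integral>\<^sup>+x. \<integral>\<^sup>+y. ennreal ((cmod (u x y))^2) \<partial>PY {} \<partial>lborel)"
    unfolding nn_eq using E.nn_integral_fst[OF m] by simp
  also have "\<dots> = (\<integral>\<^sup>+x. ennreal ((cmod (u x y0))^2) \<partial>lborel)"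
  proof (rule nn_integral_cong)
    fix x
    have "u x (\<lambda>k. undefined) = u x y0" by (rule stf_cong[OF u]) simp
    then show "(\<integral>\<^sup>+y. ennreal ((cmod (u x y))^2) \<partial>PY {}) = ennreal ((cmod (u x y0))^2)"
      by (subst PYps.nn_integral_empty) (auto simp only: zero_le)
  qed
  finally show ?thesis by (simp add: nsq_def)
qed

text \<open>The state after i meetings and the resolvent that follows: positions with labels in
  \<open>act n \<sigma> i\<close> are still variables, and the finished ones have been integrated
  out.\<close>

fun Ust :: "real \<Rightarrow> nat \<Rightarrow> complex \<Rightarrow> (real^'d \<Rightarrow> real) \<Rightarrow> nat \<Rightarrow> (nat \<Rightarrow> nat) \<Rightarrow> (real^'d \<Rightarrow> complex) \<Rightarrow> nat
    \<Rightarrow> real^'d \<Rightarrow> (nat \<Rightarrow> real^'d) \<Rightarrow> complex" where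
  "Ust L N z B n \<sigma> \<psi> 0 = RTs L N z (\<lambda>x y. \<psi> x)"
| "Ust L N z B n \<sigma> \<psi> (Suc i) = RTs L N z (Wop (BL L B) (\<sigma> i) (lastp n \<sigma> i) (Ust L N z B n \<sigma> \<psi> i))"

locale scatterer =
  fixes B :: "real^'d \<Rightarrow> real" and \<beta>0 \<beta>1 \<beta>2 :: real
  assumes B_measurable[measurable]: "B \<in> borel_measurable borel"
    and \<beta>0: "\<And>x. \<bar>B x\<bar> \<le> \<beta>0"
    and \<beta>1: "(\<integral>\<^sup>+s. ennreal (\<bar>B s\<bar>^1) \<partial>lborel) \<le> ennreal \<beta>1"
    and \<beta>2: "(\<integral>\<^sup>+s. ennreal (\<bar>B s\<bar>^2) \<partial>lborel) \<le> ennreal \<beta>2"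
    and \<beta>_nonneg: "0 \<le> \<beta>1" "0 \<le> \<beta>2"
begin

text \<open>The cost of one meeting in squared norm: an upper bound, independent of L, for \<Theta>
  of the periodised and of the limiting kernel.\<close>

definition \<kappa> :: real where "\<kappa> = \<beta>2 + \<beta>0^2 + \<beta>1^2"

lemma \<kappa>_nonneg: "0 \<le> \<kappa>" using \<beta>_nonneg by (simp add: \<kappa>_def)

lemma \<Theta>_le_real:
  assumes "(\<integral>\<^sup>+t. ennreal (\<bar>b x t\<bar>^2) \<partial>lborel) \<le> ennreal c2" "\<bar>b x (y s)\<bar>^2 \<le> c0" "(\<integral>\<^sup>+t. ennreal (\<bar>b x t\<bar>^1) \<partial>lborel) \<le> ennreal c1"
    "0 \<le> c1" "0 \<le> c2" "c2 + c0 + c1^2 \<le> c"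
  shows "\<Theta> b s x y \<le> ennreal c"
proof -
  have "0 \<le> c0" using assms(2) by (rule order_trans[rotated]) simp
  have "\<Theta> b s x y \<le> ennreal c2 + ennreal c0 + (ennreal c1)^2"
    unfolding \<Theta>_def using assms by (intro add_mono power_mono ennreal_leI) auto
  also have "\<dots> = ennreal (c2 + c0 + c1^2)" using assms \<open>0 \<le> c0\<close> by (simp add: ennreal_power ennreal_plus)
  also have "\<dots> \<le> ennreal c" using assms by (intro ennreal_leI)
  finally show ?thesis .
qed

lemma \<Theta>_BL_le: "0 < L \<Longrightarrow> \<Theta> (BL L B) s x y \<le> ennreal \<kappa>"
proof (rule \<Theta>_le_real)
  assume L: "0 < L"
  show "(\<integral>\<^sup>+t. ennreal (\<bar>BL L B x t\<bar>^2) \<partial>lborel) \<le> ennreal \<beta>2"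
    by (rule order_trans[OF nn_integral_BL_le[OF L B_measurable] \<beta>2]) simp
  show "(\<integral>\<^sup>+t. ennreal (\<bar>BL L B x t\<bar>^1) \<partial>lborel) \<le> ennreal \<beta>1"
    by (rule order_trans[OF nn_integral_BL_le[OF L B_measurable] \<beta>1]) simp
  show "\<bar>BL L B x (y s)\<bar>^2 \<le> \<beta>0^2" using \<beta>0 by (intro power_mono abs_BL_le) auto
qed (use \<beta>_nonneg in \<open>auto simp: \<kappa>_def\<close>)

lemma nn_integral_conv_power:
  "(\<integral>\<^sup>+t. ennreal (\<bar>B (x - t)\<bar>^q) \<partial>lborel) = (\<integral>\<^sup>+s. ennreal (\<bar>B s\<bar>^q) \<partial>lborel)"
  by (rule nn_integral_lborel_reflect) measurable

lemma \<Theta>_conv_le: "\<Theta> (\<lambda>x t. B (x - t)) s x y \<le> ennreal \<kappa>"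
proof (rule \<Theta>_le_real)
  show "(\<integral>\<^sup>+t. ennreal (\<bar>B (x - t)\<bar>^2) \<partial>lborel) \<le> ennreal \<beta>2" unfolding nn_integral_conv_power by (rule \<beta>2)
  show "(\<integral>\<^sup>+t. ennreal (\<bar>B (x - t)\<bar>^1) \<partial>lborel) \<le> ennreal \<beta>1" unfolding nn_integral_conv_power by (rule \<beta>1)
  show "\<bar>B (x - y s)\<bar>^2 \<le> \<beta>0^2" using \<beta>0 by (intro power_mono) auto
qed (use \<beta>_nonneg in \<open>auto simp: \<kappa>_def\<close>)

lemma nn_integral_diff_le:
  assumes L: "0 < L" and q: "0 < q" and c: "(\<integral>\<^sup>+s. ennreal (\<bar>B s\<bar>^q) \<partial>lborel) \<le> ennreal c" "0 \<le> c"
  shows "(\<integral>\<^sup>+t. ennreal (\<bar>BL L B x t - B (x - t)\<bar>^q) \<partial>lborel) \<le> ennreal (2^q * (c + c))"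
proof -
  have "(\<integral>\<^sup>+t. ennreal (\<bar>BL L B x t - B (x - t)\<bar>^q) \<partial>lborel) \<le> (\<integral>\<^sup>+t. ennreal (2^q) * (ennreal (\<bar>BL L B x t\<bar>^q) + ennreal (\<bar>B (x - t)\<bar>^q)) \<partial>lborel)"
    by (intro nn_integral_mono)
       (auto simp: ennreal_plus[symmetric] ennreal_mult[symmetric] simp del: ennreal_plus intro!: ennreal_leI abs_diff_power_le)
  also have "\<dots> = ennreal (2^q) * ((\<integral>\<^sup>+t. ennreal (\<bar>BL L B x t\<bar>^q) \<partial>lborel) + (\<integral>\<^sup>+t. ennreal (\<bar>B (x - t)\<bar>^q) \<partial>lborel))"
  proof -
    have [measurable]: "BL L B x \<in> borel_measurable borel" unfolding BL_def[abs_def] by measurable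
    show ?thesis by (simp add: nn_integral_cmult nn_integral_add)
  qed
  also have "\<dots> \<le> ennreal (2^q) * (ennreal c + ennreal c)"
    using nn_integral_BL_le[OF L B_measurable q, of x] c(1)
    by (intro mult_left_mono add_mono) (auto simp: nn_integral_conv_power)
  also have "\<dots> = ennreal (2^q * (c + c))"
    unfolding ennreal_plus[OF c(2) c(2), symmetric] using c(2) by (intro ennreal_mult[symmetric]) auto
  finally show ?thesis .
qed

text \<open>The 16 comes from the L1 term: |a - b| is estimated by 2 (|a| + |b|), which gives the
  square of 4 \<beta>1. The L2 term contributes the factor 8 and the sup term the factor 4.\<close>

lemma \<Theta>_diff_le:
  assumes L: "0 < L" shows "\<Theta> (\<lambda>x t. BL L B x t - B (x - t)) s x y \<le> ennreal (16 * \<kappa>)"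
proof (rule \<Theta>_le_real)
  show "(\<integral>\<^sup>+t. ennreal (\<bar>BL L B x t - B (x - t)\<bar>^2) \<partial>lborel) \<le> ennreal (2^2 * (\<beta>2 + \<beta>2))"
    by (rule nn_integral_diff_le[OF L _ \<beta>2]) (use \<beta>_nonneg in auto)
  show "(\<integral>\<^sup>+t. ennreal (\<bar>BL L B x t - B (x - t)\<bar>^1) \<partial>lborel) \<le> ennreal (2^1 * (\<beta>1 + \<beta>1))"
    by (rule nn_integral_diff_le[OF L _ \<beta>1]) (use \<beta>_nonneg in auto)
  have "\<bar>BL L B x (y s) - B (x - y s)\<bar> \<le> 2 * \<beta>0" using abs_BL_le[of B \<beta>0, OF \<beta>0, where L = L and x = x and t = "y s"] \<beta>0[of "x - y s"] by linarith
  then show "\<bar>BL L B x (y s) - B (x - y s)\<bar>^2 \<le> (2 * \<beta>0)^2" by (intro power_mono) auto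
qed (use \<beta>_nonneg in \<open>auto simp: \<kappa>_def power_mult_distrib\<close>)

lemma \<Theta>_diff_tendsto:
  assumes a: "filterlim a at_top sequentially" "\<And>k. 0 < a k"
  shows "(\<lambda>k. \<Theta> (\<lambda>x t. BL (a k) B x t - B (x - t)) s x y) \<longlonglongrightarrow> 0"
proof -
  have f: "(\<integral>\<^sup>+s. ennreal (\<bar>B s\<bar>^2) \<partial>lborel) < \<top>" "(\<integral>\<^sup>+s. ennreal (\<bar>B s\<bar>^1) \<partial>lborel) < \<top>"
    using \<beta>1 \<beta>2 by (auto intro: le_less_trans)
  have "(\<lambda>k. ennreal (\<bar>BL (a k) B x (y s) - B (x - y s)\<bar>^2)) \<longlonglongrightarrow> 0"
    by (rule tendsto_eventually, rule eventually_mono[OF BL_eventually[OF a, of B x "y s"]]) simp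
  moreover have "(\<lambda>k. (\<integral>\<^sup>+t. ennreal (\<bar>BL (a k) B x t - B (x - t)\<bar>^1) \<partial>lborel)^2) \<longlonglongrightarrow> 0^2"
    unfolding power2_eq_square
    by (intro tendsto_mult_ennreal nn_integral_BL_tendsto[OF a B_measurable _ f(2)]) auto
  ultimately have "(\<lambda>k. \<Theta> (\<lambda>x t. BL (a k) B x t - B (x - t)) s x y) \<longlonglongrightarrow> 0 + 0 + 0^2"
    unfolding \<Theta>_def by (intro tendsto_add nn_integral_BL_tendsto[OF a B_measurable _ f(1)]) auto
  then show ?thesis by simp
qed

text \<open>Each step costs \<kappa> for the meeting and one squared resolvent norm; the resolvent
  applied before the first meeting accounts for the exponent i + 1.\<close>

lemma Ust_stf_bound:
  assumes c: "canon n \<sigma>" and L: "0 < L" and z: "z \<notin> rpos" and \<psi>[measurable]: "\<psi> \<in> borel_measurable borel" and "i \<le> n"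
  shows "stf (act n \<sigma> i) (Ust L N z B n \<sigma> \<psi> i) \<and>
    nn (act n \<sigma> i) (Ust L N z B n \<sigma> \<psi> i) \<le> ennreal (\<kappa>^i * ((1 / infdist z rpos)^2)^(i + 1)) * nsq lborel \<psi>"
  using \<open>i \<le> n\<close>
proof (induction i)
  case 0
  have s: "stf {} (\<lambda>x y. \<psi> x)" unfolding stf_def by simp
  then show ?case using nn_RTs_le[OF L z s] nn_empty[OF s] stf_RTs[OF s] by simp
next
  case (Suc i)
  define d where "d = (1 / infdist z rpos)^2"
  have d0: "0 \<le> d" by (simp add: d_def)
  let ?A = "act n \<sigma> i" and ?u = "Ust L N z B n \<sigma> \<psi> i"
  have IH: "stf ?A ?u" "nn ?A ?u \<le> ennreal (\<kappa>^i * d^(i + 1)) * nsq lborel \<psi>" using Suc by (auto simp: d_def)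
  have tr: "label_step (\<sigma> i) (lastp n \<sigma> i) ?A (act n \<sigma> (Suc i))" using Suc by (intro label_step_act[OF c]) auto
  note W = stf_Wop[OF IH(1) BL_measurable[OF B_measurable, of L] tr]
  have "nn (act n \<sigma> (Suc i)) (Ust L N z B n \<sigma> \<psi> (Suc i)) \<le> ennreal d * nn (act n \<sigma> (Suc i)) (Wop (BL L B) (\<sigma> i) (lastp n \<sigma> i) ?u)"
    unfolding Ust.simps d_def by (rule nn_RTs_le[OF L z W]) simp
  also have "\<dots> \<le> ennreal d * (ennreal \<kappa> * nn ?A ?u)"
    by (intro mult_left_mono nn_Wop_bound[OF IH(1) _ BL_measurable[OF B_measurable] tr] \<Theta>_BL_le L) auto
  also have "\<dots> \<le> ennreal d * (ennreal \<kappa> * (ennreal (\<kappa>^i * d^(i + 1)) * nsq lborel \<psi>))"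
    by (intro mult_left_mono IH) auto
  also have "\<dots> = ennreal (\<kappa>^Suc i * d^(Suc i + 1)) * nsq lborel \<psi>"
    using \<kappa>_nonneg d0 by (simp add: ennreal_mult mult_ac)
  finally show ?case using stf_RTs[OF W] by (simp add: d_def)
qed

lemma restrict_measurable_YY: "(\<lambda>y. restrict y A) \<in> YY \<rightarrow>\<^sub>M (PY A :: (nat \<Rightarrow> real^'d) measure)"
proof -
  have "(\<lambda>y. restrict y A) \<in> YY \<rightarrow>\<^sub>M (PiM A (\<lambda>_. borel) :: (nat \<Rightarrow> real^'d) measure)"
    by (rule measurable_restrict_subset) simp
  also have "YY \<rightarrow>\<^sub>M (PiM A (\<lambda>_. borel) :: (nat \<Rightarrow> real^'d) measure) = YY \<rightarrow>\<^sub>M PY A"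
    by (intro measurable_cong_sets sets_PiM_cong) auto
  finally show ?thesis .
qed

text \<open>An L2 limit lives on \<open>PY A\<close>, whose points are extensional. Composing it
  with \<open>restrict\<close> yields a function of full families that depends on the positions in A
  only.\<close>

lemma stf_of_limit:
  fixes r :: "(real^'d) \<times> (nat \<Rightarrow> real^'d) \<Rightarrow> complex"
  assumes "r \<in> borel_measurable (lborel \<Otimes>\<^sub>M PY A)"
  shows "stf A (\<lambda>x y. r (x, restrict y A))"
    "nn A (\<lambda>x y. v x y - r (x, restrict y A)) = nsq (lborel \<Otimes>\<^sub>M PY A) (\<lambda>w. (case w of (x, y) \<Rightarrow> v x y) - r w)"
proof -
  have "(\<lambda>m. (fst m, restrict (snd m) A)) \<in> borel \<Otimes>\<^sub>M YY \<rightarrow>\<^sub>M lborel \<Otimes>\<^sub>M PY A"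
    by (intro measurable_Pair measurable_compose[OF measurable_snd restrict_measurable_YY]) auto
  from measurable_compose[OF this assms]
  show "stf A (\<lambda>x y. r (x, restrict y A))"
    unfolding stf_def case_prod_beta' by (auto cong: restrict_cong)
  show "nn A (\<lambda>x y. v x y - r (x, restrict y A)) = nsq (lborel \<Otimes>\<^sub>M PY A) (\<lambda>w. (case w of (x, y) \<Rightarrow> v x y) - r w)"
    unfolding nn_def by (intro nsq_cong) (auto simp: space_pair_measure space_PiM)
qed

lemma Ust_convergent:
  fixes a :: "nat \<Rightarrow> real" and Nn :: "nat \<Rightarrow> nat"
  assumes c: "canon n \<sigma>" and a: "filterlim a at_top sequentially" "\<And>k. 0 < a k" and N: "filterlim Nn at_top sequentially"
    and z: "z \<notin> rpos" and \<psi>[measurable]: "\<psi> \<in> borel_measurable borel" and fin: "nsq lborel \<psi> < \<top>" and "i \<le> n"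
  shows "\<exists>u. stf (act n \<sigma> i) u \<and> nn (act n \<sigma> i) u < \<top> \<and> (\<lambda>k. nn (act n \<sigma> i) (\<lambda>x y. Ust (a k) (Nn k) z B n \<sigma> \<psi> i x y - u x y)) \<longlonglongrightarrow> 0"
proof -
  have ufin: "nn (act n \<sigma> j) (Ust (a k) (Nn k) z B n \<sigma> \<psi> j) < \<top>" if "j \<le> n" for j k
    by (rule le_less_trans[OF conjunct2[OF Ust_stf_bound[OF c a(2) z \<psi> that]]]) (use fin in \<open>simp add: ennreal_mult_less_top\<close>)
  \<comment> \<open>One resolvent applied to a convergent sequence of arguments. The induction uses
    this for the first resolvent and then after every \<open>Wop\<close>.\<close>
  have main: "\<exists>u. stf A u \<and> nn A u < \<top> \<and> (\<lambda>k. nn A (\<lambda>x y. RTs (a k) (Nn k) z (v k) x y - u x y)) \<longlonglongrightarrow> 0"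
    if fA: "finite A" and v: "\<And>k. stf A (v k)" "\<And>k. nn A (v k) < \<top>" "\<And>k. nn A (RTs (a k) (Nn k) z (v k)) < \<top>" and u: "stf A u"
      and lim: "(\<lambda>k. nn A (\<lambda>x y. v k x y - u x y)) \<longlonglongrightarrow> 0" for A u and v :: "nat \<Rightarrow> real^'d \<Rightarrow> (nat \<Rightarrow> real^'d) \<Rightarrow> complex"
  proof -
    have lim': "(\<lambda>k. nsq (lborel \<Otimes>\<^sub>M PY A) (\<lambda>w. (case w of (x, y) \<Rightarrow> v k x y) - (case w of (x, y) \<Rightarrow> u x y))) \<longlonglongrightarrow> 0"
      using lim unfolding nn_def by (simp add: case_prod_beta')
    obtain r where r: "r \<in> borel_measurable (lborel \<Otimes>\<^sub>M PY A)"
      and rl: "(\<lambda>k. nsq (lborel \<Otimes>\<^sub>M PY A) (\<lambda>w. RTy (a k) (Nn k) z (\<lambda>(x, y). v k x y) w - r w)) \<longlonglongrightarrow> 0"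
      using RTy_convergent[OF PY_sigma_finite[OF fA] a N z stf_pair_measurable[OF u] stf_pair_measurable[OF v(1)] v(2)[unfolded nn_def] lim'] by blast
    let ?u = "\<lambda>x y. r (x, restrict y A)"
    have l: "(\<lambda>k. nn A (\<lambda>x y. RTs (a k) (Nn k) z (v k) x y - ?u x y)) \<longlonglongrightarrow> 0"
      using rl unfolding stf_of_limit(2)[OF r] RTs_eq_RTy .
    have "nsq (lborel \<Otimes>\<^sub>M PY A) (\<lambda>(x, y). ?u x y) < \<top>"
    proof (rule nsq_tendsto_finite)
      show "(\<lambda>(x, y). ?u x y) \<in> borel_measurable (lborel \<Otimes>\<^sub>M PY A)" by (rule stf_pair_measurable[OF stf_of_limit(1)[OF r]])
      show "(\<lambda>(x, y). RTs (a k) (Nn k) z (v k) x y) \<in> borel_measurable (lborel \<Otimes>\<^sub>M PY A)" for k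
        by (rule stf_pair_measurable[OF stf_RTs[OF v(1)]])
      show "nsq (lborel \<Otimes>\<^sub>M PY A) (\<lambda>(x, y). RTs (a k) (Nn k) z (v k) x y) < \<top>" for k using v(3)[of k] by (simp add: nn_def)
      show "(\<lambda>k. nsq (lborel \<Otimes>\<^sub>M PY A) (\<lambda>w. (case w of (x, y) \<Rightarrow> RTs (a k) (Nn k) z (v k) x y) - (case w of (x, y) \<Rightarrow> ?u x y))) \<longlonglongrightarrow> 0"
        using l unfolding nn_def by (simp add: case_prod_beta')
    qed
    then have "nn A ?u < \<top>" by (simp add: nn_def)
    then show ?thesis using l stf_of_limit(1)[OF r] by (intro exI[of _ ?u] conjI)
  qed
  show ?thesis using \<open>i \<le> n\<close>
  proof (induction i)
    case 0
    have s: "stf {} (\<lambda>x y. \<psi> x)" unfolding stf_def by simp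
    have "(\<lambda>k::nat. nn {} (\<lambda>x y. \<psi> x - \<psi> x)) \<longlonglongrightarrow> 0" by (simp add: nn_def nsq_def)
    from main[OF _ s _ _ s this] show ?case
      using nn_empty[OF s] fin ufin[of 0] by simp
  next
    case (Suc i)
    let ?A = "act n \<sigma> i" and ?A' = "act n \<sigma> (Suc i)" and ?v = "\<lambda>k. Ust (a k) (Nn k) z B n \<sigma> \<psi> i"
    let ?s = "\<sigma> i" and ?l = "lastp n \<sigma> i"
    obtain u where u: "stf ?A u" "nn ?A u < \<top>" "(\<lambda>k. nn ?A (\<lambda>x y. ?v k x y - u x y)) \<longlonglongrightarrow> 0" using Suc by auto
    have tr: "label_step ?s ?l ?A ?A'" using Suc by (intro label_step_act[OF c]) auto
    have v: "stf ?A (?v k)" for k using Ust_stf_bound[OF c a(2) z \<psi>, of i k "Nn k"] Suc by simp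
    have vf: "nn ?A (?v k) < \<top>" for k using ufin[of i k] Suc by simp
    have cm: "(\<lambda>(x, t). B (x - t)) \<in> borel_measurable (borel \<Otimes>\<^sub>M borel)" by measurable
    have \<kappa>16: "ennreal \<kappa> \<le> ennreal (16 * \<kappa>)" using \<kappa>_nonneg by (intro ennreal_leI) simp
    have lim: "(\<lambda>k. nn ?A' (\<lambda>x y. Wop (BL (a k) B) ?s ?l (?v k) x y - Wop (\<lambda>x t. B (x - t)) ?s ?l u x y)) \<longlonglongrightarrow> 0"
      by (rule nn_Wop_tendsto[where \<kappa> = "ennreal (16 * \<kappa>)", OF u(1) v _ u(2) vf BL_measurable[OF B_measurable] cm tr])
         (auto intro!: \<Theta>_diff_le \<Theta>_diff_tendsto a u(3) order_trans[OF \<Theta>_BL_le \<kappa>16] order_trans[OF \<Theta>_conv_le \<kappa>16])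
    have Wf: "nn ?A' (Wop (BL (a k) B) ?s ?l (?v k)) < \<top>" for k
      by (rule le_less_trans[OF nn_Wop_bound[OF v _ BL_measurable[OF B_measurable] tr \<Theta>_BL_le[OF a(2)]]])
         (use vf[of k] in \<open>simp_all add: ennreal_mult_less_top\<close>)
    have "\<exists>u. stf ?A' u \<and> nn ?A' u < \<top> \<and> (\<lambda>k. nn ?A' (\<lambda>x y. RTs (a k) (Nn k) z (Wop (BL (a k) B) ?s ?l (?v k)) x y - u x y)) \<longlonglongrightarrow> 0"
      by (rule main[OF _ stf_Wop[OF v BL_measurable[OF B_measurable] tr] Wf _ stf_Wop[OF u(1) cm tr] lim])
         (use ufin[of "Suc i"] Suc.prems in auto)
    then show ?case by simp
  qed
qed

end

section \<open>Integrating over scatterer positions\<close>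

text \<open>The integrand before any positions are identified or integrated: step i has its own
  position w i. Identifications are made by composing w with a pattern or with a label
  sequence.\<close>

fun Qst :: "(real^'d \<Rightarrow> real^'d \<Rightarrow> real) \<Rightarrow> real \<Rightarrow> nat \<Rightarrow> complex \<Rightarrow> (real^'d \<Rightarrow> complex) \<Rightarrow> nat
    \<Rightarrow> real^'d \<Rightarrow> (nat \<Rightarrow> real^'d) \<Rightarrow> complex" where
  "Qst b L N z \<psi> 0 = RTs L N z (\<lambda>x y. \<psi> x)"
| "Qst b L N z \<psi> (Suc i) = RTs L N z (Wop b i False (Qst b L N z \<psi> i))"

lemma stf_Qst:
  assumes "\<psi> \<in> borel_measurable borel" and b: "(\<lambda>(x, t). b x t) \<in> borel_measurable (borel \<Otimes>\<^sub>M borel)"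
  shows "stf UNIV (Qst b L N z \<psi> i)"
proof (induction i)
  case 0
  have "stf UNIV (\<lambda>x y. \<psi> x)" using assms(1) unfolding stf_def by simp
  then show ?case by (simp add: stf_RTs)
next
  case (Suc i)
  then show ?case unfolding Qst.simps by (intro stf_RTs stf_Wop[OF _ b]) (auto simp: label_step_def)
qed

text \<open>Two kernels are allowed because \<open>bw\<close> and \<open>BL\<close> will be
  exchanged at positions inside the box.\<close>

lemma Qst_cong:
  assumes "\<And>x k. k < i \<Longrightarrow> b x (w k) = b' x (w' k)"
  shows "Qst b L N z \<psi> i x w = Qst b' L N z \<psi> i x w'"
  using assms
proof (induction i arbitrary: x)
  case (Suc i)
  have "Wop b i False (Qst b L N z \<psi> i) x' w = Wop b' i False (Qst b' L N z \<psi> i) x' w'" for x'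
    using Suc by (simp add: Wop_def)
  then show ?case by (simp add: RTs_def)
qed (simp add: RTs_def)

lemma nsq_Qst_le:
  assumes L: "0 < L" and z: "z \<notin> rpos" and \<psi>: "\<psi> \<in> borel_measurable borel"
    and b: "(\<lambda>(x, t). b x t) \<in> borel_measurable (borel \<Otimes>\<^sub>M borel)" and c: "\<And>x t. \<bar>b x t\<bar> \<le> c"
  shows "nsq lborel (\<lambda>x. Qst b L N z \<psi> i x w) \<le> ennreal ((c^2)^i * ((1 / infdist z rpos)^2)^(i + 1)) * nsq lborel \<psi>"
proof (induction i)
  case 0
  then show ?case using nsq_RT_le[OF L z \<psi>, of N] by (simp add: RTs_def)
next
  case (Suc i)
  define d where "d = (1 / infdist z rpos)^2"
  have d0: "0 \<le> d" by (simp add: d_def)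
  have q: "(\<lambda>x. Qst b L N z \<psi> i x w) \<in> borel_measurable borel"
    by (rule stf_measurable[OF stf_Qst[OF \<psi> b]]) (auto intro!: measurable_YY)
  have bm: "(\<lambda>x. b x (w i)) \<in> borel_measurable borel" using b by measurable
  have "nsq lborel (\<lambda>x. Qst b L N z \<psi> (Suc i) x w) = nsq lborel (RT L N z (\<lambda>x. complex_of_real (b x (w i)) * Qst b L N z \<psi> i x w))"
    by (simp add: RTs_def Wop_def)
  also have "\<dots> \<le> ennreal d * nsq lborel (\<lambda>x. complex_of_real (b x (w i)) * Qst b L N z \<psi> i x w)"
    unfolding d_def using q bm by (intro nsq_RT_le[OF L z]) measurable
  also have "\<dots> \<le> ennreal d * (ennreal (c^2) * nsq lborel (\<lambda>x. Qst b L N z \<psi> i x w))"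
    using q c by (intro mult_left_mono nsq_mult_le) auto
  also have "\<dots> \<le> ennreal d * (ennreal (c^2) * (ennreal ((c^2)^i * d^(i + 1)) * nsq lborel \<psi>))"
    using Suc by (intro mult_left_mono) (auto simp: d_def)
  also have "\<dots> = ennreal ((c^2)^(Suc i) * d^(Suc i + 1)) * nsq lborel \<psi>"
    using d0 by (simp add: ennreal_mult mult_ac)
  finally show ?case by (simp add: d_def)
qed

text \<open>A truncated resolvent is a finite combination of bounded plane waves, with coefficients
  bounded through Bessel. The constant depends on L and N; it serves to justify Fubini.\<close>

lemma RT_pointwise_bound:
  assumes L: "0 < L"
  shows "\<exists>C. \<forall>f\<in>borel_measurable borel. nsq lborel f \<le> ennreal K \<longrightarrow> (\<forall>x::real^'d. cmod (RT L N z f x) \<le> C)"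
proof -
  let ?m = "\<lambda>p::real^'d. 1 / (complex_of_real (nu p) - z)" and ?s = "1 / sqrt (L ^ CARD('d))"
  have K: "cmod (ip lborel (ef L p) f) \<le> sqrt \<bar>K\<bar>" if f: "f \<in> borel_measurable borel" "nsq lborel f \<le> ennreal K" and p: "p \<in> lat L N" for f p
  proof -
    have "ennreal ((cmod (ip lborel (ef L p) f))^2) = ennreal (\<Sum>q\<in>{p}. (cmod (ip lborel (ef L q) f))^2)" by simp
    also have "\<dots> \<le> nsq lborel f" using p lat_subset f by (intro bessel[OF orthonormal_ef[OF L]]) auto
    also have "\<dots> \<le> ennreal \<bar>K\<bar>" using f(2) by (auto intro: order_trans ennreal_leI)
    finally have "(cmod (ip lborel (ef L p) f))^2 \<le> \<bar>K\<bar>" by simp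
    then show ?thesis by (rule real_le_rsqrt)
  qed
  show ?thesis
  proof (intro exI[of _ "\<Sum>p\<in>(lat L N :: (real^'d) set). cmod (?m p) * sqrt \<bar>K\<bar> * ?s"] ballI impI allI)
    fix f :: "real^'d \<Rightarrow> complex" and x assume f: "f \<in> borel_measurable borel" "nsq lborel f \<le> ennreal K"
    have "cmod (RT L N z f x) \<le> (\<Sum>p\<in>lat L N. cmod (?m p * ip lborel (ef L p) f * ef L p x))"
      unfolding RT_def mulop_def by (rule norm_sum)
    also have "\<dots> \<le> (\<Sum>p\<in>lat L N. cmod (?m p) * sqrt \<bar>K\<bar> * ?s)"
      unfolding norm_mult using K[OF f] norm_ef_le[of L] L by (intro sum_mono mult_mono) auto
    finally show "cmod (RT L N z f x) \<le> (\<Sum>p\<in>lat L N. cmod (?m p) * sqrt \<bar>K\<bar> * ?s)" .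
  qed
qed

lemma Qst_bounded:
  assumes L: "0 < L" and z: "z \<notin> rpos" and \<psi>: "\<psi> \<in> borel_measurable borel" and fin: "nsq lborel \<psi> < \<top>"
    and b: "(\<lambda>(x, t). b x t) \<in> borel_measurable (borel \<Otimes>\<^sub>M borel)" and c: "\<And>x t. \<bar>b x t\<bar> \<le> c"
  shows "\<exists>C. \<forall>(x::real^'d) w. cmod (Qst b L N z \<psi> i x w) \<le> C"
proof (cases i)
  case 0
  obtain K where K: "nsq lborel \<psi> \<le> ennreal K" using fin by (cases "nsq lborel \<psi>") auto
  obtain C where "\<forall>x. cmod (RT L N z \<psi> x) \<le> C"
    using RT_pointwise_bound[OF L, of K N z] \<psi> K by blast
  then show ?thesis using 0 by (auto simp: RTs_def)
next
  case (Suc j)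
  define K0 where "K0 = ennreal (c^2) * (ennreal ((c^2)^j * ((1 / infdist z rpos)^2)^(j + 1)) * nsq lborel \<psi>)"
  have "K0 < \<top>" using fin by (simp add: K0_def ennreal_mult_less_top)
  then obtain K where K: "K0 \<le> ennreal K" by (cases K0) auto
  obtain C where C: "\<And>f (x::real^'d). f \<in> borel_measurable borel \<Longrightarrow> nsq lborel f \<le> ennreal K \<Longrightarrow> cmod (RT L N z f x) \<le> C"
    using RT_pointwise_bound[OF L, of K N z] by blast
  show ?thesis
  proof (intro exI[of _ C] allI)
    fix x w
    have q: "(\<lambda>x. Qst b L N z \<psi> j x w) \<in> borel_measurable borel"
      by (rule stf_measurable[OF stf_Qst[OF \<psi> b]]) (auto intro!: measurable_YY)
    have bm: "(\<lambda>x. b x (w j)) \<in> borel_measurable borel" using b by measurable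
    have "nsq lborel (\<lambda>x. complex_of_real (b x (w j)) * Qst b L N z \<psi> j x w) \<le> ennreal (c^2) * nsq lborel (\<lambda>x. Qst b L N z \<psi> j x w)"
      using q c by (intro nsq_mult_le) auto
    also have "\<dots> \<le> K0" unfolding K0_def by (intro mult_left_mono nsq_Qst_le L z \<psi> b c) simp
    finally have "nsq lborel (\<lambda>x. complex_of_real (b x (w j)) * Qst b L N z \<psi> j x w) \<le> ennreal K" using K by simp
    moreover have "(\<lambda>x. complex_of_real (b x (w j)) * Qst b L N z \<psi> j x w) \<in> borel_measurable borel" using q bm by measurable
    ultimately show "cmod (Qst b L N z \<psi> i x w) \<le> C" using C Suc by (simp add: RTs_def Wop_def)
  qed
qed

text \<open>The plane waves are supported in a box of finite volume and H is bounded, so Fubini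
  applies to each of the finitely many coefficients.\<close>

lemma RT_integral_exchange:
  fixes H :: "real^'d \<Rightarrow> 'm \<Rightarrow> complex"
  assumes L: "0 < L" and M: "prob_space M" and H[measurable]: "(\<lambda>(x, m). H x m) \<in> borel_measurable (borel \<Otimes>\<^sub>M M)"
    and C: "\<And>x m. cmod (H x m) \<le> C"
  shows "RT L N z (\<lambda>x. \<integral>m. H x m \<partial>M) x0 = (\<integral>m. RT L N z (\<lambda>x. H x m) x0 \<partial>M)"
proof -
  interpret M: prob_space M by fact
  interpret P: pair_sigma_finite "lborel :: (real^'d) measure" M ..
  have int: "integrable (lborel \<Otimes>\<^sub>M M) (\<lambda>(x, m). cnj (ef L p x) * H x m)" for p
  proof (rule integrableI_bounded_set[where A = "Lam L \<times> space M" and B = "1 / sqrt (L ^ CARD('d)) * C"])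
    show "Lam L \<times> space M \<in> sets (lborel \<Otimes>\<^sub>M M)" by (intro pair_measureI) auto
    show "(\<lambda>(x, m). cnj (ef L p x) * H x m) \<in> borel_measurable (lborel \<Otimes>\<^sub>M M)" by measurable
    show "emeasure (lborel \<Otimes>\<^sub>M M) (Lam L \<times> space M) < \<infinity>"
      using L by (subst M.emeasure_pair_measure_Times) (auto simp: emeasure_Lam M.emeasure_space_1)
    show "AE w in lborel \<Otimes>\<^sub>M M. w \<in> Lam L \<times> space M \<longrightarrow> norm (case w of (x, m) \<Rightarrow> cnj (ef L p x) * H x m) \<le> 1 / sqrt (L ^ CARD('d)) * C"
    proof (intro AE_I2 impI)
      fix w
      have "cmod (cnj (ef L p (fst w)) * H (fst w) (snd w)) \<le> 1 / sqrt (L ^ CARD('d)) * C"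
        unfolding norm_mult complex_mod_cnj using norm_ef_le[of L p "fst w"] C L by (intro mult_mono) auto
      then show "norm (case w of (x, m) \<Rightarrow> cnj (ef L p x) * H x m) \<le> 1 / sqrt (L ^ CARD('d)) * C" by (simp add: case_prod_beta')
    qed
    show "AE w in lborel \<Otimes>\<^sub>M M. w \<notin> Lam L \<times> space M \<longrightarrow> (case w of (x, m) \<Rightarrow> cnj (ef L p x) * H x m) = 0"
      by (intro AE_I2) (auto simp: ef_def space_pair_measure indicator_eq_0_iff)
  qed
  have ipeq: "ip lborel (ef L p) (\<lambda>x. \<integral>m. H x m \<partial>M) = (\<integral>m. ip lborel (ef L p) (\<lambda>x. H x m) \<partial>M)" for p
    using P.Fubini_integral[OF int[of p]] by (simp add: ip_def)
  have ipint: "integrable M (\<lambda>m. ip lborel (ef L p) (\<lambda>x. H x m))" for p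
    using P.integrable_snd[OF int[of p]] by (simp add: ip_def)
  show ?thesis unfolding RT_def mulop_def ipeq using ipint
    by (subst Bochner_Integration.integral_sum) (auto intro!: integrable_mult_left integrable_mult_right)
qed

section \<open>Uniformly distributed positions and finished labels\<close>

definition un :: "real \<Rightarrow> (real^'d) measure" where "un L = uniform_measure lborel (Lam L)"

lemma sets_un[simp, measurable_cong]: "sets (un L) = sets borel" by (simp add: un_def)
lemma space_un[simp]: "space (un L) = UNIV" by (simp add: un_def)

lemma prob_space_un: "0 < L \<Longrightarrow> prob_space (un L)"
  unfolding un_def by (rule prob_space_uniform_measure) (simp_all add: emeasure_Lam)

lemma integral_un:
  fixes f :: "real^'d \<Rightarrow> complex"
  assumes L: "0 < L" and f: "f \<in> borel_measurable borel"
  shows "(\<integral>t. indicator (Lam L) t * f t \<partial>lborel) = complex_of_real (L ^ CARD('d)) * (\<integral>t. f t \<partial>un L)"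
proof -
  have "(\<integral>t. f t \<partial>un L) = (\<integral>t. (indicator (Lam L) t / L ^ CARD('d)) *\<^sub>R f t \<partial>lborel)"
  proof -
    have "(un L :: (real^'d) measure) = density lborel (\<lambda>t. ennreal (indicator (Lam L) t / L ^ CARD('d)))"
      unfolding un_def uniform_measure_def using L
      by (intro density_cong) (auto simp: emeasure_Lam divide_ennreal[symmetric] split: split_indicator)
    then show ?thesis using f L by (simp add: integral_density)
  qed
  also have "\<dots> = (\<integral>t. indicator (Lam L) t * f t \<partial>lborel) / L ^ CARD('d)"
    by (subst integral_divide_zero[symmetric], intro Bochner_Integration.integral_cong) (auto split: split_indicator simp: scaleR_conv_of_real)
  finally show ?thesis using L by simp
qed

definition ov :: "(nat \<Rightarrow> 'b) \<Rightarrow> (nat \<Rightarrow> 'b) \<Rightarrow> nat set \<Rightarrow> nat \<Rightarrow> 'b" where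
  "ov y w D k = (if k \<in> D then w k else y k)"

text \<open>The labels finished before step i: their positions have already been integrated out in
  \<open>Ust\<close>.\<close>

definition dn :: "nat \<Rightarrow> (nat \<Rightarrow> nat) \<Rightarrow> nat \<Rightarrow> nat set" where
  "dn n \<sigma> i = {s. s < i \<and> \<sigma> s = s \<and> s \<notin> act n \<sigma> i}"

lemma finite_dn[simp]: "finite (dn n \<sigma> i)" by (auto simp: dn_def)

lemma dn_Suc:
  assumes c: "canon n \<sigma>" and i: "i < n"
  shows "dn n \<sigma> (Suc i) = (if lastp n \<sigma> i then insert (\<sigma> i) (dn n \<sigma> i) else dn n \<sigma> i)" "\<sigma> i \<notin> dn n \<sigma> i"
proof -
  have ci: "\<sigma> i \<le> i" "\<sigma> (\<sigma> i) = \<sigma> i" using c i by (auto simp: canon_def)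
  show nin: "\<sigma> i \<notin> dn n \<sigma> i"
  proof
    assume "\<sigma> i \<in> dn n \<sigma> i"
    then have "\<sigma> i < i" "\<sigma> i \<notin> act n \<sigma> i" by (auto simp: dn_def)
    then show False using i by (auto simp: act_def)
  qed
  note st = label_step_act[OF c i, unfolded label_step_def]
  have i_act: "i \<notin> act n \<sigma> i" by (simp add: act_def)
  have last_i: "i \<in> act n \<sigma> (Suc i)" if "\<sigma> i = i" "\<not> lastp n \<sigma> i" using st that by auto
  have eqi: "i = \<sigma> i" if "\<sigma> i = i" using that by simp
  show "dn n \<sigma> (Suc i) = (if lastp n \<sigma> i then insert (\<sigma> i) (dn n \<sigma> i) else dn n \<sigma> i)"
  proof (cases "lastp n \<sigma> i")
    case True
    then have "act n \<sigma> i = insert (\<sigma> i) (act n \<sigma> (Suc i)) \<or> act n \<sigma> (Suc i) = act n \<sigma> i" "\<sigma> i \<notin> act n \<sigma> (Suc i)" using st by auto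
    then have "s \<in> dn n \<sigma> (Suc i) \<longleftrightarrow> s = \<sigma> i \<or> s \<in> dn n \<sigma> i" for s
      using ci i_act by (cases "s = \<sigma> i"; cases "s = i") (auto simp: dn_def less_Suc_eq)
    then show ?thesis using True by auto
  next
    case False
    then have "act n \<sigma> (Suc i) = insert (\<sigma> i) (act n \<sigma> i)" using st by auto
    then have "s \<in> dn n \<sigma> (Suc i) \<longleftrightarrow> s \<in> dn n \<sigma> i" for s
      using ci i_act nin by (cases "s = \<sigma> i"; cases "s = i") (auto simp: dn_def less_Suc_eq)
    then show ?thesis using False by auto
  qed
qed

lemma measurable_un: "f \<in> M \<rightarrow>\<^sub>M un L \<Longrightarrow> f \<in> M \<rightarrow>\<^sub>M borel"
  using measurable_cong_sets[OF refl sets_un] by blast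

lemma RT_cmult: "RT L N z (\<lambda>x. c * f x) x0 = c * RT L N z f x0"
  unfolding RT_def mulop_def ip_cmult_right by (simp add: sum_distrib_left mult_ac)

context scatterer
begin

lemma abs_BL_le': "\<bar>BL L B x t\<bar> \<le> \<beta>0"
  by (rule abs_BL_le) (rule \<beta>0)

text \<open>Each Lebesgue integral over a position in \<open>Ust\<close> is the volume times a
  uniform average. Moving all averages outside the resolvents leaves \<open>Qst\<close> with its
  positions identified by \<sigma>. Fubini permits this because \<open>Qst\<close> is bounded at
  fixed L and N.\<close>

lemma Ust_eq_integral_Qst:
  assumes c: "canon n \<sigma>" and L: "0 < L" and z: "z \<notin> rpos" and \<psi>: "\<psi> \<in> borel_measurable borel" and fin: "nsq lborel \<psi> < \<top>" and "i \<le> n"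
  shows "Ust L N z B n \<sigma> \<psi> i x y = complex_of_real ((L ^ CARD('d)) ^ card (dn n \<sigma> i)) *
    (\<integral>w. Qst (BL L B) L N z \<psi> i x (\<lambda>k. ov y w (dn n \<sigma> i) (\<sigma> k)) \<partial>PiM (dn n \<sigma> i) (\<lambda>_. un L))"
  using \<open>i \<le> n\<close>
proof (induction i arbitrary: x y)
  case 0
  interpret p: prob_space "PiM {} (\<lambda>_. un L) :: (nat \<Rightarrow> real^'d) measure"
    by (rule prob_space_PiM) (rule prob_space_un[OF L])
  have e: "dn n \<sigma> 0 = {}" by (simp add: dn_def)
  show ?case unfolding e by (simp add: RTs_def p.prob_space)
next
  case (Suc i)
  let ?b = "BL L B" and ?s = "\<sigma> i" and ?D = "dn n \<sigma> i" and ?c = "complex_of_real ((L ^ CARD('d)) ^ card (dn n \<sigma> i))"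
  let ?Q = "Qst (BL L B) L N z \<psi> i" and ?Q' = "Qst (BL L B) L N z \<psi> (Suc i)"
  let ?P = "PiM ?D (\<lambda>_. un L) :: (nat \<Rightarrow> real^'d) measure"
  have i: "i < n" using Suc by simp
  note IH = Suc.IH[OF less_imp_le[OF i]]
  note bm = BL_measurable[OF B_measurable, of L]
  interpret un: prob_space "un L :: (real^'d) measure" by (rule prob_space_un[OF L])
  interpret P: prob_space ?P by (rule prob_space_PiM) (rule prob_space_un[OF L])
  interpret PP: pair_sigma_finite ?P "un L :: (real^'d) measure" ..
  interpret ps: product_sigma_finite "\<lambda>_::nat. un L :: (real^'d) measure" ..
  have sD: "?s \<notin> ?D" by (rule dn_Suc(2)[OF c i])
  note Qs = stf_Qst[OF \<psi> bm, of L N z i] and Qs' = stf_Qst[OF \<psi> bm, of L N z "Suc i"]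
  obtain C where C: "\<And>x w. cmod (?Q x w) \<le> C" using Qst_bounded[OF L z \<psi> fin bm abs_BL_le', of N i] by blast
  obtain C' where C': "\<And>x w. cmod (?Q' x w) \<le> C'" using Qst_bounded[OF L z \<psi> fin bm abs_BL_le', of N "Suc i"] by blast
  have ovm: "(\<lambda>w. \<lambda>k. ov y w ?D (\<sigma> k)) \<in> ?P \<rightarrow>\<^sub>M YY" for y
  proof (rule measurable_YY)
    fix k
    show "(\<lambda>w. ov y w ?D (\<sigma> k)) \<in> ?P \<rightarrow>\<^sub>M borel"
    proof (cases "\<sigma> k \<in> ?D")
      case True
      then show ?thesis using measurable_component_singleton[of "\<sigma> k" ?D "\<lambda>_. un L :: (real^'d) measure"] by (simp add: ov_def)
    qed (simp add: ov_def)
  qed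
  have bbd: "cmod (complex_of_real (?b x t) * ?Q x w) \<le> \<beta>0 * C" for x t w
    unfolding norm_mult norm_of_real using C[of x w] abs_BL_le'[of L x t]
    by (intro mult_mono) (auto intro: order_trans[OF abs_ge_zero])
  show ?case
  proof (cases "lastp n \<sigma> i")
    case False
    have D': "dn n \<sigma> (Suc i) = ?D" using dn_Suc(1)[OF c i] False by simp
    let ?H = "\<lambda>x w. complex_of_real (?b x (y ?s)) * ?Q x (\<lambda>k. ov y w ?D (\<sigma> k))"
    have Hm: "(\<lambda>(x, w). ?H x w) \<in> borel_measurable (borel \<Otimes>\<^sub>M ?P)"
    proof -
      have "(\<lambda>m. ?Q (fst m) (\<lambda>k. ov y (snd m) ?D (\<sigma> k))) \<in> borel_measurable (borel \<Otimes>\<^sub>M ?P)"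
        by (rule stf_measurable[OF Qs measurable_fst measurable_compose[OF measurable_snd ovm]])
      moreover have "(\<lambda>m. ?b (fst m) (y ?s)) \<in> borel_measurable (borel \<Otimes>\<^sub>M ?P)" using bm by measurable
      ultimately show ?thesis unfolding case_prod_beta' by measurable
    qed
    have "Ust L N z B n \<sigma> \<psi> (Suc i) x y = RT L N z (\<lambda>x. ?c * (\<integral>w. ?H x w \<partial>?P)) x"
      using False by (simp add: RTs_def Wop_def IH mult.left_commute)
    also have "\<dots> = ?c * RT L N z (\<lambda>x. \<integral>w. ?H x w \<partial>?P) x"
      by (rule RT_cmult)
    also have "RT L N z (\<lambda>x. \<integral>w. ?H x w \<partial>?P) x = (\<integral>w. RT L N z (\<lambda>x. ?H x w) x \<partial>?P)"
      by (rule RT_integral_exchange[OF L P.prob_space_axioms Hm bbd])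
    also have "\<dots> = (\<integral>w. ?Q' x (\<lambda>k. ov y w ?D (\<sigma> k)) \<partial>?P)"
      using sD by (simp add: RTs_def Wop_def ov_def)
    finally show ?thesis unfolding D' .
  next
    case True
    have D': "dn n \<sigma> (Suc i) = insert ?s ?D" using dn_Suc(1)[OF c i] True by simp
    have ovs: "ov (y(?s := t)) w ?D = (ov y w ?D)(?s := t)" for t w using sD by (auto simp: ov_def fun_eq_iff)
    let ?G = "\<lambda>x t w. complex_of_real (?b x t) * ?Q x (\<lambda>k. ov (y(?s := t)) w ?D (\<sigma> k))"
    have ovm2: "(\<lambda>m. \<lambda>k. ov (y(?s := fst (f m))) (snd (f m)) ?D (\<sigma> k)) \<in> M \<rightarrow>\<^sub>M YY"
      if f: "f \<in> M \<rightarrow>\<^sub>M un L \<Otimes>\<^sub>M ?P" for f and M :: "'m measure"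
    proof (rule measurable_YY)
      fix k
      have f1: "(\<lambda>m. fst (f m)) \<in> M \<rightarrow>\<^sub>M borel" by (rule measurable_un[OF measurable_compose[OF f measurable_fst]])
      have f2: "(\<lambda>m. snd (f m)) \<in> M \<rightarrow>\<^sub>M ?P" using measurable_compose[OF f measurable_snd] .
      show "(\<lambda>m. ov (y(?s := fst (f m))) (snd (f m)) ?D (\<sigma> k)) \<in> M \<rightarrow>\<^sub>M borel"
      proof (cases "\<sigma> k \<in> ?D")
        case True
        then show ?thesis
          using measurable_un[OF measurable_compose[OF f2 measurable_component_singleton[of "\<sigma> k" ?D "\<lambda>_. un L :: (real^'d) measure"]]] by (simp add: ov_def)
      next
        case False
        then show ?thesis using f1 by (cases "\<sigma> k = ?s") (simp_all add: ov_def)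
      qed
    qed
    have Gm: "(\<lambda>((x, t), w). ?G x t w) \<in> borel_measurable ((borel \<Otimes>\<^sub>M un L) \<Otimes>\<^sub>M ?P)"
    proof -
      have "(\<lambda>m. ?Q (fst (fst m)) (\<lambda>k. ov (y(?s := fst (snd (fst m), snd m))) (snd (snd (fst m), snd m)) ?D (\<sigma> k))) \<in> borel_measurable ((borel \<Otimes>\<^sub>M un L) \<Otimes>\<^sub>M ?P)"
        by (rule stf_measurable[OF Qs _ ovm2]) measurable
      moreover have "(\<lambda>m. ?b (fst (fst m)) (snd (fst m))) \<in> borel_measurable ((borel \<Otimes>\<^sub>M un L) \<Otimes>\<^sub>M ?P)" using bm by measurable
      ultimately show ?thesis unfolding case_prod_beta' fst_conv snd_conv by measurable
    qed
    have Gm1: "(\<lambda>(x, t). \<integral>w. ?G x t w \<partial>?P) \<in> borel_measurable (borel \<Otimes>\<^sub>M un L)"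
      using P.borel_measurable_lebesgue_integral[of "\<lambda>m w. ?G (fst m) (snd m) w" "borel \<Otimes>\<^sub>M un L"] Gm
      by (simp add: case_prod_beta')
    have Gb1: "cmod (\<integral>w. ?G x t w \<partial>?P) \<le> \<beta>0 * C" for x t
    proof -
      have "cmod (\<integral>w. ?G x t w \<partial>?P) \<le> (\<integral>w. \<beta>0 * C \<partial>?P)"
      proof (cases "integrable ?P (\<lambda>w. ?G x t w)")
        case True
        then have "cmod (\<integral>w. ?G x t w \<partial>?P) \<le> (\<integral>w. cmod (?G x t w) \<partial>?P)" by (intro integral_norm_bound)
        also have "\<dots> \<le> (\<integral>w. \<beta>0 * C \<partial>?P)" using True bbd by (intro integral_mono) auto
        finally show ?thesis .
      next
        case False
        have "0 \<le> \<beta>0 * C" using bbd[of x t undefined] norm_ge_zero order_trans by blast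
        then show ?thesis unfolding not_integrable_integral_eq[OF False] by (simp add: P.prob_space)
      qed
      then show ?thesis by (simp add: P.prob_space)
    qed
    have Gmt: "(\<lambda>(x, w). ?G x t w) \<in> borel_measurable (borel \<Otimes>\<^sub>M ?P)" for t
    proof -
      have "(\<lambda>m. ((fst m, t), snd m)) \<in> borel \<Otimes>\<^sub>M ?P \<rightarrow>\<^sub>M (borel \<Otimes>\<^sub>M un L) \<Otimes>\<^sub>M ?P" by measurable
      from measurable_compose[OF this Gm] show ?thesis by (simp add: case_prod_beta')
    qed
    \<comment> \<open>\<open>BL\<close> vanishes for t outside the box, so an indicator may be
      inserted, and the Lebesgue integral becomes the volume times the uniform average.\<close>
    have Wt: "(\<integral>t. complex_of_real (?b x t) * (\<integral>w. ?Q x (\<lambda>k. ov (y(?s := t)) w ?D (\<sigma> k)) \<partial>?P) \<partial>lborel)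
       = complex_of_real (L ^ CARD('d)) * (\<integral>t. (\<integral>w. ?G x t w \<partial>?P) \<partial>un L)" for x
    proof -
      have "(\<integral>t. complex_of_real (?b x t) * (\<integral>w. ?Q x (\<lambda>k. ov (y(?s := t)) w ?D (\<sigma> k)) \<partial>?P) \<partial>lborel)
        = (\<integral>t. indicator (Lam L) t * (\<integral>w. ?G x t w \<partial>?P) \<partial>lborel)"
        by (intro Bochner_Integration.integral_cong) (auto simp: BL_def split: split_indicator)
      also have "\<dots> = complex_of_real (L ^ CARD('d)) * (\<integral>t. (\<integral>w. ?G x t w \<partial>?P) \<partial>un L)"
      proof (rule integral_un[OF L])
        have "(\<lambda>t. (x, t)) \<in> borel \<rightarrow>\<^sub>M borel \<Otimes>\<^sub>M un L" by measurable
        from measurable_compose[OF this Gm1] show "(\<lambda>t. \<integral>w. ?G x t w \<partial>?P) \<in> borel_measurable borel" by simp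
      qed
      finally show ?thesis .
    qed
    have "Ust L N z B n \<sigma> \<psi> (Suc i) x y = RT L N z (\<lambda>x. ?c * complex_of_real (L ^ CARD('d)) * (\<integral>t. (\<integral>w. ?G x t w \<partial>?P) \<partial>un L)) x"
    proof -
      have "Wop ?b ?s True (Ust L N z B n \<sigma> \<psi> i) x y = ?c * complex_of_real (L ^ CARD('d)) * (\<integral>t. (\<integral>w. ?G x t w \<partial>?P) \<partial>un L)" for x
      proof -
        have "Wop ?b ?s True (Ust L N z B n \<sigma> \<psi> i) x y = (\<integral>t. ?c * (complex_of_real (?b x t) * (\<integral>w. ?Q x (\<lambda>k. ov (y(?s := t)) w ?D (\<sigma> k)) \<partial>?P)) \<partial>lborel)"
          unfolding Wop_def IH by (simp add: mult.left_commute)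
        also have "\<dots> = ?c * (\<integral>t. complex_of_real (?b x t) * (\<integral>w. ?Q x (\<lambda>k. ov (y(?s := t)) w ?D (\<sigma> k)) \<partial>?P) \<partial>lborel)"
          by (rule integral_mult_right_zero)
        finally show ?thesis unfolding Wt by simp
      qed
      then show ?thesis using True by (simp add: RTs_def)
    qed
    also have "\<dots> = ?c * complex_of_real (L ^ CARD('d)) * RT L N z (\<lambda>x. \<integral>t. (\<integral>w. ?G x t w \<partial>?P) \<partial>un L) x"
      by (rule RT_cmult)
    also have "RT L N z (\<lambda>x. \<integral>t. (\<integral>w. ?G x t w \<partial>?P) \<partial>un L) x = (\<integral>t. RT L N z (\<lambda>x. \<integral>w. ?G x t w \<partial>?P) x \<partial>un L)"
      by (rule RT_integral_exchange[OF L un.prob_space_axioms Gm1 Gb1])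
    also have "\<dots> = (\<integral>t. (\<integral>w. RT L N z (\<lambda>x. ?G x t w) x \<partial>?P) \<partial>un L)"
      by (intro Bochner_Integration.integral_cong refl RT_integral_exchange[OF L P.prob_space_axioms Gmt bbd])
    also have "\<dots> = (\<integral>t. (\<integral>w. ?Q' x (\<lambda>k. ov (y(?s := t)) w ?D (\<sigma> k)) \<partial>?P) \<partial>un L)"
      using sD by (simp add: RTs_def Wop_def ov_def)
    also have "\<dots> = (\<integral>w. (\<integral>t. ?Q' x (\<lambda>k. ov (y(?s := t)) w ?D (\<sigma> k)) \<partial>un L) \<partial>?P)"
    proof (rule PP.Fubini_integral)
      interpret pp: prob_space "?P \<Otimes>\<^sub>M (un L :: (real^'d) measure)" by (rule prob_space_pair) unfold_locales
      have "(\<lambda>m. ?Q' x (\<lambda>k. ov (y(?s := fst (snd m, fst m))) (snd (snd m, fst m)) ?D (\<sigma> k))) \<in> borel_measurable (?P \<Otimes>\<^sub>M un L)"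
        by (rule stf_measurable[OF Qs' _ ovm2]) measurable
      then show "integrable (?P \<Otimes>\<^sub>M un L) (\<lambda>(w, t). ?Q' x (\<lambda>k. ov (y(?s := t)) w ?D (\<sigma> k)))"
        unfolding case_prod_beta' fst_conv snd_conv using C' by (intro pp.integrable_const_bound[where B = C']) auto
    qed
    \<comment> \<open>The integrated position moves from the parameter y to the random family w, as
      its label joins the finished ones.\<close>
    also have "\<dots> = (\<integral>w. (\<integral>t. ?Q' x (\<lambda>k. ov y (w(?s := t)) (insert ?s ?D) (\<sigma> k)) \<partial>un L) \<partial>?P)"
    proof -
      have "ov (y(?s := t)) w ?D k = ov y (w(?s := t)) (insert ?s ?D) k" for t w k using sD by (auto simp: ov_def)
      then show ?thesis by presburger
    qed
    also have "\<dots> = (\<integral>w. ?Q' x (\<lambda>k. ov y w (insert ?s ?D) (\<sigma> k)) \<partial>PiM (insert ?s ?D) (\<lambda>_. un L))"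
    proof (rule ps.product_integral_insert[symmetric, OF finite_dn sD])
      interpret pi: prob_space "PiM (insert ?s ?D) (\<lambda>_. un L) :: (nat \<Rightarrow> real^'d) measure"
        by (rule prob_space_PiM) (rule prob_space_un[OF L])
      have m: "(\<lambda>w. \<lambda>k. ov y w (insert ?s ?D) (\<sigma> k)) \<in> PiM (insert ?s ?D) (\<lambda>_. un L) \<rightarrow>\<^sub>M YY"
      proof (rule measurable_YY)
        fix k
        show "(\<lambda>w. ov y w (insert ?s ?D) (\<sigma> k)) \<in> PiM (insert ?s ?D) (\<lambda>_. un L) \<rightarrow>\<^sub>M borel"
        proof (cases "\<sigma> k \<in> insert ?s ?D")
          case True
          then show ?thesis using measurable_component_singleton[of "\<sigma> k" "insert ?s ?D" "\<lambda>_. un L :: (real^'d) measure"] by (simp add: ov_def)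
        qed (simp add: ov_def)
      qed
      have "(\<lambda>w. ?Q' x (\<lambda>k. ov y w (insert ?s ?D) (\<sigma> k))) \<in> borel_measurable (PiM (insert ?s ?D) (\<lambda>_. un L))"
        by (rule stf_measurable[OF Qs' measurable_const m]) simp
      then show "integrable (PiM (insert ?s ?D) (\<lambda>_. un L)) (\<lambda>w. ?Q' x (\<lambda>k. ov y w (insert ?s ?D) (\<sigma> k)))"
        using C' by (intro pi.integrable_const_bound[where B = C']) auto
    qed
    finally show ?thesis unfolding D' using sD by (simp add: mult.commute)
  qed
qed

end

section \<open>Label sequences and Poisson moments\<close>

text \<open>The kernel as it occurs in the potential, cut in x only. It agrees with
  \<open>BL\<close> at positions inside the box, that is almost surely.\<close>

definition bw :: "real \<Rightarrow> (real^'d \<Rightarrow> real) \<Rightarrow> real^'d \<Rightarrow> real^'d \<Rightarrow> real" where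
  "bw L B x t = indicator (Lam L) x * B (wrap L (x - t))"

lemma bw_measurable:
  assumes [measurable]: "B \<in> borel_measurable borel"
  shows "(\<lambda>(x, t). bw L B x t) \<in> borel_measurable (borel \<Otimes>\<^sub>M borel)"
  unfolding bw_def by measurable

lemma abs_bw_le: "(\<And>s. \<bar>B s\<bar> \<le> b) \<Longrightarrow> \<bar>bw L B x t\<bar> \<le> b"
  by (auto simp: bw_def abs_mult split: split_indicator intro: order_trans[OF abs_ge_zero])

lemma RT_cong_Lam:
  assumes "\<And>x. x \<in> Lam L \<Longrightarrow> f x = g x"
  shows "RT L N z f = RT L N z g"
proof -
  have "lamcut L f = lamcut L g" using assms by (auto simp: lamcut_def fun_eq_iff split: split_indicator)
  then show ?thesis by (metis RT_lamcut)
qed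

lemma RT_sum:
  assumes "0 < L" "\<And>i. i \<in> I \<Longrightarrow> f i \<in> borel_measurable borel" "\<And>i. i \<in> I \<Longrightarrow> nsq lborel (f i) < \<top>"
  shows "RT L N z (\<lambda>x. \<Sum>i\<in>I. c i * f i x) x = (\<Sum>i\<in>I. c i * RT L N z (f i) x)"
proof -
  have "ip lborel (ef L p) (\<lambda>x. \<Sum>i\<in>I. c i * f i x) = (\<Sum>i\<in>I. c i * ip lborel (ef L p) (f i))" for p
    using assms by (subst ip_sum_right) (auto simp: nsq_ef_finite nsq_cmult ennreal_mult_less_top ip_cmult_right)
  then have "RT L N z (\<lambda>x. \<Sum>i\<in>I. c i * f i x) x = (\<Sum>p\<in>lat L N. \<Sum>i\<in>I. c i * (1 / (complex_of_real (nu p) - z) * ip lborel (ef L p) (f i) * ef L p x))"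
    unfolding RT_def mulop_def by (simp add: sum_distrib_left sum_distrib_right mult_ac)
  also have "\<dots> = (\<Sum>i\<in>I. c i * RT L N z (f i) x)"
    unfolding RT_def mulop_def by (subst sum.swap) (simp add: sum_distrib_left)
  finally show ?thesis .
qed

lemma sum_PiE_lessThan_Suc:
  fixes h :: "(nat \<Rightarrow> nat) \<Rightarrow> 'b::comm_monoid_add"
  shows "(\<Sum>\<gamma>\<in>PiE {..<Suc n} (\<lambda>_. {..<m}). h \<gamma>) = (\<Sum>(g, \<gamma>)\<in>{..<m} \<times> PiE {..<n} (\<lambda>_. {..<m}). h (\<gamma>(n := g)))"
proof -
  have "(\<Sum>\<gamma>\<in>PiE {..<Suc n} (\<lambda>_. {..<m}). h \<gamma>) = (\<Sum>\<gamma>\<in>(\<lambda>(y, g). g(n := y)) ` ({..<m} \<times> PiE {..<n} (\<lambda>_. {..<m})). h \<gamma>)"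
    unfolding lessThan_Suc PiE_insert_eq ..
  also have "\<dots> = (\<Sum>w\<in>{..<m} \<times> PiE {..<n} (\<lambda>_. {..<m}). (h \<circ> (\<lambda>(y, g). g(n := y))) w)"
    by (rule sum.reindex) (rule inj_combinator, simp)
  finally show ?thesis by (simp add: case_prod_beta')
qed

definition Can :: "nat \<Rightarrow> (nat \<Rightarrow> nat) set" where
  "Can n = {\<sigma> \<in> PiE {..<n} (\<lambda>_. {..<n}). canon n \<sigma>}"

definition InjE :: "nat set \<Rightarrow> nat \<Rightarrow> (nat \<Rightarrow> nat) set" where
  "InjE S m = {\<tau> \<in> PiE S (\<lambda>_. {..<m}). inj_on \<tau> S}"

lemma finite_Can[simp]: "finite (Can n)"
  unfolding Can_def by (rule finite_subset[of _ "PiE {..<n} (\<lambda>_. {..<n})"]) (auto intro!: finite_PiE)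

lemma finite_InjE[simp]: "finite S \<Longrightarrow> finite (InjE S m)"
  unfolding InjE_def by (rule finite_subset[of _ "PiE S (\<lambda>_. {..<m})"]) (auto intro!: finite_PiE)

text \<open>Truncated subtraction gives the right value also for m < card S: one factor is then 0,
  and there is no injection.\<close>

lemma card_InjE: "finite S \<Longrightarrow> card (InjE S m) = (\<Prod>i<card S. m - i)"
proof (induction S rule: finite_induct)
  case empty
  then show ?case by (simp add: InjE_def)
next
  case (insert a S)
  have img: "InjE (insert a S) m = (\<lambda>(\<tau>, t). \<tau>(a := t)) ` (SIGMA \<tau>:InjE S m. {..<m} - \<tau> ` S)"
  proof (intro set_eqI iffI)
    fix \<tau> assume \<tau>: "\<tau> \<in> InjE (insert a S) m"
    let ?\<tau>' = "\<tau>(a := undefined)"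
    have im: "?\<tau>' ` S = \<tau> ` S" using insert(2) by (intro image_cong) auto
    have \<tau>1: "\<And>k. k = a \<or> k \<in> S \<Longrightarrow> \<tau> k < m" "\<And>k. k \<noteq> a \<Longrightarrow> k \<notin> S \<Longrightarrow> \<tau> k = undefined" and \<tau>2: "inj_on \<tau> (insert a S)"
      using \<tau> by (auto simp: InjE_def PiE_iff extensional_def)
    have "inj_on ?\<tau>' S"
      by (rule inj_on_cong[THEN iffD1, OF _ inj_on_subset[OF \<tau>2]]) (use insert(2) in auto)
    then have "?\<tau>' \<in> InjE S m" using \<tau>1 insert(2) unfolding InjE_def PiE_iff extensional_def by fastforce
    moreover have "\<tau> a \<in> {..<m} - ?\<tau>' ` S" unfolding im using \<tau>1(1)[of a] \<tau>2 insert(2) by (auto simp: inj_on_def)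
    ultimately show "\<tau> \<in> (\<lambda>(\<tau>, t). \<tau>(a := t)) ` (SIGMA \<tau>:InjE S m. {..<m} - \<tau> ` S)"
      by (intro image_eqI[of _ _ "(?\<tau>', \<tau> a)"]) auto
  next
    fix \<rho> assume "\<rho> \<in> (\<lambda>(\<tau>, t). \<tau>(a := t)) ` (SIGMA \<tau>:InjE S m. {..<m} - \<tau> ` S)"
    then obtain \<tau> t where \<tau>: "\<tau> \<in> InjE S m" and t: "t < m" "t \<notin> \<tau> ` S" and \<rho>: "\<rho> = \<tau>(a := t)" by auto
    have "\<rho> \<in> PiE (insert a S) (\<lambda>_. {..<m})"
      unfolding \<rho> using \<tau> t(1) by (intro PiE_fun_upd) (auto simp: InjE_def)
    moreover have "inj_on \<rho> (insert a S)"
      unfolding \<rho> using \<tau> t(2) insert(2)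
      by (auto simp: InjE_def inj_on_fun_updI)
    ultimately show "\<rho> \<in> InjE (insert a S) m" by (simp add: InjE_def)
  qed
  have "inj_on (\<lambda>(\<tau>, t). \<tau>(a := t)) (SIGMA \<tau>:InjE S m. {..<m} - \<tau> ` S)"
  proof (rule inj_onI, clarify)
    fix \<tau> t \<tau>' t' assume \<tau>: "\<tau> \<in> InjE S m" "\<tau>' \<in> InjE S m" and eq: "\<tau>(a := t) = \<tau>'(a := t')"
    have "\<tau> k = \<tau>' k" for k
    proof (cases "k = a")
      case True
      then show ?thesis using \<tau> insert(2) by (auto simp: InjE_def PiE_iff extensional_def)
    next
      case False
      then show ?thesis using fun_cong[OF eq, of k] by simp
    qed
    then show "\<tau> = \<tau>' \<and> t = t'" using fun_cong[OF eq, of a] by auto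
  qed
  then have "card (InjE (insert a S) m) = card (SIGMA \<tau>:InjE S m. {..<m} - \<tau> ` S)"
    unfolding img by (rule card_image)
  also have "\<dots> = (\<Sum>\<tau>\<in>InjE S m. card ({..<m} - \<tau> ` S))" using insert by (intro card_SigmaI) auto
  also have "\<dots> = (\<Sum>\<tau>\<in>InjE S m. m - card S)"
  proof (rule sum.cong[OF refl])
    fix \<tau> assume "\<tau> \<in> InjE S m"
    then have "\<tau> ` S \<subseteq> {..<m}" "card (\<tau> ` S) = card S" by (auto simp: InjE_def card_image)
    then show "card ({..<m} - \<tau> ` S) = m - card S" using insert by (simp add: card_Diff_subset)
  qed
  finally show ?case using insert by simp
qed

text \<open>Every label sequence is a composition of \<tau> with \<sigma> in exactly one way:
  \<sigma> sends a step to the first step with the same label, and \<tau> assigns distinct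
  scatterers to these first steps.\<close>

lemma sum_PiE_canon:
  fixes h :: "(nat \<Rightarrow> nat) \<Rightarrow> 'b::comm_monoid_add"
  shows "(\<Sum>\<gamma>\<in>PiE {..<n} (\<lambda>_. {..<m}). h \<gamma>) = (\<Sum>\<sigma>\<in>Can n. \<Sum>\<tau>\<in>InjE (\<sigma> ` {..<n}) m. h (restrict (\<tau> \<circ> \<sigma>) {..<n}))"
proof -
  \<comment> \<open>The minimum runs over all naturals, also beyond n where \<gamma> may be
    \<open>undefined\<close>. As i itself is a candidate, the result is at most i.\<close>
  define lab where "lab \<gamma> = restrict (\<lambda>i. LEAST j. \<gamma> j = (\<gamma> i :: nat)) {..<n}" for \<gamma>
  have lab1: "lab \<gamma> i \<le> i" "\<gamma> (lab \<gamma> i) = \<gamma> i" "\<And>j. \<gamma> j = \<gamma> i \<Longrightarrow> lab \<gamma> i \<le> j" if "i < n" for \<gamma> i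
    using that LeastI[of "\<lambda>j. \<gamma> j = \<gamma> i" i] by (auto simp: lab_def intro: Least_le)
  have lab_can: "lab \<gamma> \<in> Can n" for \<gamma>
  proof -
    have "lab \<gamma> (lab \<gamma> i) = lab \<gamma> i" if i: "i < n" for i
    proof (rule antisym)
      have l: "lab \<gamma> i < n" using lab1(1)[OF i, of \<gamma>] i by simp
      show "lab \<gamma> (lab \<gamma> i) \<le> lab \<gamma> i" by (rule lab1(1)[OF l])
      show "lab \<gamma> i \<le> lab \<gamma> (lab \<gamma> i)" by (rule lab1(3)[OF i]) (simp add: lab1(2)[OF l] lab1(2)[OF i])
    qed
    moreover have "lab \<gamma> \<in> PiE {..<n} (\<lambda>_. {..<n})"
    proof (rule PiE_I)
      fix i assume "i \<in> {..<n}"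
      then show "lab \<gamma> i \<in> {..<n}" using lab1(1)[of i \<gamma>] by simp
    qed (simp add: lab_def)
    ultimately show ?thesis using lab1(1) by (simp add: Can_def canon_def)
  qed
  have "(\<Sum>\<gamma>\<in>PiE {..<n} (\<lambda>_. {..<m}). h \<gamma>) = (\<Sum>w\<in>(SIGMA \<sigma>:Can n. InjE (\<sigma> ` {..<n}) m). h (restrict (snd w \<circ> fst w) {..<n}))"
  proof (rule sum.reindex_bij_witness[where i = "\<lambda>w. restrict (snd w \<circ> fst w) {..<n}" and j = "\<lambda>\<gamma>. (lab \<gamma>, restrict \<gamma> (lab \<gamma> ` {..<n}))"])
    fix \<gamma> assume \<gamma>: "\<gamma> \<in> PiE {..<n} (\<lambda>_. {..<m})"
    show *: "restrict (snd (lab \<gamma>, restrict \<gamma> (lab \<gamma> ` {..<n})) \<circ> fst (lab \<gamma>, restrict \<gamma> (lab \<gamma> ` {..<n}))) {..<n} = \<gamma>"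
    proof
      fix i
      show "restrict (snd (lab \<gamma>, restrict \<gamma> (lab \<gamma> ` {..<n})) \<circ> fst (lab \<gamma>, restrict \<gamma> (lab \<gamma> ` {..<n}))) {..<n} i = \<gamma> i"
        using \<gamma> lab1(2)[of i \<gamma>] by (cases "i < n") (auto simp: PiE_iff extensional_def)
    qed
    then show "h (restrict (snd (lab \<gamma>, restrict \<gamma> (lab \<gamma> ` {..<n})) \<circ> fst (lab \<gamma>, restrict \<gamma> (lab \<gamma> ` {..<n}))) {..<n}) = h \<gamma>" by simp
    have "restrict \<gamma> (lab \<gamma> ` {..<n}) \<in> InjE (lab \<gamma> ` {..<n}) m"
    proof -
      have "inj_on \<gamma> (lab \<gamma> ` {..<n})"
      proof (rule inj_onI, clarify)
        fix i j assume ij: "i < n" "j < n" "\<gamma> (lab \<gamma> i) = \<gamma> (lab \<gamma> j)"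
        then have e: "\<gamma> i = \<gamma> j" using lab1(2)[OF ij(1), of \<gamma>] lab1(2)[OF ij(2), of \<gamma>] by simp
        show "lab \<gamma> i = lab \<gamma> j" using ij e by (simp add: lab_def)
      qed
      moreover have "\<gamma> (lab \<gamma> i) < m" if "i < n" for i using \<gamma> that lab1(2)[OF that, of \<gamma>] by (auto simp: PiE_iff)
      ultimately show ?thesis by (auto simp: InjE_def inj_on_def)
    qed
    then show "(lab \<gamma>, restrict \<gamma> (lab \<gamma> ` {..<n})) \<in> (SIGMA \<sigma>:Can n. InjE (\<sigma> ` {..<n}) m)" using lab_can by simp
  next
    fix w assume w: "w \<in> (SIGMA \<sigma>:Can n. InjE (\<sigma> ` {..<n}) m)"
    obtain \<sigma> \<tau> where w': "w = (\<sigma>, \<tau>)" by (cases w)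
    have \<sigma>: "\<sigma> \<in> PiE {..<n} (\<lambda>_. {..<n})" "canon n \<sigma>" and \<tau>: "\<tau> \<in> PiE (\<sigma> ` {..<n}) (\<lambda>_. {..<m})" "inj_on \<tau> (\<sigma> ` {..<n})"
      using w by (auto simp: w' Can_def InjE_def)
    let ?\<gamma> = "restrict (\<tau> \<circ> \<sigma>) {..<n}"
    have \<sigma>n: "\<sigma> i < n" "\<sigma> i \<le> i" "\<sigma> (\<sigma> i) = \<sigma> i" if "i < n" for i using \<sigma> that by (auto simp: canon_def PiE_iff)
    show "restrict (snd w \<circ> fst w) {..<n} \<in> PiE {..<n} (\<lambda>_. {..<m})" using \<tau> by (auto simp: w' PiE_iff)
    have "lab ?\<gamma> i = \<sigma> i" if i: "i < n" for i
    proof (rule antisym)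
      show "lab ?\<gamma> i \<le> \<sigma> i" by (rule lab1(3)[OF i]) (use i \<sigma>n[OF i] in simp)
      have l: "lab ?\<gamma> i < n" using lab1(1)[OF i, of ?\<gamma>] i by simp
      have "\<tau> (\<sigma> (lab ?\<gamma> i)) = \<tau> (\<sigma> i)" using lab1(2)[OF i, of ?\<gamma>] i l by simp
      then have "\<sigma> (lab ?\<gamma> i) = \<sigma> i" using \<tau>(2) i l by (auto simp: inj_on_def)
      then show "\<sigma> i \<le> lab ?\<gamma> i" using \<sigma>n(2)[OF l] by simp
    qed
    then have lab_eq: "lab ?\<gamma> = \<sigma>" using \<sigma>(1) by (auto simp: fun_eq_iff lab_def PiE_iff extensional_def)
    have "restrict ?\<gamma> (\<sigma> ` {..<n}) = \<tau>"
    proof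
      fix s
      show "restrict ?\<gamma> (\<sigma> ` {..<n}) s = \<tau> s"
        using \<tau>(1) \<sigma>n by (cases "s \<in> \<sigma> ` {..<n}") (auto simp: PiE_iff extensional_def)
    qed
    then show "(lab (restrict (snd w \<circ> fst w) {..<n}), restrict (restrict (snd w \<circ> fst w) {..<n}) (lab (restrict (snd w \<circ> fst w) {..<n}) ` {..<n})) = w"
      by (simp add: w' lab_eq)
  qed
  also have "\<dots> = (\<Sum>\<sigma>\<in>Can n. \<Sum>\<tau>\<in>InjE (\<sigma> ` {..<n}) m. h (restrict (\<tau> \<circ> \<sigma>) {..<n}))"
    by (subst sum.Sigma) (auto simp: case_prod_beta')
  finally show ?thesis .
qed

text \<open>Distinct coordinates of an i.i.d. family are again i.i.d., so the integral does not
  depend on which scatterers the injection selects.\<close>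

lemma integral_PiM_reindex:
  fixes f :: "(nat \<Rightarrow> 'b) \<Rightarrow> complex"
  assumes M: "prob_space M" and \<tau>: "\<tau> \<in> InjE S m" and f: "f \<in> borel_measurable (PiM S (\<lambda>_. M))"
  shows "(\<integral>y. f (\<lambda>s\<in>S. y (\<tau> s)) \<partial>PiM {..<m} (\<lambda>_. M)) = (\<integral>y. f y \<partial>PiM S (\<lambda>_. M))"
proof -
  have \<tau>': "inj_on \<tau> S" "\<tau> \<in> S \<rightarrow> {..<m}" using \<tau> by (auto simp: InjE_def)
  have "distr (PiM {..<m} (\<lambda>_. M)) (PiM S (\<lambda>x. M)) (\<lambda>\<omega>. \<lambda>n\<in>S. \<omega> (\<tau> n)) = PiM S (\<lambda>x. M)"
    using distr_PiM_reindex[of "{..<m}" "\<lambda>_. M" \<tau> S] M \<tau>' by simp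
  then have "(\<integral>y. f y \<partial>PiM S (\<lambda>_. M)) = (\<integral>y. f y \<partial>distr (PiM {..<m} (\<lambda>_. M)) (PiM S (\<lambda>x. M)) (\<lambda>\<omega>. \<lambda>n\<in>S. \<omega> (\<tau> n)))" by simp
  also have "\<dots> = (\<integral>y. f (\<lambda>s\<in>S. y (\<tau> s)) \<partial>PiM {..<m} (\<lambda>_. M))"
    using \<tau>' by (intro integral_distr f measurable_restrict measurable_component_singleton) auto
  finally show ?thesis by simp
qed

lemma expectation_pmf_nat:
  fixes f :: "nat \<Rightarrow> complex"
  assumes "summable (\<lambda>m. pmf p m * cmod (f m))"
  shows "integrable (measure_pmf p) f" "measure_pmf.expectation p f = (\<Sum>m. pmf p m *\<^sub>R f m)"
proof -
  have i: "integrable (count_space UNIV) (\<lambda>m. pmf p m *\<^sub>R f m)"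
    using assms by (simp add: integrable_count_space_nat_iff)
  show "integrable (measure_pmf p) f"
    unfolding measure_pmf_eq_density using i by (subst integrable_density) auto
  show "measure_pmf.expectation p f = (\<Sum>m. pmf p m *\<^sub>R f m)"
    unfolding measure_pmf_eq_density using i by (subst integral_density) (auto intro: integral_count_space_nat)
qed

text \<open>With m = j + k the falling factorial divided by m! is 1 / j!, which leaves the
  exponential series; the terms with m < k vanish because the product contains the factor 0.\<close>

lemma poisson_factorial_moment:
  assumes l: "0 < l"
  shows "(\<lambda>m. pmf (poisson_pmf l) m * real (\<Prod>i<k. m - i)) sums (l ^ k)"
proof -
  have ffn: "(\<Prod>i<k. (j + k) - i) * fact j = (fact (j + k) :: nat)" for j
  proof (induction k)
    case (Suc k)
    have "(\<Prod>i<Suc k. (j + Suc k) - i) = (j + Suc k) * (\<Prod>i<k. (j + k) - i)"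
      by (subst prod.lessThan_Suc_shift) simp
    then show ?case using Suc by (simp only: mult.assoc) simp
  qed simp
  have ff: "real (\<Prod>i<k. (j + k) - i) * fact j = fact (j + k)" for j
    using arg_cong[OF ffn[of j], of real] by (simp only: of_nat_mult of_nat_fact)
  have "(\<lambda>j. exp (- l) * l ^ k * (l ^ j /\<^sub>R fact j)) sums (exp (- l) * l ^ k * exp l)"
    by (intro sums_mult exp_converges)
  moreover have "pmf (poisson_pmf l) (j + k) * real (\<Prod>i<k. (j + k) - i) = exp (- l) * l ^ k * (l ^ j /\<^sub>R fact j)" for j
  proof -
    have "real (\<Prod>i<k. (j + k) - i) = fact (j + k) / fact j" using ff[of j] by (simp add: field_simps)
    then show ?thesis using l by (simp add: power_add field_simps)
  qed
  moreover have "exp (- l) * l ^ k * exp l = l ^ k" by (simp add: exp_minus field_simps)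
  ultimately have "(\<lambda>j. pmf (poisson_pmf l) (j + k) * real (\<Prod>i<k. (j + k) - i)) sums (l ^ k)"
    by (simp only:)
  then have "(\<lambda>m. pmf (poisson_pmf l) m * real (\<Prod>i<k. m - i)) sums (l ^ k + (\<Sum>m<k. pmf (poisson_pmf l) m * real (\<Prod>i<k. m - i)))"
    by (subst (asm) sums_iff_shift)
  moreover have "(\<Sum>m<k. pmf (poisson_pmf l) m * real (\<Prod>i<k. m - i)) = 0"
  proof (intro sum.neutral ballI)
    fix m assume "m \<in> {..<k}"
    then have "(\<Prod>i<k. m - i) = 0" by (intro prod_zero) auto
    then show "pmf (poisson_pmf l) m * real (\<Prod>i<k. m - i) = 0" by simp
  qed
  ultimately show ?thesis by simp
qed

text \<open>A single term of the exponential series shows m^k <= k! exp m, so the weighted sum is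
  dominated by another exponential series.\<close>

lemma poisson_moment_summable:
  assumes l: "0 < l"
  shows "summable (\<lambda>m. pmf (poisson_pmf l) m * real m ^ k)"
proof (rule summable_comparison_test')
  show "summable (\<lambda>m. exp (- l) * fact k * ((l * exp 1) ^ m /\<^sub>R fact m))"
    by (intro summable_mult summable_exp_generic)
  fix m :: nat
  have "real m ^ k / fact k \<le> exp (real m)"
  proof -
    have "(\<Sum>n\<in>{k}. real m ^ n /\<^sub>R fact n) \<le> exp (real m)"
      unfolding exp_def by (intro sum_le_suminf summable_exp_generic) auto
    then show ?thesis by (simp add: divide_inverse mult.commute)
  qed
  then have "real m ^ k \<le> fact k * exp 1 ^ m" by (simp add: field_simps exp_of_nat_mult[symmetric])
  then have "exp (- l) * (l ^ m / fact m) * real m ^ k \<le> exp (- l) * (l ^ m / fact m) * (fact k * exp 1 ^ m)"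
    using l by (intro mult_left_mono) auto
  then show "norm (pmf (poisson_pmf l) m * real m ^ k) \<le> exp (- l) * fact k * ((l * exp 1) ^ m /\<^sub>R fact m)"
    using l by (simp add: power_mult_distrib field_simps)
qed

section \<open>The expansion of the expectation\<close>

lemma integral_pair_mult:
  fixes f :: "'b \<Rightarrow> complex" and g :: "'a \<Rightarrow> complex"
  assumes M: "prob_space M1" "prob_space M2" and g: "integrable M1 g" and f: "integrable M2 f"
  shows "integrable (M1 \<Otimes>\<^sub>M M2) (\<lambda>(y, v). f v * g y)"
    and "(\<integral>(y, v). f v * g y \<partial>(M1 \<Otimes>\<^sub>M M2)) = (\<integral>v. f v \<partial>M2) * (\<integral>y. g y \<partial>M1)"
proof -
  interpret M1: prob_space M1 by fact
  interpret M2: prob_space M2 by fact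
  interpret P: pair_sigma_finite M1 M2 ..
  note [measurable] = borel_measurable_integrable[OF f] borel_measurable_integrable[OF g]
  show int: "integrable (M1 \<Otimes>\<^sub>M M2) (\<lambda>(y, v). f v * g y)"
  proof (rule integrableI_bounded)
    have "(\<integral>\<^sup>+w. ennreal (norm (case w of (y, v) \<Rightarrow> f v * g y)) \<partial>(M1 \<Otimes>\<^sub>M M2)) = (\<integral>\<^sup>+y. \<integral>\<^sup>+v. ennreal (norm (f v * g y)) \<partial>M2 \<partial>M1)"
      by (subst M2.nn_integral_fst[symmetric]) auto
    also have "\<dots> = (\<integral>\<^sup>+y. (\<integral>\<^sup>+v. ennreal (norm (f v)) \<partial>M2) * ennreal (norm (g y)) \<partial>M1)"
      by (simp add: norm_mult ennreal_mult nn_integral_multc)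
    also have "\<dots> = (\<integral>\<^sup>+v. ennreal (norm (f v)) \<partial>M2) * (\<integral>\<^sup>+y. ennreal (norm (g y)) \<partial>M1)"
      by (rule nn_integral_cmult) simp
    also have "\<dots> < \<infinity>" using f g by (simp add: integrable_iff_bounded ennreal_mult_less_top)
    finally show "(\<integral>\<^sup>+w. ennreal (norm (case w of (y, v) \<Rightarrow> f v * g y)) \<partial>(M1 \<Otimes>\<^sub>M M2)) < \<infinity>" .
  qed measurable
  show "(\<integral>(y, v). f v * g y \<partial>(M1 \<Otimes>\<^sub>M M2)) = (\<integral>v. f v \<partial>M2) * (\<integral>y. g y \<partial>M1)"
    using P.integral_fst[OF int] by simp
qed

lemma cmod_ip_le:
  assumes "f \<in> borel_measurable M" "g \<in> borel_measurable M" "nsq M f \<le> ennreal (a^2)" "nsq M g \<le> ennreal (b^2)" "0 \<le> a" "0 \<le> b"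
  shows "cmod (ip M f g) \<le> a * b"
proof -
  have "ennreal ((cmod (ip M f g))^2) \<le> ennreal (a^2) * ennreal (b^2)"
    using ip_le[OF assms(1,2)] mult_mono[OF assms(3,4)] by (auto intro: order_trans)
  also have "\<dots> = ennreal ((a * b)^2)" by (simp add: ennreal_mult[symmetric] power_mult_distrib)
  finally have "(cmod (ip M f g))^2 \<le> (a * b)^2" by simp
  then show ?thesis using assms(5,6) by (simp add: power2_le_iff_abs_le)
qed

lemma L2D: "\<psi> \<in> L2 \<Longrightarrow> \<psi> \<in> borel_measurable borel" "\<psi> \<in> L2 \<Longrightarrow> nsq lborel \<psi> = ennreal ((L2norm \<psi>)^2)"
proof -
  assume \<psi>: "\<psi> \<in> L2"
  then show m: "\<psi> \<in> borel_measurable borel" by (simp add: L2_def)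
  have "nsq lborel \<psi> < \<top>" using \<psi> m nsq_finite_iff[of \<psi> lborel] by (simp add: L2_def)
  then show "nsq lborel \<psi> = ennreal ((L2norm \<psi>)^2)"
    using nsq_eq_integral[of \<psi> lborel] m by (simp add: L2norm_def)
qed

lemma L2norm_nonneg: "0 \<le> L2norm \<psi>" by (simp add: L2norm_def)

lemma ip_integral_exchange:
  fixes H :: "'a \<Rightarrow> 'm \<Rightarrow> complex"
  assumes X: "sigma_finite_measure X" and M: "prob_space M" and h: "integrable X h"
    and H[measurable]: "(\<lambda>(x, m). H x m) \<in> borel_measurable (X \<Otimes>\<^sub>M M)" and C: "\<And>x m. cmod (H x m) \<le> C"
  shows "ip X h (\<lambda>x. \<integral>m. H x m \<partial>M) = (\<integral>m. ip X h (\<lambda>x. H x m) \<partial>M)"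
proof -
  interpret X: sigma_finite_measure X by fact
  interpret M: prob_space M by fact
  interpret P: pair_sigma_finite X M ..
  note [measurable] = borel_measurable_integrable[OF h]
  have int: "integrable (X \<Otimes>\<^sub>M M) (\<lambda>(x, m). cnj (h x) * H x m)"
  proof (rule integrableI_bounded)
    have "(\<integral>\<^sup>+w. ennreal (norm (case w of (x, m) \<Rightarrow> cnj (h x) * H x m)) \<partial>(X \<Otimes>\<^sub>M M)) = (\<integral>\<^sup>+x. \<integral>\<^sup>+m. ennreal (norm (cnj (h x) * H x m)) \<partial>M \<partial>X)"
      by (subst M.nn_integral_fst[symmetric]) auto
    also have "\<dots> \<le> (\<integral>\<^sup>+x. \<integral>\<^sup>+m. ennreal \<bar>C\<bar> * ennreal (norm (h x)) \<partial>M \<partial>X)"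
    proof (intro nn_integral_mono)
      fix x m
      have "norm (cnj (h x) * H x m) \<le> \<bar>C\<bar> * norm (h x)"
        unfolding norm_mult complex_mod_cnj mult.commute[of "\<bar>C\<bar>"] using C[of x m] by (intro mult_left_mono) auto
      then show "ennreal (norm (cnj (h x) * H x m)) \<le> ennreal \<bar>C\<bar> * ennreal (norm (h x))"
        by (simp add: ennreal_mult[symmetric] ennreal_leI)
    qed
    also have "\<dots> = ennreal \<bar>C\<bar> * (\<integral>\<^sup>+x. ennreal (norm (h x)) \<partial>X)"
      by (simp add: M.emeasure_space_1 nn_integral_cmult)
    also have "\<dots> < \<infinity>" using h by (simp add: integrable_iff_bounded ennreal_mult_less_top)
    finally show "(\<integral>\<^sup>+w. ennreal (norm (case w of (x, m) \<Rightarrow> cnj (h x) * H x m)) \<partial>(X \<Otimes>\<^sub>M M)) < \<infinity>" .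
  qed measurable
  show ?thesis using P.Fubini_integral[OF int] by (simp add: ip_def)
qed

lemma integrable_lamcut:
  fixes \<psi> :: "real^'d \<Rightarrow> complex"
  assumes L: "0 < L" and [measurable]: "\<psi> \<in> borel_measurable borel" and fin: "nsq lborel \<psi> < \<top>"
  shows "integrable lborel (lamcut L \<psi>)"
proof -
  have "nsq lborel (\<lambda>x::real^'d. indicator (Lam L) x) = (\<integral>\<^sup>+x. indicator (Lam L) x \<partial>(lborel :: (real^'d) measure))"
    unfolding nsq_def by (intro nn_integral_cong) (auto split: split_indicator)
  then have "nsq lborel (\<lambda>x::real^'d. indicator (Lam L) x) < \<top>" using L by (simp add: emeasure_Lam)
  then have "integrable lborel (\<lambda>x. cnj (indicator (Lam L) x) * \<psi> x)" by (intro integrable_cnj_mult fin) auto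
  moreover have "(\<lambda>x. cnj (indicator (Lam L) x) * \<psi> x) = lamcut L \<psi>"
    by (auto simp: lamcut_def fun_eq_iff split: split_indicator)
  ultimately show ?thesis by (simp only:)
qed

text \<open>The truncated matrix element for prescribed positions, w k being the one used at step k,
  with the strengths v factored out.\<close>

definition Fq :: "(real^'d \<Rightarrow> real^'d \<Rightarrow> real) \<Rightarrow> real \<Rightarrow> nat \<Rightarrow> complex \<Rightarrow> (real^'d \<Rightarrow> complex) \<Rightarrow> (real^'d \<Rightarrow> complex) \<Rightarrow> nat \<Rightarrow> (nat \<Rightarrow> real^'d) \<Rightarrow> complex" where
  "Fq b L N z \<psi>1 \<psi>2 n w = ip lborel (lamcut L \<psi>1) (\<lambda>x. Qst b L N z \<psi>2 n x w)"

lemma Fq_measurable: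
  assumes [measurable]: "\<psi>1 \<in> borel_measurable borel" and \<psi>2: "\<psi>2 \<in> borel_measurable borel"
    and b: "(\<lambda>(x, t). b x t) \<in> borel_measurable (borel \<Otimes>\<^sub>M borel)"
  shows "Fq b L N z \<psi>1 \<psi>2 n \<in> borel_measurable YY"
proof -
  have [measurable]: "(\<lambda>m. Qst b L N z \<psi>2 n (snd m) (fst m)) \<in> borel_measurable (YY \<Otimes>\<^sub>M lborel)"
    by (rule stf_measurable[OF stf_Qst[OF \<psi>2 b]]) measurable
  have "(\<lambda>w. \<integral>x. cnj (lamcut L \<psi>1 x) * Qst b L N z \<psi>2 n x w \<partial>lborel) \<in> borel_measurable YY"
    by (rule lborel.borel_measurable_lebesgue_integral) (simp add: case_prod_beta')
  then show ?thesis unfolding Fq_def[abs_def] ip_def .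
qed

lemma Fq_cong: "(\<And>x k. k < n \<Longrightarrow> b x (w k) = b' x (w' k)) \<Longrightarrow> Fq b L N z \<psi>1 \<psi>2 n w = Fq b' L N z \<psi>1 \<psi>2 n w'"
  unfolding Fq_def using Qst_cong[of n b w b' w' L N z \<psi>2] by simp

lemma dn_n: "canon n \<sigma> \<Longrightarrow> dn n \<sigma> n = \<sigma> ` {..<n}"
proof (intro set_eqI iffI)
  fix s assume c: "canon n \<sigma>" "s \<in> \<sigma> ` {..<n}"
  then obtain i where i: "i < n" "s = \<sigma> i" by auto
  then show "s \<in> dn n \<sigma> n" using c(1) by (auto simp: dn_def canon_def intro: le_less_trans)
next
  fix s assume "s \<in> dn n \<sigma> n"
  then show "s \<in> \<sigma> ` {..<n}" by (intro image_eqI[of _ _ s]) (auto simp: dn_def)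
qed

context scatterer
begin

lemma itRT_expand:
  assumes L: "0 < L" and z: "z \<notin> rpos" and \<psi>: "\<psi> \<in> borel_measurable borel" and fin: "nsq lborel \<psi> < \<top>"
  shows "itRT L N z (potential L B m y v) n \<psi> x =
    (\<Sum>\<gamma>\<in>PiE {..<n} (\<lambda>_. {..<m}). complex_of_real (\<Prod>i<n. v (\<gamma> i)) * Qst (bw L B) L N z \<psi> n x (\<lambda>k. y (\<gamma> k)))"
proof (induction n arbitrary: x)
  case 0
  then show ?case by (simp add: RTs_def)
next
  case (Suc n)
  let ?I = "{..<m} \<times> PiE {..<n} (\<lambda>_. {..<m})" and ?Q = "Qst (bw L B) L N z \<psi> n"
  let ?c = "\<lambda>p. complex_of_real (v (fst p) * (\<Prod>i<n. v (snd p i)))"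
  let ?f = "\<lambda>p x. complex_of_real (bw L B x (y (fst p))) * ?Q x (\<lambda>k. y (snd p k))"
  note bm = bw_measurable[OF B_measurable, of L]
  have Qm: "(\<lambda>x. ?Q x w) \<in> borel_measurable borel" for w
    by (rule stf_measurable[OF stf_Qst[OF \<psi> bm]]) (auto intro!: measurable_YY)
  have bxm: "(\<lambda>x. bw L B x t) \<in> borel_measurable borel" for t using bm by measurable
  have bc: "\<bar>bw L B x t\<bar> \<le> \<beta>0" for x t by (rule abs_bw_le) (rule \<beta>0)
  have Qf: "nsq lborel (\<lambda>x. ?Q x w) < \<top>" for w
    by (rule le_less_trans[OF nsq_Qst_le[OF L z \<psi> bm bc]]) (use fin in \<open>simp add: ennreal_mult_less_top\<close>)
  have "itRT L N z (potential L B m y v) (Suc n) \<psi> x = RT L N z (\<lambda>x. \<Sum>p\<in>?I. ?c p * ?f p x) x"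
  proof -
    \<comment> \<open>\<open>bw\<close> carries a cut in x that the potential lacks. The resolvent
      sees its argument on the box only, so equality there suffices.\<close>
    have eq: "complex_of_real (potential L B m y v x) * itRT L N z (potential L B m y v) n \<psi> x = (\<Sum>p\<in>?I. ?c p * ?f p x)" if "x \<in> Lam L" for x
    proof -
      have pot: "complex_of_real (potential L B m y v x) = (\<Sum>g<m. complex_of_real (v g) * complex_of_real (bw L B x (y g)))"
        using that by (simp add: potential_def bw_def per_def)
      show ?thesis unfolding Suc pot sum_product sum.cartesian_product
        by (intro sum.cong refl) (simp only: case_prod_beta' of_real_mult mult_ac)
    qed
    have "RT L N z (\<lambda>x. complex_of_real (potential L B m y v x) * itRT L N z (potential L B m y v) n \<psi> x) = RT L N z (\<lambda>x. \<Sum>p\<in>?I. ?c p * ?f p x)"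
      by (rule RT_cong_Lam) (rule eq)
    then show ?thesis by (simp only: itRT.simps)
  qed
  also have "\<dots> = (\<Sum>p\<in>?I. ?c p * RT L N z (?f p) x)"
  proof (rule RT_sum[OF L])
    fix p
    show "?f p \<in> borel_measurable borel" using Qm bxm by measurable
    show "nsq lborel (?f p) < \<top>" by (rule nsq_bounded_mult_finite[where c = \<beta>0]) (use Qm Qf bc in auto)
  qed
  also have "\<dots> = (\<Sum>(g, \<gamma>)\<in>?I. complex_of_real (\<Prod>i<Suc n. v ((\<gamma>(n := g)) i)) * Qst (bw L B) L N z \<psi> (Suc n) x (\<lambda>k. y ((\<gamma>(n := g)) k)))"
  proof (intro sum.cong refl, clarify)
    fix g \<gamma>
    have "RT L N z (?f (g, \<gamma>)) x = Qst (bw L B) L N z \<psi> (Suc n) x (\<lambda>k. y ((\<gamma>(n := g)) k))"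
    proof -
      have "?Q x' (\<lambda>k. y (\<gamma> k)) = ?Q x' (\<lambda>k. y ((\<gamma>(n := g)) k))" for x' by (rule Qst_cong) simp
      then show ?thesis by (simp add: RTs_def Wop_def)
    qed
    then show "?c (g, \<gamma>) * RT L N z (?f (g, \<gamma>)) x = complex_of_real (\<Prod>i<Suc n. v ((\<gamma>(n := g)) i)) * Qst (bw L B) L N z \<psi> (Suc n) x (\<lambda>k. y ((\<gamma>(n := g)) k))"
      by (simp add: mult.commute)
  qed
  finally show ?case unfolding sum_PiE_lessThan_Suc .
qed

text \<open>The contribution of the pattern \<sigma> up to the moments of the strengths. After n
  meetings no label is active, so the position argument is a dummy.\<close>

definition GU :: "real \<Rightarrow> nat \<Rightarrow> complex \<Rightarrow> nat \<Rightarrow> (nat \<Rightarrow> nat) \<Rightarrow> (real^'d \<Rightarrow> complex) \<Rightarrow> (real^'d \<Rightarrow> complex) \<Rightarrow> complex" where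
  "GU L N z n \<sigma> \<psi>1 \<psi>2 = ip lborel (lamcut L \<psi>1) (\<lambda>x. Ust L N z B n \<sigma> \<psi>2 n x (\<lambda>_. 0))"

lemma integral_Fq_canon:
  assumes c: "canon n \<sigma>" and L: "0 < L" and z: "z \<notin> rpos"
    and \<psi>1: "\<psi>1 \<in> borel_measurable borel" "nsq lborel \<psi>1 < \<top>" and \<psi>2: "\<psi>2 \<in> borel_measurable borel" "nsq lborel \<psi>2 < \<top>"
  shows "(\<integral>w. Fq (bw L B) L N z \<psi>1 \<psi>2 n (\<lambda>k. w (\<sigma> k)) \<partial>PiM (\<sigma> ` {..<n}) (\<lambda>_. un L)) * complex_of_real ((L ^ CARD('d)) ^ card (\<sigma> ` {..<n})) = GU L N z n \<sigma> \<psi>1 \<psi>2"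
proof -
  let ?S = "\<sigma> ` {..<n}" and ?y = "\<lambda>_::nat. 0 :: real^'d"
  let ?P = "PiM ?S (\<lambda>_. un L) :: (nat \<Rightarrow> real^'d) measure"
  let ?C = "complex_of_real ((L ^ CARD('d)) ^ card ?S)"
  interpret P: prob_space ?P by (rule prob_space_PiM) (rule prob_space_un[OF L])
  note bm = BL_measurable[OF B_measurable, of L]
  have coord: "(\<lambda>w. w s) \<in> ?P \<rightarrow>\<^sub>M borel" if "s \<in> ?S" for s
    by (rule measurable_un[OF measurable_component_singleton[OF that]])
  have om: "(\<lambda>w. \<lambda>k. ov ?y w ?S (\<sigma> k)) \<in> ?P \<rightarrow>\<^sub>M YY"
  proof (rule measurable_YY)
    fix k show "(\<lambda>w. ov ?y w ?S (\<sigma> k)) \<in> ?P \<rightarrow>\<^sub>M borel" using coord by (cases "\<sigma> k \<in> ?S") (simp_all only: ov_def if_True if_False measurable_const space_borel UNIV_I)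
  qed
  \<comment> \<open>Only k < n matters for \<open>Fq\<close>. Overlaying on 0 gives a family that is
    measurable in every coordinate.\<close>
  have eqF: "Fq b L N z \<psi>1 \<psi>2 n (\<lambda>k. w (\<sigma> k)) = Fq b L N z \<psi>1 \<psi>2 n (\<lambda>k. ov ?y w ?S (\<sigma> k))" for b w
    by (rule Fq_cong) (simp add: ov_def)
  have AEL: "AE w in ?P. \<forall>s\<in>?S. w s \<in> Lam L"
  proof (rule AE_finite_allI[OF finite_imageI[OF finite_lessThan]])
    fix s assume s: "s \<in> ?S"
    have "AE t in un L. t \<in> (Lam L :: (real^'d) set)" unfolding un_def by (rule AE_uniform_measureI) auto
    from AE_PiM_component[of ?S "\<lambda>_. un L :: (real^'d) measure" s "\<lambda>t. t \<in> Lam L", OF prob_space_un[OF L] s this]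
    show "AE w in ?P. w s \<in> Lam L" .
  qed
  obtain C where C: "\<And>x w. cmod (Qst (BL L B) L N z \<psi>2 n x w) \<le> C" using Qst_bounded[OF L z \<psi>2 bm abs_BL_le', of N n] by blast
  have "(\<integral>w. Fq (bw L B) L N z \<psi>1 \<psi>2 n (\<lambda>k. w (\<sigma> k)) \<partial>?P) = (\<integral>w. Fq (bw L B) L N z \<psi>1 \<psi>2 n (\<lambda>k. ov ?y w ?S (\<sigma> k)) \<partial>?P)"
    by (intro Bochner_Integration.integral_cong refl eqF)
  also have "\<dots> = (\<integral>w. Fq (BL L B) L N z \<psi>1 \<psi>2 n (\<lambda>k. ov ?y w ?S (\<sigma> k)) \<partial>?P)"
  proof (rule integral_cong_AE)
    show "(\<lambda>w. Fq (bw L B) L N z \<psi>1 \<psi>2 n (\<lambda>k. ov ?y w ?S (\<sigma> k))) \<in> borel_measurable ?P"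
      by (rule measurable_compose[OF om Fq_measurable[OF \<psi>1(1) \<psi>2(1) bw_measurable[OF B_measurable]]])
    show "(\<lambda>w. Fq (BL L B) L N z \<psi>1 \<psi>2 n (\<lambda>k. ov ?y w ?S (\<sigma> k))) \<in> borel_measurable ?P"
      by (rule measurable_compose[OF om Fq_measurable[OF \<psi>1(1) \<psi>2(1) bm]])
    from AEL show "AE w in ?P. Fq (bw L B) L N z \<psi>1 \<psi>2 n (\<lambda>k. ov ?y w ?S (\<sigma> k)) = Fq (BL L B) L N z \<psi>1 \<psi>2 n (\<lambda>k. ov ?y w ?S (\<sigma> k))"
    proof eventually_elim
      fix w :: "nat \<Rightarrow> real^'d" assume w: "\<forall>s\<in>?S. w s \<in> Lam L"
      show "Fq (bw L B) L N z \<psi>1 \<psi>2 n (\<lambda>k. ov ?y w ?S (\<sigma> k)) = Fq (BL L B) L N z \<psi>1 \<psi>2 n (\<lambda>k. ov ?y w ?S (\<sigma> k))"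
        by (rule Fq_cong) (use w in \<open>simp add: ov_def bw_def BL_def\<close>)
    qed
  qed
  also have "\<dots> = ip lborel (lamcut L \<psi>1) (\<lambda>x. \<integral>w. Qst (BL L B) L N z \<psi>2 n x (\<lambda>k. ov ?y w ?S (\<sigma> k)) \<partial>?P)"
    unfolding Fq_def
  proof (rule ip_integral_exchange[OF sigma_finite_lborel P.prob_space_axioms integrable_lamcut[OF L \<psi>1] _ C, symmetric])
    have "(\<lambda>m. Qst (BL L B) L N z \<psi>2 n (fst m) (\<lambda>k. ov ?y (snd m) ?S (\<sigma> k))) \<in> borel_measurable (lborel \<Otimes>\<^sub>M ?P)"
      by (rule stf_measurable[OF stf_Qst[OF \<psi>2(1) bm] _ measurable_compose[OF measurable_snd om]]) simp
    then show "(\<lambda>(x, w). Qst (BL L B) L N z \<psi>2 n x (\<lambda>k. ov ?y w ?S (\<sigma> k))) \<in> borel_measurable (lborel \<Otimes>\<^sub>M ?P)" by (simp add: case_prod_beta')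
  qed
  finally have "(\<integral>w. Fq (bw L B) L N z \<psi>1 \<psi>2 n (\<lambda>k. w (\<sigma> k)) \<partial>?P) * ?C
     = ip lborel (lamcut L \<psi>1) (\<lambda>x. ?C * (\<integral>w. Qst (BL L B) L N z \<psi>2 n x (\<lambda>k. ov ?y w ?S (\<sigma> k)) \<partial>?P))"
    unfolding ip_cmult_right by (simp add: mult.commute)
  also have "\<dots> = GU L N z n \<sigma> \<psi>1 \<psi>2"
    unfolding GU_def Ust_eq_integral_Qst[OF c L z \<psi>2 order_refl] dn_n[OF c] ..
  finally show ?thesis .
qed

end

text \<open>The left side is at most m^n times the n-th power of the largest summand. The 1 covers m
  = 0 and n = 0, where the left side is 0^0 = 1.\<close>

lemma sum_abs_power_le:
  fixes v :: "nat \<Rightarrow> real"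
  shows "(\<Sum>g<m. \<bar>v g\<bar>) ^ n \<le> 1 + real m ^ n * (\<Sum>g<m. \<bar>v g\<bar> ^ n)"
proof (cases "m = 0")
  case True
  then show ?thesis by (cases n) auto
next
  case False
  then obtain g0 where g0: "g0 < m" "\<And>g. g < m \<Longrightarrow> \<bar>v g\<bar> \<le> \<bar>v g0\<bar>"
  proof -
    have fin: "finite ((\<lambda>g. \<bar>v g\<bar>) ` {..<m})" "(\<lambda>g. \<bar>v g\<bar>) ` {..<m} \<noteq> {}" using False by auto
    from Max_in[OF fin] obtain g0 where "g0 < m" "\<bar>v g0\<bar> = Max ((\<lambda>g. \<bar>v g\<bar>) ` {..<m})" by auto
    with fin(1) show ?thesis by (intro that[of g0]) auto
  qed
  have "(\<Sum>g<m. \<bar>v g\<bar>) \<le> (\<Sum>g<m. \<bar>v g0\<bar>)" using g0 by (intro sum_mono) auto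
  then have "(\<Sum>g<m. \<bar>v g\<bar>) ^ n \<le> (real m * \<bar>v g0\<bar>) ^ n" by (intro power_mono) (auto intro: sum_nonneg)
  also have "\<dots> = real m ^ n * \<bar>v g0\<bar> ^ n" by (rule power_mult_distrib)
  also have "\<dots> \<le> real m ^ n * (\<Sum>g<m. \<bar>v g\<bar> ^ n)" using g0(1) by (intro mult_left_mono member_le_sum) auto
  finally show ?thesis by simp
qed

lemma lamcut_per: "0 < L \<Longrightarrow> lamcut L (per L \<psi>) = lamcut L \<psi>"
  by (auto simp: lamcut_def per_def wrap_id fun_eq_iff split: split_indicator)

lemma itRT_lamcut: "lamcut L f = lamcut L g \<Longrightarrow> itRT L N z V n f = itRT L N z V n g"
proof (induction n)
  case 0
  then show ?case by (metis RT_lamcut itRT.simps(1))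
qed simp

lemma potential_measurable:
  assumes [measurable]: "B \<in> borel_measurable borel"
  shows "potential L B m y v \<in> borel_measurable borel"
  unfolding potential_def[abs_def] per_def by measurable

locale random_scatterers = scatterer B \<beta>0 \<beta>1 \<beta>2 + \<mu>: prob_space \<mu>
  for B :: "real^'d \<Rightarrow> real" and \<beta>0 \<beta>1 \<beta>2 :: real and \<mu> :: "real measure" +
  fixes n :: nat
  assumes sets_\<mu>[measurable_cong]: "sets \<mu> = sets borel" and moments: "integrable \<mu> (\<lambda>v. \<bar>v\<bar> ^ n)"
begin

definition PV :: "nat \<Rightarrow> (nat \<Rightarrow> real) measure" where "PV m = PiM {..<m} (\<lambda>_. \<mu>)"
definition PU :: "real \<Rightarrow> nat \<Rightarrow> (nat \<Rightarrow> real^'d) measure" where "PU L m = PiM {..<m} (\<lambda>_. un L)"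
text \<open>A majorant for products of n strengths, integrable by the n-th absolute moment and
  independent of L, N and the positions.\<close>

definition dom :: "nat \<Rightarrow> (nat \<Rightarrow> real) \<Rightarrow> real" where "dom m v = 1 + real m ^ n * (\<Sum>g<m. \<bar>v g\<bar> ^ n)"
definition M\<mu> :: real where "M\<mu> = (\<integral>t. \<bar>t\<bar> ^ n \<partial>\<mu>)"

lemma prob_PV: "prob_space (PV m)" unfolding PV_def by (rule prob_space_PiM) (rule \<mu>.prob_space_axioms)
lemma prob_PU: "0 < L \<Longrightarrow> prob_space (PU L m)" unfolding PU_def by (rule prob_space_PiM) (rule prob_space_un)

lemma PV_coord: "g < m \<Longrightarrow> (\<lambda>v. v g) \<in> borel_measurable (PV m)"
  unfolding PV_def using measurable_component_singleton[of g "{..<m}" "\<lambda>_. \<mu>"] measurable_cong_sets[OF refl sets_\<mu>] by blast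

lemma PU_coord: "g < m \<Longrightarrow> (\<lambda>y. y g) \<in> borel_measurable (PU L m)"
proof -
  assume "g < m"
  then have "(\<lambda>y. y g) \<in> PiM {..<m} (\<lambda>_. un L :: (real^'d) measure) \<rightarrow>\<^sub>M un L" by (intro measurable_component_singleton) simp
  then show ?thesis unfolding PU_def by (rule measurable_un)
qed

lemma integral_PV_coord:
  assumes g: "g < m"
  shows "integrable (PV m) (\<lambda>v. \<bar>v g\<bar> ^ n)" "(\<integral>v. \<bar>v g\<bar> ^ n \<partial>PV m) = M\<mu>"
proof -
  have d: "distr (PV m) \<mu> (\<lambda>v. v g) = \<mu>"
    unfolding PV_def using g by (intro distr_PiM_component \<mu>.prob_space_axioms) auto
  have c: "(\<lambda>v. v g) \<in> PV m \<rightarrow>\<^sub>M \<mu>" unfolding PV_def using g by (intro measurable_component_singleton) simp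
  have m: "(\<lambda>t. \<bar>t\<bar> ^ n) \<in> borel_measurable \<mu>" using moments by (rule borel_measurable_integrable)
  show "integrable (PV m) (\<lambda>v. \<bar>v g\<bar> ^ n)" using integrable_distr_eq[OF c m] moments by (simp add: d)
  show "(\<integral>v. \<bar>v g\<bar> ^ n \<partial>PV m) = M\<mu>" using integral_distr[OF c m] by (simp add: d M\<mu>_def)
qed

lemma integral_dom:
  shows "integrable (PV m) (dom m)" "(\<integral>v. dom m v \<partial>PV m) = 1 + real m ^ n * (real m * M\<mu>)"
proof -
  interpret prob_space "PV m" by (rule prob_PV)
  show "integrable (PV m) (dom m)" unfolding dom_def[abs_def]
    by (intro Bochner_Integration.integrable_add integrable_mult_right Bochner_Integration.integrable_sum integral_PV_coord) auto
  have "(\<integral>v. (\<Sum>g<m. \<bar>v g\<bar> ^ n) \<partial>PV m) = (\<Sum>g<m. M\<mu>)"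
    by (subst Bochner_Integration.integral_sum) (auto simp: integral_PV_coord)
  moreover have "integrable (PV m) (\<lambda>v. real m ^ n * (\<Sum>g<m. \<bar>v g\<bar> ^ n))"
    by (intro integrable_mult_right Bochner_Integration.integrable_sum integral_PV_coord) auto
  ultimately show "(\<integral>v. dom m v \<partial>PV m) = 1 + real m ^ n * (real m * M\<mu>)"
    unfolding dom_def by (simp add: prob_space)
qed

lemma dom_ge: "(\<Sum>g<m. \<bar>v g\<bar>) ^ n \<le> dom m v"
  unfolding dom_def by (rule sum_abs_power_le)

lemma integrable_prod_v:
  assumes \<gamma>: "\<gamma> \<in> PiE {..<n} (\<lambda>_. {..<m})"
  shows "integrable (PV m) (\<lambda>v. complex_of_real (\<Prod>i<n. v (\<gamma> i)))"
proof (rule Bochner_Integration.integrable_bound[OF integral_dom(1)])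
  show "(\<lambda>v. complex_of_real (\<Prod>i<n. v (\<gamma> i))) \<in> borel_measurable (PV m)"
    using \<gamma> by (intro measurable_compose[OF _ borel_measurable_of_real] borel_measurable_prod PV_coord) (auto simp: PiE_iff)
  show "AE v in PV m. norm (complex_of_real (\<Prod>i<n. v (\<gamma> i))) \<le> norm (dom m v)"
  proof (rule AE_I2)
    fix v :: "nat \<Rightarrow> real"
    have "(\<Prod>i<n. \<bar>v (\<gamma> i)\<bar>) \<le> (\<Prod>i<n. (\<Sum>g<m. \<bar>v g\<bar>))"
    proof (rule prod_mono)
      fix i assume "i \<in> {..<n}"
      then have "\<gamma> i \<in> {..<m}" using \<gamma> by (auto simp: PiE_iff)
      then have "\<bar>v (\<gamma> i)\<bar> \<le> (\<Sum>g<m. \<bar>v g\<bar>)" by (intro member_le_sum[of "\<gamma> i" "{..<m}" "\<lambda>g. \<bar>v g\<bar>"]) auto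
      then show "0 \<le> \<bar>v (\<gamma> i)\<bar> \<and> \<bar>v (\<gamma> i)\<bar> \<le> (\<Sum>g<m. \<bar>v g\<bar>)" by simp
    qed
    also have "\<dots> = (\<Sum>g<m. \<bar>v g\<bar>) ^ n" by simp
    also have "\<dots> \<le> dom m v" by (rule dom_ge)
    finally have "(\<Prod>i<n. \<bar>v (\<gamma> i)\<bar>) \<le> dom m v" .
    then show "norm (complex_of_real (\<Prod>i<n. v (\<gamma> i))) \<le> norm (dom m v)" by (simp only: norm_of_real real_norm_def abs_prod)
  qed
qed

text \<open>By independence this is a product over the distinct labels of moments of \<mu>, each of
  order the number of meetings with that label.\<close>

definition c\<sigma> :: "(nat \<Rightarrow> nat) \<Rightarrow> complex" where
  "c\<sigma> \<sigma> = (\<integral>v. complex_of_real (\<Prod>i<n. v (\<sigma> i)) \<partial>PiM (\<sigma> ` {..<n}) (\<lambda>_. \<mu>))"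

definition \<Phi>N :: "real \<Rightarrow> nat \<Rightarrow> complex \<Rightarrow> (real^'d \<Rightarrow> complex) \<Rightarrow> (real^'d \<Rightarrow> complex) \<Rightarrow> nat \<Rightarrow> (nat \<Rightarrow> real^'d) \<times> (nat \<Rightarrow> real) \<Rightarrow> complex" where
  "\<Phi>N L N z \<psi>1 \<psi>2 m w = ip lborel (lamcut L \<psi>1) (itRT L N z (potential L B m (fst w) (snd w)) n \<psi>2)"

definition \<Phi> :: "real \<Rightarrow> complex \<Rightarrow> (real^'d \<Rightarrow> complex) \<Rightarrow> (real^'d \<Rightarrow> complex) \<Rightarrow> nat \<Rightarrow> (nat \<Rightarrow> real^'d) \<times> (nat \<Rightarrow> real) \<Rightarrow> complex" where
  "\<Phi> L z \<psi>1 \<psi>2 m w = inner_L L (per L \<psi>1) (iterR L z (potential L B m (fst w) (snd w)) n (per L \<psi>2))"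

lemma abs_potential_le: "\<bar>potential L B m y v x\<bar> \<le> \<beta>0 * (\<Sum>g<m. \<bar>v g\<bar>)"
proof -
  have "\<bar>potential L B m y v x\<bar> \<le> (\<Sum>g<m. \<bar>v g * per L B (x - y g)\<bar>)" unfolding potential_def by (rule sum_abs)
  also have "\<dots> \<le> (\<Sum>g<m. \<beta>0 * \<bar>v g\<bar>)"
    unfolding abs_mult per_def using \<beta>0 by (intro sum_mono) (metis abs_ge_zero mult.commute mult_right_mono)
  finally show ?thesis by (simp add: sum_distrib_left)
qed

lemma \<beta>0_nonneg: "0 \<le> \<beta>0" using \<beta>0[of 0] by linarith

context
  fixes L :: real and z :: complex and \<psi>1 \<psi>2 :: "real^'d \<Rightarrow> complex"
  assumes L: "0 < L" and z: "z \<notin> rpos" and \<psi>1: "\<psi>1 \<in> L2" and \<psi>2: "\<psi>2 \<in> L2"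
begin

text \<open>The prefactor of the crude bound. It depends neither on N nor on the number m of
  scatterers, so it can be used for domination in both limits.\<close>

definition D :: real where "D = L2norm \<psi>1 * (L2norm \<psi>2 * (1 / infdist z rpos) ^ (n + 1)) * \<beta>0 ^ n"

lemma \<psi>_facts: "\<psi>1 \<in> borel_measurable borel" "nsq lborel \<psi>1 < \<top>" "\<psi>2 \<in> borel_measurable borel" "nsq lborel \<psi>2 < \<top>"
  using L2D[OF \<psi>1] L2D[OF \<psi>2] by auto

lemma \<Phi>N_bound: "cmod (\<Phi>N L N z \<psi>1 \<psi>2 m w) \<le> D * dom m (snd w)"
proof -
  define c where "c = \<beta>0 * (\<Sum>g<m. \<bar>snd w g\<bar>)"
  define d where "d = 1 / infdist z rpos"
  have d0: "0 \<le> d" by (simp add: d_def infdist_nonneg)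
  have c0: "0 \<le> c" unfolding c_def using \<beta>0_nonneg by (intro mult_nonneg_nonneg sum_nonneg) auto
  have V: "\<bar>potential L B m (fst w) (snd w) x\<bar> \<le> c" for x unfolding c_def by (rule abs_potential_le)
  have "nsq lborel (itRT L N z (potential L B m (fst w) (snd w)) n \<psi>2) \<le> ennreal ((c^2)^n * (d^2)^(n + 1)) * ennreal ((L2norm \<psi>2)^2)"
    using itRT_nsq_le[OF L z \<psi>_facts(3) potential_measurable[OF B_measurable] V, of N n] L2D(2)[OF \<psi>2] by (simp add: d_def)
  also have "\<dots> = ennreal ((c^n * d^(n + 1) * L2norm \<psi>2)^2)"
    by (simp only: ennreal_mult[symmetric] power_mult_distrib power_even_eq[symmetric] power_mult[symmetric] mult.commute[of 2] zero_le_power zero_le_power2 mult_nonneg_nonneg c0 d0)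
  finally have "cmod (\<Phi>N L N z \<psi>1 \<psi>2 m w) \<le> L2norm \<psi>1 * (c^n * d^(n + 1) * L2norm \<psi>2)"
    unfolding \<Phi>N_def using \<psi>_facts L2D(2)[OF \<psi>1] nsq_lamcut_le[of lborel L \<psi>1] itRT_measurable[OF L] c0 d0 L2norm_nonneg
    by (intro cmod_ip_le mult_nonneg_nonneg zero_le_power) auto
  also have "\<dots> = L2norm \<psi>1 * (L2norm \<psi>2 * d^(n + 1)) * \<beta>0^n * (\<Sum>g<m. \<bar>snd w g\<bar>)^n"
    unfolding c_def power_mult_distrib by (simp only: mult_ac)
  also have "\<dots> \<le> L2norm \<psi>1 * (L2norm \<psi>2 * d^(n + 1)) * \<beta>0^n * dom m (snd w)"
    using d0 \<beta>0_nonneg L2norm_nonneg by (intro mult_left_mono dom_ge mult_nonneg_nonneg zero_le_power)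
  finally show ?thesis by (simp only: D_def d_def)
qed

lemma \<Phi>N_tendsto: "(\<lambda>N. \<Phi>N L N z \<psi>1 \<psi>2 m w) \<longlonglongrightarrow> \<Phi> L z \<psi>1 \<psi>2 m w"
proof -
  have L2: "L2on L (per L \<psi>1)" "L2on L (per L \<psi>2)"
    unfolding L2on_iff lamcut_per[OF L] using \<psi>_facts nsq_lamcut_le[of lborel L] by (auto intro: le_less_trans)
  have "itRT L N z V n (per L \<psi>2) = itRT L N z V n \<psi>2" for N V by (rule itRT_lamcut[OF lamcut_per[OF L]])
  with ip_iterR_tendsto[OF L z L2(2,1) potential_measurable[OF B_measurable] abs_potential_le[of L m "fst w" "snd w"], of n]
  show ?thesis unfolding \<Phi>N_def \<Phi>_def lamcut_per[OF L] by simp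
qed

lemma \<Phi>N_expand:
  "\<Phi>N L N z \<psi>1 \<psi>2 m w = (\<Sum>\<gamma>\<in>PiE {..<n} (\<lambda>_. {..<m}). complex_of_real (\<Prod>i<n. snd w (\<gamma> i)) * Fq (bw L B) L N z \<psi>1 \<psi>2 n (\<lambda>k. fst w (\<gamma> k)))"
proof -
  have bc: "\<bar>bw L B x t\<bar> \<le> \<beta>0" for x t by (rule abs_bw_le) (rule \<beta>0)
  note bm = bw_measurable[OF B_measurable, of L]
  have Qm: "(\<lambda>x. Qst (bw L B) L N z \<psi>2 n x u) \<in> borel_measurable borel" for u
    by (rule stf_measurable[OF stf_Qst[OF \<psi>_facts(3) bm]]) (auto intro!: measurable_YY)
  have Qf: "nsq lborel (\<lambda>x. Qst (bw L B) L N z \<psi>2 n x u) < \<top>" for u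
    by (rule le_less_trans[OF nsq_Qst_le[OF L z \<psi>_facts(3) bm bc]]) (use \<psi>_facts in \<open>simp add: ennreal_mult_less_top\<close>)
  have l: "nsq lborel (lamcut L \<psi>1) < \<top>" using \<psi>_facts nsq_lamcut_le[of lborel L \<psi>1] by (auto intro: le_less_trans)
  have "\<Phi>N L N z \<psi>1 \<psi>2 m w = ip lborel (lamcut L \<psi>1) (\<lambda>x. \<Sum>\<gamma>\<in>PiE {..<n} (\<lambda>_. {..<m}). complex_of_real (\<Prod>i<n. snd w (\<gamma> i)) * Qst (bw L B) L N z \<psi>2 n x (\<lambda>k. fst w (\<gamma> k)))"
    unfolding \<Phi>N_def itRT_expand[OF L z \<psi>_facts(3,4), abs_def] ..
  also have "\<dots> = (\<Sum>\<gamma>\<in>PiE {..<n} (\<lambda>_. {..<m}). ip lborel (lamcut L \<psi>1) (\<lambda>x. complex_of_real (\<Prod>i<n. snd w (\<gamma> i)) * Qst (bw L B) L N z \<psi>2 n x (\<lambda>k. fst w (\<gamma> k))))"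
  proof (rule ip_sum_right)
    show "lamcut L \<psi>1 \<in> borel_measurable lborel" using \<psi>_facts by simp
    fix \<gamma> :: "nat \<Rightarrow> nat"
    show "(\<lambda>x. complex_of_real (\<Prod>i<n. snd w (\<gamma> i)) * Qst (bw L B) L N z \<psi>2 n x (\<lambda>k. fst w (\<gamma> k))) \<in> borel_measurable lborel" using Qm by simp
    show "nsq lborel (\<lambda>x. complex_of_real (\<Prod>i<n. snd w (\<gamma> i)) * Qst (bw L B) L N z \<psi>2 n x (\<lambda>k. fst w (\<gamma> k))) < \<top>"
      using Qm Qf by (subst nsq_cmult) (auto simp: ennreal_mult_less_top)
  qed (rule l)
  finally show ?thesis by (simp only: ip_cmult_right Fq_def)
qed

lemma Fq_PU:
  assumes "\<gamma> \<in> PiE {..<n} (\<lambda>_. {..<m})"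
  shows "integrable (PU L m) (\<lambda>y. Fq (bw L B) L N z \<psi>1 \<psi>2 n (\<lambda>k. y (\<gamma> k)))"
proof -
  interpret prob_space "PU L m" by (rule prob_PU[OF L])
  have bc: "\<bar>bw L B x t\<bar> \<le> \<beta>0" for x t by (rule abs_bw_le) (rule \<beta>0)
  note bm = bw_measurable[OF B_measurable, of L]
  define K where "K = (\<beta>0^n * (1 / infdist z rpos)^(n + 1) * L2norm \<psi>2)"
  have K0: "0 \<le> K" unfolding K_def using \<beta>0_nonneg L2norm_nonneg infdist_nonneg by (intro mult_nonneg_nonneg zero_le_power) auto
  have Fb: "cmod (Fq (bw L B) L N z \<psi>1 \<psi>2 n u) \<le> L2norm \<psi>1 * K" for u
    unfolding Fq_def
  proof (rule cmod_ip_le)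
    show "lamcut L \<psi>1 \<in> borel_measurable lborel" using \<psi>_facts by simp
    show "(\<lambda>x. Qst (bw L B) L N z \<psi>2 n x u) \<in> borel_measurable lborel"
      using stf_measurable[OF stf_Qst[OF \<psi>_facts(3) bm, of L N z n], of "\<lambda>x. x" borel "\<lambda>_. u"] by (simp add: measurable_YY)
    show "nsq lborel (lamcut L \<psi>1) \<le> ennreal ((L2norm \<psi>1)^2)" using nsq_lamcut_le[of lborel L \<psi>1] L2D(2)[OF \<psi>1] by simp
    have "nsq lborel (\<lambda>x. Qst (bw L B) L N z \<psi>2 n x u) \<le> ennreal ((\<beta>0^2)^n * ((1 / infdist z rpos)^2)^(n + 1)) * ennreal ((L2norm \<psi>2)^2)"
      using nsq_Qst_le[OF L z \<psi>_facts(3) bm bc, of N n u] L2D(2)[OF \<psi>2] by simp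
    also have "\<dots> = ennreal (((\<beta>0^2)^n * ((1 / infdist z rpos)^2)^(n + 1)) * (L2norm \<psi>2)^2)"
      by (rule ennreal_mult[symmetric]) auto
    also have "((\<beta>0^2)^n * ((1 / infdist z rpos)^2)^(n + 1)) * (L2norm \<psi>2)^2 = K^2"
      unfolding K_def by (simp only: power_mult_distrib power_mult[symmetric] mult.commute[of 2])
    finally show "nsq lborel (\<lambda>x. Qst (bw L B) L N z \<psi>2 n x u) \<le> ennreal (K^2)" .
  qed (use K0 L2norm_nonneg in auto)
  \<comment> \<open>For k >= n the value of \<gamma> at k is \<open>undefined\<close>, and the
    corresponding coordinate need not be measurable; \<open>Fq\<close> reads k < n only.\<close>
  define y' where "y' y k = (if k < n then y (\<gamma> k) else 0)" for y :: "nat \<Rightarrow> real^'d" and k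
  have "(\<lambda>y. y' y) \<in> PU L m \<rightarrow>\<^sub>M YY"
  proof (rule measurable_YY)
    fix k show "(\<lambda>y. y' y k) \<in> borel_measurable (PU L m)"
      using assms PU_coord[of "\<gamma> k" m L] by (cases "k < n") (auto simp: y'_def PiE_iff)
  qed
  from measurable_compose[OF this Fq_measurable[OF \<psi>_facts(1,3) bm, of L N z n]]
  have "(\<lambda>y. Fq (bw L B) L N z \<psi>1 \<psi>2 n (y' y)) \<in> borel_measurable (PU L m)" .
  moreover have "Fq (bw L B) L N z \<psi>1 \<psi>2 n (y' y) = Fq (bw L B) L N z \<psi>1 \<psi>2 n (\<lambda>k. y (\<gamma> k))" for y
    by (rule Fq_cong) (simp add: y'_def)
  ultimately have "(\<lambda>y. Fq (bw L B) L N z \<psi>1 \<psi>2 n (\<lambda>k. y (\<gamma> k))) \<in> borel_measurable (PU L m)" by (simp only:)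
  then show ?thesis using Fb by (intro integrable_const_bound[where B = "L2norm \<psi>1 * K"]) auto
qed

end

end

section \<open>Boundedness and convergence of the expectation\<close>

text \<open>Convergence along each sequence is given, but no common limit. Interleaving an arbitrary
  sequence with one reference sequence forces the two limits to coincide.\<close>

lemma ex_tendsto_at_top_real:
  fixes f :: "real \<Rightarrow> complex"
  assumes conv: "\<And>a. filterlim a at_top sequentially \<Longrightarrow> (\<And>k. 0 < a k) \<Longrightarrow> convergent (\<lambda>k. f (a k))"
  shows "\<exists>l. (f \<longlongrightarrow> l) at_top"
proof -
  have "filterlim (\<lambda>k. real k + 1) at_top sequentially"
    by (rule filterlim_at_top_mono[OF filterlim_real_sequentially]) simp
  then have "convergent (\<lambda>k. f (real k + 1))" by (rule conv) linarith
  then obtain l where l: "(\<lambda>k. f (real k + 1)) \<longlonglongrightarrow> l" by (auto simp: convergent_def)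
  have "(f \<longlongrightarrow> l) at_top"
  proof (rule tendsto_at_topI_sequentially)
    fix X :: "nat \<Rightarrow> real" assume X: "filterlim X at_top sequentially"
    \<comment> \<open>\<open>max 1\<close> keeps the interleaved sequence positive, as
      \<open>conv\<close> requires, and has no effect from some index on.\<close>
    define c where "c k = (if even k then max 1 (X (k div 2)) else real (k div 2) + 1)" for k
    have d: "filterlim (\<lambda>k::nat. k div 2) at_top sequentially" by (rule filterlim_at_top_div_const_nat) simp
    have "filterlim c at_top sequentially"
      unfolding filterlim_at_top
    proof
      fix Z
      have "eventually (\<lambda>k. Z \<le> X (k div 2)) sequentially"
        using filterlim_compose[OF X d] unfolding filterlim_at_top by blast
      moreover have "eventually (\<lambda>k. Z \<le> real (k div 2)) sequentially"
        using filterlim_compose[OF filterlim_real_sequentially d] unfolding filterlim_at_top by blast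
      ultimately show "eventually (\<lambda>k. Z \<le> c k) sequentially" by eventually_elim (auto simp: c_def)
    qed
    then have "convergent (\<lambda>k. f (c k))" by (rule conv) (auto simp: c_def)
    then obtain l' where l': "(\<lambda>k. f (c k)) \<longlonglongrightarrow> l'" by (auto simp: convergent_def)
    have "((\<lambda>k. f (c k)) \<circ> (\<lambda>k. 2 * k + 1)) \<longlonglongrightarrow> l'"
      by (rule LIMSEQ_subseq_LIMSEQ[OF l']) (auto simp: strict_mono_def)
    then have "(\<lambda>k. f (real k + 1)) \<longlonglongrightarrow> l'" by (simp add: o_def c_def)
    then have "l' = l" using l by (rule LIMSEQ_unique)
    have "((\<lambda>k. f (c k)) \<circ> (\<lambda>k. 2 * k)) \<longlonglongrightarrow> l'"
      by (rule LIMSEQ_subseq_LIMSEQ[OF l']) (auto simp: strict_mono_def)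
    then have lim: "(\<lambda>k. f (max 1 (X k))) \<longlonglongrightarrow> l" by (simp add: o_def c_def \<open>l' = l\<close>)
    have "eventually (\<lambda>k. 1 \<le> X k) sequentially" using X unfolding filterlim_at_top by blast
    then have "eventually (\<lambda>k. f (max 1 (X k)) = f (X k)) sequentially" by eventually_elim (simp add: max_absorb2)
    with lim show "(\<lambda>k. f (X k)) \<longlonglongrightarrow> l" by (rule Lim_transform_eventually)
  qed
  then show ?thesis by blast
qed

lemma stf_diff:
  assumes "stf A u" "stf A v"
  shows "stf A (\<lambda>x y. u x y - v x y)"
  using assms unfolding stf_def case_prod_beta' by (intro conjI allI impI borel_measurable_diff) metis+

lemma Ust_outside: "x \<notin> Lam L \<Longrightarrow> Ust L N z B n \<sigma> \<psi> i x y = 0"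
  by (cases i) (simp_all add: RTs_def RT_outside)

context random_scatterers
begin

definition J :: "real \<Rightarrow> nat \<Rightarrow> complex \<Rightarrow> (real^'d \<Rightarrow> complex) \<Rightarrow> (real^'d \<Rightarrow> complex) \<Rightarrow> (nat \<Rightarrow> nat) \<Rightarrow> complex" where
  "J L N z \<psi>1 \<psi>2 \<sigma> = (\<integral>w. Fq (bw L B) L N z \<psi>1 \<psi>2 n (\<lambda>k. w (\<sigma> k)) \<partial>PiM (\<sigma> ` {..<n}) (\<lambda>_. un L))"

context
  fixes L :: real and z :: complex and \<psi>1 \<psi>2 :: "real^'d \<Rightarrow> complex"
  assumes L: "0 < L" and z: "z \<notin> rpos" and \<psi>1: "\<psi>1 \<in> L2" and \<psi>2: "\<psi>2 \<in> L2"
begin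

lemma integral_prod_v_reindex:
  assumes \<tau>: "\<tau> \<in> InjE (\<sigma> ` {..<n}) m"
  shows "(\<integral>v. complex_of_real (\<Prod>i<n. v (restrict (\<tau> \<circ> \<sigma>) {..<n} i)) \<partial>PV m) = c\<sigma> \<sigma>"
proof -
  let ?S = "\<sigma> ` {..<n}"
  have coord: "(\<lambda>v. v s) \<in> borel_measurable (PiM ?S (\<lambda>_. \<mu>))" if "s \<in> ?S" for s
    using measurable_component_singleton[OF that, of "\<lambda>_. \<mu>"] measurable_cong_sets[OF refl sets_\<mu>] by blast
  have meas: "(\<lambda>v. complex_of_real (\<Prod>i<n. v (\<sigma> i))) \<in> borel_measurable (PiM ?S (\<lambda>_. \<mu>))"
    by (intro measurable_compose[OF _ borel_measurable_of_real] borel_measurable_prod coord) auto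
  have e: "(\<Prod>i<n. v (restrict (\<tau> \<circ> \<sigma>) {..<n} i)) = (\<Prod>i<n. (\<lambda>s\<in>?S. v (\<tau> s)) (\<sigma> i))" for v :: "nat \<Rightarrow> real"
    by (rule prod.cong) auto
  show ?thesis unfolding e PV_def c\<sigma>_def by (rule integral_PiM_reindex[OF \<mu>.prob_space_axioms \<tau> meas])
qed

lemma integral_Fq_reindex:
  assumes \<tau>: "\<tau> \<in> InjE (\<sigma> ` {..<n}) m"
  shows "(\<integral>y. Fq (bw L B) L N z \<psi>1 \<psi>2 n (\<lambda>k. y (restrict (\<tau> \<circ> \<sigma>) {..<n} k)) \<partial>PU L m) = J L N z \<psi>1 \<psi>2 \<sigma>"
proof -
  let ?S = "\<sigma> ` {..<n}"
  let ?P = "PiM ?S (\<lambda>_. un L) :: (nat \<Rightarrow> real^'d) measure"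
  let ?F = "Fq (bw L B) L N z \<psi>1 \<psi>2 n"
  define y' where "y' w k = (if k < n then w (\<sigma> k) else 0)" for w :: "nat \<Rightarrow> real^'d" and k
  have "(\<lambda>w. y' w) \<in> ?P \<rightarrow>\<^sub>M YY"
  proof (rule measurable_YY)
    fix k show "(\<lambda>w. y' w k) \<in> borel_measurable ?P"
    proof (cases "k < n")
      case True
      then have "(\<lambda>w. w (\<sigma> k)) \<in> ?P \<rightarrow>\<^sub>M un L" by (intro measurable_component_singleton) auto
      then have "(\<lambda>w. w (\<sigma> k)) \<in> borel_measurable ?P" by (rule measurable_un)
      then show ?thesis using True by (simp add: y'_def)
    qed (simp add: y'_def)
  qed
  from measurable_compose[OF this Fq_measurable[OF L2D(1)[OF \<psi>1] L2D(1)[OF \<psi>2] bw_measurable[OF B_measurable, of L], of L N z n]]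
  have "(\<lambda>w. ?F (y' w)) \<in> borel_measurable ?P" .
  moreover have "?F (y' w) = ?F (\<lambda>k. w (\<sigma> k))" for w by (rule Fq_cong) (simp add: y'_def)
  ultimately have meas: "(\<lambda>w. ?F (\<lambda>k. w (\<sigma> k))) \<in> borel_measurable ?P" by (simp only:)
  have e: "?F (\<lambda>k. y (restrict (\<tau> \<circ> \<sigma>) {..<n} k)) = ?F (\<lambda>k. (\<lambda>s\<in>?S. y (\<tau> s)) (\<sigma> k))" for y :: "nat \<Rightarrow> real^'d"
    by (rule Fq_cong) simp
  show ?thesis unfolding e PU_def J_def by (rule integral_PiM_reindex[OF prob_space_un[OF L] \<tau> meas])
qed

text \<open>After grouping by patterns, the integrals do not depend on the injection, so counting
  injections produces the falling factorial of m.\<close>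

lemma integral_\<Phi>N:
  shows "integrable (PU L m \<Otimes>\<^sub>M PV m) (\<Phi>N L N z \<psi>1 \<psi>2 m)"
    and "(\<integral>w. \<Phi>N L N z \<psi>1 \<psi>2 m w \<partial>(PU L m \<Otimes>\<^sub>M PV m)) =
      (\<Sum>\<sigma>\<in>Can n. complex_of_real (real (\<Prod>i<card (\<sigma> ` {..<n}). m - i)) * (c\<sigma> \<sigma> * J L N z \<psi>1 \<psi>2 \<sigma>))"
proof -
  let ?M = "PU L m \<Otimes>\<^sub>M PV m" and ?F = "Fq (bw L B) L N z \<psi>1 \<psi>2 n"
  let ?G = "PiE {..<n} (\<lambda>_. {..<m})"
  define t where "t \<gamma> w = complex_of_real (\<Prod>i<n. snd w (\<gamma> i)) * ?F (\<lambda>k. fst w (\<gamma> k))" for \<gamma> :: "nat \<Rightarrow> nat" and w :: "(nat \<Rightarrow> real^'d) \<times> (nat \<Rightarrow> real)"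
  define h where "h \<gamma> = (\<integral>v. complex_of_real (\<Prod>i<n. v (\<gamma> i)) \<partial>PV m) * (\<integral>y. ?F (\<lambda>k. y (\<gamma> k)) \<partial>PU L m)" for \<gamma> :: "nat \<Rightarrow> nat"
  have e: "\<Phi>N L N z \<psi>1 \<psi>2 m = (\<lambda>w. \<Sum>\<gamma>\<in>?G. t \<gamma> w)"
    unfolding t_def by (rule ext) (rule \<Phi>N_expand[OF L z \<psi>1 \<psi>2])
  have ti: "integrable ?M (t \<gamma>)" and th: "(\<integral>w. t \<gamma> w \<partial>?M) = h \<gamma>" if "\<gamma> \<in> ?G" for \<gamma>
    using integral_pair_mult[OF prob_PU[OF L] prob_PV Fq_PU[OF L z \<psi>1 \<psi>2 that] integrable_prod_v[OF that], of N]
    unfolding case_prod_beta' t_def[abs_def] h_def by blast+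
  show "integrable ?M (\<Phi>N L N z \<psi>1 \<psi>2 m)"
    unfolding e by (rule Bochner_Integration.integrable_sum) (rule ti)
  have "(\<integral>w. \<Phi>N L N z \<psi>1 \<psi>2 m w \<partial>?M) = (\<Sum>\<gamma>\<in>?G. h \<gamma>)"
    unfolding e using ti th by (simp add: Bochner_Integration.integral_sum)
  also have "\<dots> = (\<Sum>\<sigma>\<in>Can n. \<Sum>\<tau>\<in>InjE (\<sigma> ` {..<n}) m. h (restrict (\<tau> \<circ> \<sigma>) {..<n}))" by (rule sum_PiE_canon)
  also have "\<dots> = (\<Sum>\<sigma>\<in>Can n. \<Sum>\<tau>\<in>InjE (\<sigma> ` {..<n}) m. c\<sigma> \<sigma> * J L N z \<psi>1 \<psi>2 \<sigma>)"
    unfolding h_def by (intro sum.cong refl) (simp only: integral_prod_v_reindex integral_Fq_reindex)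
  also have "\<dots> = (\<Sum>\<sigma>\<in>Can n. complex_of_real (real (\<Prod>i<card (\<sigma> ` {..<n}). m - i)) * (c\<sigma> \<sigma> * J L N z \<psi>1 \<psi>2 \<sigma>))"
    by (simp only: sum_constant card_InjE finite_imageI finite_lessThan of_real_of_nat_eq)
  finally show "(\<integral>w. \<Phi>N L N z \<psi>1 \<psi>2 m w \<partial>?M) = (\<Sum>\<sigma>\<in>Can n. complex_of_real (real (\<Prod>i<card (\<sigma> ` {..<n}). m - i)) * (c\<sigma> \<sigma> * J L N z \<psi>1 \<psi>2 \<sigma>))" .
qed

lemma integral_dom_pair:
  shows "integrable (PU L m \<Otimes>\<^sub>M PV m) (\<lambda>w. dom m (snd w))"
    and "(\<integral>w. dom m (snd w) \<partial>(PU L m \<Otimes>\<^sub>M PV m)) = 1 + real m ^ n * (real m * M\<mu>)"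
proof -
  interpret U: prob_space "PU L m" by (rule prob_PU[OF L])
  have 1: "integrable (PU L m) (\<lambda>_. 1 :: complex)" by simp
  have d: "integrable (PV m) (\<lambda>v. complex_of_real (dom m v))" using integral_dom(1) by (simp only: complex_of_real_integrable_eq)
  note pm = integral_pair_mult[OF prob_PU[OF L] prob_PV 1 d, unfolded case_prod_beta' mult_1_right]
  show i: "integrable (PU L m \<Otimes>\<^sub>M PV m) (\<lambda>w. dom m (snd w))" using pm(1) by (simp only: complex_of_real_integrable_eq)
  have "complex_of_real (\<integral>w. dom m (snd w) \<partial>(PU L m \<Otimes>\<^sub>M PV m)) = complex_of_real (\<integral>v. dom m v \<partial>PV m)"
    using pm(2) by (simp add: U.prob_space)
  then show "(\<integral>w. dom m (snd w) \<partial>(PU L m \<Otimes>\<^sub>M PV m)) = 1 + real m ^ n * (real m * M\<mu>)"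
    unfolding of_real_eq_iff integral_dom(2) .
qed

lemma cmod_integral_\<Phi>N_le:
  "cmod (\<integral>w. \<Phi>N L N z \<psi>1 \<psi>2 m w \<partial>(PU L m \<Otimes>\<^sub>M PV m)) \<le> D z \<psi>1 \<psi>2 * (1 + real m ^ n * (real m * M\<mu>))"
proof -
  let ?M = "PU L m \<Otimes>\<^sub>M PV m"
  have "cmod (\<integral>w. \<Phi>N L N z \<psi>1 \<psi>2 m w \<partial>?M) \<le> (\<integral>w. cmod (\<Phi>N L N z \<psi>1 \<psi>2 m w) \<partial>?M)" by (rule integral_norm_bound)
  also have "\<dots> \<le> (\<integral>w. D z \<psi>1 \<psi>2 * dom m (snd w) \<partial>?M)"
    by (intro integral_mono integrable_norm integral_\<Phi>N(1) integrable_mult_right integral_dom_pair(1) \<Phi>N_bound[OF L z \<psi>1 \<psi>2])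
  finally show ?thesis by (simp only: integral_mult_right_zero integral_dom_pair(2))
qed

lemma integral_\<Phi>N_tendsto:
  "(\<lambda>N. \<integral>w. \<Phi>N L N z \<psi>1 \<psi>2 m w \<partial>(PU L m \<Otimes>\<^sub>M PV m)) \<longlonglongrightarrow> (\<integral>w. \<Phi> L z \<psi>1 \<psi>2 m w \<partial>(PU L m \<Otimes>\<^sub>M PV m))"
proof (rule integral_dominated_convergence)
  let ?M = "PU L m \<Otimes>\<^sub>M PV m"
  show m: "\<Phi>N L N z \<psi>1 \<psi>2 m \<in> borel_measurable ?M" for N
    by (rule borel_measurable_integrable) (rule integral_\<Phi>N(1))
  show "\<Phi> L z \<psi>1 \<psi>2 m \<in> borel_measurable ?M"
    by (rule borel_measurable_LIMSEQ_metric[OF m]) (rule \<Phi>N_tendsto[OF L z \<psi>1 \<psi>2])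
  show "integrable ?M (\<lambda>w. D z \<psi>1 \<psi>2 * dom m (snd w))" by (intro integrable_mult_right integral_dom_pair(1))
  show "AE w in ?M. (\<lambda>N. \<Phi>N L N z \<psi>1 \<psi>2 m w) \<longlonglongrightarrow> \<Phi> L z \<psi>1 \<psi>2 m w"
    by (intro AE_I2 \<Phi>N_tendsto[OF L z \<psi>1 \<psi>2])
  show "AE w in ?M. norm (\<Phi>N L N z \<psi>1 \<psi>2 m w) \<le> D z \<psi>1 \<psi>2 * dom m (snd w)" for N
    by (intro AE_I2 \<Phi>N_bound[OF L z \<psi>1 \<psi>2])
qed

definition TN :: "nat \<Rightarrow> complex" where "TN N = (\<Sum>\<sigma>\<in>Can n. c\<sigma> \<sigma> * GU L N z n \<sigma> \<psi>1 \<psi>2)"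

text \<open>The limit in N is taken by dominated convergence twice: over positions and strengths for
  fixed m, then over the Poisson variable, where the majorant is a polynomial in m. At fixed N the
  Poisson sum is evaluated exactly, pattern by pattern.\<close>

lemma T_tendsto: "TN \<longlonglongrightarrow> T B \<mu> n L z \<psi>1 \<psi>2"
proof -
  let ?l = "L ^ CARD('d)"
  let ?p = "poisson_pmf ?l"
  have l: "0 < ?l" using L by simp
  define A where "A N m = (\<integral>w. \<Phi>N L N z \<psi>1 \<psi>2 m w \<partial>(PU L m \<Otimes>\<^sub>M PV m))" for N m
  define A' where "A' m = (\<integral>w. \<Phi> L z \<psi>1 \<psi>2 m w \<partial>(PU L m \<Otimes>\<^sub>M PV m))" for m
  define b where "b m = D z \<psi>1 \<psi>2 * (1 + real m ^ n * (real m * M\<mu>))" for m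
  have Ab: "cmod (A N m) \<le> b m" for N m unfolding A_def b_def by (rule cmod_integral_\<Phi>N_le)
  have b0: "0 \<le> b m" for m using Ab[of 0 m] norm_ge_zero order_trans by blast
  have sb: "summable (\<lambda>m. pmf ?p m * b m)"
  proof -
    have "summable (\<lambda>m. D z \<psi>1 \<psi>2 * (pmf ?p m * real m ^ 0) + D z \<psi>1 \<psi>2 * M\<mu> * (pmf ?p m * real m ^ (n + 1)))"
      by (intro summable_add summable_mult poisson_moment_summable l)
    then show ?thesis unfolding b_def by (simp add: algebra_simps)
  qed
  have ib: "integrable (measure_pmf ?p) b"
  proof -
    have "summable (\<lambda>m. pmf ?p m * cmod (complex_of_real (b m)))" using sb b0 by simp
    from expectation_pmf_nat(1)[OF this] show ?thesis by (simp only: complex_of_real_integrable_eq)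
  qed
  have EA: "measure_pmf.expectation ?p (A N) = TN N" for N
  proof -
    have "summable (\<lambda>m. pmf ?p m * cmod (A N m))"
      by (rule summable_comparison_test'[OF sb]) (simp add: mult_left_mono Ab)
    then have 1: "measure_pmf.expectation ?p (A N) = (\<Sum>m. pmf ?p m *\<^sub>R A N m)" by (rule expectation_pmf_nat(2))
    have "(\<lambda>m. \<Sum>\<sigma>\<in>Can n. complex_of_real (pmf ?p m * real (\<Prod>i<card (\<sigma> ` {..<n}). m - i)) * (c\<sigma> \<sigma> * J L N z \<psi>1 \<psi>2 \<sigma>))
      sums (\<Sum>\<sigma>\<in>Can n. complex_of_real (?l ^ card (\<sigma> ` {..<n})) * (c\<sigma> \<sigma> * J L N z \<psi>1 \<psi>2 \<sigma>))"
      by (intro sums_sum sums_mult2 sums_of_real poisson_factorial_moment l)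
    moreover have "(\<Sum>\<sigma>\<in>Can n. complex_of_real (pmf ?p m * real (\<Prod>i<card (\<sigma> ` {..<n}). m - i)) * (c\<sigma> \<sigma> * J L N z \<psi>1 \<psi>2 \<sigma>)) = pmf ?p m *\<^sub>R A N m" for m
      unfolding A_def integral_\<Phi>N(2) scaleR_conv_of_real sum_distrib_left of_real_mult by (simp only: mult.assoc)
    moreover have "(\<Sum>\<sigma>\<in>Can n. complex_of_real (?l ^ card (\<sigma> ` {..<n})) * (c\<sigma> \<sigma> * J L N z \<psi>1 \<psi>2 \<sigma>)) = TN N"
      unfolding TN_def
    proof (rule sum.cong[OF refl])
      fix \<sigma> assume "\<sigma> \<in> Can n"
      then have c: "canon n \<sigma>" by (simp add: Can_def)
      have "J L N z \<psi>1 \<psi>2 \<sigma> * complex_of_real (?l ^ card (\<sigma> ` {..<n})) = GU L N z n \<sigma> \<psi>1 \<psi>2"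
        unfolding J_def by (rule integral_Fq_canon[OF c L z \<psi>_facts[OF L z \<psi>1 \<psi>2]])
      then show "complex_of_real (?l ^ card (\<sigma> ` {..<n})) * (c\<sigma> \<sigma> * J L N z \<psi>1 \<psi>2 \<sigma>) = c\<sigma> \<sigma> * GU L N z n \<sigma> \<psi>1 \<psi>2"
        by (metis mult.commute mult.left_commute)
    qed
    ultimately have "(\<lambda>m. pmf ?p m *\<^sub>R A N m) sums TN N" by (simp only:)
    then show ?thesis unfolding 1 by (rule sums_unique[symmetric])
  qed
  have "(\<lambda>N. measure_pmf.expectation ?p (A N)) \<longlonglongrightarrow> measure_pmf.expectation ?p A'"
  proof (rule integral_dominated_convergence[OF _ _ ib])
    show "AE m in measure_pmf ?p. (\<lambda>N. A N m) \<longlonglongrightarrow> A' m"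
      unfolding A_def A'_def by (intro AE_I2 integral_\<Phi>N_tendsto)
    show "AE m in measure_pmf ?p. norm (A N m) \<le> b m" for N by (intro AE_I2 Ab)
  qed simp_all
  moreover have "measure_pmf.expectation ?p A' = T B \<mu> n L z \<psi>1 \<psi>2"
    unfolding T_def A'_def[abs_def] PU_def PV_def un_def \<Phi>_def case_prod_beta' ..
  ultimately show ?thesis unfolding EA by simp
qed

text \<open>The square root appears because \<kappa> measures the cost of a meeting in squared
  norm.\<close>

lemma GU_bound:
  assumes c: "canon n \<sigma>"
  shows "cmod (GU L N z n \<sigma> \<psi>1 \<psi>2) \<le> L2norm \<psi>1 * (sqrt \<kappa> ^ n * (1 / infdist z rpos) ^ (n + 1) * L2norm \<psi>2)"
  unfolding GU_def
proof (rule cmod_ip_le)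
  let ?d = "1 / infdist z rpos"
  note pf = \<psi>_facts[OF L z \<psi>1 \<psi>2]
  note ub = Ust_stf_bound[OF c L z pf(3) order_refl, of N, unfolded act_n]
  show "lamcut L \<psi>1 \<in> borel_measurable lborel" using pf by simp
  show "(\<lambda>x. Ust L N z B n \<sigma> \<psi>2 n x (\<lambda>_. 0)) \<in> borel_measurable lborel"
    by (rule stf_measurable[OF conjunct1[OF ub]]) (auto intro!: measurable_YY)
  show "nsq lborel (lamcut L \<psi>1) \<le> ennreal ((L2norm \<psi>1)^2)" using nsq_lamcut_le[of lborel L \<psi>1] L2D(2)[OF \<psi>1] by simp
  have "nsq lborel (\<lambda>x. Ust L N z B n \<sigma> \<psi>2 n x (\<lambda>_. 0)) \<le> ennreal (\<kappa>^n * (?d^2)^(n + 1)) * ennreal ((L2norm \<psi>2)^2)"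
    using conjunct2[OF ub] unfolding nn_empty[OF conjunct1[OF ub], of "\<lambda>_. 0"] L2D(2)[OF \<psi>2] .
  also have "\<dots> = ennreal ((\<kappa>^n * (?d^2)^(n + 1)) * (L2norm \<psi>2)^2)"
    by (rule ennreal_mult[symmetric]) (auto simp: \<kappa>_nonneg)
  also have "(\<kappa>^n * (?d^2)^(n + 1)) * (L2norm \<psi>2)^2 = (sqrt \<kappa> ^ n * ?d ^ (n + 1) * L2norm \<psi>2)^2"
  proof -
    have "(sqrt \<kappa> ^ n)^2 = \<kappa> ^ n" using \<kappa>_nonneg by (metis power_mult mult.commute real_sqrt_pow2)
    moreover have "(?d ^ (n + 1))^2 = (?d^2)^(n + 1)" by (metis power_mult mult.commute)
    ultimately show ?thesis by (simp only: power_mult_distrib)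
  qed
  finally show "nsq lborel (\<lambda>x. Ust L N z B n \<sigma> \<psi>2 n x (\<lambda>_. 0)) \<le> ennreal ((sqrt \<kappa> ^ n * ?d ^ (n + 1) * L2norm \<psi>2)^2)" .
  show "0 \<le> sqrt \<kappa> ^ n * ?d ^ (n + 1) * L2norm \<psi>2"
    using \<kappa>_nonneg L2norm_nonneg infdist_nonneg by (intro mult_nonneg_nonneg zero_le_power) auto
qed (rule L2norm_nonneg)

text \<open>Each truncation satisfies the bound with a constant free of N and L, so the bound passes
  to the limit. The constant depends on B through \<kappa> and on \<mu> through the moments
  c\<sigma>.\<close>

lemma T_bound:
  "cmod (T B \<mu> n L z \<psi>1 \<psi>2) \<le> ((\<Sum>\<sigma>\<in>Can n. cmod (c\<sigma> \<sigma>)) * sqrt \<kappa> ^ n) * L2norm \<psi>1 * L2norm \<psi>2 / infdist z rpos ^ (n + 1)"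
proof (rule Lim_bounded[OF tendsto_norm[OF T_tendsto]], intro allI impI)
  fix N
  let ?b = "L2norm \<psi>1 * (sqrt \<kappa> ^ n * (1 / infdist z rpos) ^ (n + 1) * L2norm \<psi>2)"
  have "cmod (TN N) \<le> (\<Sum>\<sigma>\<in>Can n. cmod (c\<sigma> \<sigma>) * ?b)"
    unfolding TN_def
  proof (rule sum_norm_le)
    fix \<sigma> assume "\<sigma> \<in> Can n"
    then have "canon n \<sigma>" by (simp add: Can_def)
    from GU_bound[OF this] show "norm (c\<sigma> \<sigma> * GU L N z n \<sigma> \<psi>1 \<psi>2) \<le> cmod (c\<sigma> \<sigma>) * ?b"
      unfolding norm_mult by (rule mult_left_mono) simp
  qed
  also have "\<dots> = (\<Sum>\<sigma>\<in>Can n. cmod (c\<sigma> \<sigma>)) * ?b" by (rule sum_distrib_right[symmetric])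
  also have "\<dots> = ((\<Sum>\<sigma>\<in>Can n. cmod (c\<sigma> \<sigma>)) * sqrt \<kappa> ^ n) * L2norm \<psi>1 * L2norm \<psi>2 / infdist z rpos ^ (n + 1)"
    by (simp add: power_divide mult_ac)
  finally show "cmod (TN N) \<le> ((\<Sum>\<sigma>\<in>Can n. cmod (c\<sigma> \<sigma>)) * sqrt \<kappa> ^ n) * L2norm \<psi>1 * L2norm \<psi>2 / infdist z rpos ^ (n + 1)" .
qed

end

lemma GU_convergent:
  fixes a :: "nat \<Rightarrow> real" and Nn :: "nat \<Rightarrow> nat"
  assumes c: "canon n \<sigma>" and a: "filterlim a at_top sequentially" "\<And>k. 0 < a k" and N: "filterlim Nn at_top sequentially"
    and z: "z \<notin> rpos" and \<psi>1: "\<psi>1 \<in> L2" and \<psi>2: "\<psi>2 \<in> L2"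
  shows "convergent (\<lambda>k. GU (a k) (Nn k) z n \<sigma> \<psi>1 \<psi>2)"
proof -
  \<comment> \<open>These facts do not involve the box; their context asks for some positive size,
    and 1 will do.\<close>
  note pf = \<psi>_facts[OF zero_less_one z \<psi>1 \<psi>2]
  obtain u where u: "stf {} u" "nn {} u < \<top>" "(\<lambda>k. nn {} (\<lambda>x y. Ust (a k) (Nn k) z B n \<sigma> \<psi>2 n x y - u x y)) \<longlonglongrightarrow> 0"
    using Ust_convergent[OF c a N z pf(3,4) order_refl, unfolded act_n] by (elim exE conjE) (rule that)
  define U where "U k x = Ust (a k) (Nn k) z B n \<sigma> \<psi>2 n x (\<lambda>_. 0)" for k x
  have s: "stf {} (Ust (a k) (Nn k) z B n \<sigma> \<psi>2 n)" for k
    using Ust_stf_bound[OF c a(2) z pf(3) order_refl, of k "Nn k", unfolded act_n] by (rule conjunct1)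
  have Uf: "nsq lborel (U k) < \<top>" for k
  proof -
    have "nsq lborel (U k) = nn {} (Ust (a k) (Nn k) z B n \<sigma> \<psi>2 n)"
      unfolding U_def[abs_def] by (rule nn_empty[OF s, symmetric])
    also have "\<dots> \<le> ennreal (\<kappa>^n * ((1 / infdist z rpos)^2)^(n + 1)) * nsq lborel \<psi>2"
      using Ust_stf_bound[OF c a(2) z pf(3) order_refl, of k "Nn k", unfolded act_n] by (rule conjunct2)
    also have "\<dots> < \<top>" using pf(4) by (simp add: ennreal_mult_less_top)
    finally show ?thesis .
  qed
  have "(\<lambda>k. ip lborel \<psi>1 (U k)) \<longlonglongrightarrow> ip lborel \<psi>1 (\<lambda>x. u x (\<lambda>_. 0))"
  proof (rule ip_tendsto)
    show "U k \<in> borel_measurable lborel" for k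
      unfolding U_def[abs_def] by (rule stf_measurable[OF s]) (auto intro!: measurable_YY)
    show "(\<lambda>x. u x (\<lambda>_. 0)) \<in> borel_measurable lborel" by (rule stf_measurable[OF u(1)]) (auto intro!: measurable_YY)
    show "\<psi>1 \<in> borel_measurable lborel" using pf(1) by simp
    show "nsq lborel (\<lambda>x. u x (\<lambda>_. 0)) < \<top>" using u(2) unfolding nn_empty[OF u(1), of "\<lambda>_. 0"] .
    show "nsq lborel \<psi>1 < \<top>" by (rule pf(2))
    have "nn {} (\<lambda>x y. Ust (a k) (Nn k) z B n \<sigma> \<psi>2 n x y - u x y) = nsq lborel (\<lambda>x. U k x - u x (\<lambda>_. 0))" for k
      unfolding U_def by (rule nn_empty[OF stf_diff[OF s u(1)]])
    with u(3) show "(\<lambda>k. nsq lborel (\<lambda>x. U k x - u x (\<lambda>_. 0))) \<longlonglongrightarrow> 0" by (simp only:)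
  qed (rule Uf)
  \<comment> \<open>\<open>Ust\<close> vanishes outside the box, so the cut of \<psi>1 may be
    dropped and the left argument no longer depends on k.\<close>
  moreover have "ip lborel \<psi>1 (U k) = GU (a k) (Nn k) z n \<sigma> \<psi>1 \<psi>2" for k
  proof -
    have "cnj (\<psi>1 x) * U k x = cnj (lamcut (a k) \<psi>1 x) * U k x" for x
      by (cases "x \<in> Lam (a k)") (simp_all add: U_def Ust_outside lamcut_def)
    then show ?thesis unfolding GU_def ip_def U_def[symmetric] by (simp only:)
  qed
  ultimately show ?thesis by (auto simp: convergent_def)
qed

lemma T_sequence_convergent:
  assumes a: "filterlim a at_top sequentially" "\<And>k. 0 < a k"
    and z: "z \<notin> rpos" and \<psi>1: "\<psi>1 \<in> L2" and \<psi>2: "\<psi>2 \<in> L2"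
  shows "convergent (\<lambda>k. T B \<mu> n (a k) z \<psi>1 \<psi>2)"
proof -
  define S where "S k N = (\<Sum>\<sigma>\<in>Can n. c\<sigma> \<sigma> * GU (a k) N z n \<sigma> \<psi>1 \<psi>2)" for k N
  define T' where "T' k = T B \<mu> n (a k) z \<psi>1 \<psi>2" for k
  have lim: "S k \<longlonglongrightarrow> T' k" for k
    using T_tendsto[OF a(2) z \<psi>1 \<psi>2, of k] unfolding TN_def[OF a(2) z \<psi>1 \<psi>2, abs_def] S_def[abs_def] T'_def .
  \<comment> \<open>k <= N forces the chosen cutoffs to tend to infinity, as
    \<open>GU_convergent\<close> requires.\<close>
  have "\<exists>N. k \<le> N \<and> dist (S k N) (T' k) < inverse (real (Suc k))" for k
  proof -
    have "0 < inverse (real (Suc k))" by simp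
    from metric_LIMSEQ_D[OF lim[of k] this] obtain N0 where "\<And>N. N0 \<le> N \<Longrightarrow> dist (S k N) (T' k) < inverse (real (Suc k))" by blast
    then show ?thesis by (intro exI[of _ "max k N0"]) simp
  qed
  then obtain Nn where Nn: "\<And>k. k \<le> Nn k" "\<And>k. dist (S k (Nn k)) (T' k) < inverse (real (Suc k))" by metis
  have N: "filterlim Nn at_top sequentially"
    by (rule filterlim_at_top_mono[OF filterlim_ident]) (simp add: Nn(1))
  have "convergent (\<lambda>k. S k (Nn k))"
    unfolding S_def
  proof (intro convergent_sum convergent_mult convergent_const)
    fix \<sigma> assume "\<sigma> \<in> Can n"
    then have "canon n \<sigma>" by (simp add: Can_def)
    then show "convergent (\<lambda>k. GU (a k) (Nn k) z n \<sigma> \<psi>1 \<psi>2)" by (rule GU_convergent[OF _ a N z \<psi>1 \<psi>2])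
  qed
  then obtain l where l: "(\<lambda>k. S k (Nn k)) \<longlonglongrightarrow> l" by (auto simp: convergent_def)
  have "(\<lambda>k. T' k - S k (Nn k)) \<longlonglongrightarrow> 0"
  proof (rule Lim_null_comparison[OF _ LIMSEQ_inverse_real_of_nat], intro always_eventually allI)
    fix k show "norm (T' k - S k (Nn k)) \<le> inverse (real (Suc k))"
      using Nn(2)[of k] by (simp only: dist_norm norm_minus_commute)
  qed
  from Lim_transform[OF l this] show ?thesis unfolding T'_def convergent_def by blast
qed

end

theorem theorem2:
  fixes B :: "real^'d \<Rightarrow> real" and \<mu> :: "real measure" and n :: nat
  assumes B_schwartz: "schwartz B"
    and B_supp: "(\<exists>r. \<forall>x. r < norm x \<longrightarrow> B x = 0) \<or>
                 (\<forall>j x. B (\<chi> i. if i = j then - (x $ i) else x $ i) = B x)"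
    and mu_prob: "prob_space \<mu>" and mu_sets: "sets \<mu> = sets borel"
    and mu_moments: "\<forall>k::nat. integrable \<mu> (\<lambda>v. \<bar>v\<bar> ^ k)"
  shows "(\<forall>z \<psi>1 \<psi>2. z \<notin> complex_of_real ` {0..} \<longrightarrow> \<psi>1 \<in> L2 \<longrightarrow> \<psi>2 \<in> L2 \<longrightarrow>
            (\<exists>l. ((\<lambda>L. T B \<mu> n L z \<psi>1 \<psi>2) \<longlongrightarrow> l) at_top))
       \<and> (\<exists>K. \<forall>L z \<psi>1 \<psi>2. 1 \<le> L \<longrightarrow> z \<notin> complex_of_real ` {0..} \<longrightarrow> \<psi>1 \<in> L2 \<longrightarrow> \<psi>2 \<in> L2 \<longrightarrow>
            cmod (T B \<mu> n L z \<psi>1 \<psi>2)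
              \<le> K * L2norm \<psi>1 * L2norm \<psi>2 / infdist z (complex_of_real ` {0..}) ^ (n + 1))"
proof -
  obtain b where b: "\<And>x. \<bar>B x\<bar> \<le> b" using schwartz_bound(2)[OF B_schwartz] by blast
  have meas[measurable]: "B \<in> borel_measurable borel"
    using schwartz_bound(1)[OF B_schwartz] by (rule borel_measurable_continuous_onI)
  have int1: "integrable lborel (\<lambda>x. \<bar>B x\<bar> ^ 1)" using schwartz_bound(3)[OF B_schwartz] by simp
  \<comment> \<open>B is bounded by b, so the square of |B| is at most b |B|.\<close>
  have int2: "integrable lborel (\<lambda>x. \<bar>B x\<bar> ^ 2)"
  proof (rule Bochner_Integration.integrable_bound[OF integrable_mult_right[OF int1, of b]])
    show "AE x in lborel. norm (\<bar>B x\<bar> ^ 2) \<le> norm (b * \<bar>B x\<bar> ^ 1)"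
    proof (rule AE_I2)
      fix x
      have "\<bar>B x\<bar> * \<bar>B x\<bar> \<le> b * \<bar>B x\<bar>" using b[of x] by (intro mult_right_mono) auto
      then show "norm (\<bar>B x\<bar> ^ 2) \<le> norm (b * \<bar>B x\<bar> ^ 1)" by (simp add: power2_eq_square)
    qed
  qed simp
  have nn: "(\<integral>\<^sup>+x. ennreal (\<bar>B x\<bar> ^ k) \<partial>lborel) \<le> ennreal (\<integral>x. \<bar>B x\<bar> ^ k \<partial>lborel)"
    if "integrable lborel (\<lambda>x. \<bar>B x\<bar> ^ k)" for k
    using nn_integral_eq_integral[OF that] by simp
  interpret \<mu>: prob_space \<mu> by (rule mu_prob)
  interpret random_scatterers B b "\<integral>x. \<bar>B x\<bar> ^ 1 \<partial>lborel" "\<integral>x. \<bar>B x\<bar> ^ 2 \<partial>lborel" \<mu> n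
    by unfold_locales (use meas b nn[OF int1] nn[OF int2] mu_sets mu_moments in auto)
  show ?thesis
  proof (intro conjI allI impI)
    fix z and \<psi>1 \<psi>2 :: "real^'d \<Rightarrow> complex" assume "z \<notin> rpos" "\<psi>1 \<in> L2" "\<psi>2 \<in> L2"
    then show "\<exists>l. ((\<lambda>L. T B \<mu> n L z \<psi>1 \<psi>2) \<longlongrightarrow> l) at_top"
      by (intro ex_tendsto_at_top_real T_sequence_convergent)
  next
    show "\<exists>K. \<forall>L z \<psi>1 \<psi>2. 1 \<le> L \<longrightarrow> z \<notin> rpos \<longrightarrow> \<psi>1 \<in> L2 \<longrightarrow> \<psi>2 \<in> L2 \<longrightarrow>
            cmod (T B \<mu> n L z \<psi>1 \<psi>2) \<le> K * L2norm \<psi>1 * L2norm \<psi>2 / infdist z rpos ^ (n + 1)"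
      by (intro exI[of _ "(\<Sum>\<sigma>\<in>Can n. cmod (c\<sigma> \<sigma>)) * sqrt \<kappa> ^ n"] allI impI T_bound) auto
  qed
qed

end
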